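(* For every $M\in\mathcal{M}$, the mapping $I:M_G^{2,0}(0,T)\to L_G^2(\mathcal{F}_T)$, defined for $\eta_t=\sum_{j=0}^{n-1}\xi_{t_j}I_{[t_j,t_{j+1})}(t)$ by $$I(\eta)=\int_0^T\eta_t\,dM_t=\sum_{j=0}^{n-1}\xi_{t_j}(M_{t_{j+1}}-M_{t_j}),$$ is a linear continuous mapping (for the norm $\|\cdot\|_{2,A}$) and thus can be continuously extended to $I:M_{G,A}^2(0,T)\to L_G^2(\mathcal{F}_T)$. Moreover, for all $\eta\in M_{G,A}^2(0,T)$, the process $\big\{\int_0^t\eta_s\,dM_s\big\}_{t\in[0,T]}$ is a symmetric G-martingale and $$\hat{\mathbb{E}}\Big[\Big|\int_0^T\eta_t\,dM_t\Big|^2\Big]\le\hat{\mathbb{E}}\Big[\int_0^T|\eta_t|^2dA_t\Big].$$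
   Context: Setting. Fix $\sigma_0\in[0,1]$ and let $G(\alpha)=\frac12(\alpha^+-\sigma_0^2\alpha^-)$, where $\alpha^+=\max\{0,\alpha\}$, $\alpha^-=-\min\{0,\alpha\}$. $C_{l,lip}(\mathbb{R}^m)$ is the space of functions $\varphi:\mathbb{R}^m\to\mathbb{R}$ with $|\varphi(x)-\varphi(y)|\le C(1+|x|^n+|y|^n)|x-y|$ for some $C>0$, $n\in\mathbb{N}$ depending on $\varphi$. $\Omega=C_0(\mathbb{R}^+)$ is the space of continuous $\omega:[0,\infty)\to\mathbb{R}$ with $\omega_0=0$ (topology of locally uniform convergence), $B_t(\omega)=\omega_t$. $L_{ip}^0(\mathcal{F}_t)=\{\varphi(B_{t_1},\dots,B_{t_m}): m\ge1,\ t_i\in[0,t],\ \varphi\in C_{l,lip}(\mathbb{R}^m)\}$, $L^0_{ip}(\mathcal{F})=\bigcup_nL^0_{ip}(\mathcal{F}_n)$. A sublinear expectation is a functional $\mathbb{E}$ on a linear space of random variables (stable under composition with functions in $C_{l,lip}$) that is monotone, preserves constants, satisfies $\mathbb{E}[X]-\mathbb{E}[Y]\le\mathbb{E}[X-Y]$ and is positively homogeneous. $Y$ is independent of $X$ if $\mathbb{E}[\varphi(X,Y)]=\mathbb{E}\big[\mathbb{E}[\varphi(x,Y)]_{x=X}\big]$ for all $\varphi\in C_{l,lip}$. $\xi\sim\mathcal{N}(0,[\sigma_0^2,1])$ means that for every $\varphi\in C_{l,lip}(\mathbb{R})$, $u(t,x)=\mathbb{E}[\varphi(x+\sqrt t\,\xi)]$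 is the unique continuous viscosity solution with polynomial growth of $\partial_tu=G(\partial^2_{xx}u)$, $u(0,\cdot)=\varphi$. G-expectation $\hat{\mathbb{E}}$: for $0=t_0\le\dots\le t_m$ and $X=\varphi(B_{t_1}-B_{t_0},\dots,B_{t_m}-B_{t_{m-1}})$, $\hat{\mathbb{E}}[X]=\tilde{\mathbb{E}}[\varphi(\sqrt{t_1-t_0}\,\xi_1,\dots,\sqrt{t_m-t_{m-1}}\,\xi_m)]$, where under a sublinear expectation $\tilde{\mathbb{E}}$, $\xi_i\sim\mathcal{N}(0,[\sigma_0^2,1])$ and $\xi_{i+1}$ is independent of $(\xi_1,\dots,\xi_i)$; and $\hat{\mathbb{E}}[X|\mathcal{H}_{t_j}]=\psi(B_{t_1}-B_{t_0},\dots,B_{t_j}-B_{t_{j-1}})$ with $\psi(x_1,\dots,x_j)=\tilde{\mathbb{E}}[\varphi(x_1,\dots,x_j,\sqrt{t_{j+1}-t_j}\,\xi_{j+1},\dots,\sqrt{t_m-t_{m-1}}\,\xi_m)]$. For $p\ge1$, $L_G^p(\mathcal{F})$, $L_G^p(\mathcal{F}_t)$ are the completions of $L_{ip}^0(\mathcal{F})$, $L_{ip}^0(\mathcal{F}_t)$ under $\|X\|_p=\hat{\mathbb{E}}[|X|^p]^{1/p}$; $\hat{\mathbb{E}}[\cdot]$ and $\hat{\mathbb{E}}[\cdot|\mathcal{H}_t]$ extend continuously. There is a weakly compact family $\mathcal{P}$ of probability measures on $(\Omega,\mathcal{B}(\Omega))$ with $\hat{\mathbb{E}}[X]=\max_{P\in\mathcal{P}}E_P[X]$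 for $X\in L_G^1(\mathcal{F})$; for other random variables $\hat{\mathbb{E}}[X]:=\sup_{P\in\mathcal{P}}E_P[X]$. Quasi-surely (q.s.) means outside a set $N$ with $c(N):=\sup_{P\in\mathcal{P}}P(N)=0$. A process $M$ is a G-martingale (resp. G-supermartingale) if $M_t\in L_G^1(\mathcal{F}_t)$ for all $t$ and $\hat{\mathbb{E}}[M_t|\mathcal{H}_s]=M_s$ (resp. $\le M_s$) q.s. for all $s\le t$; it is a symmetric G-martingale if $M$ and $-M$ are G-martingales. Fix $T>0$ and a continuous increasing process $A=\{A_t\}_{t\in[0,T]}$ with $A_0=0$, $A_t\in L_G^1(\mathcal{F}_t)$ for all $t$, and $\hat{\mathbb{E}}[A_T]<\infty$. For $p\ge1$, $M_G^{p,0}(0,T)$ is the space of step processes $\eta_t=\sum_{j=0}^{n-1}\xi_{t_j}I_{[t_j,t_{j+1})}(t)$, $0=t_0<\dots<t_n=T$, $\xi_{t_j}\in L_G^p(\mathcal{F}_{t_j})$, and $M_{G,A}^p(0,T)$ is its completion under $\|\eta\|_{p,A}=\big(\hat{\mathbb{E}}[\int_0^T|\eta_t|^pdA_t]\big)^{1/p}$. $\mathcal{M}$ is the set of continuous symmetric G-martingales $M$ (on $[0,T]$) such that $M^2-A$ is a G-supermartingale. For $0\le s\le t\le T$, $\int_s^t\eta_u\,dM_u:=\int_0^TI_{[s,t]}(u)\eta_u\,dM_u$.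
   Formalization: Since I need not map all of M_G^{2,0} into L_G^2(F_T), that membership, the completion M_{G,A}^2, the martingale claim and the inequality use only step processes η with ∫|η|²dA in L_G^1(F_T); the sum formula, linearity and continuity remain on all of M_G^{2,0}. *)

theory Defs
  imports "HOL-Probability.Probability"
begin

section \<open>Path space\<close>

text \<open>A path on \<open>[0,\<infinity>)\<close> is stored as a function on the whole line that vanishes on the negative
  half-axis, so that it is determined by its values on \<open>[0,\<infinity>)\<close>.\<close>

typedef path = "{\<omega> :: real \<Rightarrow> real. continuous_on {0..} \<omega> \<and> \<omega> 0 = 0 \<and> (\<forall>t<0. \<omega> t = 0)}"
  by (rule exI[of _ "\<lambda>_. 0"]) auto

definition B :: "real \<Rightarrow> path \<Rightarrow> real" where
  "B t \<omega> = Rep_path \<omega> t"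

text \<open>Topology of locally uniform convergence; \<open>borel\<close> on \<open>path\<close> is its Borel \<open>\<sigma>\<close>-algebra.\<close>

instantiation path :: topological_space
begin

definition open_path :: "path set \<Rightarrow> bool" where
  "open_path U \<longleftrightarrow>
     (\<forall>\<omega>\<in>U. \<exists>K \<epsilon>. 0 < \<epsilon> \<and> (\<forall>\<omega>'. (\<forall>t\<in>{0..K}. \<bar>B t \<omega>' - B t \<omega>\<bar> < \<epsilon>) \<longrightarrow> \<omega>' \<in> U))"

instance
proof
  show "open (UNIV :: path set)"
    unfolding open_path_def by (auto intro: exI[of _ 1])
next
  fix S U :: "path set"
  assume S: "open S" and U: "open U"
  show "open (S \<inter> U)"
    unfolding open_path_def
  proof
    fix \<omega> assume "\<omega> \<in> S \<inter> U"
    then obtain K1 e1 K2 e2 where e: "0 < e1" "0 < e2"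
      and 1: "\<And>\<omega>'. (\<forall>t\<in>{0..K1}. \<bar>B t \<omega>' - B t \<omega>\<bar> < e1) \<Longrightarrow> \<omega>' \<in> S"
      and 2: "\<And>\<omega>'. (\<forall>t\<in>{0..K2}. \<bar>B t \<omega>' - B t \<omega>\<bar> < e2) \<Longrightarrow> \<omega>' \<in> U"
      using S U unfolding open_path_def by (metis IntE)
    have "\<omega>' \<in> S \<inter> U" if "\<forall>t\<in>{0..max K1 K2}. \<bar>B t \<omega>' - B t \<omega>\<bar> < min e1 e2" for \<omega>'
      using that by (intro IntI 1 2) auto
    then show "\<exists>K \<epsilon>. 0 < \<epsilon> \<and>
        (\<forall>\<omega>'. (\<forall>t\<in>{0..K}. \<bar>B t \<omega>' - B t \<omega>\<bar> < \<epsilon>) \<longrightarrow> \<omega>' \<in> S \<inter> U)"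
      using e by (intro exI[of _ "max K1 K2"] exI[of _ "min e1 e2"]) auto
  qed
next
  fix \<K> :: "path set set"
  assume "\<forall>S\<in>\<K>. open S"
  then show "open (\<Union>\<K>)"
    unfolding open_path_def by (meson UnionE UnionI)
qed

end


section \<open>Sublinear expectations and the G-normal distribution\<close>

text \<open>Vectors in \<open>\<real>\<^sup>m\<close> are lists of length \<open>m\<close>, since the dimension is a bound variable throughout;
  the values of \<open>\<phi>\<close> on lists of other lengths are irrelevant.\<close>

definition C_l_lip :: "nat \<Rightarrow> (real list \<Rightarrow> real) set" where
  "C_l_lip m = {\<phi>. \<exists>C>0. \<exists>n::nat. \<forall>x y. length x = m \<longrightarrow> length y = m \<longrightarrow>
     \<bar>\<phi> x - \<phi> y\<bar> \<le> C * (1 + L2_set ((!) x) {..<m} ^ n + L2_set ((!) y) {..<m} ^ n)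
                       * L2_set (\<lambda>i. x ! i - y ! i) {..<m}}"

definition sublinear_expectation :: "('a \<Rightarrow> real) set \<Rightarrow> (('a \<Rightarrow> real) \<Rightarrow> real) \<Rightarrow> bool" where
  "sublinear_expectation H E \<longleftrightarrow>
     (\<forall>c. (\<lambda>_. c) \<in> H) \<and>
     (\<forall>X\<in>H. \<forall>Y\<in>H. (\<lambda>w. X w + Y w) \<in> H) \<and>
     (\<forall>c. \<forall>X\<in>H. (\<lambda>w. c * X w) \<in> H) \<and>
     (\<forall>m. \<forall>\<phi>\<in>C_l_lip m. \<forall>X :: nat \<Rightarrow> 'a \<Rightarrow> real.
        (\<forall>i<m. X i \<in> H) \<longrightarrow> (\<lambda>w. \<phi> (map (\<lambda>i. X i w) [0..<m])) \<in> H) \<and>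
     (\<forall>X\<in>H. \<forall>Y\<in>H. (\<forall>w. X w \<le> Y w) \<longrightarrow> E X \<le> E Y) \<and>
     (\<forall>c. E (\<lambda>_. c) = c) \<and>
     (\<forall>X\<in>H. \<forall>Y\<in>H. E X - E Y \<le> E (\<lambda>w. X w - Y w)) \<and>
     (\<forall>c\<ge>0. \<forall>X\<in>H. E (\<lambda>w. c * X w) = c * E X)"

text \<open>The random vector \<open>Y\<close> is independent of the random vector \<open>X\<close> (not a symmetric relation).\<close>

definition independent_of ::
  "(('a \<Rightarrow> real) \<Rightarrow> real) \<Rightarrow> ('a \<Rightarrow> real) list \<Rightarrow> ('a \<Rightarrow> real) list \<Rightarrow> bool" where
  "independent_of E Y X \<longleftrightarrow>
     (\<forall>\<phi>\<in>C_l_lip (length X + length Y).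
        E (\<lambda>w. \<phi> (map (\<lambda>Z. Z w) X @ map (\<lambda>Z. Z w) Y)) =
        E (\<lambda>w. E (\<lambda>w'. \<phi> (map (\<lambda>Z. Z w) X @ map (\<lambda>Z. Z w') Y))))"

definition G :: "real \<Rightarrow> real \<Rightarrow> real" where
  "G \<sigma>\<^sub>0 \<alpha> = (max 0 \<alpha> - \<sigma>\<^sub>0\<^sup>2 * (- min 0 \<alpha>)) / 2"

text \<open>\<open>\<psi>\<close> is of class \<open>C\<^sup>1\<^sup>,\<^sup>2\<close> on the open set \<open>U\<close>, with derivatives
  \<open>a = \<partial>\<^sub>t\<psi>\<close>, \<open>b = \<partial>\<^sub>x\<psi>\<close> and \<open>c = \<partial>\<^sub>x\<^sub>x\<psi>\<close>.\<close>

definition C12_on :: "(real \<times> real) set \<Rightarrow> (real \<Rightarrow> real \<Rightarrow> real) \<Rightarrow> (real \<Rightarrow> real \<Rightarrow> real) \<Rightarrow>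
    (real \<Rightarrow> real \<Rightarrow> real) \<Rightarrow> (real \<Rightarrow> real \<Rightarrow> real) \<Rightarrow> bool" where
  "C12_on U \<psi> a b c \<longleftrightarrow>
     open U \<and>
     (\<forall>(t, x)\<in>U. ((\<lambda>s. \<psi> s x) has_real_derivative a t x) (at t) \<and>
                 (\<psi> t has_real_derivative b t x) (at x) \<and>
                 (b t has_real_derivative c t x) (at x)) \<and>
     continuous_on U (\<lambda>(t, x). a t x) \<and>
     continuous_on U (\<lambda>(t, x). b t x) \<and>
     continuous_on U (\<lambda>(t, x). c t x)"

definition viscosity_subsolution :: "real \<Rightarrow> (real \<Rightarrow> real \<Rightarrow> real) \<Rightarrow> bool" where
  "viscosity_subsolution \<sigma>\<^sub>0 u \<longleftrightarrow>
     (\<forall>U \<psi> a b c t x. C12_on U \<psi> a b c \<and> U \<subseteq> {0<..} \<times> UNIV \<and> (t, x) \<in> U \<and>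
        (\<forall>(s, y)\<in>U. u s y - \<psi> s y \<le> u t x - \<psi> t x) \<longrightarrow> a t x - G \<sigma>\<^sub>0 (c t x) \<le> 0)"

definition viscosity_supersolution :: "real \<Rightarrow> (real \<Rightarrow> real \<Rightarrow> real) \<Rightarrow> bool" where
  "viscosity_supersolution \<sigma>\<^sub>0 u \<longleftrightarrow>
     (\<forall>U \<psi> a b c t x. C12_on U \<psi> a b c \<and> U \<subseteq> {0<..} \<times> UNIV \<and> (t, x) \<in> U \<and>
        (\<forall>(s, y)\<in>U. u s y - \<psi> s y \<ge> u t x - \<psi> t x) \<longrightarrow> a t x - G \<sigma>\<^sub>0 (c t x) \<ge> 0)"

text \<open>Continuous viscosity solutions of \<open>\<partial>\<^sub>tu = G(\<partial>\<^sub>x\<^sub>xu)\<close>, \<open>u(0,\<cdot>) = f\<close>, with polynomial growth in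
  \<open>x\<close>, locally uniformly in \<open>t\<close>.\<close>

definition G_heat_solution :: "real \<Rightarrow> (real \<Rightarrow> real) \<Rightarrow> (real \<Rightarrow> real \<Rightarrow> real) \<Rightarrow> bool" where
  "G_heat_solution \<sigma>\<^sub>0 f u \<longleftrightarrow>
     continuous_on ({0..} \<times> UNIV) (\<lambda>(t, x). u t x) \<and>
     (\<forall>T. \<exists>C. \<exists>k::nat. \<forall>t\<in>{0..T}. \<forall>x. \<bar>u t x\<bar> \<le> C * (1 + \<bar>x\<bar> ^ k)) \<and>
     viscosity_subsolution \<sigma>\<^sub>0 u \<and> viscosity_supersolution \<sigma>\<^sub>0 u \<and>
     (\<forall>x. u 0 x = f x)"

text \<open>\<open>\<xi> \<sim> N(0, [\<sigma>\<^sub>0\<^sup>2, 1])\<close> under \<open>E\<close>.\<close>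

definition G_normal :: "real \<Rightarrow> (('a \<Rightarrow> real) \<Rightarrow> real) \<Rightarrow> ('a \<Rightarrow> real) \<Rightarrow> bool" where
  "G_normal \<sigma>\<^sub>0 E \<xi> \<longleftrightarrow>
     (\<forall>\<phi>\<in>C_l_lip 1. let u = (\<lambda>t x. E (\<lambda>w. \<phi> [x + sqrt t * \<xi> w])) in
        G_heat_solution \<sigma>\<^sub>0 (\<lambda>x. \<phi> [x]) u \<and>
        (\<forall>v. G_heat_solution \<sigma>\<^sub>0 (\<lambda>x. \<phi> [x]) v \<longrightarrow> (\<forall>t\<ge>0. \<forall>x. v t x = u t x)))"


section \<open>G-expectation\<close>

definition Lip0 :: "real \<Rightarrow> (path \<Rightarrow> real) set" where
  "Lip0 t = {X. \<exists>m\<ge>1. \<exists>s :: nat \<Rightarrow> real. \<exists>\<phi>\<in>C_l_lip m.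
     (\<forall>i<m. s i \<in> {0..t}) \<and> X = (\<lambda>\<omega>. \<phi> (map (\<lambda>i. B (s i) \<omega>) [0..<m]))}"

definition Lip0_all :: "(path \<Rightarrow> real) set" where
  "Lip0_all = (\<Union>n::nat. Lip0 (real n))"

text \<open>Times \<open>0 = t\<^sub>0 \<le> \<dots> \<le> t\<^sub>m\<close>, the increments of \<open>B\<close> with index in \<open>{j..<k}\<close>, and their counterparts
  \<open>\<surd>(t\<^sub>i\<^sub>+\<^sub>1 - t\<^sub>i) \<xi>\<^sub>i\<^sub>+\<^sub>1\<close>; the sequence \<open>\<xi>\<^sub>1, \<xi>\<^sub>2, \<dots>\<close> is indexed from \<open>0\<close>.\<close>

definition times :: "nat \<Rightarrow> (nat \<Rightarrow> real) \<Rightarrow> bool" where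
  "times m t \<longleftrightarrow> t 0 = 0 \<and> (\<forall>i<m. t i \<le> t (Suc i))"

definition B_increments :: "(nat \<Rightarrow> real) \<Rightarrow> nat \<Rightarrow> nat \<Rightarrow> path \<Rightarrow> real list" where
  "B_increments t j k \<omega> = map (\<lambda>i. B (t (Suc i)) \<omega> - B (t i) \<omega>) [j..<k]"

definition xi_increments :: "(nat \<Rightarrow> 'a \<Rightarrow> real) \<Rightarrow> (nat \<Rightarrow> real) \<Rightarrow> nat \<Rightarrow> nat \<Rightarrow> 'a \<Rightarrow> real list" where
  "xi_increments \<xi> t j k w = map (\<lambda>i. sqrt (t (Suc i) - t i) * \<xi> i w) [j..<k]"

text \<open>The property of \<open>E\<close> that defines the G-expectation on cylinder random variables.\<close>

definition G_expectation ::
  "(('a \<Rightarrow> real) \<Rightarrow> real) \<Rightarrow> (nat \<Rightarrow> 'a \<Rightarrow> real) \<Rightarrow> ((path \<Rightarrow> real) \<Rightarrow> real) \<Rightarrow> bool" where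
  "G_expectation E\<^sub>\<xi> \<xi> E \<longleftrightarrow>
     (\<forall>m\<ge>1. \<forall>t. \<forall>\<phi>\<in>C_l_lip m. times m t \<longrightarrow>
        E (\<lambda>\<omega>. \<phi> (B_increments t 0 m \<omega>)) = E\<^sub>\<xi> (\<lambda>w. \<phi> (xi_increments \<xi> t 0 m w)))"

text \<open>\<open>Y = E[X | H\<^sub>t]\<close> for cylinder random variables.\<close>

definition cylinder_cond ::
  "(('a \<Rightarrow> real) \<Rightarrow> real) \<Rightarrow> (nat \<Rightarrow> 'a \<Rightarrow> real) \<Rightarrow> real \<Rightarrow> (path \<Rightarrow> real) \<Rightarrow> (path \<Rightarrow> real) \<Rightarrow> bool" where
  "cylinder_cond E\<^sub>\<xi> \<xi> r X Y \<longleftrightarrow>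
     (\<exists>m\<ge>1. \<exists>j\<le>m. \<exists>t. \<exists>\<phi>\<in>C_l_lip m. times m t \<and> t j = r \<and>
        X = (\<lambda>\<omega>. \<phi> (B_increments t 0 m \<omega>)) \<and>
        Y = (\<lambda>\<omega>. E\<^sub>\<xi> (\<lambda>w. \<phi> (B_increments t 0 j \<omega> @ xi_increments \<xi> t j m w))))"


section \<open>Families of probability measures\<close>

text \<open>The topology of weak convergence on the probability measures on \<open>\<B>(\<Omega>)\<close>.\<close>

definition weak_topology :: "path measure topology" where
  "weak_topology = topology_generated_by
     {{P. prob_space P \<and> sets P = sets borel \<and> (\<integral>\<omega>. f \<omega> \<partial>P) \<in> V} | (f :: path \<Rightarrow> real) V.
        continuous_on UNIV f \<and> bounded (range f) \<and> open V}"

text \<open>\<open>sup\<^bsub>P\<in>\<P>\<^esub> E\<^sub>P[X]\<close> for nonnegative \<open>X\<close>, possibly infinite.\<close>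

definition upper_expectation :: "path measure set \<Rightarrow> (path \<Rightarrow> ennreal) \<Rightarrow> ennreal" where
  "upper_expectation \<P> X = (SUP P\<in>\<P>. \<integral>\<^sup>+\<omega>. X \<omega> \<partial>P)"

definition capacity :: "path measure set \<Rightarrow> path set \<Rightarrow> ennreal" where
  "capacity \<P> N = (SUP P\<in>\<P>. emeasure P N)"

definition qs :: "path measure set \<Rightarrow> (path \<Rightarrow> bool) \<Rightarrow> bool" where
  "qs \<P> Q \<longleftrightarrow> (\<exists>N\<in>sets borel. capacity \<P> N = 0 \<and> (\<forall>\<omega>. \<omega> \<notin> N \<longrightarrow> Q \<omega>))"

text \<open>The completions \<open>L\<^sub>G\<^sup>p\<close> are realised as spaces of Borel random variables (to be identified when
  equal q.s.): \<open>L\<^sub>G\<^sup>p\<close> is the closure of the cylinder random variables under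
  \<open>X \<mapsto> (sup\<^bsub>P\<in>\<P>\<^esub> E\<^sub>P[\<bar>X\<bar>\<^sup>p])\<^sup>1\<^sup>/\<^sup>p\<close>, which on cylinder random variables is the norm given by the
  G-expectation once \<open>\<P>\<close> represents it (\<open>represents\<close> below). Convergence in norm is expressed without
  the root.\<close>

definition Lp_closure ::
  "path measure set \<Rightarrow> real \<Rightarrow> (path \<Rightarrow> real) set \<Rightarrow> (path \<Rightarrow> real) set" where
  "Lp_closure \<P> p L = {X \<in> borel_measurable borel. \<exists>Z :: nat \<Rightarrow> path \<Rightarrow> real. (\<forall>n. Z n \<in> L) \<and>
     (\<lambda>n. upper_expectation \<P> (\<lambda>\<omega>. ennreal (\<bar>X \<omega> - Z n \<omega>\<bar> powr p))) \<longlonglongrightarrow> 0}"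

definition LG :: "path measure set \<Rightarrow> real \<Rightarrow> real \<Rightarrow> (path \<Rightarrow> real) set" where
  "LG \<P> p t = Lp_closure \<P> p (Lip0 t)"

definition LG_all :: "path measure set \<Rightarrow> real \<Rightarrow> (path \<Rightarrow> real) set" where
  "LG_all \<P> p = Lp_closure \<P> p Lip0_all"

definition represents :: "path measure set \<Rightarrow> ((path \<Rightarrow> real) \<Rightarrow> real) \<Rightarrow> bool" where
  "represents \<P> E \<longleftrightarrow>
     compactin weak_topology \<P> \<and>
     (\<forall>X\<in>LG_all \<P> 1. (\<exists>P\<in>\<P>. E X = (\<integral>\<omega>. X \<omega> \<partial>P)) \<and> (\<forall>P\<in>\<P>. (\<integral>\<omega>. X \<omega> \<partial>P) \<le> E X))"


section \<open>G-martingales\<close>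

text \<open>A version of \<open>E[X | H\<^sub>t]\<close> for \<open>X\<close> in \<open>L\<^sub>G\<^sup>1\<close>: the value at \<open>X\<close> of the continuous extension of
  the conditional expectation of cylinder random variables, unique up to q.s. equality.\<close>

definition G_cond :: "path measure set \<Rightarrow> (('a \<Rightarrow> real) \<Rightarrow> real) \<Rightarrow> (nat \<Rightarrow> 'a \<Rightarrow> real) \<Rightarrow>
    real \<Rightarrow> (path \<Rightarrow> real) \<Rightarrow> path \<Rightarrow> real" where
  "G_cond \<P> E\<^sub>\<xi> \<xi> t X = (SOME Y. Y \<in> LG \<P> 1 t \<and> (\<exists>U V.
     (\<forall>n::nat. cylinder_cond E\<^sub>\<xi> \<xi> t (U n) (V n)) \<and>
     (\<lambda>n. upper_expectation \<P> (\<lambda>\<omega>. ennreal \<bar>X \<omega> - U n \<omega>\<bar>)) \<longlonglongrightarrow> 0 \<and>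
     (\<lambda>n. upper_expectation \<P> (\<lambda>\<omega>. ennreal \<bar>Y \<omega> - V n \<omega>\<bar>)) \<longlonglongrightarrow> 0))"

definition G_martingale :: "path measure set \<Rightarrow> (('a \<Rightarrow> real) \<Rightarrow> real) \<Rightarrow> (nat \<Rightarrow> 'a \<Rightarrow> real) \<Rightarrow>
    real \<Rightarrow> (real \<Rightarrow> path \<Rightarrow> real) \<Rightarrow> bool" where
  "G_martingale \<P> E\<^sub>\<xi> \<xi> T M \<longleftrightarrow>
     (\<forall>t\<in>{0..T}. M t \<in> LG \<P> 1 t) \<and>
     (\<forall>s t. 0 \<le> s \<and> s \<le> t \<and> t \<le> T \<longrightarrow> qs \<P> (\<lambda>\<omega>. G_cond \<P> E\<^sub>\<xi> \<xi> s (M t) \<omega> = M s \<omega>))"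

definition G_supermartingale :: "path measure set \<Rightarrow> (('a \<Rightarrow> real) \<Rightarrow> real) \<Rightarrow> (nat \<Rightarrow> 'a \<Rightarrow> real) \<Rightarrow>
    real \<Rightarrow> (real \<Rightarrow> path \<Rightarrow> real) \<Rightarrow> bool" where
  "G_supermartingale \<P> E\<^sub>\<xi> \<xi> T M \<longleftrightarrow>
     (\<forall>t\<in>{0..T}. M t \<in> LG \<P> 1 t) \<and>
     (\<forall>s t. 0 \<le> s \<and> s \<le> t \<and> t \<le> T \<longrightarrow> qs \<P> (\<lambda>\<omega>. G_cond \<P> E\<^sub>\<xi> \<xi> s (M t) \<omega> \<le> M s \<omega>))"

definition symmetric_G_martingale ::
  "path measure set \<Rightarrow> (('a \<Rightarrow> real) \<Rightarrow> real) \<Rightarrow> (nat \<Rightarrow> 'a \<Rightarrow> real) \<Rightarrow>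
    real \<Rightarrow> (real \<Rightarrow> path \<Rightarrow> real) \<Rightarrow> bool" where
  "symmetric_G_martingale \<P> E\<^sub>\<xi> \<xi> T M \<longleftrightarrow>
     G_martingale \<P> E\<^sub>\<xi> \<xi> T M \<and> G_martingale \<P> E\<^sub>\<xi> \<xi> T (\<lambda>t \<omega>. - M t \<omega>)"

text \<open>The set \<open>\<M>\<close> determined by the increasing process \<open>A\<close>.\<close>

definition integrators :: "path measure set \<Rightarrow> (('a \<Rightarrow> real) \<Rightarrow> real) \<Rightarrow> (nat \<Rightarrow> 'a \<Rightarrow> real) \<Rightarrow>
    real \<Rightarrow> (real \<Rightarrow> path \<Rightarrow> real) \<Rightarrow> (real \<Rightarrow> path \<Rightarrow> real) set" where
  "integrators \<P> E\<^sub>\<xi> \<xi> T A = {M.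
     qs \<P> (\<lambda>\<omega>. continuous_on {0..T} (\<lambda>t. M t \<omega>)) \<and>
     symmetric_G_martingale \<P> E\<^sub>\<xi> \<xi> T M \<and>
     G_supermartingale \<P> E\<^sub>\<xi> \<xi> T (\<lambda>t \<omega>. (M t \<omega>)\<^sup>2 - A t \<omega>)}"


section \<open>Integrands\<close>

text \<open>\<open>\<integral>\<^sub>0\<^sup>T f(t) dA\<^sub>t(\<omega>)\<close> for nonnegative \<open>f\<close>: the Lebesgue-Stieltjes integral for the path \<open>A(\<omega>)\<close>,
  which is extended from \<open>[0,T]\<close> to the line by constants.\<close>

definition dA_integral ::
  "real \<Rightarrow> (real \<Rightarrow> path \<Rightarrow> real) \<Rightarrow> (real \<Rightarrow> ennreal) \<Rightarrow> path \<Rightarrow> ennreal" where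
  "dA_integral T A f \<omega> =
     (\<integral>\<^sup>+t\<in>{0..T}. f t \<partial>interval_measure (\<lambda>t. A (max 0 (min t T)) \<omega>))"

text \<open>\<open>\<parallel>\<eta>\<parallel>\<^sub>p\<^sub>,\<^sub>A\<close> to the power \<open>p\<close>.\<close>

definition normA_pow :: "path measure set \<Rightarrow> real \<Rightarrow> real \<Rightarrow> (real \<Rightarrow> path \<Rightarrow> real) \<Rightarrow>
    (real \<Rightarrow> path \<Rightarrow> real) \<Rightarrow> ennreal" where
  "normA_pow \<P> p T A \<eta> =
     upper_expectation \<P> (\<lambda>\<omega>. dA_integral T A (\<lambda>t. ennreal (\<bar>\<eta> t \<omega>\<bar> powr p)) \<omega>)"

definition step_rep :: "path measure set \<Rightarrow> real \<Rightarrow> real \<Rightarrow> nat \<Rightarrow> (nat \<Rightarrow> real) \<Rightarrow>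
    (nat \<Rightarrow> path \<Rightarrow> real) \<Rightarrow> (real \<Rightarrow> path \<Rightarrow> real) \<Rightarrow> bool" where
  "step_rep \<P> p T n t \<xi> \<eta> \<longleftrightarrow>
     t 0 = 0 \<and> t n = T \<and> (\<forall>j<n. t j < t (Suc j)) \<and> (\<forall>j<n. \<xi> j \<in> LG \<P> p (t j)) \<and>
     \<eta> = (\<lambda>u \<omega>. \<Sum>j<n. \<xi> j \<omega> * indicator {t j..<t (Suc j)} u)"

text \<open>The step processes \<open>M\<^sub>G\<^sup>p\<^sup>,\<^sup>0(0,T)\<close>.\<close>

definition MG0 :: "path measure set \<Rightarrow> real \<Rightarrow> real \<Rightarrow> (real \<Rightarrow> path \<Rightarrow> real) set" where
  "MG0 \<P> p T = {\<eta>. \<exists>n t \<xi>. step_rep \<P> p T n t \<xi> \<eta>}"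

text \<open>The step processes whose norm \<open>\<parallel>\<eta>\<parallel>\<^sub>p\<^sub>,\<^sub>A\<close> is given by the G-expectation of a random variable in
  \<open>L\<^sub>G\<^sup>1\<close>. For a general \<open>A\<close> this is not automatic: \<open>\<xi>\<^sub>j\<close> in \<open>L\<^sub>G\<^sup>p\<close> and \<open>A\<^sub>t\<close> in \<open>L\<^sub>G\<^sup>1\<close> do not make
  \<open>\<bar>\<xi>\<^sub>j\<bar>\<^sup>p (A\<^bsub>t\<^sub>j\<^sub>+\<^sub>1\<^esub> - A\<^bsub>t\<^sub>j\<^esub>)\<close> integrable, and even where its upper expectation is finite it may
  fail to lie in \<open>L\<^sub>G\<^sup>1\<close>, in which case the stochastic integral need not lie in \<open>L\<^sub>G\<^sup>p\<close>.\<close>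

definition MG0_A :: "path measure set \<Rightarrow> real \<Rightarrow> real \<Rightarrow> (real \<Rightarrow> path \<Rightarrow> real) \<Rightarrow>
    (real \<Rightarrow> path \<Rightarrow> real) set" where
  "MG0_A \<P> p T A = {\<eta> \<in> MG0 \<P> p T. \<exists>Y\<in>LG \<P> 1 T. qs \<P> (\<lambda>\<omega>. 0 \<le> Y \<omega> \<and>
     dA_integral T A (\<lambda>t. ennreal (\<bar>\<eta> t \<omega>\<bar> powr p)) \<omega> = ennreal (Y \<omega>))}"

text \<open>The completion \<open>M\<^bsub>G,A\<^esub>\<^sup>p(0,T)\<close>, realised as a space of measurable processes (to be identified
  when their distance is zero); this realisation is complete because Cauchy sequences of step processes have
  subsequences converging \<open>P \<otimes> dA\<close>-almost everywhere for all \<open>P \<in> \<P>\<close> simultaneously.\<close>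

definition MGA :: "path measure set \<Rightarrow> real \<Rightarrow> real \<Rightarrow> (real \<Rightarrow> path \<Rightarrow> real) \<Rightarrow>
    (real \<Rightarrow> path \<Rightarrow> real) set" where
  "MGA \<P> p T A = {\<eta>.
     (\<lambda>(t, \<omega>). \<eta> t \<omega>) \<in> borel_measurable (restrict_space borel {0..T} \<Otimes>\<^sub>M borel) \<and>
     (\<exists>\<zeta> :: nat \<Rightarrow> real \<Rightarrow> path \<Rightarrow> real. (\<forall>n. \<zeta> n \<in> MG0_A \<P> p T A) \<and>
        (\<lambda>n. normA_pow \<P> p T A (\<lambda>t \<omega>. \<eta> t \<omega> - \<zeta> n t \<omega>)) \<longlonglongrightarrow> 0)}"

definition linear_map_on :: "path measure set \<Rightarrow> (real \<Rightarrow> path \<Rightarrow> real) set \<Rightarrow>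
    ((real \<Rightarrow> path \<Rightarrow> real) \<Rightarrow> path \<Rightarrow> real) \<Rightarrow> bool" where
  "linear_map_on \<P> S I \<longleftrightarrow>
     (\<forall>\<eta>\<in>S. \<forall>\<zeta>\<in>S. \<forall>a b. (\<lambda>t \<omega>. a * \<eta> t \<omega> + b * \<zeta> t \<omega>) \<in> S \<and>
        qs \<P> (\<lambda>\<omega>. I (\<lambda>t \<omega>. a * \<eta> t \<omega> + b * \<zeta> t \<omega>) \<omega> = a * I \<eta> \<omega> + b * I \<zeta> \<omega>))"

definition continuous_map_on :: "path measure set \<Rightarrow> real \<Rightarrow> (real \<Rightarrow> path \<Rightarrow> real) \<Rightarrow>
    (real \<Rightarrow> path \<Rightarrow> real) set \<Rightarrow> ((real \<Rightarrow> path \<Rightarrow> real) \<Rightarrow> path \<Rightarrow> real) \<Rightarrow> bool" where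
  "continuous_map_on \<P> T A S I \<longleftrightarrow>
     (\<forall>\<eta>\<in>S. \<forall>\<zeta> :: nat \<Rightarrow> real \<Rightarrow> path \<Rightarrow> real. (\<forall>n. \<zeta> n \<in> S) \<and>
        (\<lambda>n. normA_pow \<P> 2 T A (\<lambda>t \<omega>. \<zeta> n t \<omega> - \<eta> t \<omega>)) \<longlonglongrightarrow> 0 \<longrightarrow>
        (\<lambda>n. upper_expectation \<P> (\<lambda>\<omega>. ennreal (\<bar>I (\<zeta> n) \<omega> - I \<eta> \<omega>\<bar>\<^sup>2))) \<longlonglongrightarrow> 0)"

end

theory Submission
  imports Defs
begin

text \<open>Under a single measure \<open>P \<in> \<P>\<close> the theorem is the classical isometry argument for square integrable
  martingales, and taking suprema over \<open>\<P>\<close> yields the statement about G-expectations. Two things have to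
  be supplied: a description of conditional G-expectations by the individual measures, and the
  verification that the integrals stay in the closure \<open>L\<^sub>G\<^sup>2\<close> of the cylinder random variables.

  \<^bold>\<open>Conditional expectations.\<close> Let \<open>V\<close> be the conditional G-expectation at time \<open>s\<close> of a cylinder random
  variable \<open>U\<close>, and let \<open>Z \<ge> 0\<close> and \<open>W\<close> be cylinder random variables of the past. Integrating out the
  increments after \<open>s\<close> first gives \<open>E (Z (U - W)) = E (Z (V - W))\<close> (\<open>E_cylinder_cond\<close>). Since \<open>E\<close> is a
  maximum over \<open>\<P>\<close>, this says that \<open>Z (U - V)\<close> has nonpositive integral under every \<open>P\<close>, and that the
  integral of \<open>Z (V - W)\<close> under \<open>P\<close> is at most that of \<open>Z (U - W)\<close> under some \<open>Q\<close>. It follows that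
  conditioning is Lipschitz in \<open>L\<^sub>G\<^sup>1\<close> (\<open>cylinder_cond_contraction\<close>), so that the extension exists, and that
  a process is a symmetric G-martingale if and only if it is a martingale under every \<open>P\<close>
  (\<open>symmetric_G_martingale_integral\<close>, \<open>symmetric_G_martingaleI\<close>). In the same way, \<open>M\<^sup>2 - A\<close> is a
  supermartingale under every \<open>P\<close>.

  \<^bold>\<open>Isometry inequality.\<close> For a step process with bounded coefficients the mixed terms of the squared
  integral vanish under \<open>P\<close>, and the diagonal terms are estimated by the increments of \<open>A\<close>. Truncation and
  Fatou's lemma extend this to square integrable coefficients (\<open>step_isometry\<close>). The supremum over \<open>P\<close>
  bounds the integral of every step process in mean square by its norm (\<open>pnorm_SI_le\<close>).

  \<^bold>\<open>Membership in \<open>L\<^sub>G\<^sup>2\<close>.\<close> A bounded element of \<open>L\<^sub>G\<^sup>1\<close> times an element of \<open>L\<^sub>G\<^sup>2\<close> is again in \<open>L\<^sub>G\<^sup>2\<close>, so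
  integrals of step processes with truncated coefficients cause no difficulty. If the integral of the
  square with respect to \<open>A\<close> is dominated by some \<open>Y \<in> L\<^sub>G\<^sup>1\<close>, what truncation removes is small
  uniformly over \<open>\<P>\<close>, because elements of \<open>L\<^sub>G\<^sup>1\<close> are uniformly integrable (\<open>truncation_small\<close>);
  the isometry inequality transfers this to the integrals (\<open>SI_stop_LGk\<close>). The same estimate shows that the
  step processes whose norm is given by an element of \<open>L\<^sub>G\<^sup>1\<close> form a linear space that is closed
  under stopping.

  \<^bold>\<open>Extension.\<close> By completeness of \<open>L\<^sub>G\<^sup>2\<close>, approximating step processes give a limit, recorded as a relation
  between integrands and values (\<open>integral_rel\<close>). The relation is linear and satisfies the isometry
  inequality (\<open>integral_rel_bound\<close>), which yields uniqueness and continuity. The martingale property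
  holds for stopped step integrals, and passes to the limit.\<close>

section \<open>Locally Lipschitz functions of polynomial growth\<close>

definition l1norm :: "nat \<Rightarrow> real list \<Rightarrow> real" where
  "l1norm m x = (\<Sum>i<m. \<bar>x ! i\<bar>)"

definition l1dist :: "nat \<Rightarrow> real list \<Rightarrow> real list \<Rightarrow> real" where
  "l1dist m x y = (\<Sum>i<m. \<bar>x ! i - y ! i\<bar>)"

lemma l1norm_nonneg [simp]: "0 \<le> l1norm m x"
  by (simp add: l1norm_def sum_nonneg)

lemma l1dist_nonneg [simp]: "0 \<le> l1dist m x y"
  by (simp add: l1dist_def sum_nonneg)

lemma sum_le_card_L2: "(\<Sum>i<m. \<bar>f i\<bar>) \<le> real m * L2_set f {..<m}"
proof -
  have "\<bar>f i\<bar> \<le> L2_set f {..<m}" if "i < m" for i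
    using that member_le_L2_set[of "{..<m}" i "\<lambda>i. \<bar>f i\<bar>"] by (simp add: L2_set_def)
  then have "(\<Sum>i<m. \<bar>f i\<bar>) \<le> (\<Sum>i<m. L2_set f {..<m})" by (intro sum_mono) auto
  then show ?thesis by simp
qed

lemma one_add_add_power_le:
  fixes a b :: real
  assumes "0 \<le> a" "0 \<le> b"
  shows "(1 + a + b) ^ n \<le> 3 ^ n * (1 + a ^ n + b ^ n)"
proof -
  let ?M = "max 1 (max a b)"
  have "(1 + a + b) ^ n \<le> (3 * ?M) ^ n"
    using assms by (intro power_mono) auto
  also have "\<dots> = 3 ^ n * ?M ^ n" by (simp add: power_mult_distrib)
  also have "?M ^ n \<le> 1 + a ^ n + b ^ n"
    using assms by (auto simp: max_def)
  finally show ?thesis by simp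
qed

text \<open>Measuring lists by the sum of absolute values, and moving the powers outside, changes only the
  constants; this form of the condition composes well.\<close>

lemma C_l_lip_iff:
  "\<phi> \<in> C_l_lip m \<longleftrightarrow> (\<exists>C\<ge>0. \<exists>n. \<forall>x y. length x = m \<longrightarrow> length y = m \<longrightarrow>
      \<bar>\<phi> x - \<phi> y\<bar> \<le> C * (1 + l1norm m x + l1norm m y) ^ n * l1dist m x y)" (is "_ \<longleftrightarrow> ?R")
proof
  assume "\<phi> \<in> C_l_lip m"
  then obtain C n where C: "C > 0" and b: "\<And>x y. length x = m \<Longrightarrow> length y = m \<Longrightarrow>
     \<bar>\<phi> x - \<phi> y\<bar> \<le> C * (1 + L2_set ((!) x) {..<m} ^ n + L2_set ((!) y) {..<m} ^ n)
                       * L2_set (\<lambda>i. x ! i - y ! i) {..<m}"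
    unfolding C_l_lip_def by blast
  have "\<bar>\<phi> x - \<phi> y\<bar> \<le> (3 * C) * (1 + l1norm m x + l1norm m y) ^ n * l1dist m x y"
    if l: "length x = m" "length y = m" for x y
  proof -
    have p: "L2_set ((!) z) {..<m} ^ n \<le> (1 + l1norm m x + l1norm m y) ^ n" if "z = x \<or> z = y" for z
    proof (rule power_mono)
      have "L2_set ((!) z) {..<m} \<le> l1norm m z" unfolding l1norm_def by (rule L2_set_le_sum_abs)
      then show "L2_set ((!) z) {..<m} \<le> 1 + l1norm m x + l1norm m y"
        by (rule order_trans) (use that in auto)
    qed (simp add: L2_set_nonneg)
    have "1 \<le> (1 + l1norm m x + l1norm m y) ^ n" by (rule one_le_power) simp
    then have "1 + L2_set ((!) x) {..<m} ^ n + L2_set ((!) y) {..<m} ^ n \<le> 3 * (1 + l1norm m x + l1norm m y) ^ n"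
      using p[OF disjI1[OF refl]] p[OF disjI2[OF refl]] by linarith
    then have "C * (1 + L2_set ((!) x) {..<m} ^ n + L2_set ((!) y) {..<m} ^ n) * L2_set (\<lambda>i. x ! i - y ! i) {..<m}
      \<le> C * (3 * (1 + l1norm m x + l1norm m y) ^ n) * l1dist m x y"
      using C L2_set_le_sum_abs[of "\<lambda>i. x ! i - y ! i" "{..<m}"] unfolding l1dist_def
      by (intro mult_mono) (auto simp: L2_set_nonneg sum_nonneg)
    with b[OF l] show ?thesis by (simp add: mult_ac)
  qed
  with C show ?R by (intro exI[of _ "3*C"]) auto
next
  assume ?R
  then obtain C n where C: "C \<ge> 0" and b: "\<And>x y. length x = m \<Longrightarrow> length y = m \<Longrightarrow>
      \<bar>\<phi> x - \<phi> y\<bar> \<le> C * (1 + l1norm m x + l1norm m y) ^ n * l1dist m x y" by blast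
  define K where "K = 1 + real m"
  have "\<bar>\<phi> x - \<phi> y\<bar> \<le> ((C+1) * 3 ^ n * K ^ n * K) * (1 + L2_set ((!) x) {..<m} ^ n + L2_set ((!) y) {..<m} ^ n)
                       * L2_set (\<lambda>i. x ! i - y ! i) {..<m}"
    if l: "length x = m" "length y = m" for x y
  proof -
    have n1: "l1norm m z \<le> K * L2_set ((!) z) {..<m}" for z
      using sum_le_card_L2[of "(!) z" m] L2_set_nonneg[of "(!) z" "{..<m}"]
      unfolding l1norm_def K_def distrib_right by linarith
    have d1: "l1dist m x y \<le> K * L2_set (\<lambda>i. x ! i - y ! i) {..<m}"
      using sum_le_card_L2[of "\<lambda>i. x ! i - y ! i" m] L2_set_nonneg[of "\<lambda>i. x ! i - y ! i" "{..<m}"]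
      unfolding l1dist_def K_def distrib_right by linarith
    have "(1 + l1norm m x + l1norm m y) \<le> K * (1 + L2_set ((!) x) {..<m} + L2_set ((!) y) {..<m})"
      using n1[of x] n1[of y] by (simp add: algebra_simps K_def)
    then have "(1 + l1norm m x + l1norm m y) ^ n \<le> (K * (1 + L2_set ((!) x) {..<m} + L2_set ((!) y) {..<m})) ^ n"
      by (intro power_mono) auto
    also have "\<dots> \<le> K ^ n * (3 ^ n * (1 + L2_set ((!) x) {..<m} ^ n + L2_set ((!) y) {..<m} ^ n))"
      unfolding power_mult_distrib
      by (intro mult_left_mono one_add_add_power_le) (auto simp: L2_set_nonneg K_def)
    finally have p: "(1 + l1norm m x + l1norm m y) ^ n 
        \<le> K ^ n * (3 ^ n * (1 + L2_set ((!) x) {..<m} ^ n + L2_set ((!) y) {..<m} ^ n))" .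
    have "C * (1 + l1norm m x + l1norm m y) ^ n * l1dist m x y \<le> 
      (C+1) * (K ^ n * (3 ^ n * (1 + L2_set ((!) x) {..<m} ^ n + L2_set ((!) y) {..<m} ^ n)))
         * (K * L2_set (\<lambda>i. x ! i - y ! i) {..<m})"
      using C p d1 by (intro mult_mono) (auto simp: L2_set_nonneg K_def)
    with b[OF l] show ?thesis by (simp add: mult_ac)
  qed
  moreover have "(C+1) * 3 ^ n * K ^ n * K > 0" using C by (simp add: K_def)
  ultimately show "\<phi> \<in> C_l_lip m" unfolding C_l_lip_def by blast
qed

lemma C_l_lipI:
  assumes "0 \<le> C" and "\<And>x y. length x = m \<Longrightarrow> length y = m \<Longrightarrow>
      \<bar>\<phi> x - \<phi> y\<bar> \<le> C * (1 + l1norm m x + l1norm m y) ^ n * l1dist m x y"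
  shows "\<phi> \<in> C_l_lip m"
  using assms unfolding C_l_lip_iff by blast

lemma C_l_lipE:
  assumes "\<phi> \<in> C_l_lip m"
  obtains C n where "0 \<le> C" and "\<And>x y. length x = m \<Longrightarrow> length y = m \<Longrightarrow>
      \<bar>\<phi> x - \<phi> y\<bar> \<le> C * (1 + l1norm m x + l1norm m y) ^ n * l1dist m x y"
  using assms unfolding C_l_lip_iff by blast

lemma C_l_lip_cong:
  assumes "\<phi> \<in> C_l_lip m" "\<And>x. length x = m \<Longrightarrow> \<phi> x = \<psi> x"
  shows "\<psi> \<in> C_l_lip m"
  using assms unfolding C_l_lip_iff by metis

text \<open>Finitely many functions share their constants, as the composition with a function of all of them
  requires.\<close>

lemma C_l_lip_uniform:
  fixes k :: nat
  assumes "\<And>i. i < k \<Longrightarrow> g i \<in> C_l_lip m"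
  shows "\<exists>C\<ge>0. \<exists>n. \<forall>i<k. \<forall>x y. length x = m \<longrightarrow> length y = m \<longrightarrow>
      \<bar>g i x - g i y\<bar> \<le> C * (1 + l1norm m x + l1norm m y) ^ n * l1dist m x y"
  using assms
proof (induction k)
  case 0
  then show ?case by (intro exI[of _ 0]) auto
next
  case (Suc k)
  have "\<exists>C\<ge>0. \<exists>n. \<forall>i<k. \<forall>x y. length x = m \<longrightarrow> length y = m \<longrightarrow>
      \<bar>g i x - g i y\<bar> \<le> C * (1 + l1norm m x + l1norm m y) ^ n * l1dist m x y"
    by (rule Suc.IH) (rule Suc.prems, simp)
  then obtain C n where C: "0 \<le> C" and b: "\<And>i x y. i < k \<Longrightarrow> length x = m \<Longrightarrow> length y = m \<Longrightarrow>
      \<bar>g i x - g i y\<bar> \<le> C * (1 + l1norm m x + l1norm m y) ^ n * l1dist m x y" 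
    by blast
  have "g k \<in> C_l_lip m" by (rule Suc.prems) simp
  then obtain C' n' where C': "0 \<le> C'" and b': "\<And>x y. length x = m \<Longrightarrow> length y = m \<Longrightarrow>
      \<bar>g k x - g k y\<bar> \<le> C' * (1 + l1norm m x + l1norm m y) ^ n' * l1dist m x y" by (rule C_l_lipE) blast
  have mono: "c * (1 + l1norm m x + l1norm m y) ^ p * l1dist m x y
      \<le> (C + C') * (1 + l1norm m x + l1norm m y) ^ (n + n') * l1dist m x y"
    if "c \<le> C + C'" "p \<le> n + n'" "0 \<le> c" for c p x y
    using that C C' by (intro mult_right_mono mult_mono power_increasing) auto
  have "\<bar>g i x - g i y\<bar> \<le> (C + C') * (1 + l1norm m x + l1norm m y) ^ (n + n') * l1dist m x y"
    if "i < Suc k" "length x = m" "length y = m" for i x y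
  proof (cases "i = k")
    case True
    with b'[OF that(2,3)] mono[of C' n' x y] C C' show ?thesis by simp
  next
    case False
    with that(1) have "i < k" by simp
    from b[OF this that(2,3)] mono[of C n x y] C C' show ?thesis by simp
  qed
  then show ?case using C C' by (intro exI[of _ "C + C'"] conjI exI[of _ "n + n'"]) auto
qed

lemma C_l_lip_compose:
  assumes \<phi>: "\<phi> \<in> C_l_lip k" and g: "\<And>i. i < k \<Longrightarrow> g i \<in> C_l_lip m"
  shows "(\<lambda>x. \<phi> (map (\<lambda>i. g i x) [0..<k])) \<in> C_l_lip m"
proof -
  have "\<exists>C\<ge>0. \<exists>n. \<forall>i<k. \<forall>x y. length x = m \<longrightarrow> length y = m \<longrightarrow>
      \<bar>g i x - g i y\<bar> \<le> C * (1 + l1norm m x + l1norm m y) ^ n * l1dist m x y"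
    by (rule C_l_lip_uniform) (rule g)
  then obtain L q where L: "0 \<le> L" and
    lip: "\<And>i x y. i < k \<Longrightarrow> length x = m \<Longrightarrow> length y = m \<Longrightarrow>
      \<bar>g i x - g i y\<bar> \<le> L * (1 + l1norm m x + l1norm m y) ^ q * l1dist m x y" by blast
  from \<phi> obtain C n where C: "0 \<le> C" and b: "\<And>x y. length x = k \<Longrightarrow> length y = k \<Longrightarrow>
      \<bar>\<phi> x - \<phi> y\<bar> \<le> C * (1 + l1norm k x + l1norm k y) ^ n * l1dist k x y" by (rule C_l_lipE) blast
  let ?z = "replicate m (0::real)"
  define K where "K = (\<Sum>i<k. \<bar>g i ?z\<bar>) + real k * L"
  have K: "0 \<le> K" using L by (simp add: K_def sum_nonneg)
  let ?G = "\<lambda>x. map (\<lambda>i. g i x) [0..<k]"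
  have growth: "l1norm k (?G x) \<le> K * (1 + l1norm m x + l1norm m y) ^ Suc q" 
    if "length x = m" for x y
  proof -
    let ?S = "1 + l1norm m x + l1norm m y"
    have S1: "1 \<le> ?S" by simp
    then have S: "1 \<le> ?S ^ Suc q" by (rule one_le_power)
    have z: "l1norm m ?z = 0" "l1dist m x ?z = l1norm m x" by (auto simp: l1norm_def l1dist_def)
    have "l1norm k (?G x) = (\<Sum>i<k. \<bar>g i x\<bar>)" by (simp add: l1norm_def)
    also have "\<dots> \<le> (\<Sum>i<k. \<bar>g i ?z\<bar> * ?S ^ Suc q + L * ?S ^ Suc q)"
    proof (rule sum_mono)
      fix i assume "i \<in> {..<k}"
      then have i: "i < k" by simp
      have "\<bar>g i x\<bar> \<le> \<bar>g i ?z\<bar> + L * (1 + l1norm m x) ^ q * l1norm m x"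
        using lip[OF i that, of ?z] z by simp
      also have "L * (1 + l1norm m x) ^ q * l1norm m x \<le> L * ?S ^ q * ?S"
        using L by (intro mult_mono power_mono) auto
      also have "\<bar>g i ?z\<bar> \<le> \<bar>g i ?z\<bar> * ?S ^ Suc q" using mult_left_mono[OF S, of "\<bar>g i ?z\<bar>"] by simp
      finally show "\<bar>g i x\<bar> \<le> \<bar>g i ?z\<bar> * ?S ^ Suc q + L * ?S ^ Suc q" by (simp add: mult_ac)
    qed
    also have "\<dots> = K * ?S ^ Suc q"
      by (simp only: K_def sum.distrib sum_distrib_right[symmetric] sum_constant card_lessThan distrib_right mult.assoc)
    finally show ?thesis .
  qed
  show ?thesis
  proof (rule C_l_lipI[of "C * (1 + 2 * K) ^ n * (real k * L)" _ _ "Suc q * n + q"])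
    show "0 \<le> C * (1 + 2 * K) ^ n * (real k * L)" using C K L by simp
    fix x y :: "real list" assume l: "length x = m" "length y = m"
    let ?S = "1 + l1norm m x + l1norm m y"
    have "1 \<le> ?S" by simp
    then have S: "1 \<le> ?S ^ Suc q" by (rule one_le_power)
    have "l1norm k (?G y) \<le> K * ?S ^ Suc q" using growth[OF l(2), of x] by (simp add: add_ac)
    with growth[OF l(1), of y] S have "1 + l1norm k (?G x) + l1norm k (?G y) \<le> (1 + 2 * K) * ?S ^ Suc q"
      by (simp add: algebra_simps)
    then have p: "(1 + l1norm k (?G x) + l1norm k (?G y)) ^ n \<le> ((1 + 2 * K) * ?S ^ Suc q) ^ n"
      by (rule power_mono) (simp add: add_nonneg_nonneg)
    have "l1dist k (?G x) (?G y) = (\<Sum>i<k. \<bar>g i x - g i y\<bar>)" by (simp add: l1dist_def)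
    also have "\<dots> \<le> (\<Sum>i<k. L * ?S ^ q * l1dist m x y)" using lip l by (intro sum_mono) auto
    finally have d: "l1dist k (?G x) (?G y) \<le> real k * L * (?S ^ q * l1dist m x y)" by (simp add: mult_ac)
    have "\<bar>\<phi> (?G x) - \<phi> (?G y)\<bar> \<le> C * (1 + l1norm k (?G x) + l1norm k (?G y)) ^ n * l1dist k (?G x) (?G y)"
      by (rule b) auto
    also have "\<dots> \<le> C * ((1 + 2 * K) * ?S ^ Suc q) ^ n * (real k * L * (?S ^ q * l1dist m x y))"
      using C K p d by (intro mult_mono) (auto intro!: mult_nonneg_nonneg)
    also have "\<dots> = C * (1 + 2 * K) ^ n * (real k * L) * ?S ^ (Suc q * n + q) * l1dist m x y"
      by (simp only: power_add power_mult[of _ "Suc q" n] power_mult_distrib) (simp only: mult_ac)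
    finally show "\<bar>\<phi> (?G x) - \<phi> (?G y)\<bar> \<le> \<dots>" .
  qed
qed

lemma C_l_lip_compose_list:
  assumes "\<phi> \<in> C_l_lip k" and "\<And>y. length y = m \<Longrightarrow> length (F y) = k"
    and "\<And>i. i < k \<Longrightarrow> (\<lambda>y. F y ! i) \<in> C_l_lip m"
  shows "(\<lambda>y. \<phi> (F y)) \<in> C_l_lip m"
proof (rule C_l_lip_cong)
  show "(\<lambda>y. \<phi> (map (\<lambda>i. F y ! i) [0..<k])) \<in> C_l_lip m"
    by (rule C_l_lip_compose) (use assms in auto)
  show "\<phi> (map (\<lambda>i. F y ! i) [0..<k]) = \<phi> (F y)" if "length y = m" for y
    using assms(2)[OF that] map_nth[of "F y"] by simp
qed

lemma C_l_lip_const [simp]: "(\<lambda>_. c) \<in> C_l_lip m"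
  by (rule C_l_lipI[of 0 _ _ 0]) simp_all

lemma C_l_lip_nth:
  assumes "i < m"
  shows "(\<lambda>x. x ! i) \<in> C_l_lip m"
proof (rule C_l_lipI[of 1 _ _ 0])
  show "\<bar>x ! i - y ! i\<bar> \<le> 1 * (1 + l1norm m x + l1norm m y) ^ 0 * l1dist m x y" for x y :: "real list"
    using member_le_sum[of i "{..<m}" "\<lambda>i. \<bar>x ! i - y ! i\<bar>"] assms by (simp add: l1dist_def)
qed simp

lemma C_l_lip_lipschitz:
  assumes \<phi>: "\<phi> \<in> C_l_lip m" and h: "\<And>x y. \<bar>h x - h y\<bar> \<le> L * \<bar>x - y :: real\<bar>"
  shows "(\<lambda>x. h (\<phi> x)) \<in> C_l_lip m"
proof -
  from \<phi> obtain C n where C: "0 \<le> C" and b: "\<And>x y. length x = m \<Longrightarrow> length y = m \<Longrightarrow>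
      \<bar>\<phi> x - \<phi> y\<bar> \<le> C * (1 + l1norm m x + l1norm m y) ^ n * l1dist m x y" by (rule C_l_lipE) blast
  have L: "0 \<le> L" using h[of 0 1] by simp
  show ?thesis
  proof (rule C_l_lipI[of "L * C" _ _ n])
    fix x y :: "real list" assume "length x = m" "length y = m"
    from mult_left_mono[OF b[OF this] L] h[of "\<phi> x" "\<phi> y"]
    show "\<bar>h (\<phi> x) - h (\<phi> y)\<bar> \<le> L * C * (1 + l1norm m x + l1norm m y) ^ n * l1dist m x y"
      by (simp add: mult_ac)
  qed (use L C in simp)
qed

lemma C_l_lip_add:
  assumes "\<phi> \<in> C_l_lip m" "\<psi> \<in> C_l_lip m"
  shows "(\<lambda>x. \<phi> x + \<psi> x) \<in> C_l_lip m"
proof -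
  define g where "g = (\<lambda>i::nat. if i = 0 then \<phi> else \<psi>)"
  have "(\<lambda>x. x ! 0 + x ! 1) \<in> C_l_lip 2"
    by (rule C_l_lipI[of 1 _ _ 0]) (auto simp: l1dist_def eval_nat_numeral)
  from C_l_lip_compose[OF this, of g m] assms show ?thesis by (simp add: g_def)
qed

lemma C_l_lip_cmult:
  assumes "\<phi> \<in> C_l_lip m"
  shows "(\<lambda>x. c * \<phi> x) \<in> C_l_lip m"
proof (rule C_l_lip_lipschitz[OF assms])
  show "\<bar>c * x - c * y\<bar> \<le> \<bar>c\<bar> * \<bar>x - y\<bar>" for x y
    by (metis abs_mult order_refl right_diff_distrib)
qed

lemma C_l_lip_mult:
  assumes "\<phi> \<in> C_l_lip m" "\<psi> \<in> C_l_lip m"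
  shows "(\<lambda>x. \<phi> x * \<psi> x) \<in> C_l_lip m"
proof -
  define g where "g = (\<lambda>i::nat. if i = 0 then \<phi> else \<psi>)"
  have "(\<lambda>x. x ! 0 * x ! 1) \<in> C_l_lip 2"
  proof (rule C_l_lipI[of 1 _ _ 1])
    fix x y :: "real list"
    have "\<bar>x!0 * x!1 - y!0 * y!1\<bar> \<le> \<bar>x!0\<bar> * \<bar>x!1 - y!1\<bar> + \<bar>y!1\<bar> * \<bar>x!0 - y!0\<bar>"
    proof -
      have "x!0 * x!1 - y!0 * y!1 = x!0 * (x!1 - y!1) + y!1 * (x!0 - y!0)" by (simp only: ring_distribs) (simp add: mult.commute)
      then show ?thesis by (metis abs_mult abs_triangle_ineq)
    qed
    also have "\<dots> \<le> (1 + l1norm 2 x + l1norm 2 y) * \<bar>x!1 - y!1\<bar> + (1 + l1norm 2 x + l1norm 2 y) * \<bar>x!0 - y!0\<bar>"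
      by (intro add_mono mult_right_mono) (auto simp: l1norm_def eval_nat_numeral)
    finally show "\<bar>x!0 * x!1 - y!0 * y!1\<bar> \<le> 1 * (1 + l1norm 2 x + l1norm 2 y) ^ 1 * l1dist 2 x y"
      by (simp add: l1dist_def eval_nat_numeral algebra_simps)
  qed simp
  from C_l_lip_compose[OF this, of g m] assms show ?thesis by (simp add: g_def)
qed

lemma C_l_lip_sum:
  assumes "\<And>i. i \<in> I \<Longrightarrow> \<phi> i \<in> C_l_lip m"
  shows "(\<lambda>x. \<Sum>i\<in>I. \<phi> i x) \<in> C_l_lip m"
  using assms
proof (induction I rule: infinite_finite_induct)
  case (insert i I)
  then show ?case using C_l_lip_add[of "\<phi> i" m "\<lambda>x. \<Sum>i\<in>I. \<phi> i x"] by simp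
qed simp_all

lemma C_l_lip_power:
  assumes "\<phi> \<in> C_l_lip m"
  shows "(\<lambda>x. \<phi> x ^ n) \<in> C_l_lip m"
proof (induction n)
  case (Suc n)
  then show ?case using C_l_lip_mult[OF assms, of "\<lambda>x. \<phi> x ^ n"] by simp
qed simp

lemma C_l_lip_abs: "\<phi> \<in> C_l_lip m \<Longrightarrow> (\<lambda>x. \<bar>\<phi> x\<bar>) \<in> C_l_lip m"
  by (rule C_l_lip_lipschitz[where h = abs and L = 1]) (assumption, simp add: abs_triangle_ineq3)

lemma C_l_lip_tendsto:
  assumes "\<phi> \<in> C_l_lip m" and l: "\<And>a. length (f a) = m" "length x = m"
    and t: "\<And>i. i < m \<Longrightarrow> ((\<lambda>a. f a ! i) \<longlongrightarrow> x ! i) F"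
  shows "((\<lambda>a. \<phi> (f a)) \<longlongrightarrow> \<phi> x) F"
proof -
  from assms(1) obtain C n where C: "0 \<le> C" and b: "\<And>x y. length x = m \<Longrightarrow> length y = m \<Longrightarrow>
      \<bar>\<phi> x - \<phi> y\<bar> \<le> C * (1 + l1norm m x + l1norm m y) ^ n * l1dist m x y" by (rule C_l_lipE) blast
  have "((\<lambda>a. C * (1 + l1norm m (f a) + l1norm m x) ^ n * l1dist m (f a) x) \<longlongrightarrow>
     C * (1 + l1norm m x + l1norm m x) ^ n * l1dist m x x) F"
    unfolding l1norm_def l1dist_def using t by (intro tendsto_intros) auto
  then have "((\<lambda>a. C * (1 + l1norm m (f a) + l1norm m x) ^ n * l1dist m (f a) x) \<longlongrightarrow> 0) F"
    by (simp add: l1dist_def)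
  then have "((\<lambda>a. \<phi> (f a) - \<phi> x) \<longlongrightarrow> 0) F"
    by (rule Lim_null_comparison[rotated]) (use b l in \<open>auto intro!: always_eventually\<close>)
  then show ?thesis by (simp add: LIM_zero_cancel)
qed

section \<open>Sequences of independent G-normal variables\<close>

locale G_normal_sequence =
  fixes \<sigma>\<^sub>0 :: real and H :: "('a \<Rightarrow> real) set" and E\<^sub>\<xi> :: "('a \<Rightarrow> real) \<Rightarrow> real"
    and \<xi> :: "nat \<Rightarrow> 'a \<Rightarrow> real"
  assumes sublinear: "sublinear_expectation H E\<^sub>\<xi>"
    and xi_H: "\<xi> i \<in> H"
    and xi_normal: "G_normal \<sigma>\<^sub>0 E\<^sub>\<xi> (\<xi> i)"
    and xi_indep: "independent_of E\<^sub>\<xi> [\<xi> (Suc i)] (map \<xi> [0..<Suc i])"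
begin

lemma H_const: "(\<lambda>_. c) \<in> H"
  and H_add: "X \<in> H \<Longrightarrow> Y \<in> H \<Longrightarrow> (\<lambda>w. X w + Y w) \<in> H"
  and H_cmult: "X \<in> H \<Longrightarrow> (\<lambda>w. c * X w) \<in> H"
  and H_compose: "\<phi> \<in> C_l_lip m \<Longrightarrow> (\<And>i. i < m \<Longrightarrow> Z i \<in> H) \<Longrightarrow> (\<lambda>w. \<phi> (map (\<lambda>i. Z i w) [0..<m])) \<in> H"
  and E_mono: "X \<in> H \<Longrightarrow> Y \<in> H \<Longrightarrow> (\<And>w. X w \<le> Y w) \<Longrightarrow> E\<^sub>\<xi> X \<le> E\<^sub>\<xi> Y"
  and E_const: "E\<^sub>\<xi> (\<lambda>_. c) = c"
  and E_diff: "X \<in> H \<Longrightarrow> Y \<in> H \<Longrightarrow> E\<^sub>\<xi> X - E\<^sub>\<xi> Y \<le> E\<^sub>\<xi> (\<lambda>w. X w - Y w)"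
  and E_cmult: "0 \<le> c \<Longrightarrow> X \<in> H \<Longrightarrow> E\<^sub>\<xi> (\<lambda>w. c * X w) = c * E\<^sub>\<xi> X"
  using sublinear unfolding sublinear_expectation_def by simp_all

lemma H_compose_list:
  assumes "\<phi> \<in> C_l_lip m" "\<And>w. length (Z w) = m" "\<And>i. i < m \<Longrightarrow> (\<lambda>w. Z w ! i) \<in> H"
  shows "(\<lambda>w. \<phi> (Z w)) \<in> H"
proof -
  have "(\<lambda>w. \<phi> (map (\<lambda>i. Z w ! i) [0..<m])) \<in> H"
    by (rule H_compose) (use assms in auto)
  also have "(\<lambda>w. \<phi> (map (\<lambda>i. Z w ! i) [0..<m])) = (\<lambda>w. \<phi> (Z w))"
    by (metis assms(2) map_nth)
  finally show ?thesis .
qed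

lemma H_diff: "X \<in> H \<Longrightarrow> Y \<in> H \<Longrightarrow> (\<lambda>w. X w - Y w) \<in> H"
  using H_add[OF _ H_cmult[of Y "-1"], of X] by simp

lemma H_abs:
  assumes "X \<in> H" shows "(\<lambda>w. \<bar>X w\<bar>) \<in> H"
proof -
  have "(\<lambda>x::real list. \<bar>x ! 0\<bar>) \<in> C_l_lip 1" by (intro C_l_lip_abs C_l_lip_nth) simp
  from H_compose_list[OF this, of "\<lambda>w. [X w]"] assms show ?thesis by simp
qed

lemma E_add_const:
  assumes "X \<in> H" shows "E\<^sub>\<xi> (\<lambda>w. X w + c) = E\<^sub>\<xi> X + c"
proof (rule antisym)
  have H: "(\<lambda>w. X w + c) \<in> H" by (rule H_add[OF assms H_const])
  show "E\<^sub>\<xi> (\<lambda>w. X w + c) \<le> E\<^sub>\<xi> X + c" using E_diff[OF H assms] E_const[of c] by simp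
  show "E\<^sub>\<xi> X + c \<le> E\<^sub>\<xi> (\<lambda>w. X w + c)" using E_diff[OF assms H] E_const[of "-c"] by simp
qed

lemma E_abs_diff:
  assumes "X \<in> H" "Y \<in> H" shows "\<bar>E\<^sub>\<xi> X - E\<^sub>\<xi> Y\<bar> \<le> E\<^sub>\<xi> (\<lambda>w. \<bar>X w - Y w\<bar>)"
proof -
  have "E\<^sub>\<xi> X - E\<^sub>\<xi> Y \<le> E\<^sub>\<xi> (\<lambda>w. \<bar>X w - Y w\<bar>)" if "X \<in> H" "Y \<in> H" for X Y
  proof -
    have "E\<^sub>\<xi> (\<lambda>w. X w - Y w) \<le> E\<^sub>\<xi> (\<lambda>w. \<bar>X w - Y w\<bar>)"
      by (intro E_mono H_abs H_diff that) simp
    with E_diff[OF that] show ?thesis by simp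
  qed
  from this[OF assms] this[OF assms(2,1)] show ?thesis by (simp add: abs_minus_commute)
qed

text \<open>Integrating out the last coordinates keeps the growth condition: the moments of those
  coordinates enter only through the constant.\<close>

lemma C_l_lip_expect:
  assumes \<phi>: "\<phi> \<in> C_l_lip (m + k)" and l: "\<And>w. length (Z w) = k"
    and Z: "\<And>i. i < k \<Longrightarrow> (\<lambda>w. Z w ! i) \<in> H"
  shows "(\<lambda>x. E\<^sub>\<xi> (\<lambda>w. \<phi> (x @ Z w))) \<in> C_l_lip m"
proof -
  from \<phi> obtain C n where C: "0 \<le> C" and b: "\<And>x y. length x = m + k \<Longrightarrow> length y = m + k \<Longrightarrow>
      \<bar>\<phi> x - \<phi> y\<bar> \<le> C * (1 + l1norm (m + k) x + l1norm (m + k) y) ^ n * l1dist (m + k) x y"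
    by (rule C_l_lipE) blast
  have split: "l1norm (m + k) (x @ z) = l1norm m x + l1norm k z"
       "l1dist (m + k) (x @ z) (y @ z) = l1dist m x y" 
     if "length x = m" "length y = m" for x y z :: "real list"
  proof -
    have s: "(\<Sum>i<m+k. f i) = (\<Sum>i<m. f i) + (\<Sum>i<k. f (m + i))" for f :: "nat \<Rightarrow> real"
      by (induction k) auto
    show "l1norm (m + k) (x @ z) = l1norm m x + l1norm k z" 
       "l1dist (m + k) (x @ z) (y @ z) = l1dist m x y" 
      unfolding l1norm_def l1dist_def s using that by (auto simp: nth_append intro!: sum.cong)
  qed
  define Q where "Q = (\<lambda>w. (1 + 2 * l1norm k (Z w)) ^ n)"
  have "(\<lambda>z. (1 + 2 * l1norm k z) ^ n) \<in> C_l_lip k"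
    unfolding l1norm_def
    by (intro C_l_lip_power C_l_lip_add C_l_lip_const C_l_lip_cmult C_l_lip_sum C_l_lip_abs C_l_lip_nth) auto
  from H_compose_list[OF this l Z] have Q: "Q \<in> H" by (simp add: Q_def)
  have "E\<^sub>\<xi> (\<lambda>_. 0) \<le> E\<^sub>\<xi> Q" by (intro E_mono H_const Q) (simp add: Q_def)
  then have Q0: "0 \<le> E\<^sub>\<xi> Q" by (simp add: E_const)
  have inH: "(\<lambda>w. \<phi> (x @ Z w)) \<in> H" if "length x = m" for x
  proof (rule H_compose_list[OF \<phi>])
    show "(\<lambda>w. (x @ Z w) ! i) \<in> H" if "i < m + k" for i
      using Z[of "i - m"] that \<open>length x = m\<close> by (cases "i < m") (auto simp: nth_append H_const)
  qed (use that l in simp)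
  show ?thesis
  proof (rule C_l_lipI[of "C * E\<^sub>\<xi> Q" _ _ n])
    fix x y :: "real list" assume xy: "length x = m" "length y = m"
    let ?S = "1 + l1norm m x + l1norm m y"
    let ?c = "C * ?S ^ n * l1dist m x y"
    have c: "0 \<le> ?c" using C by simp
    have pw: "\<bar>\<phi> (x @ Z w) - \<phi> (y @ Z w)\<bar> \<le> ?c * Q w" for w
    proof -
      have "1 + l1norm (m + k) (x @ Z w) + l1norm (m + k) (y @ Z w) = ?S + 2 * l1norm k (Z w)"
        using split(1)[OF xy] split(1)[OF xy(2,1)] by simp
      also have "\<dots> \<le> ?S * (1 + 2 * l1norm k (Z w))"
        by (simp add: algebra_simps)
      finally have "(1 + l1norm (m + k) (x @ Z w) + l1norm (m + k) (y @ Z w)) ^ n \<le> (?S * (1 + 2 * l1norm k (Z w))) ^ n"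
        by (rule power_mono) (simp add: add_nonneg_nonneg)
      then have "C * (1 + l1norm (m + k) (x @ Z w) + l1norm (m + k) (y @ Z w)) ^ n * l1dist m x y \<le> C * (?S * (1 + 2 * l1norm k (Z w))) ^ n * l1dist m x y"
        using C by (intro mult_right_mono mult_left_mono) auto
      also have "\<dots> = ?c * Q w" by (simp only: Q_def power_mult_distrib mult_ac)
      finally show ?thesis using b[of "x @ Z w" "y @ Z w"] xy l split(2)[OF xy] by simp
    qed
    have "\<bar>E\<^sub>\<xi> (\<lambda>w. \<phi> (x @ Z w)) - E\<^sub>\<xi> (\<lambda>w. \<phi> (y @ Z w))\<bar> \<le> E\<^sub>\<xi> (\<lambda>w. \<bar>\<phi> (x @ Z w) - \<phi> (y @ Z w)\<bar>)"
      by (intro E_abs_diff inH xy)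
    also have "\<dots> \<le> E\<^sub>\<xi> (\<lambda>w. ?c * Q w)"
      by (intro E_mono H_abs H_diff inH xy H_cmult Q pw)
    also have "\<dots> = ?c * E\<^sub>\<xi> Q" by (rule E_cmult[OF c Q])
    finally show "\<bar>E\<^sub>\<xi> (\<lambda>w. \<phi> (x @ Z w)) - E\<^sub>\<xi> (\<lambda>w. \<phi> (y @ Z w))\<bar> \<le> C * E\<^sub>\<xi> Q * ?S ^ n * l1dist m x y"
      by (simp only: mult_ac)
  qed (use C Q0 in simp)
qed

definition block :: "(nat \<Rightarrow> real) \<Rightarrow> nat \<Rightarrow> nat \<Rightarrow> 'a \<Rightarrow> real list" where
  "block c j k w = map (\<lambda>i. c i * \<xi> i w) [j..<k]"

lemma length_block [simp]: "length (block c j k w) = k - j"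
  by (simp add: block_def)

lemma block_H: "i < k - j \<Longrightarrow> (\<lambda>w. block c j k w ! i) \<in> H"
  by (simp add: block_def H_cmult xi_H)

lemma block_Suc: "block c j (Suc (j + k)) w = block c j (j + k) w @ [c (j + k) * \<xi> (j + k) w]"
  by (simp add: block_def)

lemma xi_indep_last:
  assumes "\<phi> \<in> C_l_lip (Suc j)"
  shows "E\<^sub>\<xi> (\<lambda>w. \<phi> (map (\<lambda>i. \<xi> i w) [0..<j] @ [\<xi> j w])) =
    E\<^sub>\<xi> (\<lambda>w. E\<^sub>\<xi> (\<lambda>w'. \<phi> (map (\<lambda>i. \<xi> i w) [0..<j] @ [\<xi> j w'])))"
proof (cases j)
  case 0
  then show ?thesis by (simp add: E_const)
next
  case (Suc i)
  have "\<phi> \<in> C_l_lip (length (map \<xi> [0..<Suc i]) + length [\<xi> (Suc i)])" using assms Suc by simp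
  with xi_indep[of i] have "E\<^sub>\<xi> (\<lambda>w. \<phi> (map (\<lambda>Z. Z w) (map \<xi> [0..<Suc i]) @ map (\<lambda>Z. Z w) [\<xi> (Suc i)])) =
        E\<^sub>\<xi> (\<lambda>w. E\<^sub>\<xi> (\<lambda>w'. \<phi> (map (\<lambda>Z. Z w) (map \<xi> [0..<Suc i]) @ map (\<lambda>Z. Z w') [\<xi> (Suc i)])))"
    unfolding independent_of_def by blast
  then show ?thesis unfolding Suc map_map comp_def by simp
qed

text \<open>Independence of \<open>\<xi> (j + k)\<close> from all its predecessors, applied to a function that ignores those
  before index \<open>j\<close>.\<close>

lemma block_indep_last:
  assumes \<phi>: "\<phi> \<in> C_l_lip (m + Suc k)" and x: "length x = m"
  shows "E\<^sub>\<xi> (\<lambda>w. \<phi> (x @ block c j (Suc (j + k)) w)) =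
    E\<^sub>\<xi> (\<lambda>w. E\<^sub>\<xi> (\<lambda>w'. \<phi> ((x @ block c j (j + k) w) @ [c (j + k) * \<xi> (j + k) w'])))"
proof -
  define F where "F = (\<lambda>y::real list. x @ map (\<lambda>i. c i * y ! i) [j..<Suc (j + k)])"
  have "(\<lambda>y. \<phi> (F y)) \<in> C_l_lip (Suc (j + k))"
  proof (rule C_l_lip_compose_list[OF \<phi>])
    show "length (F y) = m + Suc k" for y by (simp add: F_def x)
    show "(\<lambda>y. F y ! i) \<in> C_l_lip (Suc (j + k))" if "i < m + Suc k" for i
    proof (cases "i < m")
      case True then show ?thesis by (simp add: F_def x nth_append)
    next
      case False
      then obtain a where a: "i = m + a" using le_Suc_ex not_less by blast
      with that have ak: "a < Suc k" by simp
      have "F y ! i = c (j + a) * y ! (j + a)" for y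
        using ak x unfolding F_def a by (simp add: nth_append del: upt_Suc)
      moreover have "(\<lambda>y. c (j + a) * y ! (j + a)) \<in> C_l_lip (Suc (j + k))"
        by (rule C_l_lip_cmult, rule C_l_lip_nth) (use ak in simp)
      ultimately show ?thesis by simp
    qed
  qed
  from xi_indep_last[OF this] have "E\<^sub>\<xi> (\<lambda>w. \<phi> (F (map (\<lambda>i. \<xi> i w) [0..<j+k] @ [\<xi> (j+k) w]))) =
    E\<^sub>\<xi> (\<lambda>w. E\<^sub>\<xi> (\<lambda>w'. \<phi> (F (map (\<lambda>i. \<xi> i w) [0..<j+k] @ [\<xi> (j+k) w']))))" .
  moreover have "F (map (\<lambda>i. \<xi> i w) [0..<j+k] @ [\<xi> (j+k) w'])
      = (x @ block c j (j + k) w) @ [c (j + k) * \<xi> (j + k) w']" for w w'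
    unfolding F_def block_def by (auto simp: nth_append)
  ultimately show ?thesis by (simp add: block_Suc)
qed

lemma C_l_lip_expect_block:
  assumes "\<phi> \<in> C_l_lip (m + (k - j))"
  shows "(\<lambda>x. E\<^sub>\<xi> (\<lambda>w. \<phi> (x @ block c j k w))) \<in> C_l_lip m"
  by (rule C_l_lip_expect[OF assms]) (auto intro: block_H)

lemma C_l_lip_expect_single:
  assumes "\<phi> \<in> C_l_lip (Suc m)"
  shows "(\<lambda>x. E\<^sub>\<xi> (\<lambda>w. \<phi> (x @ [c * \<xi> i w]))) \<in> C_l_lip m"
  by (rule C_l_lip_expect[where k = 1]) (use assms in \<open>auto intro: H_cmult xi_H\<close>)

text \<open>The last variable is independent of all the others, so the variables can be integrated out one by
  one, starting from the end.\<close>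

lemma expect_block_tower:
  assumes "\<phi> \<in> C_l_lip (k + l)"
  shows "E\<^sub>\<xi> (\<lambda>w. \<phi> (block c 0 (k + l) w)) =
    E\<^sub>\<xi> (\<lambda>w. E\<^sub>\<xi> (\<lambda>w'. \<phi> (block c 0 k w @ block c k (k + l) w')))"
  using assms
proof (induction l arbitrary: \<phi>)
  case 0
  then show ?case by (simp add: block_def E_const)
next
  case (Suc l)
  define \<phi>1 where "\<phi>1 = (\<lambda>y. E\<^sub>\<xi> (\<lambda>w'. \<phi> (y @ [c (k + l) * \<xi> (k + l) w'])))"
  have \<phi>1: "\<phi>1 \<in> C_l_lip (k + l)" unfolding \<phi>1_def
    by (rule C_l_lip_expect_single) (use Suc.prems in simp)
  have "E\<^sub>\<xi> (\<lambda>w. \<phi> (block c 0 (k + Suc l) w)) = E\<^sub>\<xi> (\<lambda>w. \<phi>1 (block c 0 (k + l) w))"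
    using block_indep_last[of \<phi> 0 "k + l" "[]" c 0] Suc.prems by (simp add: \<phi>1_def)
  also have "\<dots> = E\<^sub>\<xi> (\<lambda>w. E\<^sub>\<xi> (\<lambda>w'. \<phi>1 (block c 0 k w @ block c k (k + l) w')))"
    by (rule Suc.IH[OF \<phi>1])
  also have "(\<lambda>w. E\<^sub>\<xi> (\<lambda>w'. \<phi>1 (block c 0 k w @ block c k (k + l) w'))) =
     (\<lambda>w. E\<^sub>\<xi> (\<lambda>w'. \<phi> (block c 0 k w @ block c k (k + Suc l) w')))"
    using block_indep_last[of \<phi> k l _ c k] Suc.prems by (simp add: \<phi>1_def)
  finally show ?case .
qed

text \<open>The G-heat equation determines \<open>E\<^sub>\<xi> (\<phi> (x + \<surd>t \<xi>))\<close>; here \<open>t = 1\<close> and \<open>x = 0\<close>.\<close>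

lemma xi_identically_distributed:
  assumes "\<phi> \<in> C_l_lip 1"
  shows "E\<^sub>\<xi> (\<lambda>w. \<phi> [\<xi> i w]) = E\<^sub>\<xi> (\<lambda>w. \<phi> [\<xi> k w])"
proof -
  have "G_heat_solution \<sigma>\<^sub>0 (\<lambda>x. \<phi> [x]) (\<lambda>t x. E\<^sub>\<xi> (\<lambda>w. \<phi> [x + sqrt t * \<xi> i w]))"
    using xi_normal[of i] assms unfolding G_normal_def Let_def by blast
  with xi_normal[of k] assms
  have "\<forall>t\<ge>0. \<forall>x. E\<^sub>\<xi> (\<lambda>w. \<phi> [x + sqrt t * \<xi> i w]) = E\<^sub>\<xi> (\<lambda>w. \<phi> [x + sqrt t * \<xi> k w])"
    unfolding G_normal_def Let_def by blast
  from this[rule_format, of 1 0] show ?thesis by simp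
qed

text \<open>Only the scaling factors matter, not the indices: once a variable has been isolated by independence, it
  may be replaced by any identically distributed one. This makes the conditional expectation
  independent of the number of times used to describe the past.\<close>

lemma expect_block_shift:
  assumes "\<phi> \<in> C_l_lip (m + k)" "length x = m" "\<And>i. i < k \<Longrightarrow> c (j + i) = c' (j' + i)"
  shows "E\<^sub>\<xi> (\<lambda>w. \<phi> (x @ block c j (j + k) w)) = E\<^sub>\<xi> (\<lambda>w. \<phi> (x @ block c' j' (j' + k) w))"
  using assms
proof (induction k arbitrary: \<phi>)
  case 0
  then show ?case by (simp add: block_def)
next
  case (Suc k)
  define \<phi>1 where "\<phi>1 = (\<lambda>y. E\<^sub>\<xi> (\<lambda>w'. \<phi> (y @ [c (j + k) * \<xi> (j + k) w'])))"
  have \<phi>1: "\<phi>1 \<in> C_l_lip (m + k)" unfolding \<phi>1_def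
    by (rule C_l_lip_expect_single) (use Suc.prems in simp)
  have same: "\<phi>1 y = E\<^sub>\<xi> (\<lambda>w'. \<phi> (y @ [c' (j' + k) * \<xi> (j' + k) w']))" if "length y = m + k" for y
  proof -
    have "(\<lambda>z. \<phi> (y @ [c (j + k) * z ! 0])) \<in> C_l_lip 1"
    proof (rule C_l_lip_compose_list[OF Suc.prems(1)])
      show "(\<lambda>z. (y @ [c (j + k) * z ! 0]) ! i) \<in> C_l_lip 1" if "i < m + Suc k" for i
        using that \<open>length y = m + k\<close> C_l_lip_cmult[OF C_l_lip_nth[of 0 1]]
        by (cases "i < m + k") (auto simp: nth_append)
    qed (use that in simp)
    from xi_identically_distributed[OF this, of "j + k" "j' + k"] Suc.prems(3)[of k]
    show ?thesis by (simp add: \<phi>1_def)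
  qed
  have "E\<^sub>\<xi> (\<lambda>w. \<phi> (x @ block c j (j + Suc k) w)) = E\<^sub>\<xi> (\<lambda>w. \<phi>1 (x @ block c j (j + k) w))"
    using block_indep_last[OF Suc.prems(1,2), of c j] by (simp add: \<phi>1_def)
  also have "\<dots> = E\<^sub>\<xi> (\<lambda>w. \<phi>1 (x @ block c' j' (j' + k) w))"
    by (rule Suc.IH[OF \<phi>1]) (use Suc.prems in auto)
  also have "\<dots> = E\<^sub>\<xi> (\<lambda>w. \<phi> (x @ block c' j' (j' + Suc k) w))"
    using block_indep_last[OF Suc.prems(1,2), of c' j'] Suc.prems(2) by (simp add: same)
  finally show ?case .
qed

lemma xi_increments_block: "xi_increments \<xi> t = block (\<lambda>i. sqrt (t (Suc i) - t i))"
  by (intro ext) (simp add: xi_increments_def block_def)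

end

section \<open>Cylinder random variables\<close>

lemma tendsto_B: "((\<lambda>\<omega>'. B t \<omega>') \<longlongrightarrow> B t \<omega>) (at \<omega> within S)"
proof (cases "t < 0")
  case True
  then have "B t \<omega>' = 0" for \<omega>' using Rep_path[of \<omega>'] by (auto simp: B_def)
  then show ?thesis by simp
next
  case False
  show ?thesis
  proof (rule topological_tendstoI)
    fix V :: "real set" assume V: "open V" "B t \<omega> \<in> V"
    have "open (B t -` V)"
      unfolding open_path_def
    proof
      fix \<omega>' assume "\<omega>' \<in> B t -` V"
      with V obtain e where e: "0 < e" "\<And>y. \<bar>y - B t \<omega>'\<bar> < e \<Longrightarrow> y \<in> V"
        unfolding open_dist dist_real_def by auto
      with False show "\<exists>K \<epsilon>. 0 < \<epsilon> \<and> (\<forall>\<omega>''. (\<forall>s\<in>{0..K}. \<bar>B s \<omega>'' - B s \<omega>'\<bar> < \<epsilon>) \<longrightarrow> \<omega>'' \<in> B t -` V)"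
        by (intro exI[of _ t] exI[of _ e]) auto
    qed
    with V have "\<forall>\<^sub>F \<omega>' in at \<omega> within S. \<omega>' \<in> B t -` V"
      unfolding eventually_at_topological by blast
    then show "\<forall>\<^sub>F \<omega>' in at \<omega> within S. B t \<omega>' \<in> V" by simp
  qed
qed

lemma B_0 [simp]: "B 0 \<omega> = 0"
  using Rep_path[of \<omega>] by (auto simp: B_def)

lemma Lip0_measurable:
  assumes "X \<in> Lip0 t" shows "X \<in> borel_measurable borel"
proof -
  from assms obtain m s \<phi> where "\<phi> \<in> C_l_lip m" and X: "X = (\<lambda>\<omega>. \<phi> (map (\<lambda>i. B (s i) \<omega>) [0..<m]))"
    unfolding Lip0_def by auto
  then have "(X \<longlongrightarrow> X \<omega>) (at \<omega> within UNIV)" for \<omega>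
    unfolding X by (intro C_l_lip_tendsto[of \<phi> m]) (auto intro: tendsto_B)
  then show ?thesis by (intro borel_measurable_continuous_onI) (simp add: continuous_on_def)
qed

lemma Lip0_common:
  assumes "X \<in> Lip0 t" "Y \<in> Lip0 t"
  obtains m s \<phi> \<psi> where "m \<ge> (1::nat)" "\<And>i. i < m \<Longrightarrow> s i \<in> {0..t}" "\<phi> \<in> C_l_lip m" "\<psi> \<in> C_l_lip m"
     "X = (\<lambda>\<omega>. \<phi> (map (\<lambda>i. B (s i) \<omega>) [0..<m]))" "Y = (\<lambda>\<omega>. \<psi> (map (\<lambda>i. B (s i) \<omega>) [0..<m]))"
proof -
  from assms(1) obtain m s \<phi> where m: "m \<ge> 1" and s: "\<And>i. i < m \<Longrightarrow> s i \<in> {0..t}" and \<phi>: "\<phi> \<in> C_l_lip m"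
    and X: "X = (\<lambda>\<omega>. \<phi> (map (\<lambda>i. B (s i) \<omega>) [0..<m]))"
    unfolding Lip0_def by auto
  from assms(2) obtain m' s' \<psi> where s': "\<And>i. i < m' \<Longrightarrow> s' i \<in> {0..t}" and \<psi>: "\<psi> \<in> C_l_lip m'"
    and Y: "Y = (\<lambda>\<omega>. \<psi> (map (\<lambda>i. B (s' i) \<omega>) [0..<m']))"
    unfolding Lip0_def by auto
  define r where "r i = (if i < m then s i else s' (i - m))" for i
  show thesis
  proof (rule that[of "m + m'" r "\<lambda>x. \<phi> (map (\<lambda>i. x ! i) [0..<m])" "\<lambda>x. \<psi> (map (\<lambda>i. x ! (m + i)) [0..<m'])"])
    show "r i \<in> {0..t}" if "i < m + m'" for i using s[of i] s'[of "i - m"] that by (auto simp: r_def)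
    show "(\<lambda>x. \<phi> (map ((!) x) [0..<m])) \<in> C_l_lip (m + m')"
      by (intro C_l_lip_compose \<phi> C_l_lip_nth) simp
    show "(\<lambda>x. \<psi> (map (\<lambda>i. x ! (m + i)) [0..<m'])) \<in> C_l_lip (m + m')"
      by (intro C_l_lip_compose \<psi> C_l_lip_nth) simp
    have 1: "map (\<lambda>i. map (\<lambda>i. B (r i) \<omega>) [0..<m + m'] ! i) [0..<m] = map (\<lambda>i. B (s i) \<omega>) [0..<m]" for \<omega>
      by (rule map_cong) (auto simp: r_def)
    have 2: "map (\<lambda>i. map (\<lambda>i. B (r i) \<omega>) [0..<m + m'] ! (m + i)) [0..<m'] = map (\<lambda>i. B (s' i) \<omega>) [0..<m']" for \<omega>
      by (rule map_cong) (auto simp: r_def)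
    show "X = (\<lambda>\<omega>. \<phi> (map ((!) (map (\<lambda>i. B (r i) \<omega>) [0..<m + m'])) [0..<m]))" 
      by (simp only: X 1)
    show "Y = (\<lambda>\<omega>. \<psi> (map (\<lambda>i. map (\<lambda>i. B (r i) \<omega>) [0..<m + m'] ! (m + i)) [0..<m']))"
      by (simp only: Y 2)
  qed (use m in simp)
qed

lemma Lip0I:
  assumes "m \<ge> 1" "\<And>i. i < m \<Longrightarrow> s i \<in> {0..t}" "\<phi> \<in> C_l_lip m"
  shows "(\<lambda>\<omega>. \<phi> (map (\<lambda>i. B (s i) \<omega>) [0..<m])) \<in> Lip0 t"
  unfolding Lip0_def using assms by blast

lemma Lip0_add:
  assumes "X \<in> Lip0 t" "Y \<in> Lip0 t" shows "(\<lambda>\<omega>. X \<omega> + Y \<omega>) \<in> Lip0 t"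
proof -
  from assms obtain m s \<phi> \<psi> where m: "m \<ge> (1::nat)" "\<And>i. i < m \<Longrightarrow> s i \<in> {0..t}" and C: "\<phi> \<in> C_l_lip m" "\<psi> \<in> C_l_lip m"
    and XY: "X = (\<lambda>\<omega>. \<phi> (map (\<lambda>i. B (s i) \<omega>) [0..<m]))" "Y = (\<lambda>\<omega>. \<psi> (map (\<lambda>i. B (s i) \<omega>) [0..<m]))"
    by (rule Lip0_common) blast
  from Lip0I[OF m C_l_lip_add[OF C]] show ?thesis by (simp only: XY)
qed

lemma Lip0_mult:
  assumes "X \<in> Lip0 t" "Y \<in> Lip0 t" shows "(\<lambda>\<omega>. X \<omega> * Y \<omega>) \<in> Lip0 t"
proof -
  from assms obtain m s \<phi> \<psi> where m: "m \<ge> (1::nat)" "\<And>i. i < m \<Longrightarrow> s i \<in> {0..t}" and C: "\<phi> \<in> C_l_lip m" "\<psi> \<in> C_l_lip m"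
    and XY: "X = (\<lambda>\<omega>. \<phi> (map (\<lambda>i. B (s i) \<omega>) [0..<m]))" "Y = (\<lambda>\<omega>. \<psi> (map (\<lambda>i. B (s i) \<omega>) [0..<m]))"
    by (rule Lip0_common) blast
  from Lip0I[OF m C_l_lip_mult[OF C]] show ?thesis by (simp only: XY)
qed

lemma Lip0_lipschitz:
  assumes "X \<in> Lip0 t" and h: "\<And>x y. \<bar>h x - h y\<bar> \<le> L * \<bar>x - y :: real\<bar>"
  shows "(\<lambda>\<omega>. h (X \<omega>)) \<in> Lip0 t"
proof -
  from assms(1) obtain m s \<phi> where "m \<ge> 1" "\<And>i. i < m \<Longrightarrow> s i \<in> {0..t}" "\<phi> \<in> C_l_lip m"
    "X = (\<lambda>\<omega>. \<phi> (map (\<lambda>i. B (s i) \<omega>) [0..<m]))"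
    unfolding Lip0_def by auto
  with Lip0I[of m s t "\<lambda>x. h (\<phi> x)"] C_l_lip_lipschitz[of \<phi> m h L] h show ?thesis by simp
qed

lemma Lip0_const: "0 \<le> t \<Longrightarrow> (\<lambda>_. c) \<in> Lip0 t"
  using Lip0I[of 1 "\<lambda>_. 0" t "\<lambda>_. c"] by simp

lemma Lip0_cmult:
  assumes "X \<in> Lip0 t" shows "(\<lambda>\<omega>. c * X \<omega>) \<in> Lip0 t"
proof (rule Lip0_lipschitz[OF assms])
  show "\<bar>c * x - c * y\<bar> \<le> \<bar>c\<bar> * \<bar>x - y\<bar>" for x y
    by (metis abs_mult order_refl right_diff_distrib)
qed

lemma Lip0_diff: "X \<in> Lip0 t \<Longrightarrow> Y \<in> Lip0 t \<Longrightarrow> (\<lambda>\<omega>. X \<omega> - Y \<omega>) \<in> Lip0 t"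
  using Lip0_add[OF _ Lip0_cmult[of Y t "-1"], of X] by simp

lemma Lip0_nonneg_time: "X \<in> Lip0 t \<Longrightarrow> 0 \<le> t"
  unfolding Lip0_def by (auto dest: spec[of _ 0])

lemma Lip0_power: "X \<in> Lip0 t \<Longrightarrow> (\<lambda>\<omega>. X \<omega> ^ n) \<in> Lip0 t"
proof (induction n)
  case (Suc n)
  then show ?case using Lip0_mult[of X t "\<lambda>\<omega>. X \<omega> ^ n"] by simp
qed (simp add: Lip0_const Lip0_nonneg_time)

lemma Lip0_mono:
  assumes "X \<in> Lip0 s" "s \<le> t" shows "X \<in> Lip0 t"
proof -
  from assms(1) obtain m r \<phi> where "m \<ge> 1" "\<And>i. i < m \<Longrightarrow> r i \<in> {0..s}" "\<phi> \<in> C_l_lip m"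
    "X = (\<lambda>\<omega>. \<phi> (map (\<lambda>i. B (r i) \<omega>) [0..<m]))"
    unfolding Lip0_def by auto
  with Lip0I[of m r t \<phi>] assms(2) show ?thesis by fastforce
qed

lemma Lip0_all_iff: "X \<in> Lip0_all \<longleftrightarrow> (\<exists>t. X \<in> Lip0 t)"
proof
  assume "\<exists>t. X \<in> Lip0 t"
  then obtain t where "X \<in> Lip0 t" ..
  moreover obtain n :: nat where "t \<le> real n" using real_arch_simple by blast
  ultimately show "X \<in> Lip0_all" unfolding Lip0_all_def using Lip0_mono by blast
qed (auto simp: Lip0_all_def)

lemma sum_B_increments:
  assumes "t 0 = 0"
  shows "l \<le> j \<Longrightarrow> (\<Sum>i<l. B_increments t 0 j \<omega> ! i) = B (t l) \<omega>"
proof (induction l)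
  case (Suc l)
  then show ?case by (simp add: B_increments_def)
qed (simp add: assms)

lemma length_B_increments [simp]: "length (B_increments t j k \<omega>) = k - j"
  by (simp add: B_increments_def)

text \<open>A cylinder random variable is a function of the increments along every sequence of times that passes
  through a certain finite set, so finitely many of them can be described by the same increments.\<close>

lemma Lip0_via_increments:
  assumes "X \<in> Lip0 r"
  shows "\<exists>S. finite S \<and> S \<subseteq> {0..r} \<and> (\<forall>j t. t 0 = 0 \<longrightarrow> S \<subseteq> t ` {..j} \<longrightarrow>
     (\<exists>\<phi>\<in>C_l_lip j. X = (\<lambda>\<omega>. \<phi> (B_increments t 0 j \<omega>))))"
proof -
  from assms obtain m s \<phi> where s: "\<And>i. i < m \<Longrightarrow> s i \<in> {0..r}" and \<phi>: "\<phi> \<in> C_l_lip m"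
    and X: "X = (\<lambda>\<omega>. \<phi> (map (\<lambda>i. B (s i) \<omega>) [0..<m]))"
    unfolding Lip0_def by auto
  have "\<exists>\<phi>\<in>C_l_lip j. X = (\<lambda>\<omega>. \<phi> (B_increments t 0 j \<omega>))" if t: "t 0 = 0" "s ` {..<m} \<subseteq> t ` {..j}" for j t
  proof -
    have "\<forall>i\<in>{..<m}. \<exists>l. l \<le> j \<and> s i = t l" using t(2) by fastforce
    then obtain l where l: "\<And>i. i < m \<Longrightarrow> l i \<le> j \<and> s i = t (l i)" by (metis lessThan_iff)
    define \<psi> where "\<psi> = (\<lambda>x. \<phi> (map (\<lambda>i. \<Sum>a<l i. x ! a) [0..<m]))"
    have "\<psi> \<in> C_l_lip j" unfolding \<psi>_def
    proof (rule C_l_lip_compose[OF \<phi>])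
      fix i assume "i < m"
      with l have "l i \<le> j" by blast
      then show "(\<lambda>x. \<Sum>a<l i. x ! a) \<in> C_l_lip j"
        by (intro C_l_lip_sum C_l_lip_nth) auto
    qed
    moreover have "map (\<lambda>i. \<Sum>a<l i. B_increments t 0 j \<omega> ! a) [0..<m] = map (\<lambda>i. B (s i) \<omega>) [0..<m]" for \<omega>
      using l by (intro map_cong) (auto simp: sum_B_increments t(1))
    then have "X = (\<lambda>\<omega>. \<psi> (B_increments t 0 j \<omega>))" by (simp only: X \<psi>_def)
    ultimately show ?thesis by blast
  qed
  with s show ?thesis by (intro exI[of _ "s ` {..<m}"]) auto
qed

lemma increments_Lip0:
  assumes "\<phi> \<in> C_l_lip j" "\<And>i. i \<le> j \<Longrightarrow> t i \<in> {0..r}"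
  shows "(\<lambda>\<omega>. \<phi> (B_increments t 0 j \<omega>)) \<in> Lip0 r"
proof -
  define \<psi> where "\<psi> = (\<lambda>x::real list. \<phi> (map (\<lambda>i. x ! (Suc i) - x ! i) [0..<j]))"
  have "(\<lambda>x. x ! (Suc i) + (-1) * x ! i) \<in> C_l_lip (Suc j)" if "i < j" for i
    by (intro C_l_lip_add C_l_lip_cmult C_l_lip_nth) (use that in auto)
  then have "\<psi> \<in> C_l_lip (Suc j)" unfolding \<psi>_def by (intro C_l_lip_compose assms) simp
  from Lip0I[OF _ _ this, of t r] assms(2)
  have "(\<lambda>\<omega>. \<psi> (map (\<lambda>i. B (t i) \<omega>) [0..<Suc j])) \<in> Lip0 r" by simp
  moreover have "\<psi> (map (\<lambda>i. B (t i) \<omega>) [0..<Suc j]) = \<phi> (B_increments t 0 j \<omega>)" for \<omega>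
    unfolding \<psi>_def B_increments_def by (intro arg_cong[of _ _ \<phi>] map_cong) (auto simp del: upt_Suc)
  ultimately show ?thesis by simp
qed

lemma times_mono:
  assumes "times m t" "j \<le> m" shows "i \<le> j \<Longrightarrow> t i \<le> t j"
  using assms(2)
proof (induction j)
  case (Suc j)
  show ?case
  proof (cases "i = Suc j")
    case False
    with Suc have "t i \<le> t j" by simp
    also have "t j \<le> t (Suc j)" using assms(1) Suc.prems unfolding times_def by simp
    finally show ?thesis .
  qed simp
qed simp

lemma grid_exists:
  assumes "finite S" "S \<subseteq> {0..}"
  obtains n t where "n \<ge> 1" "times n t" "t ` {..n} = insert 0 S"
proof -
  define S' where "S' = insert 0 S"
  define L where "L = 0 # sorted_list_of_set S'"
  have S': "finite S'" "0 \<in> S'" "S' \<subseteq> {0..}" using assms by (auto simp: S'_def)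
  then have L: "sorted L" "length L = Suc (card S')" "set L = S'"
    by (auto simp: L_def)
  have "(!) L ` {..card S'} = insert 0 S"
    using L nth_image[of "length L" L] unfolding S'_def[symmetric]
    by (simp add: atLeast0LessThan lessThan_Suc_atMost)
  moreover have "times (card S') ((!) L)"
    unfolding times_def
  proof (intro conjI allI impI)
    show "L ! 0 = 0" by (simp add: L_def)
    show "L ! i \<le> L ! Suc i" if "i < card S'" for i
      using sorted_nth_mono[OF L(1), of i "Suc i"] that L(2) by simp
  qed
  moreover have "card S' \<ge> 1" using S' by (simp add: Suc_le_eq card_gt_0_iff) blast
  ultimately show thesis using that by blast
qed

locale G_expectation_space = G_normal_sequence +
  fixes E :: "(path \<Rightarrow> real) \<Rightarrow> real"
  assumes G_exp: "G_expectation E\<^sub>\<xi> \<xi> E"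
begin

lemma E_cylinder:
  assumes "m \<ge> 1" "times m t" "\<phi> \<in> C_l_lip m"
  shows "E (\<lambda>\<omega>. \<phi> (B_increments t 0 m \<omega>)) = E\<^sub>\<xi> (\<lambda>w. \<phi> (xi_increments \<xi> t 0 m w))"
  using G_exp assms unfolding G_expectation_def by blast

lemma E_mono_cylinder:
  assumes "X \<in> Lip0 r" "Y \<in> Lip0 r" "\<And>\<omega>. X \<omega> \<le> Y \<omega>"
  shows "E X \<le> E Y"
proof -
  from Lip0_via_increments[OF assms(1)] obtain S1 where S1: "finite S1" "S1 \<subseteq> {0..r}"
    "\<And>j t. t 0 = 0 \<Longrightarrow> S1 \<subseteq> t ` {..j} \<Longrightarrow> (\<exists>\<phi>\<in>C_l_lip j. X = (\<lambda>\<omega>. \<phi> (B_increments t 0 j \<omega>)))"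
    by metis
  from Lip0_via_increments[OF assms(2)] obtain S2 where S2: "finite S2" "S2 \<subseteq> {0..r}"
    "\<And>j t. t 0 = 0 \<Longrightarrow> S2 \<subseteq> t ` {..j} \<Longrightarrow> (\<exists>\<phi>\<in>C_l_lip j. Y = (\<lambda>\<omega>. \<phi> (B_increments t 0 j \<omega>)))"
    by metis
  obtain n t where t: "n \<ge> 1" "times n t" "t ` {..n} = insert 0 (S1 \<union> S2)"
  proof (rule grid_exists[of "S1 \<union> S2"])
    show "S1 \<union> S2 \<subseteq> {0..}" using S1(2) S2(2) by force
  qed (use S1 S2 in auto)
  then have t0: "t 0 = 0" by (simp add: times_def)
  from S1(3)[of t n] t t0 obtain \<phi> where \<phi>: "\<phi> \<in> C_l_lip n" "X = (\<lambda>\<omega>. \<phi> (B_increments t 0 n \<omega>))" by blast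
  from S2(3)[of t n] t t0 obtain \<psi> where \<psi>: "\<psi> \<in> C_l_lip n" "Y = (\<lambda>\<omega>. \<psi> (B_increments t 0 n \<omega>))" by blast
  \<comment> \<open>Only the values of \<open>\<psi>\<close> on increments of paths are known to dominate those of \<open>\<phi>\<close>, so \<open>\<psi>\<close> is
     replaced by the maximum of both.\<close>
  define \<theta> where "\<theta> = (\<lambda>x. \<phi> x + (\<bar>\<psi> x + (-1) * \<phi> x\<bar>))"
  have \<theta>: "\<theta> \<in> C_l_lip n" unfolding \<theta>_def by (intro C_l_lip_add C_l_lip_abs C_l_lip_cmult \<phi> \<psi>)
  have Y: "Y = (\<lambda>\<omega>. \<theta> (B_increments t 0 n \<omega>))"
  proof
    fix \<omega> show "Y \<omega> = \<theta> (B_increments t 0 n \<omega>)" using assms(3)[of \<omega>] by (simp add: \<phi> \<psi> \<theta>_def)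
  qed
  have inH: "(\<lambda>w. f (xi_increments \<xi> t 0 n w)) \<in> H" if "f \<in> C_l_lip n" for f
    unfolding xi_increments_block by (rule H_compose_list[OF that]) (auto intro: block_H)
  have "E X = E\<^sub>\<xi> (\<lambda>w. \<phi> (xi_increments \<xi> t 0 n w))" unfolding \<phi>(2) by (rule E_cylinder) (use t \<phi> in auto)
  also have "\<dots> \<le> E\<^sub>\<xi> (\<lambda>w. \<theta> (xi_increments \<xi> t 0 n w))"
    by (intro E_mono inH \<phi> \<theta>) (simp add: \<theta>_def)
  also have "\<dots> = E Y" unfolding Y by (rule E_cylinder[symmetric]) (use t \<theta> in auto)
  finally show ?thesis .
qed

lemma cylinder_cond_Lip0:
  assumes "cylinder_cond E\<^sub>\<xi> \<xi> r U V"
  shows "U \<in> Lip0_all" "V \<in> Lip0 r" "0 \<le> r"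
proof -
  from assms obtain m j t \<phi> where m: "m \<ge> 1" "j \<le> m" and \<phi>: "\<phi> \<in> C_l_lip m" and t: "times m t" "t j = r"
    and U: "U = (\<lambda>\<omega>. \<phi> (B_increments t 0 m \<omega>))"
    and V: "V = (\<lambda>\<omega>. E\<^sub>\<xi> (\<lambda>w. \<phi> (B_increments t 0 j \<omega> @ xi_increments \<xi> t j m w)))"
    unfolding cylinder_cond_def by blast
  have t0: "t 0 = 0" using t by (simp add: times_def)
  have "t i \<in> {0..t m}" if "i \<le> m" for i using times_mono[OF t(1), of m i] times_mono[OF t(1), of i 0] that t0 by simp
  then show "U \<in> Lip0_all" unfolding Lip0_all_iff U using increments_Lip0[OF \<phi>] by blast
  have ti: "t i \<in> {0..r}" if "i \<le> j" for i using times_mono[OF t(1), of j i] times_mono[OF t(1), of i 0] that t0 t m by simp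
  from ti[of 0] t0 show "0 \<le> r" by simp
  have "(\<lambda>x. E\<^sub>\<xi> (\<lambda>w. \<phi> (x @ xi_increments \<xi> t j m w))) \<in> C_l_lip j"
    unfolding xi_increments_block by (rule C_l_lip_expect_block) (use \<phi> m in simp)
  from increments_Lip0[OF this ti] show "V \<in> Lip0 r" unfolding V by simp
qed

lemma cylinder_cond_exists:
  assumes "X \<in> Lip0_all" "0 \<le> r"
  shows "\<exists>V. cylinder_cond E\<^sub>\<xi> \<xi> r X V"
proof -
  from assms obtain r' where X: "X \<in> Lip0 r'" by (auto simp: Lip0_all_iff)
  from Lip0_via_increments[OF X] obtain S1 where S1: "finite S1" "S1 \<subseteq> {0..r'}"
    "\<And>j t. t 0 = 0 \<Longrightarrow> S1 \<subseteq> t ` {..j} \<Longrightarrow> (\<exists>\<phi>\<in>C_l_lip j. X = (\<lambda>\<omega>. \<phi> (B_increments t 0 j \<omega>)))"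
    by metis
  obtain n t where t: "n \<ge> 1" "times n t" "t ` {..n} = insert 0 (insert r S1)"
  proof (rule grid_exists[of "insert r S1"])
    show "insert r S1 \<subseteq> {0..}" using S1(2) assms(2) by force
  qed (use S1 in auto)
  then have "t 0 = 0" by (simp add: times_def)
  with S1(3)[of t n] t obtain \<phi> where "\<phi> \<in> C_l_lip n" "X = (\<lambda>\<omega>. \<phi> (B_increments t 0 n \<omega>))" by blast
  moreover from t(3) obtain j where "j \<le> n" "t j = r" by (metis atMost_iff imageE insertCI)
  ultimately show ?thesis unfolding cylinder_cond_def using t by blast
qed

text \<open>The times before \<open>r\<close> are refined so that \<open>Z\<close> and \<open>W\<close> become functions of the increments between
  them. The increments after \<open>r\<close> can then be integrated out first, and while this is done \<open>Z\<close> is a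
  nonnegative constant and \<open>W\<close> a constant, which a sublinear expectation lets through; what remains is
  the function that defines \<open>V\<close>, because shifting the indices of the later variables does not change
  their distribution.\<close>

lemma E_cylinder_cond:
  assumes UV: "cylinder_cond E\<^sub>\<xi> \<xi> r U V" and Z: "Z \<in> Lip0 r" "\<And>\<omega>. 0 \<le> Z \<omega>" and W: "W \<in> Lip0 r"
  shows "E (\<lambda>\<omega>. Z \<omega> * (U \<omega> - W \<omega>)) = E (\<lambda>\<omega>. Z \<omega> * (V \<omega> - W \<omega>))"
proof -
  from UV obtain m j t \<phi> where m: "m \<ge> 1" "j \<le> m" and \<phi>: "\<phi> \<in> C_l_lip m" and t: "times m t" "t j = r"
    and U: "U = (\<lambda>\<omega>. \<phi> (B_increments t 0 m \<omega>))"
    and V: "V = (\<lambda>\<omega>. E\<^sub>\<xi> (\<lambda>w. \<phi> (B_increments t 0 j \<omega> @ xi_increments \<xi> t j m w)))"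
    unfolding cylinder_cond_def by blast
  have t0: "t 0 = 0" using t by (simp add: times_def)
  have ti: "t i \<in> {0..r}" if "i \<le> j" for i using times_mono[OF t(1), of j i] times_mono[OF t(1), of i 0] that t0 t m by simp
  then have r0: "0 \<le> r" using t0 by fastforce
  from Lip0_via_increments[OF Z(1)] obtain S1 where S1: "finite S1" "S1 \<subseteq> {0..r}"
    "\<And>j t. t 0 = 0 \<Longrightarrow> S1 \<subseteq> t ` {..j} \<Longrightarrow> (\<exists>\<phi>\<in>C_l_lip j. Z = (\<lambda>\<omega>. \<phi> (B_increments t 0 j \<omega>)))"
    by metis
  from Lip0_via_increments[OF W] obtain S2 where S2: "finite S2" "S2 \<subseteq> {0..r}"
    "\<And>j t. t 0 = 0 \<Longrightarrow> S2 \<subseteq> t ` {..j} \<Longrightarrow> (\<exists>\<phi>\<in>C_l_lip j. W = (\<lambda>\<omega>. \<phi> (B_increments t 0 j \<omega>)))"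
    by metis
  define S where "S = insert r (t ` {..j} \<union> S1 \<union> S2)"
  have S: "finite S" "S \<subseteq> {0..r}" using S1 S2 ti r0 by (auto simp: S_def)
  obtain n t1 where n: "n \<ge> 1" "times n t1" "t1 ` {..n} = insert 0 S"
  proof (rule grid_exists[of S])
    show "S \<subseteq> {0..}" using S(2) by force
  qed (use S in auto)
  have t1n: "t1 n = r"
  proof (rule antisym)
    show "t1 n \<le> r" using n(3) S r0 by (metis atLeastAtMost_iff atMost_iff imageI insertE le_refl subsetD)
    obtain i where "i \<le> n" "t1 i = r" using n(3) unfolding S_def by (metis atMost_iff imageE insertCI)
    with times_mono[OF n(2), of n i] show "r \<le> t1 n" by simp
  qed
  define t' where "t' i = (if i \<le> n then t1 i else t (i - n + j))" for i
  define m' where "m' = n + (m - j)"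
  have t'n: "t' (n + i) = t (j + i)" for i
    by (cases i) (simp_all add: t'_def t1n t(2) add.commute)
  have t'0: "t' 0 = 0" using n(2) by (simp add: t'_def times_def)
  have times': "times m' t'" unfolding times_def
  proof (intro conjI allI impI t'0)
    fix i assume i: "i < m'"
    show "t' i \<le> t' (Suc i)"
    proof (cases "i < n")
      case True then show ?thesis using n(2) by (simp add: t'_def times_def)
    next
      case False
      then obtain a where a: "i = n + a" using le_Suc_ex not_less by blast
      with i have "j + a < m" by (simp add: m'_def)
      with t(1) have "t (j + a) \<le> t (Suc (j + a))" by (simp add: times_def)
      then show ?thesis using t'n[of a] t'n[of "Suc a"] a by simp
    qed
  qed
  have times'n: "times n t'" using n(2) by (simp add: times_def t'_def)
  have img: "t' ` {..n} = insert 0 S" using n(3) by (auto simp: t'_def image_def)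
  obtain zf where zf: "zf \<in> C_l_lip n" "Z = (\<lambda>\<omega>. zf (B_increments t' 0 n \<omega>))"
    using S1(3)[of t' n] t'0 img by (auto simp: S_def)
  obtain wf where wf: "wf \<in> C_l_lip n" "W = (\<lambda>\<omega>. wf (B_increments t' 0 n \<omega>))"
    using S2(3)[of t' n] t'0 img by (auto simp: S_def)
  have "\<forall>i\<in>{..j}. \<exists>l. l \<le> n \<and> t i = t' l"
  proof
    fix i assume "i \<in> {..j}"
    then have "t i \<in> t' ` {..n}" unfolding img S_def by blast
    then show "\<exists>l. l \<le> n \<and> t i = t' l" by blast
  qed
  then obtain idx where idx: "\<And>i. i \<le> j \<Longrightarrow> idx i \<le> n \<and> t i = t' (idx i)" by (metis atMost_iff)
  \<comment> \<open>\<open>F\<close> recovers the increments along \<open>t\<close> from those along the refined times \<open>t'\<close>.\<close>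
  define F where "F y = map (\<lambda>i. (\<Sum>a<idx (Suc i). y ! a) + (-1) * (\<Sum>a<idx i. y ! a)) [0..<j]" for y :: "real list"
  have lF [simp]: "length (F y) = j" for y by (simp add: F_def)
  have FC: "(\<lambda>y. F y ! i) \<in> C_l_lip n" if "i < j" for i
  proof -
    have "idx i \<le> n" "idx (Suc i) \<le> n" using idx[of i] idx[of "Suc i"] that by auto
    then have "(\<lambda>y. (\<Sum>a<idx (Suc i). y ! a) + (-1) * (\<Sum>a<idx i. y ! a)) \<in> C_l_lip n"
      by (intro C_l_lip_add C_l_lip_cmult C_l_lip_sum C_l_lip_nth) auto
    with that show ?thesis by (simp add: F_def)
  qed
  have FB: "F (B_increments t' 0 n \<omega>) = B_increments t 0 j \<omega>" for \<omega>
    unfolding F_def B_increments_def[of t 0 j]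
  proof (rule map_cong)
    fix i assume "i \<in> set [0..<j]"
    then have "i < j" by simp
    then have "idx i \<le> n" "idx (Suc i) \<le> n" "t i = t' (idx i)" "t (Suc i) = t' (idx (Suc i))"
      using idx[of i] idx[of "Suc i"] by auto
    then show "(\<Sum>a<idx (Suc i). B_increments t' 0 n \<omega> ! a) + (-1) * (\<Sum>a<idx i. B_increments t' 0 n \<omega> ! a)
      = B (t (Suc i)) \<omega> - B (t i) \<omega>" by (simp add: sum_B_increments t'0)
  qed simp
  define c where "c i = sqrt (t' (Suc i) - t' i)" for i
  define \<kappa> where "\<kappa> z = E\<^sub>\<xi> (\<lambda>w. \<phi> (z @ xi_increments \<xi> t j m w))" for z
  have \<kappa>: "\<kappa> \<in> C_l_lip j" unfolding \<kappa>_def xi_increments_block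
    by (rule C_l_lip_expect_block) (use \<phi> m in simp)
  have \<kappa>': "E\<^sub>\<xi> (\<lambda>w. \<phi> (z @ block c n m' w)) = \<kappa> z" if "length z = j" for z
  proof -
    have "E\<^sub>\<xi> (\<lambda>w. \<phi> (z @ block (\<lambda>i. sqrt (t (Suc i) - t i)) j (j + (m - j)) w)) = E\<^sub>\<xi> (\<lambda>w. \<phi> (z @ block c n (n + (m - j)) w))"
    proof (rule expect_block_shift)
      show "sqrt (t (Suc (j + i)) - t (j + i)) = c (n + i)" for i
        using t'n[of i] t'n[of "Suc i"] by (simp add: c_def)
    qed (use \<phi> m that in auto)
    with m show ?thesis by (simp add: \<kappa>_def xi_increments_block m'_def)
  qed
  define zf' where "zf' x = \<bar>zf x\<bar>" for x
  have zf': "zf' \<in> C_l_lip n" unfolding zf'_def by (rule C_l_lip_abs[OF zf(1)])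
  define \<Phi> where "\<Phi> y = zf' (take n y) * (\<phi> (F (take n y) @ drop n y) + (-1) * wf (take n y))" for y
  define \<Psi> where "\<Psi> y = zf' y * (\<kappa> (F y) + (-1) * wf y)" for y
  have tk: "(\<lambda>y. f (take n y)) \<in> C_l_lip m'" if "f \<in> C_l_lip n" for f
    by (rule C_l_lip_compose_list[OF that]) (auto simp: m'_def intro: C_l_lip_nth)
  have \<Phi>1: "(\<lambda>y. \<phi> (F (take n y) @ drop n y)) \<in> C_l_lip m'"
  proof (rule C_l_lip_compose_list[OF \<phi>])
    show "length (F (take n y) @ drop n y) = m" if "length y = m'" for y using that m by (simp add: m'_def)
    show "(\<lambda>y. (F (take n y) @ drop n y) ! i) \<in> C_l_lip m'" if "i < m" for i
    proof (cases "i < j")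
      case True
      with tk[OF FC[OF True]] show ?thesis by (simp add: nth_append)
    next
      case False
      show ?thesis
      proof (rule C_l_lip_cong[OF C_l_lip_nth[of "n + (i - j)"]])
        show "n + (i - j) < m'" using False that by (simp add: m'_def)
        show "y ! (n + (i - j)) = (F (take n y) @ drop n y) ! i" if "length y = m'" for y
          using False that by (simp add: nth_append m'_def)
      qed
    qed
  qed
  have \<Phi>: "\<Phi> \<in> C_l_lip m'" unfolding \<Phi>_def
    by (intro C_l_lip_mult C_l_lip_add C_l_lip_cmult tk zf' wf \<Phi>1)
  have \<Psi>: "\<Psi> \<in> C_l_lip n" unfolding \<Psi>_def
    by (intro C_l_lip_mult C_l_lip_add C_l_lip_cmult zf' wf C_l_lip_compose_list[OF \<kappa>] FC) auto
  have BU: "B_increments t 0 m \<omega> = B_increments t 0 j \<omega> @ B_increments t j m \<omega>" for \<omega>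
    using m upt_add_eq_append[of 0 j "m - j"] by (simp add: B_increments_def)
  have Bshift: "B_increments t j m \<omega> = B_increments t' n m' \<omega>" for \<omega>
  proof (rule nth_equalityI)
    show "B_increments t j m \<omega> ! i = B_increments t' n m' \<omega> ! i" if "i < length (B_increments t j m \<omega>)" for i
      using t'n[of i] t'n[of "Suc i"] that by (simp add: B_increments_def m'_def)
  qed (simp add: m'_def)
  have B': "B_increments t' 0 m' \<omega> = B_increments t' 0 n \<omega> @ B_increments t' n m' \<omega>" for \<omega>
    using upt_add_eq_append[of 0 n "m - j"] by (simp add: B_increments_def m'_def)
  have ZZ: "zf' (B_increments t' 0 n \<omega>) = Z \<omega>" for \<omega> using Z(2)[of \<omega>] by (simp add: zf'_def zf(2))
  have "(\<lambda>\<omega>. Z \<omega> * (U \<omega> - W \<omega>)) = (\<lambda>\<omega>. \<Phi> (B_increments t' 0 m' \<omega>))"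
    unfolding \<Phi>_def B' U BU Bshift by (simp add: FB ZZ wf(2))
  then have "E (\<lambda>\<omega>. Z \<omega> * (U \<omega> - W \<omega>)) = E\<^sub>\<xi> (\<lambda>w. \<Phi> (xi_increments \<xi> t' 0 m' w))"
    using E_cylinder[OF _ times' \<Phi>] n(1) by (simp add: m'_def)
  also have "\<dots> = E\<^sub>\<xi> (\<lambda>w. E\<^sub>\<xi> (\<lambda>w'. \<Phi> (block c 0 n w @ block c n m' w')))"
    using expect_block_tower[of \<Phi> n "m - j" c] \<Phi> unfolding m'_def xi_increments_block c_def by simp
  also have "(\<lambda>w. E\<^sub>\<xi> (\<lambda>w'. \<Phi> (block c 0 n w @ block c n m' w'))) = (\<lambda>w. \<Psi> (block c 0 n w))"
  proof
    fix w
    let ?x = "block c 0 n w"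
    have inH: "(\<lambda>w'. \<phi> (F ?x @ block c n m' w')) \<in> H"
    proof (rule H_compose_list[OF \<phi>])
      show "(\<lambda>w'. (F ?x @ block c n m' w') ! i) \<in> H" if "i < m" for i
        using that m by (cases "i < j") (auto simp: nth_append H_const m'_def intro!: block_H)
    qed (use m in \<open>simp add: m'_def\<close>)
    have "E\<^sub>\<xi> (\<lambda>w'. \<Phi> (?x @ block c n m' w')) = E\<^sub>\<xi> (\<lambda>w'. zf' ?x * (\<phi> (F ?x @ block c n m' w') + (-1) * wf ?x))"
      by (simp add: \<Phi>_def)
    also have "\<dots> = zf' ?x * E\<^sub>\<xi> (\<lambda>w'. \<phi> (F ?x @ block c n m' w') + (-1) * wf ?x)"
      by (rule E_cmult) (auto simp: zf'_def intro!: H_diff inH H_const)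
    also have "\<dots> = \<Psi> ?x" using E_add_const[OF inH, of "(-1) * wf ?x"] \<kappa>'[of "F ?x"] by (simp add: \<Psi>_def)
    finally show "E\<^sub>\<xi> (\<lambda>w'. \<Phi> (?x @ block c n m' w')) = \<Psi> ?x" .
  qed
  also have "E\<^sub>\<xi> (\<lambda>w. \<Psi> (block c 0 n w)) = E (\<lambda>\<omega>. \<Psi> (B_increments t' 0 n \<omega>))"
    using E_cylinder[OF n(1) times'n \<Psi>] unfolding xi_increments_block c_def by simp
  also have "(\<lambda>\<omega>. \<Psi> (B_increments t' 0 n \<omega>)) = (\<lambda>\<omega>. Z \<omega> * (V \<omega> - W \<omega>))"
    by (simp add: \<Psi>_def FB ZZ wf(2) V \<kappa>_def)
  finally show ?thesis .
qed

end

section \<open>Upper expectations and the spaces of their integrable random variables\<close>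

lemma ennreal_tendsto_0I:
  fixes f :: "nat \<Rightarrow> ennreal"
  assumes "\<And>e::real. 0 < e \<Longrightarrow> \<exists>N. \<forall>n\<ge>N. f n \<le> ennreal e"
  shows "f \<longlonglongrightarrow> 0"
proof (rule order_tendstoI)
  fix a :: ennreal assume "0 < a"
  then obtain e :: real where e: "0 < e" "ennreal e < a"
    by (metis ennreal_less_zero_iff ennreal_zero_less_top dense ennreal_cases not_less_zero order_less_imp_not_less top.not_eq_extremum)
  from assms[OF e(1)] obtain N where "\<forall>n\<ge>N. f n \<le> ennreal e" ..
  with e show "\<forall>\<^sub>F n in sequentially. f n < a"
    unfolding eventually_sequentially by (meson le_less_trans)
qed simp

lemma ennreal_tendsto_0D:
  fixes f :: "nat \<Rightarrow> ennreal"
  assumes "f \<longlonglongrightarrow> 0" "0 < e"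
  shows "\<exists>N. \<forall>n\<ge>N. f n \<le> ennreal e"
proof -
  from assms have "\<forall>\<^sub>F n in sequentially. f n < ennreal e"
    by (intro order_tendstoD) (auto simp: ennreal_zero_less_top)
  then show ?thesis unfolding eventually_sequentially by (meson order_less_imp_le)
qed

lemma abs_add_power_le:
  fixes a b :: real
  shows "\<bar>a + b\<bar> ^ k \<le> 2 ^ k * (\<bar>a\<bar> ^ k + \<bar>b\<bar> ^ k)"
proof -
  let ?M = "max \<bar>a\<bar> \<bar>b\<bar>"
  have "\<bar>a + b\<bar> ^ k \<le> (2 * ?M) ^ k" by (rule power_mono) auto
  also have "\<dots> = 2 ^ k * ?M ^ k" by (simp add: power_mult_distrib)
  also have "?M ^ k \<le> \<bar>a\<bar> ^ k + \<bar>b\<bar> ^ k" by (auto simp: max_def)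
  finally show ?thesis by simp
qed

definition clip :: "real \<Rightarrow> real \<Rightarrow> real \<Rightarrow> real" where
  "clip a b x = max a (min b x)"

lemma clip_lipschitz: "\<bar>clip a b x - clip a b y\<bar> \<le> 1 * \<bar>x - y\<bar>"
  by (auto simp: clip_def max_def min_def)

lemma clip_range: "a \<le> b \<Longrightarrow> a \<le> clip a b x \<and> clip a b x \<le> b"
  by (auto simp: clip_def)

lemma clip_measurable [measurable]: "X \<in> borel_measurable M \<Longrightarrow> (\<lambda>w. clip a b (X w)) \<in> borel_measurable M"
  unfolding clip_def by simp

lemma clip_diff_closer: "a \<le> x \<Longrightarrow> x \<le> b \<Longrightarrow> \<bar>x - clip a b y\<bar> \<le> \<bar>x - y\<bar>"
  by (auto simp: clip_def max_def min_def)

lemma clip_sym_diff: "0 \<le> N \<Longrightarrow> \<bar>x - clip (-N) N x\<bar> \<le> \<bar>x\<bar> * indicator {N<..} \<bar>x\<bar>"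
  by (auto simp: clip_def indicator_def max_def min_def)

lemma abs_clip_sym: "0 \<le> N \<Longrightarrow> \<bar>clip (-N) N x\<bar> \<le> N" "0 \<le> N \<Longrightarrow> \<bar>clip (-N) N x\<bar> \<le> \<bar>x\<bar>"
  by (auto simp: clip_def max_def min_def)

lemma clip_sym_eq: "\<bar>x\<bar> \<le> N \<Longrightarrow> clip (-N) N x = x"
  by (auto simp: clip_def max_def min_def)

lemma clip_tendsto: "(\<lambda>n. clip (- real n) (real n) x) \<longlonglongrightarrow> x"
proof (rule tendsto_eventually)
  obtain N :: nat where "\<bar>x\<bar> \<le> real N" using real_arch_simple by blast
  then have "\<forall>n\<ge>N. clip (- real n) (real n) x = x" by (intro allI impI clip_sym_eq) linarith
  then show "\<forall>\<^sub>F n in sequentially. clip (- real n) (real n) x = x"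
    unfolding eventually_sequentially by blast
qed

text \<open>Finite first absolute moments of cylinder random variables imply finite higher ones, because powers of
  cylinder random variables are cylinder random variables.\<close>

locale prob_family =
  fixes \<P> :: "path measure set"
  assumes prob: "P \<in> \<P> \<Longrightarrow> prob_space P"
    and P_sets: "P \<in> \<P> \<Longrightarrow> sets P = sets borel"
    and moments: "X \<in> Lip0 t \<Longrightarrow> upper_expectation \<P> (\<lambda>\<omega>. ennreal \<bar>X \<omega>\<bar>) < \<infinity>"
begin

abbreviation UE :: "(path \<Rightarrow> ennreal) \<Rightarrow> ennreal" where "UE \<equiv> upper_expectation \<P>"

lemma P_meas: "P \<in> \<P> \<Longrightarrow> borel_measurable P = borel_measurable borel"
  by (rule measurable_cong_sets) (auto simp: P_sets)

lemma P_space: "P \<in> \<P> \<Longrightarrow> space P = UNIV"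
  using sets_eq_imp_space_eq[OF P_sets] by simp

lemma UE_upper: "P \<in> \<P> \<Longrightarrow> (\<integral>\<^sup>+\<omega>. f \<omega> \<partial>P) \<le> UE f"
  unfolding upper_expectation_def by (rule SUP_upper)

lemma UE_least: "(\<And>P. P \<in> \<P> \<Longrightarrow> (\<integral>\<^sup>+\<omega>. f \<omega> \<partial>P) \<le> c) \<Longrightarrow> UE f \<le> c"
  unfolding upper_expectation_def by (rule SUP_least)

lemma UE_mono_AE:
  assumes "\<And>P. P \<in> \<P> \<Longrightarrow> AE \<omega> in P. f \<omega> \<le> g \<omega>" shows "UE f \<le> UE g"
proof (rule UE_least)
  fix P assume P: "P \<in> \<P>"
  have "(\<integral>\<^sup>+\<omega>. f \<omega> \<partial>P) \<le> (\<integral>\<^sup>+\<omega>. g \<omega> \<partial>P)" by (rule nn_integral_mono_AE[OF assms[OF P]])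
  also have "\<dots> \<le> UE g" by (rule UE_upper[OF P])
  finally show "(\<integral>\<^sup>+\<omega>. f \<omega> \<partial>P) \<le> UE g" .
qed

lemma UE_mono: "(\<And>\<omega>. f \<omega> \<le> g \<omega>) \<Longrightarrow> UE f \<le> UE g"
  by (rule UE_mono_AE) simp

lemma UE_add:
  assumes [measurable]: "f \<in> borel_measurable borel" "g \<in> borel_measurable borel"
  shows "UE (\<lambda>\<omega>. f \<omega> + g \<omega>) \<le> UE f + UE g"
proof (rule UE_least)
  fix P assume P: "P \<in> \<P>"
  have "(\<integral>\<^sup>+\<omega>. f \<omega> + g \<omega> \<partial>P) = (\<integral>\<^sup>+\<omega>. f \<omega> \<partial>P) + (\<integral>\<^sup>+\<omega>. g \<omega> \<partial>P)"
    by (rule nn_integral_add) (simp_all add: P_meas[OF P])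
  also have "\<dots> \<le> UE f + UE g" by (intro add_mono UE_upper P)
  finally show "(\<integral>\<^sup>+\<omega>. f \<omega> + g \<omega> \<partial>P) \<le> UE f + UE g" .
qed

lemma UE_cmult:
  assumes [measurable]: "f \<in> borel_measurable borel"
  shows "UE (\<lambda>\<omega>. c * f \<omega>) \<le> c * UE f"
proof (rule UE_least)
  fix P assume P: "P \<in> \<P>"
  have "(\<integral>\<^sup>+\<omega>. c * f \<omega> \<partial>P) = c * (\<integral>\<^sup>+\<omega>. f \<omega> \<partial>P)"
    by (rule nn_integral_cmult) (simp add: P_meas[OF P])
  also have "\<dots> \<le> c * UE f" by (intro mult_left_mono UE_upper P) simp
  finally show "(\<integral>\<^sup>+\<omega>. c * f \<omega> \<partial>P) \<le> c * UE f" .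
qed

lemma UE_const_le: "UE (\<lambda>_. c) \<le> c"
proof (rule UE_least)
  fix P assume "P \<in> \<P>"
  then interpret prob_space P by (rule prob)
  show "(\<integral>\<^sup>+\<omega>. c \<partial>P) \<le> c" by (simp add: emeasure_space_1)
qed

text \<open>The \<open>k\<close>-th power of the usual norm. Its triangle inequality holds only up to a factor, which does not
  affect convergence.\<close>

definition pnorm :: "nat \<Rightarrow> (path \<Rightarrow> real) \<Rightarrow> ennreal" where
  "pnorm k X = UE (\<lambda>\<omega>. ennreal (\<bar>X \<omega>\<bar> ^ k))"

lemma pnorm_mono_AE:
  assumes "\<And>P. P \<in> \<P> \<Longrightarrow> AE \<omega> in P. \<bar>X \<omega>\<bar> \<le> \<bar>Y \<omega>\<bar>" shows "pnorm k X \<le> pnorm k Y"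
  unfolding pnorm_def
proof (rule UE_mono_AE)
  fix P assume "P \<in> \<P>"
  from assms[OF this] show "AE \<omega> in P. ennreal (\<bar>X \<omega>\<bar> ^ k) \<le> ennreal (\<bar>Y \<omega>\<bar> ^ k)"
    by eventually_elim (auto intro: ennreal_leI power_mono)
qed

lemma pnorm_mono: "(\<And>\<omega>. \<bar>X \<omega>\<bar> \<le> \<bar>Y \<omega>\<bar>) \<Longrightarrow> pnorm k X \<le> pnorm k Y"
  by (rule pnorm_mono_AE) simp

lemma pnorm_minus_commute: "pnorm k (\<lambda>\<omega>. X \<omega> - Y \<omega>) = pnorm k (\<lambda>\<omega>. Y \<omega> - X \<omega>)"
  by (simp add: pnorm_def abs_minus_commute)

lemma pnorm_add:
  assumes [measurable]: "X \<in> borel_measurable borel" "Y \<in> borel_measurable borel"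
  shows "pnorm k (\<lambda>\<omega>. X \<omega> + Y \<omega>) \<le> 2 ^ k * (pnorm k X + pnorm k Y)"
proof -
  have "pnorm k (\<lambda>\<omega>. X \<omega> + Y \<omega>) \<le> UE (\<lambda>\<omega>. ennreal (2 ^ k) * (ennreal (\<bar>X \<omega>\<bar> ^ k) + ennreal (\<bar>Y \<omega>\<bar> ^ k)))"
    unfolding pnorm_def
    by (intro UE_mono) (simp add: ennreal_leI abs_add_power_le flip: ennreal_mult ennreal_plus)
  also have "\<dots> \<le> ennreal (2 ^ k) * UE (\<lambda>\<omega>. ennreal (\<bar>X \<omega>\<bar> ^ k) + ennreal (\<bar>Y \<omega>\<bar> ^ k))"
    by (rule UE_cmult) measurable
  also have "\<dots> \<le> ennreal (2 ^ k) * (pnorm k X + pnorm k Y)"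
    unfolding pnorm_def by (intro mult_left_mono UE_add) simp_all
  also have "ennreal (2 ^ k) = 2 ^ k" by (simp flip: ennreal_power)
  finally show ?thesis .
qed

lemma pnorm_triangle:
  assumes "X \<in> borel_measurable borel" "Y \<in> borel_measurable borel" "Z \<in> borel_measurable borel"
  shows "pnorm k (\<lambda>\<omega>. X \<omega> - Z \<omega>) \<le> 2 ^ k * (pnorm k (\<lambda>\<omega>. X \<omega> - Y \<omega>) + pnorm k (\<lambda>\<omega>. Y \<omega> - Z \<omega>))"
  using pnorm_add[of "\<lambda>\<omega>. X \<omega> - Y \<omega>" "\<lambda>\<omega>. Y \<omega> - Z \<omega>" k] assms by simp

lemma pnorm_cmult:
  assumes [measurable]: "X \<in> borel_measurable borel"
  shows "pnorm k (\<lambda>\<omega>. c * X \<omega>) \<le> ennreal (\<bar>c\<bar> ^ k) * pnorm k X"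
  unfolding pnorm_def abs_mult power_mult_distrib
  by (subst ennreal_mult) (auto intro!: UE_cmult)

text \<open>The factor \<open>2\<^sup>k\<close> of the triangle inequality and the two summands are absorbed by \<open>2 ^ Suc k\<close>.\<close>

lemma pnorm_triangle_eps:
  assumes "X \<in> borel_measurable borel" "Y \<in> borel_measurable borel" "Z \<in> borel_measurable borel" "0 \<le> e"
    and "pnorm k (\<lambda>\<omega>. X \<omega> - Y \<omega>) \<le> ennreal (e / 2 ^ Suc k)" "pnorm k (\<lambda>\<omega>. Y \<omega> - Z \<omega>) \<le> ennreal (e / 2 ^ Suc k)"
  shows "pnorm k (\<lambda>\<omega>. X \<omega> - Z \<omega>) \<le> ennreal e"
proof -
  have "pnorm k (\<lambda>\<omega>. X \<omega> - Z \<omega>) \<le> 2 ^ k * (pnorm k (\<lambda>\<omega>. X \<omega> - Y \<omega>) + pnorm k (\<lambda>\<omega>. Y \<omega> - Z \<omega>))"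
    by (rule pnorm_triangle) (use assms in auto)
  also have "\<dots> \<le> 2 ^ k * (ennreal (e / 2 ^ Suc k) + ennreal (e / 2 ^ Suc k))"
    by (intro mult_left_mono add_mono assms) simp
  also have "ennreal (e / 2 ^ Suc k) + ennreal (e / 2 ^ Suc k) = ennreal (e / 2 ^ Suc k + e / 2 ^ Suc k)"
    by (rule ennreal_plus[symmetric]) (use assms(4) in auto)
  also have "2 ^ k * \<dots> = ennreal (2 ^ k) * \<dots>" by (simp flip: ennreal_power)
  also have "\<dots> = ennreal (2 ^ k * (e / 2 ^ Suc k + e / 2 ^ Suc k))"
    using assms(4) by (subst ennreal_mult) auto
  also have "2 ^ k * (e / 2 ^ Suc k + e / 2 ^ Suc k) = e" by (simp add: field_simps)
  finally show ?thesis .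
qed

text \<open>This follows from \<open>\<bar>x\<bar> \<le> e + \<bar>x\<bar>\<^sup>k / e\<^sup>k\<^sup>-\<^sup>1\<close>.\<close>

lemma pnorm_1_le:
  assumes [measurable]: "X \<in> borel_measurable borel" and e: "0 < e" and k: "1 \<le> k" and X: "pnorm k X \<le> ennreal (e ^ k)"
  shows "pnorm 1 X \<le> ennreal (2 * e)"
proof -
  from k obtain j where j: "k = Suc j" by (cases k) auto
  have pw: "\<bar>X \<omega>\<bar> \<le> e + 1 / e ^ j * \<bar>X \<omega>\<bar> ^ k" for \<omega>
  proof (cases "\<bar>X \<omega>\<bar> \<le> e")
    case False
    then have "e ^ j \<le> \<bar>X \<omega>\<bar> ^ j" using e by (intro power_mono) auto
    then have "\<bar>X \<omega>\<bar> * e ^ j \<le> \<bar>X \<omega>\<bar> * \<bar>X \<omega>\<bar> ^ j" by (intro mult_left_mono) auto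
    then have "\<bar>X \<omega>\<bar> \<le> 1 / e ^ j * \<bar>X \<omega>\<bar> ^ k" using e by (simp add: j field_simps)
    with e show ?thesis by linarith
  next
    case True
    moreover have "0 \<le> 1 / e ^ j * \<bar>X \<omega>\<bar> ^ k" using e by simp
    ultimately show ?thesis by linarith
  qed
  have "pnorm 1 X \<le> UE (\<lambda>\<omega>. ennreal e + ennreal (1 / e ^ j) * ennreal (\<bar>X \<omega>\<bar> ^ k))"
    unfolding pnorm_def using pw e
    by (intro UE_mono) (simp add: ennreal_leI flip: ennreal_mult ennreal_plus)
  also have "\<dots> \<le> UE (\<lambda>_. ennreal e) + UE (\<lambda>\<omega>. ennreal (1 / e ^ j) * ennreal (\<bar>X \<omega>\<bar> ^ k))"
    by (rule UE_add) measurable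
  also have "\<dots> \<le> ennreal e + ennreal (1 / e ^ j) * pnorm k X"
    unfolding pnorm_def by (intro add_mono UE_const_le UE_cmult) measurable
  also have "\<dots> \<le> ennreal e + ennreal (1 / e ^ j) * ennreal (e ^ k)"
    by (intro add_mono mult_left_mono X) auto
  also have "\<dots> = ennreal (2 * e)" using e by (simp add: j flip: ennreal_mult ennreal_plus)
  finally show ?thesis .
qed

definition LGk :: "nat \<Rightarrow> real \<Rightarrow> (path \<Rightarrow> real) set" where
  "LGk k t = LG \<P> (real k) t"

lemma LG_1: "LG \<P> 1 t = LGk 1 t" by (simp add: LGk_def)
lemma LG_2: "LG \<P> 2 t = LGk 2 t" by (simp add: LGk_def)

lemma abs_powr_of_nat: "1 \<le> k \<Longrightarrow> \<bar>x::real\<bar> powr real k = \<bar>x\<bar> ^ k"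
  by (cases "x = 0") (auto simp: powr_realpow)

lemma LGk_measurable: "X \<in> LGk k t \<Longrightarrow> X \<in> borel_measurable borel"
  unfolding LGk_def LG_def Lp_closure_def by simp

lemma LGk_approx:
  assumes "X \<in> LGk k t" "1 \<le> k" "0 < e"
  shows "\<exists>Z\<in>Lip0 t. pnorm k (\<lambda>\<omega>. X \<omega> - Z \<omega>) \<le> ennreal e"
proof -
  from assms(1) obtain Z where Z: "\<And>n. Z n \<in> Lip0 t" 
    and "(\<lambda>n. UE (\<lambda>\<omega>. ennreal (\<bar>X \<omega> - Z n \<omega>\<bar> powr real k))) \<longlonglongrightarrow> 0"
    unfolding LGk_def LG_def Lp_closure_def by blast
  then have "(\<lambda>n. pnorm k (\<lambda>\<omega>. X \<omega> - Z n \<omega>)) \<longlonglongrightarrow> 0"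
    by (simp add: pnorm_def abs_powr_of_nat[OF assms(2)])
  from ennreal_tendsto_0D[OF this assms(3)] show ?thesis using Z by blast
qed

lemma LGkI:
  assumes X: "X \<in> borel_measurable borel" and k: "1 \<le> k"
    and a: "\<And>e. 0 < e \<Longrightarrow> \<exists>Z\<in>Lip0 t. pnorm k (\<lambda>\<omega>. X \<omega> - Z \<omega>) \<le> ennreal e"
  shows "X \<in> LGk k t"
proof -
  have "\<exists>Z\<in>Lip0 t. pnorm k (\<lambda>\<omega>. X \<omega> - Z \<omega>) \<le> ennreal (inverse (real (Suc n)))" for n
    by (rule a) simp
  then obtain Z where Z: "\<And>n. Z n \<in> Lip0 t" "\<And>n. pnorm k (\<lambda>\<omega>. X \<omega> - Z n \<omega>) \<le> ennreal (inverse (real (Suc n)))"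
    by metis
  have "(\<lambda>n. pnorm k (\<lambda>\<omega>. X \<omega> - Z n \<omega>)) \<longlonglongrightarrow> 0"
  proof (rule ennreal_tendsto_0I)
    fix e :: real assume "0 < e"
    then obtain N where N: "inverse (real (Suc N)) < e" using reals_Archimedean by blast
    have "pnorm k (\<lambda>\<omega>. X \<omega> - Z n \<omega>) \<le> ennreal e" if "n \<ge> N" for n
    proof -
      have "inverse (real (Suc n)) \<le> inverse (real (Suc N))" using that by (intro le_imp_inverse_le) auto
      with N have "inverse (real (Suc n)) \<le> e" by linarith
      with Z(2)[of n] show ?thesis using ennreal_leI order_trans by blast
    qed
    then show "\<exists>N. \<forall>n\<ge>N. pnorm k (\<lambda>\<omega>. X \<omega> - Z n \<omega>) \<le> ennreal e" by blast
  qed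
  then show ?thesis using X Z(1) 
    unfolding LGk_def LG_def Lp_closure_def by (auto simp: pnorm_def abs_powr_of_nat[OF k])
qed

lemma pnorm_diff_self: "1 \<le> k \<Longrightarrow> pnorm k (\<lambda>\<omega>. X \<omega> - X \<omega>) = 0"
proof -
  assume "1 \<le> k"
  then have "pnorm k (\<lambda>\<omega>. X \<omega> - X \<omega>) = UE (\<lambda>_. 0)" by (simp add: pnorm_def power_0_left)
  then show ?thesis using UE_const_le[of 0] by simp
qed

lemma Lip0_LGk: "Z \<in> Lip0 t \<Longrightarrow> 1 \<le> k \<Longrightarrow> Z \<in> LGk k t"
proof (rule LGkI[OF Lip0_measurable])
  show "\<exists>Z'\<in>Lip0 t. pnorm k (\<lambda>\<omega>. Z \<omega> - Z' \<omega>) \<le> ennreal e" if "Z \<in> Lip0 t" "1 \<le> k" "0 < e" for e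
    using that by (intro bexI[of _ Z]) (simp_all only: pnorm_diff_self zero_le)
qed

lemma LGk_closed:
  assumes X [measurable]: "X \<in> borel_measurable borel" and k: "1 \<le> k"
    and a: "\<And>e. 0 < e \<Longrightarrow> \<exists>Y\<in>LGk k t. pnorm k (\<lambda>\<omega>. X \<omega> - Y \<omega>) \<le> ennreal e"
  shows "X \<in> LGk k t"
proof (rule LGkI[OF X k])
  fix e :: real assume e: "0 < e"
  then have e': "0 < e / 2 ^ Suc k" by simp
  from a[OF e'] obtain Y where Y: "Y \<in> LGk k t" "pnorm k (\<lambda>\<omega>. X \<omega> - Y \<omega>) \<le> ennreal (e / 2 ^ Suc k)" by blast
  from LGk_approx[OF Y(1) k e'] obtain Z where Z: "Z \<in> Lip0 t" "pnorm k (\<lambda>\<omega>. Y \<omega> - Z \<omega>) \<le> ennreal (e / 2 ^ Suc k)" by blast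
  have "pnorm k (\<lambda>\<omega>. X \<omega> - Z \<omega>) \<le> ennreal e"
    by (rule pnorm_triangle_eps[OF X LGk_measurable[OF Y(1)] Lip0_measurable[OF Z(1)] _ Y(2) Z(2)]) (use e in simp)
  with Z show "\<exists>Z\<in>Lip0 t. pnorm k (\<lambda>\<omega>. X \<omega> - Z \<omega>) \<le> ennreal e" by blast
qed

lemma LGk_closed_limit:
  assumes X: "X \<in> borel_measurable borel" and k: "1 \<le> k" and Y: "\<And>n. Y n \<in> LGk k t"
    and lim: "(\<lambda>n. pnorm k (\<lambda>\<omega>. X \<omega> - Y n \<omega>)) \<longlonglongrightarrow> 0"
  shows "X \<in> LGk k t"
proof (rule LGk_closed[OF X k])
  fix e :: real assume "0 < e"
  from ennreal_tendsto_0D[OF lim this] Y show "\<exists>Y\<in>LGk k t. pnorm k (\<lambda>\<omega>. X \<omega> - Y \<omega>) \<le> ennreal e" by blast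
qed

lemma LGk_mono_time: "X \<in> LGk k s \<Longrightarrow> s \<le> t \<Longrightarrow> 1 \<le> k \<Longrightarrow> X \<in> LGk k t"
  by (rule LGkI[OF LGk_measurable]) (use LGk_approx Lip0_mono in blast)+

lemma LGk_nonneg_time: "X \<in> LGk k t \<Longrightarrow> 1 \<le> k \<Longrightarrow> 0 \<le> t"
  using LGk_approx[of X k t 1] Lip0_nonneg_time by auto

lemma LGk_const: "0 \<le> t \<Longrightarrow> 1 \<le> k \<Longrightarrow> (\<lambda>_. c) \<in> LGk k t"
  by (intro Lip0_LGk Lip0_const)

lemma LGk_add:
  assumes X: "X \<in> LGk k t" and Y: "Y \<in> LGk k t" and k: "1 \<le> k"
  shows "(\<lambda>\<omega>. X \<omega> + Y \<omega>) \<in> LGk k t"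
proof (rule LGkI[OF _ k])
  note [measurable] = LGk_measurable[OF X] LGk_measurable[OF Y]
  show "(\<lambda>\<omega>. X \<omega> + Y \<omega>) \<in> borel_measurable borel" by measurable
  fix e :: real assume e: "0 < e"
  then have e': "0 < e / 2 ^ Suc k" by simp
  from LGk_approx[OF X k e'] obtain Z where Z: "Z \<in> Lip0 t" "pnorm k (\<lambda>\<omega>. X \<omega> - Z \<omega>) \<le> ennreal (e / 2 ^ Suc k)" by blast
  from LGk_approx[OF Y k e'] obtain Z' where Z': "Z' \<in> Lip0 t" "pnorm k (\<lambda>\<omega>. Y \<omega> - Z' \<omega>) \<le> ennreal (e / 2 ^ Suc k)" by blast
  note [measurable] = Lip0_measurable[OF Z(1)] Lip0_measurable[OF Z'(1)]
  have "pnorm k (\<lambda>\<omega>. (X \<omega> + Y \<omega>) - (Z \<omega> + Z' \<omega>)) \<le> ennreal e"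
  proof (rule pnorm_triangle_eps[where Y = "\<lambda>\<omega>. Z \<omega> + Y \<omega>"])
    show "pnorm k (\<lambda>\<omega>. X \<omega> + Y \<omega> - (Z \<omega> + Y \<omega>)) \<le> ennreal (e / 2 ^ Suc k)" using Z(2) by simp
    show "pnorm k (\<lambda>\<omega>. Z \<omega> + Y \<omega> - (Z \<omega> + Z' \<omega>)) \<le> ennreal (e / 2 ^ Suc k)" using Z'(2) by simp
  qed (use e in simp_all)
  with Z Z' show "\<exists>W\<in>Lip0 t. pnorm k (\<lambda>\<omega>. X \<omega> + Y \<omega> - W \<omega>) \<le> ennreal e"
    by (intro bexI[of _ "\<lambda>\<omega>. Z \<omega> + Z' \<omega>"] Lip0_add) auto
qed

lemma LGk_lipschitz:
  assumes X: "X \<in> LGk k t" and k: "1 \<le> k" and h: "\<And>x y. \<bar>h x - h y\<bar> \<le> L * \<bar>x - y :: real\<bar>"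
    and hm: "h \<in> borel_measurable borel"
  shows "(\<lambda>\<omega>. h (X \<omega>)) \<in> LGk k t"
proof (rule LGkI[OF _ k])
  note [measurable] = LGk_measurable[OF X] hm
  show "(\<lambda>\<omega>. h (X \<omega>)) \<in> borel_measurable borel" by measurable
  have L: "0 \<le> L" using h[of 0 1] by simp
  fix e :: real assume e: "0 < e"
  define d where "d = e / (L + 1) ^ k"
  have d: "0 < d" "(L + 1) ^ k * d = e" using L e by (auto simp: d_def)
  from LGk_approx[OF X k d(1)] obtain Z where Z: "Z \<in> Lip0 t" "pnorm k (\<lambda>\<omega>. X \<omega> - Z \<omega>) \<le> ennreal d" by blast
  note [measurable] = Lip0_measurable[OF Z(1)]
  have "pnorm k (\<lambda>\<omega>. h (X \<omega>) - h (Z \<omega>)) \<le> pnorm k (\<lambda>\<omega>. (L + 1) * (X \<omega> - Z \<omega>))"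
  proof (rule pnorm_mono)
    fix \<omega>
    have "L * \<bar>X \<omega> - Z \<omega>\<bar> \<le> (L + 1) * \<bar>X \<omega> - Z \<omega>\<bar>" by (intro mult_right_mono) auto
    with h[of "X \<omega>" "Z \<omega>"] L show "\<bar>h (X \<omega>) - h (Z \<omega>)\<bar> \<le> \<bar>(L + 1) * (X \<omega> - Z \<omega>)\<bar>" by (simp add: abs_mult)
  qed
  also have "\<dots> \<le> ennreal (\<bar>L + 1\<bar> ^ k) * pnorm k (\<lambda>\<omega>. X \<omega> - Z \<omega>)" by (rule pnorm_cmult) measurable
  also have "\<dots> \<le> ennreal (\<bar>L + 1\<bar> ^ k) * ennreal d" by (intro mult_left_mono Z(2)) simp
  also have "\<dots> = ennreal e" using L d by (subst ennreal_mult[symmetric]) auto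
  finally show "\<exists>W\<in>Lip0 t. pnorm k (\<lambda>\<omega>. h (X \<omega>) - W \<omega>) \<le> ennreal e"
    using Lip0_lipschitz[OF Z(1) h] by (intro bexI[of _ "\<lambda>\<omega>. h (Z \<omega>)"]) auto
qed

lemma LGk_cmult: 
  assumes "X \<in> LGk k t" "1 \<le> k" shows "(\<lambda>\<omega>. c * X \<omega>) \<in> LGk k t"
proof (rule LGk_lipschitz[OF assms])
  show "\<bar>c * x - c * y\<bar> \<le> \<bar>c\<bar> * \<bar>x - y\<bar>" for x y
    by (metis abs_mult order_refl right_diff_distrib)
qed simp

lemma LGk_minus: "X \<in> LGk k t \<Longrightarrow> 1 \<le> k \<Longrightarrow> (\<lambda>\<omega>. - X \<omega>) \<in> LGk k t"
  using LGk_cmult[of X k t "-1"] by simp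

lemma LGk_diff: "X \<in> LGk k t \<Longrightarrow> Y \<in> LGk k t \<Longrightarrow> 1 \<le> k \<Longrightarrow> (\<lambda>\<omega>. X \<omega> - Y \<omega>) \<in> LGk k t"
  using LGk_add[OF _ LGk_minus[of Y], of X] by simp

lemma LGk_sum:
  assumes "0 \<le> t" "1 \<le> k" "\<And>i. i \<in> I \<Longrightarrow> X i \<in> LGk k t"
  shows "(\<lambda>\<omega>. \<Sum>i\<in>I. X i \<omega>) \<in> LGk k t"
  using assms(3)
proof (induction I rule: infinite_finite_induct)
  case (insert i I)
  then show ?case using LGk_add[of "X i" k t "\<lambda>\<omega>. \<Sum>i\<in>I. X i \<omega>"] assms(2) by simp
qed (use LGk_const[OF assms(1,2), of 0] in simp_all)

lemma LGk_clip: "X \<in> LGk k t \<Longrightarrow> 1 \<le> k \<Longrightarrow> (\<lambda>\<omega>. clip a b (X \<omega>)) \<in> LGk k t"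
  by (rule LGk_lipschitz[where h = "clip a b" and L = 1]) (auto intro: clip_lipschitz[simplified])

lemma Lip0_clip: "X \<in> Lip0 t \<Longrightarrow> (\<lambda>\<omega>. clip a b (X \<omega>)) \<in> Lip0 t"
  by (rule Lip0_lipschitz[where h = "clip a b" and L = 1]) (auto intro: clip_lipschitz[simplified])

lemma LGk_1:
  assumes X: "X \<in> LGk k t" and k: "1 \<le> k" shows "X \<in> LGk 1 t"
proof (rule LGkI[OF LGk_measurable[OF X]])
  fix e :: real assume e: "0 < e"
  then have "0 < (e/2) ^ k" by simp
  from LGk_approx[OF X k this] obtain Z where Z: "Z \<in> Lip0 t" "pnorm k (\<lambda>\<omega>. X \<omega> - Z \<omega>) \<le> ennreal ((e/2) ^ k)" by blast
  note [measurable] = LGk_measurable[OF X] Lip0_measurable[OF Z(1)]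
  have "pnorm 1 (\<lambda>\<omega>. X \<omega> - Z \<omega>) \<le> ennreal (2 * (e/2))"
    by (rule pnorm_1_le[OF _ _ k Z(2)]) (use e in auto)
  with Z show "\<exists>Z\<in>Lip0 t. pnorm 1 (\<lambda>\<omega>. X \<omega> - Z \<omega>) \<le> ennreal e" by auto
qed simp

lemma pnorm_Lip0_finite: "Z \<in> Lip0 t \<Longrightarrow> pnorm k Z < \<infinity>"
  using moments[OF Lip0_power[of Z t k]] by (simp add: pnorm_def power_abs)

lemma LGk_pnorm_finite:
  assumes X: "X \<in> LGk k t" and k: "1 \<le> k" shows "pnorm k X < \<infinity>"
proof -
  from LGk_approx[OF X k, of 1] obtain Z where Z: "Z \<in> Lip0 t" "pnorm k (\<lambda>\<omega>. X \<omega> - Z \<omega>) \<le> ennreal 1" by auto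
  note [measurable] = LGk_measurable[OF X] Lip0_measurable[OF Z(1)]
  have "pnorm k X \<le> 2 ^ k * (pnorm k (\<lambda>\<omega>. X \<omega> - Z \<omega>) + pnorm k Z)"
    using pnorm_add[of "\<lambda>\<omega>. X \<omega> - Z \<omega>" Z k] by simp
  also have "\<dots> < \<infinity>"
  proof -
    have "pnorm k (\<lambda>\<omega>. X \<omega> - Z \<omega>) < \<top>" using Z(2) by (rule order.strict_trans1) simp
    then show ?thesis using pnorm_Lip0_finite[OF Z(1), of k]
      by (simp add: ennreal_mult_less_top power_less_top_ennreal)
  qed
  finally show ?thesis .
qed

text \<open>Uniform integrability: a cylinder random variable has all moments, so that its tails are
  controlled by a higher moment, and every element of the closure inherits this.\<close>

lemma LGk_uniformly_integrable:
  assumes X: "X \<in> LGk k t" and k: "1 \<le> k" and e: "0 < e"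
  obtains K where "0 < K" "\<And>N. N \<ge> K \<Longrightarrow> UE (\<lambda>\<omega>. ennreal (\<bar>X \<omega>\<bar> ^ k * indicator {N<..} \<bar>X \<omega>\<bar>)) \<le> ennreal e"
proof -
  define c :: real where "c = 2 ^ k"
  have c: "1 \<le> c" by (simp add: c_def)
  from LGk_approx[OF X k, of "e / (2 * c)"] e c obtain Z 
    where Z: "Z \<in> Lip0 t" "pnorm k (\<lambda>\<omega>. X \<omega> - Z \<omega>) \<le> ennreal (e / (2 * c))" by auto
  note [measurable] = LGk_measurable[OF X] Lip0_measurable[OF Z(1)]
  obtain m where m: "0 \<le> m" "pnorm (Suc k) Z = ennreal m"
    using pnorm_Lip0_finite[OF Z(1), of "Suc k"] by (cases "pnorm (Suc k) Z") auto
  define K where "K = 1 + 4 * c * m / e"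
  have K: "1 \<le> K" using e c m by (simp add: K_def)
  show thesis
  proof (rule that)
    show "0 < K" using K by simp
    fix N assume N: "K \<le> N"
    with K have N0: "0 < N" by simp
    \<comment> \<open>Either \<open>\<bar>X\<bar> \<le> 2 \<bar>X - Z\<bar>\<close>, or \<open>\<bar>X\<bar> \<le> 2 \<bar>Z\<bar>\<close> and then \<open>1 \<le> 2 \<bar>Z\<bar> / N\<close> on the tail.\<close>
    have pw: "\<bar>X \<omega>\<bar> ^ k * indicator {N<..} \<bar>X \<omega>\<bar> \<le> c * \<bar>X \<omega> - Z \<omega>\<bar> ^ k + 2 * c / N * \<bar>Z \<omega>\<bar> ^ Suc k" for \<omega>
    proof (cases "\<bar>X \<omega>\<bar> > N")
      case True
      note big = True
      have n1: "0 \<le> c * \<bar>X \<omega> - Z \<omega>\<bar> ^ k" "0 \<le> 2 * c / N * \<bar>Z \<omega>\<bar> ^ Suc k" using c N0 by auto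
      show ?thesis
      proof (cases "\<bar>X \<omega>\<bar> \<le> 2 * \<bar>X \<omega> - Z \<omega>\<bar>")
        case True
        then have "\<bar>X \<omega>\<bar> ^ k \<le> (2 * \<bar>X \<omega> - Z \<omega>\<bar>) ^ k" by (intro power_mono) auto
        also have "\<dots> = c * \<bar>X \<omega> - Z \<omega>\<bar> ^ k" by (simp add: c_def power_mult_distrib)
        finally have "\<bar>X \<omega>\<bar> ^ k * indicator {N<..} \<bar>X \<omega>\<bar> \<le> c * \<bar>X \<omega> - Z \<omega>\<bar> ^ k" using big by simp
        with n1(2) show ?thesis by linarith
      next
        case False
        with abs_triangle_ineq[of "X \<omega> - Z \<omega>" "Z \<omega>"] have z1: "\<bar>X \<omega>\<bar> \<le> 2 * \<bar>Z \<omega>\<bar>" by simp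
        with big have z: "\<bar>X \<omega>\<bar> \<le> 2 * \<bar>Z \<omega>\<bar>" "N \<le> 2 * \<bar>Z \<omega>\<bar>" by auto
        have "\<bar>X \<omega>\<bar> ^ k \<le> (2 * \<bar>Z \<omega>\<bar>) ^ k" using z by (intro power_mono) auto
        also have "\<dots> = c * \<bar>Z \<omega>\<bar> ^ k * 1" by (simp add: c_def power_mult_distrib)
        also have "\<dots> \<le> c * \<bar>Z \<omega>\<bar> ^ k * (2 * \<bar>Z \<omega>\<bar> / N)" using z c N0 by (intro mult_left_mono) auto
        finally have "\<bar>X \<omega>\<bar> ^ k * indicator {N<..} \<bar>X \<omega>\<bar> \<le> 2 * c / N * \<bar>Z \<omega>\<bar> ^ Suc k" using big by (simp add: mult_ac)
        with n1(1) show ?thesis by linarith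
      qed
    next
      case False
      then show ?thesis using c N0 by (simp add: indicator_def)
    qed
    have "UE (\<lambda>\<omega>. ennreal (\<bar>X \<omega>\<bar> ^ k * indicator {N<..} \<bar>X \<omega>\<bar>)) \<le> UE (\<lambda>\<omega>. ennreal c * ennreal (\<bar>X \<omega> - Z \<omega>\<bar> ^ k) + ennreal (2 * c / N) * ennreal (\<bar>Z \<omega>\<bar> ^ Suc k))"
    proof (rule UE_mono)
      fix \<omega>
      have a: "ennreal c * ennreal (\<bar>X \<omega> - Z \<omega>\<bar> ^ k) = ennreal (c * \<bar>X \<omega> - Z \<omega>\<bar> ^ k)"
        by (rule ennreal_mult[symmetric]) (use c in auto)
      have b: "ennreal (2 * c / N) * ennreal (\<bar>Z \<omega>\<bar> ^ Suc k) = ennreal (2 * c / N * \<bar>Z \<omega>\<bar> ^ Suc k)"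
        by (rule ennreal_mult[symmetric]) (use c N0 in auto)
      have "ennreal c * ennreal (\<bar>X \<omega> - Z \<omega>\<bar> ^ k) + ennreal (2 * c / N) * ennreal (\<bar>Z \<omega>\<bar> ^ Suc k)
        = ennreal (c * \<bar>X \<omega> - Z \<omega>\<bar> ^ k + 2 * c / N * \<bar>Z \<omega>\<bar> ^ Suc k)"
        unfolding a b by (rule ennreal_plus[symmetric]) (use c N0 in auto)
      with pw[of \<omega>] show "ennreal (\<bar>X \<omega>\<bar> ^ k * indicator {N<..} \<bar>X \<omega>\<bar>) \<le> ennreal c * ennreal (\<bar>X \<omega> - Z \<omega>\<bar> ^ k) + ennreal (2 * c / N) * ennreal (\<bar>Z \<omega>\<bar> ^ Suc k)"
        by (simp add: ennreal_leI)
    qed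
    also have "\<dots> \<le> UE (\<lambda>\<omega>. ennreal c * ennreal (\<bar>X \<omega> - Z \<omega>\<bar> ^ k)) + UE (\<lambda>\<omega>. ennreal (2 * c / N) * ennreal (\<bar>Z \<omega>\<bar> ^ Suc k))"
      by (rule UE_add) measurable
    also have "\<dots> \<le> ennreal c * pnorm k (\<lambda>\<omega>. X \<omega> - Z \<omega>) + ennreal (2 * c / N) * pnorm (Suc k) Z"
      unfolding pnorm_def by (intro add_mono UE_cmult) measurable
    also have "\<dots> \<le> ennreal c * ennreal (e / (2 * c)) + ennreal (2 * c / N) * ennreal m"
      unfolding m(2) by (intro add_mono mult_left_mono Z(2)) auto
    also have "\<dots> = ennreal (c * (e / (2 * c)) + 2 * c / N * m)"
      using c N0 e m by (subst ennreal_plus, simp, simp, subst (1 2) ennreal_mult) auto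
    also have "\<dots> \<le> ennreal e"
    proof (rule ennreal_leI)
      have "4 * c * m / e \<le> N" using N by (simp add: K_def)
      then have "4 * c * m \<le> e * N" using e by (simp add: field_simps)
      then have "2 * c / N * m \<le> e / 2" using N0 by (simp add: field_simps)
      then show "c * (e / (2 * c)) + 2 * c / N * m \<le> e" using c by simp
    qed
    finally show "UE (\<lambda>\<omega>. ennreal (\<bar>X \<omega>\<bar> ^ k * indicator {N<..} \<bar>X \<omega>\<bar>)) \<le> ennreal e" .
  qed
qed

lemma LGk_clip_approx:
  assumes X: "X \<in> LGk k t" and k: "1 \<le> k" and e: "0 < e"
  obtains K where "0 < K" "\<And>N. N \<ge> K \<Longrightarrow> pnorm k (\<lambda>\<omega>. X \<omega> - clip (-N) N (X \<omega>)) \<le> ennreal e"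
proof -
  from LGk_uniformly_integrable[OF X k e] obtain K where K: "0 < K"
    "\<And>N. N \<ge> K \<Longrightarrow> UE (\<lambda>\<omega>. ennreal (\<bar>X \<omega>\<bar> ^ k * indicator {N<..} \<bar>X \<omega>\<bar>)) \<le> ennreal e" by blast
  have "pnorm k (\<lambda>\<omega>. X \<omega> - clip (-N) N (X \<omega>)) \<le> ennreal e" if "K \<le> N" for N
  proof -
    have "pnorm k (\<lambda>\<omega>. X \<omega> - clip (-N) N (X \<omega>)) \<le> UE (\<lambda>\<omega>. ennreal (\<bar>X \<omega>\<bar> ^ k * indicator {N<..} \<bar>X \<omega>\<bar>))"
      unfolding pnorm_def
    proof (intro UE_mono ennreal_leI)
      fix \<omega>
      have "\<bar>X \<omega> - clip (-N) N (X \<omega>)\<bar> ^ k \<le> (\<bar>X \<omega>\<bar> * indicator {N<..} \<bar>X \<omega>\<bar>) ^ k"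
        by (intro power_mono clip_sym_diff) (use K(1) that in auto)
      then show "\<bar>X \<omega> - clip (-N) N (X \<omega>)\<bar> ^ k \<le> \<bar>X \<omega>\<bar> ^ k * indicator {N<..} \<bar>X \<omega>\<bar>"
        using k by (cases "N < \<bar>X \<omega>\<bar>") (auto simp: power_0_left)
    qed
    with K(2)[OF that] show ?thesis by (rule order_trans[rotated])
  qed
  with K(1) show thesis by (rule that)
qed

lemma LGk_bounded_approx:
  assumes X: "X \<in> LGk 1 t" and b: "\<And>\<omega>. a \<le> X \<omega> \<and> X \<omega> \<le> b" and e: "0 < e"
  shows "\<exists>Z\<in>Lip0 t. (\<forall>\<omega>. a \<le> Z \<omega> \<and> Z \<omega> \<le> b) \<and> pnorm 1 (\<lambda>\<omega>. X \<omega> - Z \<omega>) \<le> ennreal e"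
proof -
  from LGk_approx[OF X _ e] obtain Z where Z: "Z \<in> Lip0 t" "pnorm 1 (\<lambda>\<omega>. X \<omega> - Z \<omega>) \<le> ennreal e" by auto
  have "a \<le> b" using b[of undefined] by linarith
  then have "\<forall>\<omega>. a \<le> clip a b (Z \<omega>) \<and> clip a b (Z \<omega>) \<le> b" by (simp add: clip_range)
  moreover have "pnorm 1 (\<lambda>\<omega>. X \<omega> - clip a b (Z \<omega>)) \<le> pnorm 1 (\<lambda>\<omega>. X \<omega> - Z \<omega>)"
    using b by (intro pnorm_mono clip_diff_closer) auto
  ultimately show ?thesis using Lip0_clip[OF Z(1), of a b] Z(2) by (intro bexI[of _ "\<lambda>\<omega>. clip a b (Z \<omega>)"]) auto
qed

text \<open>Approximating cylinder random variables may be clipped to the bounds of \<open>X\<close>, and for bounded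
  differences the \<open>k\<close>-th power is controlled by the first.\<close>

lemma LGk_bounded:
  assumes X: "X \<in> LGk 1 t" and b: "\<And>\<omega>. \<bar>X \<omega>\<bar> \<le> K" and k: "1 \<le> k"
  shows "X \<in> LGk k t"
proof (rule LGkI[OF LGk_measurable[OF X] k])
  fix e :: real assume e: "0 < e"
  have K: "0 \<le> K" using b[of undefined] by linarith
  from k obtain j where j: "k = Suc j" by (cases k) auto
  define c where "c = (2 * K + 1) ^ j"
  have c: "0 < c" using K by (simp add: c_def)
  obtain Z where Z: "Z \<in> Lip0 t" "\<And>\<omega>. -K \<le> Z \<omega> \<and> Z \<omega> \<le> K" "pnorm 1 (\<lambda>\<omega>. X \<omega> - Z \<omega>) \<le> ennreal (e / c)"
  proof -
    have "-K \<le> X \<omega> \<and> X \<omega> \<le> K" for \<omega> using b[of \<omega>] by linarith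
    from LGk_bounded_approx[OF X this, of "e / c"] e c that show thesis by auto
  qed
  note [measurable] = LGk_measurable[OF X] Lip0_measurable[OF Z(1)]
  have "pnorm k (\<lambda>\<omega>. X \<omega> - Z \<omega>) \<le> UE (\<lambda>\<omega>. ennreal c * ennreal (\<bar>X \<omega> - Z \<omega>\<bar> ^ 1))"
    unfolding pnorm_def
  proof (rule UE_mono)
    fix \<omega>
    have "\<bar>X \<omega> - Z \<omega>\<bar> ^ j \<le> c" unfolding c_def by (rule power_mono) (use b[of \<omega>] Z(2)[of \<omega>] in auto)
    from mult_right_mono[OF this, of "\<bar>X \<omega> - Z \<omega>\<bar>"]
    have "\<bar>X \<omega> - Z \<omega>\<bar> ^ k \<le> c * \<bar>X \<omega> - Z \<omega>\<bar>" unfolding j by (simp add: mult.commute)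
    then show "ennreal (\<bar>X \<omega> - Z \<omega>\<bar> ^ k) \<le> ennreal c * ennreal (\<bar>X \<omega> - Z \<omega>\<bar> ^ 1)"
      using c by (simp add: ennreal_leI flip: ennreal_mult)
  qed
  also have "\<dots> \<le> ennreal c * pnorm 1 (\<lambda>\<omega>. X \<omega> - Z \<omega>)" unfolding pnorm_def by (rule UE_cmult) measurable
  also have "\<dots> \<le> ennreal c * ennreal (e / c)" by (intro mult_left_mono Z(3)) simp
  also have "\<dots> = ennreal e" using c e by (simp flip: ennreal_mult)
  finally show "\<exists>Z\<in>Lip0 t. pnorm k (\<lambda>\<omega>. X \<omega> - Z \<omega>) \<le> ennreal e" using Z(1) by blast
qed

text \<open>If \<open>X\<close> is bounded too, products of approximations approximate the product; in general \<open>X\<close> is truncated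
  first, which uniform integrability permits.\<close>

lemma LGk_mult_bounded:
  assumes \<zeta>: "\<zeta> \<in> LGk 1 t" and b: "\<And>\<omega>. \<bar>\<zeta> \<omega>\<bar> \<le> K" and X: "X \<in> LGk k t" and k: "1 \<le> k"
  shows "(\<lambda>\<omega>. \<zeta> \<omega> * X \<omega>) \<in> LGk k t"
proof -
  note [measurable] = LGk_measurable[OF \<zeta>] LGk_measurable[OF X]
  have K: "0 \<le> K" using b[of undefined] by linarith
  have bb: "(\<lambda>\<omega>. \<zeta> \<omega> * Y \<omega>) \<in> LGk k t" if Y: "Y \<in> LGk 1 t" and bY: "\<And>\<omega>. \<bar>Y \<omega>\<bar> \<le> N" for Y N
  proof -
    note [measurable] = LGk_measurable[OF Y]
    have N: "0 \<le> N" using bY[of undefined] by linarith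
    have "(\<lambda>\<omega>. \<zeta> \<omega> * Y \<omega>) \<in> LGk 1 t"
    proof (rule LGkI)
      fix e :: real assume e: "0 < e"
      define d where "d = e / (2 * (K + N + 1))"
      have d: "0 < d" using e K N by (simp add: d_def)
      obtain Z where Z: "Z \<in> Lip0 t" "pnorm 1 (\<lambda>\<omega>. \<zeta> \<omega> - Z \<omega>) \<le> ennreal d"
        using LGk_approx[OF \<zeta> _ d] by auto
      obtain Z' where Z': "Z' \<in> Lip0 t" "\<And>\<omega>. -N \<le> Z' \<omega> \<and> Z' \<omega> \<le> N" "pnorm 1 (\<lambda>\<omega>. Y \<omega> - Z' \<omega>) \<le> ennreal d"
      proof -
        have "-N \<le> Y \<omega> \<and> Y \<omega> \<le> N" for \<omega> using bY[of \<omega>] by linarith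
        from LGk_bounded_approx[OF Y this d] that show thesis by auto
      qed
      note [measurable] = Lip0_measurable[OF Z(1)] Lip0_measurable[OF Z'(1)]
      let ?c = "K + N + 1"
      have "pnorm 1 (\<lambda>\<omega>. \<zeta> \<omega> * Y \<omega> - Z \<omega> * Z' \<omega>) \<le> 
         UE (\<lambda>\<omega>. ennreal ?c * (ennreal (\<bar>Y \<omega> - Z' \<omega>\<bar> ^ 1) + ennreal (\<bar>\<zeta> \<omega> - Z \<omega>\<bar> ^ 1)))"
        unfolding pnorm_def
      proof (rule UE_mono)
        fix \<omega>
        have "\<zeta> \<omega> * Y \<omega> - Z \<omega> * Z' \<omega> = \<zeta> \<omega> * (Y \<omega> - Z' \<omega>) + Z' \<omega> * (\<zeta> \<omega> - Z \<omega>)"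
          by (simp add: algebra_simps)
        then have "\<bar>\<zeta> \<omega> * Y \<omega> - Z \<omega> * Z' \<omega>\<bar> \<le> \<bar>\<zeta> \<omega>\<bar> * \<bar>Y \<omega> - Z' \<omega>\<bar> + \<bar>Z' \<omega>\<bar> * \<bar>\<zeta> \<omega> - Z \<omega>\<bar>"
          by (metis abs_mult abs_triangle_ineq)
        also have "\<dots> \<le> ?c * \<bar>Y \<omega> - Z' \<omega>\<bar> + ?c * \<bar>\<zeta> \<omega> - Z \<omega>\<bar>"
          using b[of \<omega>] Z'(2)[of \<omega>] K N by (intro add_mono mult_right_mono) auto
        finally show "ennreal (\<bar>\<zeta> \<omega> * Y \<omega> - Z \<omega> * Z' \<omega>\<bar> ^ 1) \<le> ennreal ?c * (ennreal (\<bar>Y \<omega> - Z' \<omega>\<bar> ^ 1) + ennreal (\<bar>\<zeta> \<omega> - Z \<omega>\<bar> ^ 1))"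
          using K N by (simp add: ennreal_leI distrib_left flip: ennreal_mult ennreal_plus)
      qed
      also have "\<dots> \<le> ennreal ?c * UE (\<lambda>\<omega>. ennreal (\<bar>Y \<omega> - Z' \<omega>\<bar> ^ 1) + ennreal (\<bar>\<zeta> \<omega> - Z \<omega>\<bar> ^ 1))" by (rule UE_cmult) measurable
      also have "\<dots> \<le> ennreal ?c * (pnorm 1 (\<lambda>\<omega>. Y \<omega> - Z' \<omega>) + pnorm 1 (\<lambda>\<omega>. \<zeta> \<omega> - Z \<omega>))"
        unfolding pnorm_def by (intro mult_left_mono UE_add) simp_all
      also have "\<dots> \<le> ennreal ?c * (ennreal d + ennreal d)" by (intro mult_left_mono add_mono Z Z') simp
      also have "\<dots> = ennreal (?c * (d + d))" using d K N by (simp flip: ennreal_plus ennreal_mult)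
      also have "?c * (d + d) = (2 * ?c) * d" by (simp add: algebra_simps)
      also have "(2 * ?c) * d = e" unfolding d_def using K N by (intro nonzero_mult_div_cancel_left[THEN trans[OF times_divide_eq_right]]) simp
      finally show "\<exists>W\<in>Lip0 t. pnorm 1 (\<lambda>\<omega>. \<zeta> \<omega> * Y \<omega> - W \<omega>) \<le> ennreal e"
        using Lip0_mult[OF Z(1) Z'(1)] by (intro bexI[of _ "\<lambda>\<omega>. Z \<omega> * Z' \<omega>"])
    qed simp_all
    then show ?thesis
    proof (rule LGk_bounded[OF _ _ k])
      show "\<bar>\<zeta> \<omega> * Y \<omega>\<bar> \<le> K * N" for \<omega> unfolding abs_mult using b[of \<omega>] bY[of \<omega>] K by (intro mult_mono) auto
    qed
  qed
  show ?thesis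
  proof (rule LGk_closed[OF _ k])
    fix e :: real assume e: "0 < e"
    define d where "d = e / (K + 1) ^ k"
    have d: "0 < d" "(K + 1) ^ k * d = e" using K e by (auto simp: d_def)
    from LGk_clip_approx[OF X k d(1)] obtain N where N: "0 < N" 
      "pnorm k (\<lambda>\<omega>. X \<omega> - clip (-N) N (X \<omega>)) \<le> ennreal d" by blast
    have "pnorm k (\<lambda>\<omega>. \<zeta> \<omega> * X \<omega> - \<zeta> \<omega> * clip (-N) N (X \<omega>)) \<le> pnorm k (\<lambda>\<omega>. (K + 1) * (X \<omega> - clip (-N) N (X \<omega>)))"
    proof (rule pnorm_mono)
      fix \<omega>
      have "\<bar>\<zeta> \<omega> * X \<omega> - \<zeta> \<omega> * clip (-N) N (X \<omega>)\<bar> = \<bar>\<zeta> \<omega>\<bar> * \<bar>X \<omega> - clip (-N) N (X \<omega>)\<bar>"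
        by (simp add: abs_mult flip: right_diff_distrib)
      also have "\<dots> \<le> (K + 1) * \<bar>X \<omega> - clip (-N) N (X \<omega>)\<bar>" using b[of \<omega>] by (intro mult_right_mono) auto
      finally show "\<bar>\<zeta> \<omega> * X \<omega> - \<zeta> \<omega> * clip (-N) N (X \<omega>)\<bar> \<le> \<bar>(K + 1) * (X \<omega> - clip (-N) N (X \<omega>))\<bar>"
        using K by (simp add: abs_mult)
    qed
    also have "\<dots> \<le> ennreal (\<bar>K + 1\<bar> ^ k) * pnorm k (\<lambda>\<omega>. X \<omega> - clip (-N) N (X \<omega>))" by (rule pnorm_cmult) measurable
    also have "\<dots> \<le> ennreal (\<bar>K + 1\<bar> ^ k) * ennreal d" by (intro mult_left_mono N(2)) simp
    also have "\<dots> = ennreal e" using K d by (simp flip: ennreal_mult)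
    finally show "\<exists>Y\<in>LGk k t. pnorm k (\<lambda>\<omega>. \<zeta> \<omega> * X \<omega> - Y \<omega>) \<le> ennreal e"
      using bb[OF LGk_clip[OF LGk_1[OF X k] order.refl] abs_clip_sym(1)[OF less_imp_le[OF N(1)]]]
      by (intro bexI[of _ "\<lambda>\<omega>. \<zeta> \<omega> * clip (-N) N (X \<omega>)"])
  qed measurable
qed

text \<open>Absolute continuity, uniformly over \<open>\<P>\<close>: split \<open>Y\<close> at a level above which it is small.\<close>

lemma LGk_absolutely_continuous:
  assumes Y: "Y \<in> LGk 1 t" and e: "0 < e"
  obtains d where "0 < d" "\<And>D. D \<in> sets borel \<Longrightarrow> UE (indicator D) \<le> ennreal d \<Longrightarrow> UE (\<lambda>\<omega>. ennreal (\<bar>Y \<omega>\<bar> * indicator D \<omega>)) \<le> ennreal e"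
proof -
  note [measurable] = LGk_measurable[OF Y]
  have e2: "0 < e / 2" using e by simp
  obtain K where K: "0 < K"
    "UE (\<lambda>\<omega>. ennreal (\<bar>Y \<omega>\<bar> ^ 1 * indicator {K<..} \<bar>Y \<omega>\<bar>)) \<le> ennreal (e/2)"
    by (rule LGk_uniformly_integrable[OF Y order.refl e2]) blast
  show thesis
  proof (rule that)
    show "0 < e / (2 * K)" using e K by simp
    fix D :: "path set" assume [measurable]: "D \<in> sets borel" and D: "UE (indicator D) \<le> ennreal (e / (2 * K))"
    have "UE (\<lambda>\<omega>. ennreal (\<bar>Y \<omega>\<bar> * indicator D \<omega>)) \<le> UE (\<lambda>\<omega>. ennreal (\<bar>Y \<omega>\<bar> ^ 1 * indicator {K<..} \<bar>Y \<omega>\<bar>) + ennreal K * indicator D \<omega>)"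
    proof (rule UE_mono)
      fix \<omega> show "ennreal (\<bar>Y \<omega>\<bar> * indicator D \<omega>) \<le> ennreal (\<bar>Y \<omega>\<bar> ^ 1 * indicator {K<..} \<bar>Y \<omega>\<bar>) + ennreal K * indicator D \<omega>"
        by (cases "\<omega> \<in> D"; cases "K < \<bar>Y \<omega>\<bar>") (auto simp: ennreal_leI)
    qed
    also have "\<dots> \<le> UE (\<lambda>\<omega>. ennreal (\<bar>Y \<omega>\<bar> ^ 1 * indicator {K<..} \<bar>Y \<omega>\<bar>)) + UE (\<lambda>\<omega>. ennreal K * indicator D \<omega>)"
      by (rule UE_add) measurable
    also have "\<dots> \<le> ennreal (e/2) + ennreal K * UE (indicator D)"
      by (intro add_mono K(2) UE_cmult) measurable
    also have "\<dots> \<le> ennreal (e/2) + ennreal K * ennreal (e / (2 * K))" by (intro add_mono mult_left_mono D) auto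
    also have "\<dots> = ennreal e" using K e by (simp flip: ennreal_mult ennreal_plus)
    finally show "UE (\<lambda>\<omega>. ennreal (\<bar>Y \<omega>\<bar> * indicator D \<omega>)) \<le> ennreal e" .
  qed
qed

lemma LGk_markov:
  assumes X: "X \<in> LGk 1 t" and d: "0 < d"
  obtains K where "0 < K" "\<And>N. N \<ge> K \<Longrightarrow> UE (indicator {\<omega>. N < \<bar>X \<omega>\<bar>}) \<le> ennreal d"
proof -
  note [measurable] = LGk_measurable[OF X]
  obtain K where K: "0 < K"
    "\<And>N. N \<ge> K \<Longrightarrow> UE (\<lambda>\<omega>. ennreal (\<bar>X \<omega>\<bar> ^ 1 * indicator {N<..} \<bar>X \<omega>\<bar>)) \<le> ennreal d"
    by (rule LGk_uniformly_integrable[OF X order.refl d]) blast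
  show thesis
  proof (rule that[of "max 1 K"])
    fix N assume N: "max 1 K \<le> N"
    have "UE (indicator {\<omega>. N < \<bar>X \<omega>\<bar>}) \<le> UE (\<lambda>\<omega>. ennreal (\<bar>X \<omega>\<bar> ^ 1 * indicator {N<..} \<bar>X \<omega>\<bar>))"
      using N by (intro UE_mono) (auto simp: indicator_def simp flip: ennreal_1 intro!: ennreal_leI)
    with K(2)[of N] N show "UE (indicator {\<omega>. N < \<bar>X \<omega>\<bar>}) \<le> ennreal d" by (meson max.boundedE order_trans)
  qed simp
qed

text \<open>Completeness. A subsequence with summable distances converges almost surely under every
  \<open>P \<in> \<P>\<close>, so that its pointwise limit serves all of them at once.\<close>

lemma LGk_complete:
  assumes X: "\<And>n. X n \<in> LGk k t" and k: "1 \<le> k"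
    and cauchy: "\<And>e. 0 < e \<Longrightarrow> \<exists>N. \<forall>m\<ge>N. \<forall>n\<ge>N. pnorm k (\<lambda>\<omega>. X m \<omega> - X n \<omega>) \<le> ennreal e"
  shows "\<exists>Y\<in>LGk k t. (\<lambda>n. pnorm k (\<lambda>\<omega>. Y \<omega> - X n \<omega>)) \<longlonglongrightarrow> 0"
proof -
  note [measurable] = LGk_measurable[OF X]
  have "\<forall>j. \<exists>N. \<forall>m\<ge>N. \<forall>n\<ge>N. pnorm k (\<lambda>\<omega>. X m \<omega> - X n \<omega>) \<le> ennreal (((1/2) ^ j) ^ k)"
    using cauchy by simp
  then obtain N where N: "\<And>j m n. N j \<le> m \<Longrightarrow> N j \<le> n \<Longrightarrow> pnorm k (\<lambda>\<omega>. X m \<omega> - X n \<omega>) \<le> ennreal (((1/2) ^ j) ^ k)"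
    by metis
  define r where "r j = j + (\<Sum>i\<le>j. N i)" for j
  have rN: "N j \<le> r i" if "j \<le> i" for i j
    using member_le_sum[of j "{..i}" N] that by (simp add: r_def)
  define \<Delta> where "\<Delta> j \<omega> = X (r (Suc j)) \<omega> - X (r j) \<omega>" for j \<omega>
  have [measurable]: "\<Delta> j \<in> borel_measurable borel" for j unfolding \<Delta>_def by measurable
  have \<Delta>: "pnorm 1 (\<Delta> j) \<le> ennreal (2 * (1/2) ^ j)" for j
  proof (rule pnorm_1_le[OF _ _ k])
    show "pnorm k (\<Delta> j) \<le> ennreal (((1/2) ^ j) ^ k)" unfolding \<Delta>_def by (rule N) (auto intro: rN)
  qed auto
  define Y where "Y \<omega> = lim (\<lambda>j. X (r j) \<omega>)" for \<omega>
  have Ym [measurable]: "Y \<in> borel_measurable borel" unfolding Y_def by measurable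
  have conv: "AE \<omega> in P. (\<lambda>j. X (r j) \<omega>) \<longlonglongrightarrow> Y \<omega>" if P: "P \<in> \<P>" for P
  proof -
    note [measurable_cong] = P_sets[OF P]
    have "(\<integral>\<^sup>+\<omega>. (\<Sum>j. ennreal \<bar>\<Delta> j \<omega>\<bar>) \<partial>P) = (\<Sum>j. \<integral>\<^sup>+\<omega>. ennreal \<bar>\<Delta> j \<omega>\<bar> \<partial>P)"
      by (rule nn_integral_suminf) measurable
    also have "\<dots> \<le> (\<Sum>j. ennreal (2 * (1/2) ^ j))"
    proof (rule suminf_le)
      show "(\<integral>\<^sup>+\<omega>. ennreal \<bar>\<Delta> j \<omega>\<bar> \<partial>P) \<le> ennreal (2 * (1/2) ^ j)" for j
        using UE_upper[OF P, of "\<lambda>\<omega>. ennreal \<bar>\<Delta> j \<omega>\<bar>"] \<Delta>[of j] by (simp add: pnorm_def)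
    qed auto
    also have "\<dots> = ennreal (\<Sum>j. 2 * (1/2) ^ j)"
      by (rule suminf_ennreal2) (auto intro!: summable_mult summable_geometric)
    also have "\<dots> < \<infinity>" by simp
    finally have "AE \<omega> in P. (\<Sum>j. ennreal \<bar>\<Delta> j \<omega>\<bar>) \<noteq> \<infinity>"
      by (intro nn_integral_noteq_infinite) auto
    then show ?thesis
    proof eventually_elim
      case (elim \<omega>)
      then have "summable (\<lambda>j. \<bar>\<Delta> j \<omega>\<bar>)"
        by (intro summable_suminf_not_top) auto
      then have "summable (\<lambda>j. \<Delta> j \<omega>)" by (rule summable_rabs_cancel)
      then have "convergent (\<lambda>n. \<Sum>j<n. \<Delta> j \<omega>)" by (simp add: summable_iff_convergent)
      moreover have "(\<Sum>j<n. \<Delta> j \<omega>) = X (r n) \<omega> - X (r 0) \<omega>" for n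
        unfolding \<Delta>_def by (rule sum_lessThan_telescope)
      ultimately have "convergent (\<lambda>n. X (r n) \<omega> - X (r 0) \<omega>)" by simp
      then have "convergent (\<lambda>n. (X (r n) \<omega> - X (r 0) \<omega>) + X (r 0) \<omega>)"
        by (rule convergent_add[OF _ convergent_const])
      then show ?case unfolding Y_def by (simp add: convergent_LIMSEQ_iff)
    qed
  qed
  have lim: "(\<lambda>n. pnorm k (\<lambda>\<omega>. Y \<omega> - X n \<omega>)) \<longlonglongrightarrow> 0"
  proof (rule ennreal_tendsto_0I)
    fix e :: real assume "0 < e"
    from cauchy[OF this] obtain n0 where n0: "\<And>m n. n0 \<le> m \<Longrightarrow> n0 \<le> n \<Longrightarrow> pnorm k (\<lambda>\<omega>. X m \<omega> - X n \<omega>) \<le> ennreal e" by blast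
    have "pnorm k (\<lambda>\<omega>. Y \<omega> - X n \<omega>) \<le> ennreal e" if n: "n0 \<le> n" for n
      unfolding pnorm_def
    proof (rule UE_least)
      fix P assume P: "P \<in> \<P>"
      note [measurable_cong] = P_sets[OF P]
      have "(\<integral>\<^sup>+\<omega>. ennreal (\<bar>Y \<omega> - X n \<omega>\<bar> ^ k) \<partial>P) = (\<integral>\<^sup>+\<omega>. liminf (\<lambda>j. ennreal (\<bar>X (r j) \<omega> - X n \<omega>\<bar> ^ k)) \<partial>P)"
        using conv[OF P]
      proof (intro nn_integral_cong_AE, eventually_elim)
        case (elim \<omega>)
        then have "(\<lambda>j. ennreal (\<bar>X (r j) \<omega> - X n \<omega>\<bar> ^ k)) \<longlonglongrightarrow> ennreal (\<bar>Y \<omega> - X n \<omega>\<bar> ^ k)"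
          by (intro tendsto_intros)
        then show ?case by (rule lim_imp_Liminf[OF sequentially_bot, symmetric])
      qed
      also have "\<dots> \<le> liminf (\<lambda>j. \<integral>\<^sup>+\<omega>. ennreal (\<bar>X (r j) \<omega> - X n \<omega>\<bar> ^ k) \<partial>P)"
        by (rule nn_integral_liminf) measurable
      also have "\<dots> \<le> liminf (\<lambda>j. ennreal e)"
      proof (rule Liminf_mono)
        show "\<forall>\<^sub>F j in sequentially. (\<integral>\<^sup>+\<omega>. ennreal (\<bar>X (r j) \<omega> - X n \<omega>\<bar> ^ k) \<partial>P) \<le> ennreal e"
          unfolding eventually_sequentially
        proof (intro exI[of _ n0] allI impI)
          fix j assume "n0 \<le> j"
          then have "n0 \<le> r j" by (simp add: r_def)
          from UE_upper[OF P, of "\<lambda>\<omega>. ennreal (\<bar>X (r j) \<omega> - X n \<omega>\<bar> ^ k)"] n0[OF this n]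
          show "(\<integral>\<^sup>+\<omega>. ennreal (\<bar>X (r j) \<omega> - X n \<omega>\<bar> ^ k) \<partial>P) \<le> ennreal e" by (simp add: pnorm_def)
        qed
      qed
      also have "\<dots> = ennreal e" by (simp add: Liminf_const)
      finally show "(\<integral>\<^sup>+\<omega>. ennreal (\<bar>Y \<omega> - X n \<omega>\<bar> ^ k) \<partial>P) \<le> ennreal e" .
    qed
    then show "\<exists>N. \<forall>n\<ge>N. pnorm k (\<lambda>\<omega>. Y \<omega> - X n \<omega>) \<le> ennreal e" by blast
  qed
  from LGk_closed_limit[OF Ym k X lim] lim show ?thesis by blast
qed

lemma LGk_integrable:
  assumes "X \<in> LGk 1 t" "P \<in> \<P>" shows "integrable P X"
proof (rule integrableI_bounded)
  show "X \<in> borel_measurable P" unfolding P_meas[OF assms(2)] by (rule LGk_measurable[OF assms(1)])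
  have "(\<integral>\<^sup>+\<omega>. ennreal (norm (X \<omega>)) \<partial>P) \<le> pnorm 1 X"
    using UE_upper[OF assms(2), of "\<lambda>\<omega>. ennreal \<bar>X \<omega>\<bar>"] by (simp add: pnorm_def)
  also have "\<dots> < \<infinity>" by (rule LGk_pnorm_finite[OF assms(1)]) simp
  finally show "(\<integral>\<^sup>+\<omega>. ennreal (norm (X \<omega>)) \<partial>P) < \<infinity>" .
qed

lemma LGk_square_integrable:
  assumes "X \<in> LGk 2 t" "P \<in> \<P>" shows "integrable P (\<lambda>\<omega>. (X \<omega>)\<^sup>2)"
proof (rule integrableI_bounded)
  show "(\<lambda>\<omega>. (X \<omega>)\<^sup>2) \<in> borel_measurable P"
    unfolding P_meas[OF assms(2)] using LGk_measurable[OF assms(1)] by measurable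
  have "(\<integral>\<^sup>+\<omega>. ennreal (norm ((X \<omega>)\<^sup>2)) \<partial>P) \<le> pnorm 2 X"
    using UE_upper[OF assms(2), of "\<lambda>\<omega>. ennreal (\<bar>X \<omega>\<bar>\<^sup>2)"] by (simp add: pnorm_def)
  also have "\<dots> < \<infinity>" by (rule LGk_pnorm_finite[OF assms(1)]) simp
  finally show "(\<integral>\<^sup>+\<omega>. ennreal (norm ((X \<omega>)\<^sup>2)) \<partial>P) < \<infinity>" .
qed

lemma LGk_product_integrable:
  assumes X: "X \<in> LGk 2 t" and Y: "Y \<in> LGk 2 s" and P: "P \<in> \<P>" shows "integrable P (\<lambda>\<omega>. X \<omega> * Y \<omega>)"
proof (rule Bochner_Integration.integrable_bound)
  show "integrable P (\<lambda>\<omega>. (X \<omega>)\<^sup>2 + (Y \<omega>)\<^sup>2)"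
    by (intro Bochner_Integration.integrable_add LGk_square_integrable[OF X P] LGk_square_integrable[OF Y P])
  show "(\<lambda>\<omega>. X \<omega> * Y \<omega>) \<in> borel_measurable P"
    unfolding P_meas[OF P] using LGk_measurable[OF X] LGk_measurable[OF Y] by measurable
  have "\<bar>x * y\<bar> \<le> x\<^sup>2 + y\<^sup>2" for x y :: real
  proof -
    have "2 * \<bar>x * y\<bar> \<le> x\<^sup>2 + y\<^sup>2" using sum_squares_bound[of "\<bar>x\<bar>" "\<bar>y\<bar>"] by (simp add: abs_mult)
    then show ?thesis using abs_ge_zero[of "x * y"] by linarith
  qed
  then show "AE \<omega> in P. norm (X \<omega> * Y \<omega>) \<le> norm ((X \<omega>)\<^sup>2 + (Y \<omega>)\<^sup>2)" by simp
qed

lemma integrable_mult_bounded: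
  fixes \<zeta> X :: "path \<Rightarrow> real"
  assumes P: "P \<in> \<P>" and X: "integrable P X" and \<zeta>: "\<zeta> \<in> borel_measurable borel" "\<And>\<omega>. \<bar>\<zeta> \<omega>\<bar> \<le> K"
  shows "integrable P (\<lambda>\<omega>. \<zeta> \<omega> * X \<omega>)"
proof (rule Bochner_Integration.integrable_bound)
  show "integrable P (\<lambda>\<omega>. K * X \<omega>)" using X by simp
  show "(\<lambda>\<omega>. \<zeta> \<omega> * X \<omega>) \<in> borel_measurable P"
    using borel_measurable_integrable[OF X] \<zeta>(1) unfolding P_meas[OF P] by measurable
  have "\<bar>\<zeta> \<omega>\<bar> * \<bar>X \<omega>\<bar> \<le> \<bar>K\<bar> * \<bar>X \<omega>\<bar>" for \<omega>
    using \<zeta>(2)[of \<omega>] by (intro mult_right_mono) auto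
  then show "AE \<omega> in P. norm (\<zeta> \<omega> * X \<omega>) \<le> norm (K * X \<omega>)" by (simp add: abs_mult)
qed

lemma integral_mult_diff_le:
  fixes \<zeta> X Y :: "path \<Rightarrow> real"
  assumes P: "P \<in> \<P>" and X: "integrable P X" and Y: "integrable P Y"
    and \<zeta>: "\<zeta> \<in> borel_measurable borel" "\<And>\<omega>. \<bar>\<zeta> \<omega>\<bar> \<le> K"
    and e: "pnorm 1 (\<lambda>\<omega>. X \<omega> - Y \<omega>) \<le> ennreal e" "0 \<le> e"
  shows "\<bar>(\<integral>\<omega>. \<zeta> \<omega> * X \<omega> \<partial>P) - (\<integral>\<omega>. \<zeta> \<omega> * Y \<omega> \<partial>P)\<bar> \<le> K * e"
proof -
  have K: "0 \<le> K" using \<zeta>(2)[of undefined] by linarith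
  have D: "integrable P (\<lambda>\<omega>. X \<omega> - Y \<omega>)" using X Y by simp
  have "ennreal (\<integral>\<omega>. \<bar>X \<omega> - Y \<omega>\<bar> \<partial>P) = (\<integral>\<^sup>+\<omega>. ennreal \<bar>X \<omega> - Y \<omega>\<bar> \<partial>P)"
    by (rule nn_integral_eq_integral[symmetric]) (use D in auto)
  also have "\<dots> \<le> ennreal e"
    using UE_upper[OF P, of "\<lambda>\<omega>. ennreal \<bar>X \<omega> - Y \<omega>\<bar>"] e(1) by (simp add: pnorm_def)
  finally have le: "(\<integral>\<omega>. \<bar>X \<omega> - Y \<omega>\<bar> \<partial>P) \<le> e" using e(2) by simp
  have "(\<integral>\<omega>. \<zeta> \<omega> * X \<omega> \<partial>P) - (\<integral>\<omega>. \<zeta> \<omega> * Y \<omega> \<partial>P) = (\<integral>\<omega>. \<zeta> \<omega> * (X \<omega> - Y \<omega>) \<partial>P)"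
    by (subst Bochner_Integration.integral_diff[symmetric])
       (auto intro: integrable_mult_bounded[OF P X \<zeta>] integrable_mult_bounded[OF P Y \<zeta>] simp: right_diff_distrib)
  also have "\<bar>\<dots>\<bar> \<le> (\<integral>\<omega>. \<bar>\<zeta> \<omega> * (X \<omega> - Y \<omega>)\<bar> \<partial>P)"
    by (rule integral_abs_bound)
  also have "\<dots> \<le> (\<integral>\<omega>. K * \<bar>X \<omega> - Y \<omega>\<bar> \<partial>P)"
  proof (rule integral_mono)
    show "integrable P (\<lambda>\<omega>. \<bar>\<zeta> \<omega> * (X \<omega> - Y \<omega>)\<bar>)"
      using integrable_mult_bounded[OF P D \<zeta>] by simp
    show "\<bar>\<zeta> \<omega> * (X \<omega> - Y \<omega>)\<bar> \<le> K * \<bar>X \<omega> - Y \<omega>\<bar>" for \<omega>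
      unfolding abs_mult by (intro mult_right_mono \<zeta>(2)) simp
  qed (use D in simp)
  also have "\<dots> = K * (\<integral>\<omega>. \<bar>X \<omega> - Y \<omega>\<bar> \<partial>P)" by simp
  also have "\<dots> \<le> K * e" by (intro mult_left_mono le K)
  finally show ?thesis .
qed

text \<open>The approximating cylinder weights can be kept between \<open>0\<close> and \<open>K\<close>, so that dominated convergence
  applies along a subsequence that converges almost everywhere.\<close>

lemma integral_le_0_bounded_LG:
  assumes P: "P \<in> \<P>" and D: "integrable P D"
    and Z: "\<And>Z. Z \<in> Lip0 s \<Longrightarrow> (\<And>\<omega>. 0 \<le> Z \<omega> \<and> Z \<omega> \<le> K) \<Longrightarrow> (\<integral>\<omega>. Z \<omega> * D \<omega> \<partial>P) \<le> 0"
    and \<zeta>: "\<zeta> \<in> LGk 1 s" "\<And>\<omega>. 0 \<le> \<zeta> \<omega> \<and> \<zeta> \<omega> \<le> K"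
  shows "(\<integral>\<omega>. \<zeta> \<omega> * D \<omega> \<partial>P) \<le> 0"
proof -
  note [measurable] = LGk_measurable[OF \<zeta>(1)]
  have "\<exists>Z\<in>Lip0 s. (\<forall>\<omega>. 0 \<le> Z \<omega> \<and> Z \<omega> \<le> K) \<and> pnorm 1 (\<lambda>\<omega>. \<zeta> \<omega> - Z \<omega>) \<le> ennreal ((1/2) ^ n)" for n :: nat
    by (rule LGk_bounded_approx[OF \<zeta>]) simp
  then obtain Z where Zn: "\<And>n. Z n \<in> Lip0 s" "\<And>n \<omega>. 0 \<le> Z n \<omega> \<and> Z n \<omega> \<le> K"
    "\<And>n. pnorm 1 (\<lambda>\<omega>. \<zeta> \<omega> - Z n \<omega>) \<le> ennreal ((1/2) ^ n)" by metis
  note [measurable] = Lip0_measurable[OF Zn(1)] borel_measurable_integrable[OF D]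
  note [measurable_cong] = P_sets[OF P]
  have int: "integrable P (\<lambda>\<omega>. Z n \<omega> - \<zeta> \<omega>)" for n
    using LGk_integrable[OF LGk_diff[OF Lip0_LGk[OF Zn(1)] \<zeta>(1)] P] by simp
  have "(\<lambda>n. \<integral>\<omega>. norm (Z n \<omega> - \<zeta> \<omega>) \<partial>P) \<longlonglongrightarrow> 0"
  proof (rule tendsto_sandwich[of "\<lambda>_. 0" _ _ "\<lambda>n. (1/2) ^ n"])
    have "(\<integral>\<omega>. norm (Z n \<omega> - \<zeta> \<omega>) \<partial>P) \<le> (1/2) ^ n" for n
    proof -
      have "ennreal (\<integral>\<omega>. norm (Z n \<omega> - \<zeta> \<omega>) \<partial>P) = (\<integral>\<^sup>+\<omega>. ennreal (norm (Z n \<omega> - \<zeta> \<omega>)) \<partial>P)"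
        by (rule nn_integral_eq_integral[symmetric]) (use int in auto)
      also have "\<dots> \<le> ennreal ((1/2) ^ n)"
        using UE_upper[OF P, of "\<lambda>\<omega>. ennreal \<bar>\<zeta> \<omega> - Z n \<omega>\<bar>"] Zn(3)[of n] by (simp add: pnorm_def abs_minus_commute)
      finally show ?thesis by simp
    qed
    then show "\<forall>\<^sub>F n in sequentially. (\<integral>\<omega>. norm (Z n \<omega> - \<zeta> \<omega>) \<partial>P) \<le> (1/2) ^ n" by simp
  qed (auto intro: LIMSEQ_realpow_zero)
  from tendsto_L1_AE_subseq[OF int this] obtain r where r: "strict_mono r" "AE \<omega> in P. (\<lambda>n. Z (r n) \<omega> - \<zeta> \<omega>) \<longlonglongrightarrow> 0" by blast
  have "(\<lambda>n. \<integral>\<omega>. Z (r n) \<omega> * D \<omega> \<partial>P) \<longlonglongrightarrow> (\<integral>\<omega>. \<zeta> \<omega> * D \<omega> \<partial>P)"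
  proof (rule integral_dominated_convergence)
    show "integrable P (\<lambda>\<omega>. K * norm (D \<omega>))" using D by simp
    show "AE \<omega> in P. (\<lambda>n. Z (r n) \<omega> * D \<omega>) \<longlonglongrightarrow> \<zeta> \<omega> * D \<omega>"
      using r(2)
    proof eventually_elim
      case (elim \<omega>)
      then have "(\<lambda>n. Z (r n) \<omega>) \<longlonglongrightarrow> \<zeta> \<omega>" by (rule LIM_zero_cancel)
      then show ?case by (intro tendsto_intros)
    qed
    show "AE \<omega> in P. norm (Z (r n) \<omega> * D \<omega>) \<le> K * norm (D \<omega>)" for n
      using Zn(2)[of "r n"] by (auto simp: abs_mult intro!: mult_right_mono)
  qed measurable
  then show ?thesis by (rule LIMSEQ_le_const2) (use Z[OF Zn(1) Zn(2)] in blast)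
qed

lemma qs_AE: "qs \<P> Q \<Longrightarrow> P \<in> \<P> \<Longrightarrow> AE \<omega> in P. Q \<omega>"
proof -
  assume "qs \<P> Q" and P: "P \<in> \<P>"
  then obtain N where N: "N \<in> sets borel" "capacity \<P> N = 0" "\<And>\<omega>. \<omega> \<notin> N \<Longrightarrow> Q \<omega>" unfolding qs_def by blast
  have "emeasure P N \<le> capacity \<P> N" unfolding capacity_def using P by (rule SUP_upper)
  then have "N \<in> null_sets P" using N P_sets[OF P] by auto
  then show "AE \<omega> in P. Q \<omega>" by (rule AE_I') (use N(3) in blast)
qed

lemma AE_qs:
  assumes "{\<omega>. \<not> Q \<omega>} \<in> sets borel" "\<And>P. P \<in> \<P> \<Longrightarrow> AE \<omega> in P. Q \<omega>" shows "qs \<P> Q"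
proof -
  have "emeasure P {\<omega>. \<not> Q \<omega>} = 0" if P: "P \<in> \<P>" for P
    using assms(2)[OF P] assms(1) by (subst (asm) AE_iff_measurable[OF _ refl]) (simp_all add: P_sets[OF P] P_space[OF P])
  then have "capacity \<P> {\<omega>. \<not> Q \<omega>} = 0" by (auto simp: capacity_def intro!: antisym SUP_least)
  with assms(1) show ?thesis unfolding qs_def by blast
qed

lemma AE_qs_eq:
  assumes [measurable]: "X \<in> borel_measurable borel" "Y \<in> borel_measurable borel"
    and "\<And>P. P \<in> \<P> \<Longrightarrow> AE \<omega> in P. X \<omega> = (Y \<omega> :: real)"
  shows "qs \<P> (\<lambda>\<omega>. X \<omega> = Y \<omega>)"
proof (rule AE_qs)
  have "{\<omega> \<in> space borel. \<not> X \<omega> = Y \<omega>} \<in> sets borel" by measurable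
  then show "{\<omega>. \<not> X \<omega> = Y \<omega>} \<in> sets borel" by simp
qed (rule assms)

lemma pnorm_0_AE:
  assumes [measurable]: "X \<in> borel_measurable borel" and "pnorm k X = 0" and k: "1 \<le> k" and P: "P \<in> \<P>"
  shows "AE \<omega> in P. X \<omega> = 0"
proof -
  note [measurable_cong] = P_sets[OF P]
  have "(\<integral>\<^sup>+\<omega>. ennreal (\<bar>X \<omega>\<bar> ^ k) \<partial>P) = 0"
    using UE_upper[OF P, of "\<lambda>\<omega>. ennreal (\<bar>X \<omega>\<bar> ^ k)"] assms(2) by (simp add: pnorm_def)
  then have "AE \<omega> in P. ennreal (\<bar>X \<omega>\<bar> ^ k) = 0" by (subst (asm) nn_integral_0_iff_AE) auto
  then show ?thesis
  proof eventually_elim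
    case (elim \<omega>)
    then have "\<bar>X \<omega>\<bar> ^ k \<le> 0" unfolding ennreal_eq_0_iff .
    show ?case
    proof (rule ccontr)
      assume "X \<omega> \<noteq> 0"
      then have "0 < \<bar>X \<omega>\<bar>" by simp
      then have "0 < \<bar>X \<omega>\<bar> ^ k" by (rule zero_less_power)
      with \<open>\<bar>X \<omega>\<bar> ^ k \<le> 0\<close> show False by linarith
    qed
  qed
qed

end

section \<open>Conditional G-expectations and martingales\<close>

locale G_framework = G_expectation_space +
  fixes \<P> :: "path measure set"
  assumes rep: "represents \<P> E"
begin

lemma E_represented:
  assumes X: "X \<in> Lip0 t"
  shows "\<exists>P\<in>\<P>. E X = (\<integral>\<omega>. X \<omega> \<partial>P)" and "P \<in> \<P> \<Longrightarrow> (\<integral>\<omega>. X \<omega> \<partial>P) \<le> E X"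
proof -
  have 0: "upper_expectation \<P> (\<lambda>\<omega>. ennreal (\<bar>X \<omega> - X \<omega>\<bar> powr 1)) = 0"
    unfolding upper_expectation_def by (auto intro!: antisym SUP_least)
  have "X \<in> Lip0_all" using X by (auto simp: Lip0_all_iff)
  then have "X \<in> LG_all \<P> 1" unfolding LG_all_def Lp_closure_def
    using Lip0_measurable[OF X] 0 by (auto intro!: exI[of _ "\<lambda>_. X"])
  with rep show "\<exists>P\<in>\<P>. E X = (\<integral>\<omega>. X \<omega> \<partial>P)" and "P \<in> \<P> \<Longrightarrow> (\<integral>\<omega>. X \<omega> \<partial>P) \<le> E X"
    unfolding represents_def by blast+
qed

lemma P_prob_borel:
  assumes "P \<in> \<P>" shows "prob_space P \<and> sets P = sets borel"
proof -
  have "\<P> \<subseteq> topspace weak_topology" using rep compactin_subset_topspace unfolding represents_def by blast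
  with assms have "P \<in> topspace weak_topology" by blast
  then show ?thesis unfolding weak_topology_def topology_generated_by_topspace by blast
qed

sublocale prob_family \<P>
proof (rule prob_family.intro)
  show "prob_space P" "sets P = sets borel" if "P \<in> \<P>" for P using P_prob_borel[OF that] by auto
  fix X t assume X: "X \<in> Lip0 t"
  \<comment> \<open>The Bochner integral of a nonintegrable function is \<open>0\<close>, so that the bound by \<open>E\<close> is applied to
     truncations, which are integrable.\<close>
  have "(\<integral>\<^sup>+\<omega>. ennreal \<bar>X \<omega>\<bar> \<partial>P) \<le> ennreal (E (\<lambda>\<omega>. \<bar>X \<omega>\<bar>))" if P: "P \<in> \<P>" for P
  proof -
    interpret prob_space P using P_prob_borel[OF P] by blast
    have sP [measurable_cong]: "sets P = sets borel" using P_prob_borel[OF P] by blast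
    note [measurable] = Lip0_measurable[OF X]
    have aX: "(\<lambda>\<omega>. \<bar>X \<omega>\<bar>) \<in> Lip0 t"
      by (rule Lip0_lipschitz[OF X, where h = abs and L = 1]) (simp add: abs_triangle_ineq3)
    have bound: "(\<integral>\<^sup>+\<omega>. ennreal (min \<bar>X \<omega>\<bar> (real n)) \<partial>P) \<le> ennreal (E (\<lambda>\<omega>. \<bar>X \<omega>\<bar>))" for n
    proof -
      have mX: "(\<lambda>\<omega>. min \<bar>X \<omega>\<bar> (real n)) \<in> Lip0 t"
        by (rule Lip0_lipschitz[OF aX, where h = "\<lambda>x. min x (real n)" and L = 1]) (auto simp: min_def)
      have int: "integrable P (\<lambda>\<omega>. min \<bar>X \<omega>\<bar> (real n))"
        by (rule integrable_const_bound[of _ "real n"]) auto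
      have "(\<integral>\<^sup>+\<omega>. ennreal (min \<bar>X \<omega>\<bar> (real n)) \<partial>P) = ennreal (\<integral>\<omega>. min \<bar>X \<omega>\<bar> (real n) \<partial>P)"
        by (rule nn_integral_eq_integral[OF int]) auto
      also have "\<dots> \<le> ennreal (E (\<lambda>\<omega>. min \<bar>X \<omega>\<bar> (real n)))"
        by (intro ennreal_leI E_represented(2)[OF mX P])
      also have "\<dots> \<le> ennreal (E (\<lambda>\<omega>. \<bar>X \<omega>\<bar>))"
        by (intro ennreal_leI E_mono_cylinder[OF mX aX]) simp
      finally show ?thesis .
    qed
    have lim: "(\<lambda>n. ennreal (min \<bar>X \<omega>\<bar> (real n))) \<longlonglongrightarrow> ennreal \<bar>X \<omega>\<bar>" for \<omega>
    proof (rule tendsto_eventually)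
      obtain N :: nat where "\<bar>X \<omega>\<bar> \<le> real N" using real_arch_simple by blast
      then have "\<forall>n\<ge>N. ennreal (min \<bar>X \<omega>\<bar> (real n)) = ennreal \<bar>X \<omega>\<bar>" by (auto simp: min_def)
      then show "\<forall>\<^sub>F n in sequentially. ennreal (min \<bar>X \<omega>\<bar> (real n)) = ennreal \<bar>X \<omega>\<bar>"
        unfolding eventually_sequentially by blast
    qed
    have "(\<integral>\<^sup>+\<omega>. ennreal \<bar>X \<omega>\<bar> \<partial>P) = (\<integral>\<^sup>+\<omega>. liminf (\<lambda>n. ennreal (min \<bar>X \<omega>\<bar> (real n))) \<partial>P)"
      using lim_imp_Liminf[OF sequentially_bot lim] by simp
    also have "\<dots> \<le> liminf (\<lambda>n. \<integral>\<^sup>+\<omega>. ennreal (min \<bar>X \<omega>\<bar> (real n)) \<partial>P)"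
      by (rule nn_integral_liminf) measurable
    also have "\<dots> \<le> liminf (\<lambda>n. ennreal (E (\<lambda>\<omega>. \<bar>X \<omega>\<bar>)))"
      by (rule Liminf_mono) (simp add: bound)
    also have "\<dots> = ennreal (E (\<lambda>\<omega>. \<bar>X \<omega>\<bar>))" by (simp add: Liminf_const)
    finally show ?thesis .
  qed
  then have "upper_expectation \<P> (\<lambda>\<omega>. ennreal \<bar>X \<omega>\<bar>) \<le> ennreal (E (\<lambda>\<omega>. \<bar>X \<omega>\<bar>))"
    unfolding upper_expectation_def by (rule SUP_least)
  also have "\<dots> < \<infinity>" by simp
  finally show "upper_expectation \<P> (\<lambda>\<omega>. ennreal \<bar>X \<omega>\<bar>) < \<infinity>" .
qed

text \<open>The next two lemmas read the identity for \<open>E\<close> through the measures that represent it. Since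
  \<open>E (Z (U - V)) = E (Z (V - V)) = 0\<close>, the conditional G-expectation dominates the conditional
  expectation under every \<open>P\<close>; and since the value \<open>E (Z (U - W)) = E (Z (V - W))\<close> is attained by some
  \<open>Q\<close>, it does so without loss.\<close>

lemma cylinder_cond_dominates:
  assumes UV: "cylinder_cond E\<^sub>\<xi> \<xi> s U V" and Z: "Z \<in> Lip0 s" "\<And>\<omega>. 0 \<le> Z \<omega>" and P: "P \<in> \<P>"
  shows "(\<integral>\<omega>. Z \<omega> * (U \<omega> - V \<omega>) \<partial>P) \<le> 0"
proof -
  note c = cylinder_cond_Lip0[OF UV]
  obtain t where "U \<in> Lip0 t" using c(1) by (auto simp: Lip0_all_iff)
  then have "U \<in> Lip0 (max s t)" "V \<in> Lip0 (max s t)" "Z \<in> Lip0 (max s t)" using c(2) Z(1) by (auto intro: Lip0_mono)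
  then have "(\<lambda>\<omega>. Z \<omega> * (U \<omega> - V \<omega>)) \<in> Lip0 (max s t)" by (intro Lip0_mult Lip0_diff)
  then have "(\<integral>\<omega>. Z \<omega> * (U \<omega> - V \<omega>) \<partial>P) \<le> E (\<lambda>\<omega>. Z \<omega> * (U \<omega> - V \<omega>))" by (rule E_represented(2)[OF _ P])
  also have "\<dots> = E (\<lambda>\<omega>. Z \<omega> * (V \<omega> - V \<omega>))" by (rule E_cylinder_cond[OF UV Z c(2)])
  also have "\<dots> = E (\<lambda>_. 0)" by simp
  also have "\<dots> = 0" using E_represented(1)[OF Lip0_const[of 0 0]] by auto
  finally show ?thesis .
qed

lemma cylinder_cond_attained:
  assumes UV: "cylinder_cond E\<^sub>\<xi> \<xi> s U V" and Z: "Z \<in> Lip0 s" "\<And>\<omega>. 0 \<le> Z \<omega>" and W: "W \<in> Lip0 s" and P: "P \<in> \<P>"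
  shows "\<exists>Q\<in>\<P>. (\<integral>\<omega>. Z \<omega> * (V \<omega> - W \<omega>) \<partial>P) \<le> (\<integral>\<omega>. Z \<omega> * (U \<omega> - W \<omega>) \<partial>Q)"
proof -
  note c = cylinder_cond_Lip0[OF UV]
  obtain t where "U \<in> Lip0 t" using c(1) by (auto simp: Lip0_all_iff)
  then have "U \<in> Lip0 (max s t)" "W \<in> Lip0 (max s t)" "Z \<in> Lip0 (max s t)" using W Z(1) by (auto intro: Lip0_mono)
  then have "(\<lambda>\<omega>. Z \<omega> * (U \<omega> - W \<omega>)) \<in> Lip0 (max s t)" by (intro Lip0_mult Lip0_diff)
  from E_represented(1)[OF this] obtain Q where Q: "Q \<in> \<P>" "E (\<lambda>\<omega>. Z \<omega> * (U \<omega> - W \<omega>)) = (\<integral>\<omega>. Z \<omega> * (U \<omega> - W \<omega>) \<partial>Q)" by blast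
  have "(\<lambda>\<omega>. Z \<omega> * (V \<omega> - W \<omega>)) \<in> Lip0 s" by (intro Lip0_mult Lip0_diff c(2) W Z)
  then have "(\<integral>\<omega>. Z \<omega> * (V \<omega> - W \<omega>) \<partial>P) \<le> E (\<lambda>\<omega>. Z \<omega> * (V \<omega> - W \<omega>))"
    by (rule E_represented(2)[OF _ P])
  also have "\<dots> = E (\<lambda>\<omega>. Z \<omega> * (U \<omega> - W \<omega>))" by (rule E_cylinder_cond[OF UV Z W, symmetric])
  finally show ?thesis using Q by auto
qed

lemma Lip0_integrable: "X \<in> Lip0 t \<Longrightarrow> P \<in> \<P> \<Longrightarrow> integrable P X"
  using LGk_integrable Lip0_LGk by blast

lemma pnorm_ge_integral:
  assumes X: "X \<in> LGk 1 t" and P: "P \<in> \<P>"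
  shows "ennreal (\<integral>\<omega>. \<bar>X \<omega>\<bar> \<partial>P) \<le> pnorm 1 X"
proof -
  have "ennreal (\<integral>\<omega>. \<bar>X \<omega>\<bar> \<partial>P) = (\<integral>\<^sup>+\<omega>. ennreal \<bar>X \<omega>\<bar> \<partial>P)"
    by (rule nn_integral_eq_integral[symmetric]) (use LGk_integrable[OF X P] in auto)
  also have "\<dots> \<le> pnorm 1 X" using UE_upper[OF P, of "\<lambda>\<omega>. ennreal \<bar>X \<omega>\<bar>"] by (simp add: pnorm_def)
  finally show ?thesis .
qed

text \<open>The factor \<open>2\<close> comes from treating positive and negative parts separately. In
  \<open>(V - V')\<^sup>+ \<le> \<zeta> (V - V') + e\<close>, the weight \<open>\<zeta>\<close> is a Lipschitz approximation to the indicator of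
  \<open>V > V'\<close>, so that the two inequalities above apply to \<open>\<zeta> (V - V')\<close>.\<close>

lemma cylinder_cond_contraction:
  assumes UV: "cylinder_cond E\<^sub>\<xi> \<xi> s U V" and UV': "cylinder_cond E\<^sub>\<xi> \<xi> s U' V'"
  shows "pnorm 1 (\<lambda>\<omega>. V \<omega> - V' \<omega>) \<le> 2 * pnorm 1 (\<lambda>\<omega>. U \<omega> - U' \<omega>)"
proof -
  have half: "(\<integral>\<omega>. max 0 (V \<omega> - V' \<omega>) \<partial>P) \<le> a"
    if UV: "cylinder_cond E\<^sub>\<xi> \<xi> s U V" and UV': "cylinder_cond E\<^sub>\<xi> \<xi> s U' V'" and P: "P \<in> \<P>" 
     and a: "pnorm 1 (\<lambda>\<omega>. U \<omega> - U' \<omega>) \<le> ennreal a" "0 \<le> a" for U V U' V' P a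
  proof (rule field_le_epsilon)
    fix e :: real assume e: "0 < e"
    interpret prob_space P by (rule prob[OF P])
    note c = cylinder_cond_Lip0[OF UV] cylinder_cond_Lip0[OF UV']
    define \<zeta> where "\<zeta> \<omega> = clip 0 1 ((1/e) * (V \<omega> - V' \<omega>))" for \<omega>
    have \<zeta>: "\<zeta> \<in> Lip0 s" unfolding \<zeta>_def by (intro Lip0_clip Lip0_cmult Lip0_diff c)
    have \<zeta>01: "0 \<le> \<zeta> \<omega>" "\<zeta> \<omega> \<le> 1" for \<omega> using clip_range[of 0 1] by (auto simp: \<zeta>_def)
    obtain t where t: "U \<in> Lip0 t" using c by (auto simp: Lip0_all_iff)
    obtain t' where t': "U' \<in> Lip0 t'" using c by (auto simp: Lip0_all_iff)
    define r where "r = max s (max t t')"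
    have r: "U \<in> Lip0 r" "U' \<in> Lip0 r" "V \<in> Lip0 r" "V' \<in> Lip0 r" "\<zeta> \<in> Lip0 r"
      using Lip0_mono[OF t, of r] Lip0_mono[OF t', of r] Lip0_mono[OF c(2), of r] Lip0_mono[OF c(5), of r] Lip0_mono[OF \<zeta>, of r]
      by (simp_all add: r_def)
    have int: "integrable Q (\<lambda>\<omega>. \<zeta> \<omega> * (f \<omega> - g \<omega>))" if "f \<in> Lip0 r" "g \<in> Lip0 r" "Q \<in> \<P>" for f g Q
      by (rule Lip0_integrable[OF _ that(3), of _ r]) (intro Lip0_mult Lip0_diff that r)
    have "(\<integral>\<omega>. max 0 (V \<omega> - V' \<omega>) \<partial>P) \<le> (\<integral>\<omega>. \<zeta> \<omega> * (V \<omega> - V' \<omega>) + e \<partial>P)"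
    proof (rule integral_mono)
      show "integrable P (\<lambda>\<omega>. max 0 (V \<omega> - V' \<omega>))"
        by (intro integrable_max integrable_const Bochner_Integration.integrable_diff Lip0_integrable[OF r(3) P] Lip0_integrable[OF r(4) P])
      show "integrable P (\<lambda>\<omega>. \<zeta> \<omega> * (V \<omega> - V' \<omega>) + e)"
        using int[OF r(3,4) P] by simp
      fix \<omega>
      show "max 0 (V \<omega> - V' \<omega>) \<le> \<zeta> \<omega> * (V \<omega> - V' \<omega>) + e"
      proof (cases "e \<le> V \<omega> - V' \<omega>")
        case True
        then have "1 \<le> (1/e) * (V \<omega> - V' \<omega>)" using e by (simp add: field_simps)
        then have "\<zeta> \<omega> = 1" by (simp add: \<zeta>_def clip_def)
        with True e show ?thesis by simp
      next
        case False
        show ?thesis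
        proof (cases "0 \<le> V \<omega> - V' \<omega>")
          case True
          then have "0 \<le> \<zeta> \<omega> * (V \<omega> - V' \<omega>)" using \<zeta>01(1) by simp
          with False True show ?thesis by simp
        next
          case False
          then have "(1/e) * (V \<omega> - V' \<omega>) \<le> 0" using e by (simp add: field_simps)
          then have "\<zeta> \<omega> = 0" by (simp add: \<zeta>_def clip_def)
          with False e show ?thesis by simp
        qed
      qed
    qed
    also have "\<dots> = (\<integral>\<omega>. \<zeta> \<omega> * (V \<omega> - V' \<omega>) \<partial>P) + e"
      using int[OF r(3,4) P] by (simp add: prob_space)
    also have "(\<integral>\<omega>. \<zeta> \<omega> * (V \<omega> - V' \<omega>) \<partial>P) \<le> a"
    proof -
      obtain Q where Q: "Q \<in> \<P>" "(\<integral>\<omega>. \<zeta> \<omega> * (V \<omega> - V' \<omega>) \<partial>P) \<le> (\<integral>\<omega>. \<zeta> \<omega> * (U \<omega> - V' \<omega>) \<partial>Q)"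
        using cylinder_cond_attained[OF UV \<zeta> \<zeta>01(1) c(5) P] by blast
      note Q(2)
      also have "(\<integral>\<omega>. \<zeta> \<omega> * (U \<omega> - V' \<omega>) \<partial>Q) = (\<integral>\<omega>. \<zeta> \<omega> * (U \<omega> - U' \<omega>) + \<zeta> \<omega> * (U' \<omega> - V' \<omega>) \<partial>Q)"
        by (simp add: algebra_simps)
      also have "\<dots> = (\<integral>\<omega>. \<zeta> \<omega> * (U \<omega> - U' \<omega>) \<partial>Q) + (\<integral>\<omega>. \<zeta> \<omega> * (U' \<omega> - V' \<omega>) \<partial>Q)"
        by (intro Bochner_Integration.integral_add int r Q)
      also have "\<dots> \<le> (\<integral>\<omega>. \<zeta> \<omega> * (U \<omega> - U' \<omega>) \<partial>Q) + 0"
        by (intro add_left_mono cylinder_cond_dominates[OF UV' \<zeta> \<zeta>01(1) Q(1)])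
      also have "\<dots> \<le> (\<integral>\<omega>. \<bar>U \<omega> - U' \<omega>\<bar> \<partial>Q)"
        unfolding add_0_right
      proof (rule integral_mono[OF int[OF r(1,2) Q(1)]])
        show "integrable Q (\<lambda>\<omega>. \<bar>U \<omega> - U' \<omega>\<bar>)"
          by (intro integrable_abs Bochner_Integration.integrable_diff Lip0_integrable[OF r(1) Q(1)] Lip0_integrable[OF r(2) Q(1)])
        show "\<zeta> \<omega> * (U \<omega> - U' \<omega>) \<le> \<bar>U \<omega> - U' \<omega>\<bar>" for \<omega>
        proof -
          have "\<zeta> \<omega> * (U \<omega> - U' \<omega>) \<le> \<zeta> \<omega> * \<bar>U \<omega> - U' \<omega>\<bar>" using \<zeta>01 by (intro mult_left_mono) auto
          also have "\<dots> \<le> 1 * \<bar>U \<omega> - U' \<omega>\<bar>" using \<zeta>01 by (intro mult_right_mono) auto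
          finally show ?thesis by simp
        qed
      qed
      also have "\<dots> \<le> a"
      proof -
        have "ennreal (\<integral>\<omega>. \<bar>U \<omega> - U' \<omega>\<bar> \<partial>Q) \<le> pnorm 1 (\<lambda>\<omega>. U \<omega> - U' \<omega>)"
          by (rule pnorm_ge_integral[OF _ Q(1), of _ r]) (intro Lip0_LGk Lip0_diff r order.refl)
        also note a(1)
        finally show ?thesis using a(2) by simp
      qed
      finally show ?thesis .
    qed
    finally show "(\<integral>\<omega>. max 0 (V \<omega> - V' \<omega>) \<partial>P) \<le> a + e" by simp
  qed
  note c = cylinder_cond_Lip0[OF UV] cylinder_cond_Lip0[OF UV']
  show ?thesis
  proof (cases "pnorm 1 (\<lambda>\<omega>. U \<omega> - U' \<omega>)")
    case (real a)
    have p: "pnorm 1 (\<lambda>\<omega>. U \<omega> - U' \<omega>) \<le> ennreal a" "pnorm 1 (\<lambda>\<omega>. U' \<omega> - U \<omega>) \<le> ennreal a"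
      using real(2) pnorm_minus_commute[of 1 U' U] by simp_all
    have "pnorm 1 (\<lambda>\<omega>. V \<omega> - V' \<omega>) \<le> ennreal (2 * a)"
      unfolding pnorm_def
    proof (rule UE_least)
      fix P assume P: "P \<in> \<P>"
      interpret prob_space P by (rule prob[OF P])
      have intm: "integrable P (\<lambda>\<omega>. max 0 (V \<omega> - V' \<omega>))" "integrable P (\<lambda>\<omega>. max 0 (V' \<omega> - V \<omega>))"
        by (intro integrable_max integrable_const Bochner_Integration.integrable_diff Lip0_integrable[OF c(2) P] Lip0_integrable[OF c(5) P])+
      have eq: "\<bar>V \<omega> - V' \<omega>\<bar> = max 0 (V \<omega> - V' \<omega>) + max 0 (V' \<omega> - V \<omega>)" for \<omega> by auto
      have "(\<integral>\<^sup>+\<omega>. ennreal (\<bar>V \<omega> - V' \<omega>\<bar> ^ 1) \<partial>P) = ennreal (\<integral>\<omega>. max 0 (V \<omega> - V' \<omega>) + max 0 (V' \<omega> - V \<omega>) \<partial>P)"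
        unfolding power_one_right eq
        by (rule nn_integral_eq_integral[OF Bochner_Integration.integrable_add[OF intm]]) auto
      also have "(\<integral>\<omega>. max 0 (V \<omega> - V' \<omega>) + max 0 (V' \<omega> - V \<omega>) \<partial>P) \<le> a + a"
        unfolding Bochner_Integration.integral_add[OF intm]
        using half[OF UV UV' P p(1) real(1)] half[OF UV' UV P p(2) real(1)] by (rule add_mono)
      finally show "(\<integral>\<^sup>+\<omega>. ennreal (\<bar>V \<omega> - V' \<omega>\<bar> ^ 1) \<partial>P) \<le> ennreal (2 * a)" by (simp add: ennreal_leI)
    qed
    also have "\<dots> = 2 * pnorm 1 (\<lambda>\<omega>. U \<omega> - U' \<omega>)" using real by (simp add: ennreal_mult)
    finally show ?thesis .
  qed (simp add: ennreal_mult_top)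
qed

abbreviation cond :: "real \<Rightarrow> (path \<Rightarrow> real) \<Rightarrow> path \<Rightarrow> real" where "cond \<equiv> G_cond \<P> E\<^sub>\<xi> \<xi>"

text \<open>By contraction, the conditional expectations of cylinder random variables converging to \<open>X\<close> form a
  Cauchy sequence. That a limit exists gives content to \<open>G_cond\<close>, which is defined by choice.\<close>

lemma G_cond_exists:
  assumes X: "X \<in> LGk 1 t" and s: "0 \<le> s"
  shows "\<exists>Y. Y \<in> LG \<P> 1 s \<and> (\<exists>U V.
     (\<forall>n::nat. cylinder_cond E\<^sub>\<xi> \<xi> s (U n) (V n)) \<and>
     (\<lambda>n. upper_expectation \<P> (\<lambda>\<omega>. ennreal \<bar>X \<omega> - U n \<omega>\<bar>)) \<longlonglongrightarrow> 0 \<and>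
     (\<lambda>n. upper_expectation \<P> (\<lambda>\<omega>. ennreal \<bar>Y \<omega> - V n \<omega>\<bar>)) \<longlonglongrightarrow> 0)"
proof -
  have "\<forall>n. \<exists>Z\<in>Lip0 t. pnorm 1 (\<lambda>\<omega>. X \<omega> - Z \<omega>) \<le> ennreal (inverse (real (Suc n)))"
    using LGk_approx[OF X] by simp
  then obtain U where U: "\<And>n. U n \<in> Lip0 t" "\<And>n. pnorm 1 (\<lambda>\<omega>. X \<omega> - U n \<omega>) \<le> ennreal (inverse (real (Suc n)))"
    by metis
  have "\<forall>n. \<exists>V. cylinder_cond E\<^sub>\<xi> \<xi> s (U n) V"
    using cylinder_cond_exists[OF _ s] U(1) Lip0_all_iff by blast
  then obtain V where V: "\<And>n. cylinder_cond E\<^sub>\<xi> \<xi> s (U n) (V n)" by metis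
  note Vc = cylinder_cond_Lip0[OF V]
  note [measurable] = LGk_measurable[OF X] Lip0_measurable[OF U(1)] Lip0_measurable[OF Vc(2)]
  have U_lim: "\<exists>N. \<forall>n\<ge>N. pnorm 1 (\<lambda>\<omega>. X \<omega> - U n \<omega>) \<le> ennreal e" if e: "0 < e" for e
  proof -
    obtain N where N: "inverse (real (Suc N)) < e" using reals_Archimedean[OF e] by blast
    have "pnorm 1 (\<lambda>\<omega>. X \<omega> - U n \<omega>) \<le> ennreal e" if "n \<ge> N" for n
    proof -
      have "inverse (real (Suc n)) \<le> inverse (real (Suc N))" using that by (intro le_imp_inverse_le) auto
      with N have "inverse (real (Suc n)) \<le> e" by linarith
      with U(2)[of n] show ?thesis using ennreal_leI order_trans by blast
    qed
    then show ?thesis by blast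
  qed
  have cauchy: "\<exists>N. \<forall>m\<ge>N. \<forall>n\<ge>N. pnorm 1 (\<lambda>\<omega>. V m \<omega> - V n \<omega>) \<le> ennreal e" if e: "0 < e" for e
  proof -
    from e have "0 < (e/2) / 2 ^ Suc 1" by simp
    from U_lim[OF this] obtain N where N: "\<And>n. n \<ge> N \<Longrightarrow> pnorm 1 (\<lambda>\<omega>. X \<omega> - U n \<omega>) \<le> ennreal ((e/2) / 2 ^ Suc 1)" by blast
    have "pnorm 1 (\<lambda>\<omega>. V m \<omega> - V n \<omega>) \<le> ennreal e" if "m \<ge> N" "n \<ge> N" for m n
    proof -
      have "pnorm 1 (\<lambda>\<omega>. U m \<omega> - U n \<omega>) \<le> ennreal (e/2)"
        by (rule pnorm_triangle_eps[where Y = X]) (use e N that pnorm_minus_commute[of 1 X] in auto)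
      then have "2 * pnorm 1 (\<lambda>\<omega>. U m \<omega> - U n \<omega>) \<le> 2 * ennreal (e/2)" by (rule mult_left_mono) simp
      also have "\<dots> = ennreal e"
      proof -
        have "2 * ennreal (e/2) = ennreal 2 * ennreal (e/2)" by simp
        also have "\<dots> = ennreal e" using e by (simp flip: ennreal_mult del: ennreal_numeral)
        finally show ?thesis .
      qed
      finally show ?thesis using cylinder_cond_contraction[OF V V, of m n] by (rule order_trans[rotated])
    qed
    then show ?thesis by blast
  qed
  have "\<exists>Y\<in>LGk 1 s. (\<lambda>n. pnorm 1 (\<lambda>\<omega>. Y \<omega> - V n \<omega>)) \<longlonglongrightarrow> 0"
    by (rule LGk_complete[OF Lip0_LGk[OF Vc(2)] _ cauchy]) simp_all
  then obtain Y where Y: "Y \<in> LGk 1 s" "(\<lambda>n. pnorm 1 (\<lambda>\<omega>. Y \<omega> - V n \<omega>)) \<longlonglongrightarrow> 0" by blast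
  have "(\<lambda>n. pnorm 1 (\<lambda>\<omega>. X \<omega> - U n \<omega>)) \<longlonglongrightarrow> 0"
    by (rule ennreal_tendsto_0I) (rule U_lim)
  with Y V show ?thesis unfolding pnorm_def power_one_right LG_1 by blast
qed

lemma G_cond_spec:
  assumes X: "X \<in> LGk 1 t" and s: "0 \<le> s"
  obtains U V where "cond s X \<in> LGk 1 s" "\<And>n::nat. cylinder_cond E\<^sub>\<xi> \<xi> s (U n) (V n)"
    "(\<lambda>n. pnorm 1 (\<lambda>\<omega>. X \<omega> - U n \<omega>)) \<longlonglongrightarrow> 0" "(\<lambda>n. pnorm 1 (\<lambda>\<omega>. cond s X \<omega> - V n \<omega>)) \<longlonglongrightarrow> 0"
proof -
  have "cond s X \<in> LG \<P> 1 s \<and> (\<exists>U V.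
     (\<forall>n::nat. cylinder_cond E\<^sub>\<xi> \<xi> s (U n) (V n)) \<and>
     (\<lambda>n. upper_expectation \<P> (\<lambda>\<omega>. ennreal \<bar>X \<omega> - U n \<omega>\<bar>)) \<longlonglongrightarrow> 0 \<and>
     (\<lambda>n. upper_expectation \<P> (\<lambda>\<omega>. ennreal \<bar>cond s X \<omega> - V n \<omega>\<bar>)) \<longlonglongrightarrow> 0)"
    unfolding G_cond_def by (rule someI_ex[OF G_cond_exists[OF assms]])
  then show thesis unfolding LG_1 using that unfolding pnorm_def power_one_right by blast
qed

lemma G_cond_LGk: "X \<in> LGk 1 t \<Longrightarrow> 0 \<le> s \<Longrightarrow> cond s X \<in> LGk 1 s"
  by (rule G_cond_spec)

lemma G_cond_dominates:
  assumes X: "X \<in> LGk 1 t" and s: "0 \<le> s" and P: "P \<in> \<P>"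
    and \<zeta>: "\<zeta> \<in> LGk 1 s" "\<And>\<omega>. 0 \<le> \<zeta> \<omega> \<and> \<zeta> \<omega> \<le> K"
  shows "(\<integral>\<omega>. \<zeta> \<omega> * (X \<omega> - cond s X \<omega>) \<partial>P) \<le> 0"
proof (rule integral_le_0_bounded_LG[OF P _ _ \<zeta>])
  obtain U V where UV: "cond s X \<in> LGk 1 s" "\<And>n::nat. cylinder_cond E\<^sub>\<xi> \<xi> s (U n) (V n)"
    and lim: "(\<lambda>n. pnorm 1 (\<lambda>\<omega>. X \<omega> - U n \<omega>)) \<longlonglongrightarrow> 0" "(\<lambda>n. pnorm 1 (\<lambda>\<omega>. cond s X \<omega> - V n \<omega>)) \<longlonglongrightarrow> 0"
    by (rule G_cond_spec[OF X s]) blast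
  note c = cylinder_cond_Lip0[OF UV(2)]
  note iX = LGk_integrable[OF X P] and iY = LGk_integrable[OF UV(1) P]
  show "integrable P (\<lambda>\<omega>. X \<omega> - cond s X \<omega>)" using iX iY by simp
  fix Z assume Z: "Z \<in> Lip0 s" "\<And>\<omega>. 0 \<le> Z \<omega> \<and> Z \<omega> \<le> K"
  have K: "0 \<le> K" using Z(2)[of undefined] by linarith
  have Zb: "Z \<in> borel_measurable borel" "\<And>\<omega>. \<bar>Z \<omega>\<bar> \<le> K" using Z Lip0_measurable by auto
  note im = integrable_mult_bounded[OF P _ Zb]
  show "(\<integral>\<omega>. Z \<omega> * (X \<omega> - cond s X \<omega>) \<partial>P) \<le> 0"
  proof (rule field_le_epsilon)
    fix e :: real assume e: "0 < e"
    \<comment> \<open>\<open>K + 1\<close> instead of \<open>K\<close>, which may be \<open>0\<close>.\<close>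
    define d where "d = e / (2 * (K + 1))"
    have "(2 * (K + 1)) * d = e" unfolding d_def using K
      by (intro nonzero_mult_div_cancel_left[THEN trans[OF times_divide_eq_right]]) simp
    moreover have "0 < d" using e K by (simp add: d_def)
    ultimately have d: "0 < d" "K * d + K * d \<le> e" by (auto simp: algebra_simps)
    from ennreal_tendsto_0D[OF lim(1) d(1)] ennreal_tendsto_0D[OF lim(2) d(1)] obtain n where
      n: "pnorm 1 (\<lambda>\<omega>. X \<omega> - U n \<omega>) \<le> ennreal d" "pnorm 1 (\<lambda>\<omega>. cond s X \<omega> - V n \<omega>) \<le> ennreal d"
      by (metis nle_le)
    obtain r where "U n \<in> Lip0 r" using c(1)[of n] by (auto simp: Lip0_all_iff)
    then have iU: "integrable P (U n)" by (rule Lip0_integrable[OF _ P])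
    have iV: "integrable P (V n)" by (rule Lip0_integrable[OF c(2) P])
    have 1: "(\<integral>\<omega>. Z \<omega> * X \<omega> \<partial>P) \<le> (\<integral>\<omega>. Z \<omega> * U n \<omega> \<partial>P) + K * d"
      using integral_mult_diff_le[OF P iX iU Zb n(1)] d(1) by simp
    have 2: "(\<integral>\<omega>. Z \<omega> * V n \<omega> \<partial>P) \<le> (\<integral>\<omega>. Z \<omega> * cond s X \<omega> \<partial>P) + K * d"
      using integral_mult_diff_le[OF P iY iV Zb n(2)] d(1) by simp
    have 3: "(\<integral>\<omega>. Z \<omega> * U n \<omega> \<partial>P) - (\<integral>\<omega>. Z \<omega> * V n \<omega> \<partial>P) \<le> 0"
      using cylinder_cond_dominates[OF UV(2)[of n] Z(1) _ P] Z(2) im[OF iU] im[OF iV] by (simp add: right_diff_distrib)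
    have "(\<integral>\<omega>. Z \<omega> * (X \<omega> - cond s X \<omega>) \<partial>P) = (\<integral>\<omega>. Z \<omega> * X \<omega> \<partial>P) - (\<integral>\<omega>. Z \<omega> * cond s X \<omega> \<partial>P)"
      using im[OF iX] im[OF iY] by (simp add: right_diff_distrib)
    with 1 2 3 d(2) show "(\<integral>\<omega>. Z \<omega> * (X \<omega> - cond s X \<omega>) \<partial>P) \<le> 0 + e" by linarith
  qed
qed

text \<open>The measure \<open>Q\<close> that attains the value for an approximation of \<open>X\<close> varies with the approximation, so
  that no single measure survives the limit. A bound that holds under all measures does.\<close>

lemma G_cond_attained:
  assumes X: "X \<in> LGk 1 t" and s: "0 \<le> s" and P: "P \<in> \<P>" and W: "W \<in> LGk 1 s"
    and \<zeta>: "\<zeta> \<in> LGk 1 s" "\<And>\<omega>. 0 \<le> \<zeta> \<omega> \<and> \<zeta> \<omega> \<le> K"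
    and le: "\<And>Q Z. Q \<in> \<P> \<Longrightarrow> Z \<in> LGk 1 s \<Longrightarrow> (\<And>\<omega>. 0 \<le> Z \<omega> \<and> Z \<omega> \<le> K) \<Longrightarrow> (\<integral>\<omega>. Z \<omega> * (X \<omega> - W \<omega>) \<partial>Q) \<le> 0"
  shows "(\<integral>\<omega>. \<zeta> \<omega> * (cond s X \<omega> - W \<omega>) \<partial>P) \<le> 0"
proof (rule integral_le_0_bounded_LG[OF P _ _ \<zeta>])
  obtain U V where UV: "cond s X \<in> LGk 1 s" "\<And>n::nat. cylinder_cond E\<^sub>\<xi> \<xi> s (U n) (V n)"
    and lim: "(\<lambda>n. pnorm 1 (\<lambda>\<omega>. X \<omega> - U n \<omega>)) \<longlonglongrightarrow> 0" "(\<lambda>n. pnorm 1 (\<lambda>\<omega>. cond s X \<omega> - V n \<omega>)) \<longlonglongrightarrow> 0"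
    by (rule G_cond_spec[OF X s]) blast
  note c = cylinder_cond_Lip0[OF UV(2)]
  note iY = LGk_integrable[OF UV(1) P] and iW = LGk_integrable[OF W]
  show "integrable P (\<lambda>\<omega>. cond s X \<omega> - W \<omega>)" using iY iW[OF P] by simp
  fix Z assume Z: "Z \<in> Lip0 s" "\<And>\<omega>. 0 \<le> Z \<omega> \<and> Z \<omega> \<le> K"
  have K: "0 \<le> K" using Z(2)[of undefined] by linarith
  have Zb: "Z \<in> borel_measurable borel" "\<And>\<omega>. \<bar>Z \<omega>\<bar> \<le> K" using Z Lip0_measurable by auto
  note im = integrable_mult_bounded[OF _ _ Zb]
  show "(\<integral>\<omega>. Z \<omega> * (cond s X \<omega> - W \<omega>) \<partial>P) \<le> 0"
  proof (rule field_le_epsilon)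
    fix e :: real assume e: "0 < e"
    define d where "d = e / (4 * (K + 1))"
    have "(4 * (K + 1)) * d = e" unfolding d_def using K
      by (intro nonzero_mult_div_cancel_left[THEN trans[OF times_divide_eq_right]]) simp
    moreover have "0 < d" using e K by (simp add: d_def)
    ultimately have d: "0 < d" "K * d + K * d + K * d + K * d \<le> e" by (auto simp: algebra_simps)
    from ennreal_tendsto_0D[OF lim(1) d(1)] ennreal_tendsto_0D[OF lim(2) d(1)] obtain n where
      n: "pnorm 1 (\<lambda>\<omega>. X \<omega> - U n \<omega>) \<le> ennreal d" "pnorm 1 (\<lambda>\<omega>. cond s X \<omega> - V n \<omega>) \<le> ennreal d"
      by (metis nle_le)
    obtain W' where W': "W' \<in> Lip0 s" "pnorm 1 (\<lambda>\<omega>. W \<omega> - W' \<omega>) \<le> ennreal d"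
      using LGk_approx[OF W order.refl d(1)] by blast
    obtain r where r: "U n \<in> Lip0 r" using c(1)[of n] by (auto simp: Lip0_all_iff)
    note iU = Lip0_integrable[OF r] and iW' = Lip0_integrable[OF W'(1)]
    have iV: "integrable P (V n)" by (rule Lip0_integrable[OF c(2) P])
    obtain Q where Q: "Q \<in> \<P>" "(\<integral>\<omega>. Z \<omega> * (V n \<omega> - W' \<omega>) \<partial>P) \<le> (\<integral>\<omega>. Z \<omega> * (U n \<omega> - W' \<omega>) \<partial>Q)"
      using cylinder_cond_attained[OF UV(2)[of n] Z(1) _ W'(1) P] Z(2) by blast
    note iX = LGk_integrable[OF X Q(1)]
    have 1: "(\<integral>\<omega>. Z \<omega> * cond s X \<omega> \<partial>P) \<le> (\<integral>\<omega>. Z \<omega> * V n \<omega> \<partial>P) + K * d"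
      using integral_mult_diff_le[OF P iY iV Zb n(2)] d(1) by simp
    have 2: "(\<integral>\<omega>. Z \<omega> * W' \<omega> \<partial>P) \<le> (\<integral>\<omega>. Z \<omega> * W \<omega> \<partial>P) + K * d"
      using integral_mult_diff_le[OF P iW[OF P] iW'[OF P] Zb W'(2)] d(1) by simp
    have 3: "(\<integral>\<omega>. Z \<omega> * U n \<omega> \<partial>Q) \<le> (\<integral>\<omega>. Z \<omega> * X \<omega> \<partial>Q) + K * d"
      using integral_mult_diff_le[OF Q(1) iX iU[OF Q(1)] Zb n(1)] d(1) by simp
    have 4: "(\<integral>\<omega>. Z \<omega> * W \<omega> \<partial>Q) \<le> (\<integral>\<omega>. Z \<omega> * W' \<omega> \<partial>Q) + K * d"
      using integral_mult_diff_le[OF Q(1) iW[OF Q(1)] iW'[OF Q(1)] Zb W'(2)] d(1) by simp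
    have 5: "(\<integral>\<omega>. Z \<omega> * X \<omega> \<partial>Q) - (\<integral>\<omega>. Z \<omega> * W \<omega> \<partial>Q) \<le> 0"
      using le[OF Q(1) Lip0_LGk[OF Z(1)] Z(2)] im[OF Q(1) iX] im[OF Q(1) iW[OF Q(1)]] by (simp add: right_diff_distrib)
    have 6: "(\<integral>\<omega>. Z \<omega> * V n \<omega> \<partial>P) - (\<integral>\<omega>. Z \<omega> * W' \<omega> \<partial>P) \<le> (\<integral>\<omega>. Z \<omega> * U n \<omega> \<partial>Q) - (\<integral>\<omega>. Z \<omega> * W' \<omega> \<partial>Q)"
      using Q(2) im[OF P iV] im[OF P iW'[OF P]] im[OF Q(1) iU[OF Q(1)]] im[OF Q(1) iW'[OF Q(1)]] by (simp add: right_diff_distrib)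
    have "(\<integral>\<omega>. Z \<omega> * (cond s X \<omega> - W \<omega>) \<partial>P) = (\<integral>\<omega>. Z \<omega> * cond s X \<omega> \<partial>P) - (\<integral>\<omega>. Z \<omega> * W \<omega> \<partial>P)"
      using im[OF P iY] im[OF P iW[OF P]] by (simp add: right_diff_distrib)
    with 1 2 3 4 5 6 d(2) show "(\<integral>\<omega>. Z \<omega> * (cond s X \<omega> - W \<omega>) \<partial>P) \<le> 0 + e" by linarith
  qed
qed

text \<open>The weight \<open>\<zeta> = (Y - W)\<^sup>+ \<and> 1\<close> makes the integrand nonnegative.\<close>

lemma AE_le_from_integrals:
  assumes Y: "Y \<in> LGk 1 s" and W: "W \<in> LGk 1 s" and P: "P \<in> \<P>"
    and le: "\<And>\<zeta>. \<zeta> \<in> LGk 1 s \<Longrightarrow> (\<And>\<omega>. 0 \<le> \<zeta> \<omega> \<and> \<zeta> \<omega> \<le> 1) \<Longrightarrow> (\<integral>\<omega>. \<zeta> \<omega> * (Y \<omega> - W \<omega>) \<partial>P) \<le> 0"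
  shows "AE \<omega> in P. Y \<omega> \<le> W \<omega>"
proof -
  define \<zeta> where "\<zeta> \<omega> = clip 0 1 (Y \<omega> - W \<omega>)" for \<omega>
  have D: "(\<lambda>\<omega>. Y \<omega> - W \<omega>) \<in> LGk 1 s" by (intro LGk_diff Y W order.refl)
  have \<zeta>: "\<zeta> \<in> LGk 1 s" unfolding \<zeta>_def by (intro LGk_clip D order.refl)
  have \<zeta>01: "0 \<le> \<zeta> \<omega> \<and> \<zeta> \<omega> \<le> 1" for \<omega> unfolding \<zeta>_def by (rule clip_range) simp
  have nn: "0 \<le> \<zeta> \<omega> * (Y \<omega> - W \<omega>)" for \<omega>
    by (cases "0 \<le> Y \<omega> - W \<omega>") (use \<zeta>01[of \<omega>] in \<open>auto simp: \<zeta>_def clip_def\<close>)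
  have b1: "\<bar>\<zeta> \<omega>\<bar> \<le> 1" for \<omega> using \<zeta>01[of \<omega>] by simp
  have int: "integrable P (\<lambda>\<omega>. \<zeta> \<omega> * (Y \<omega> - W \<omega>))"
    by (rule integrable_mult_bounded[OF P LGk_integrable[OF D P] LGk_measurable[OF \<zeta>] b1])
  have "(\<integral>\<omega>. \<zeta> \<omega> * (Y \<omega> - W \<omega>) \<partial>P) = 0"
    using le[OF \<zeta> \<zeta>01] nn by (intro antisym integral_nonneg_AE) auto
  then have "AE \<omega> in P. \<zeta> \<omega> * (Y \<omega> - W \<omega>) = 0"
    using integral_nonneg_eq_0_iff_AE[OF int] nn by simp
  then show ?thesis
  proof eventually_elim
    case (elim \<omega>)
    show ?case
    proof (rule ccontr)
      assume "\<not> Y \<omega> \<le> W \<omega>"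
      then have "0 < \<zeta> \<omega>" "0 < Y \<omega> - W \<omega>" by (auto simp: \<zeta>_def clip_def)
      then have "0 < \<zeta> \<omega> * (Y \<omega> - W \<omega>)" by simp
      with elim show False by linarith
    qed
  qed
qed

text \<open>Attainment gives \<open>cond s X \<le> W\<close>, and domination the reverse inequality.\<close>

lemma G_cond_eqI:
  assumes X: "X \<in> LGk 1 t" and W: "W \<in> LGk 1 s"
    and eq: "\<And>Q \<zeta>. Q \<in> \<P> \<Longrightarrow> \<zeta> \<in> LGk 1 s \<Longrightarrow> (\<And>\<omega>. 0 \<le> \<zeta> \<omega> \<and> \<zeta> \<omega> \<le> 1) \<Longrightarrow> (\<integral>\<omega>. \<zeta> \<omega> * (X \<omega> - W \<omega>) \<partial>Q) = 0"
  shows "qs \<P> (\<lambda>\<omega>. cond s X \<omega> = W \<omega>)"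
proof (rule AE_qs_eq)
  have s: "0 \<le> s" by (rule LGk_nonneg_time[OF W]) simp
  have C: "cond s X \<in> LGk 1 s" by (rule G_cond_LGk[OF X s])
  show "cond s X \<in> borel_measurable borel" "W \<in> borel_measurable borel" using C W LGk_measurable by auto
  fix P assume P: "P \<in> \<P>"
  have "AE \<omega> in P. cond s X \<omega> \<le> W \<omega>"
  proof (rule AE_le_from_integrals[OF C W P])
    fix \<zeta> assume z: "\<zeta> \<in> LGk 1 s" "\<And>\<omega>. 0 \<le> \<zeta> \<omega> \<and> \<zeta> \<omega> \<le> 1"
    show "(\<integral>\<omega>. \<zeta> \<omega> * (cond s X \<omega> - W \<omega>) \<partial>P) \<le> 0"
      by (rule G_cond_attained[OF X s P W z]) (simp add: eq)
  qed
  moreover have "AE \<omega> in P. W \<omega> \<le> cond s X \<omega>"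
  proof (rule AE_le_from_integrals[OF W C P])
    fix \<zeta> assume z: "\<zeta> \<in> LGk 1 s" "\<And>\<omega>. 0 \<le> \<zeta> \<omega> \<and> \<zeta> \<omega> \<le> 1"
    have zb: "\<zeta> \<in> borel_measurable borel" "\<And>\<omega>. \<bar>\<zeta> \<omega>\<bar> \<le> 1" using z LGk_measurable by auto
    note im = integrable_mult_bounded[OF P LGk_integrable[OF _ P] zb]
    have "(\<integral>\<omega>. \<zeta> \<omega> * (W \<omega> - cond s X \<omega>) \<partial>P) = (\<integral>\<omega>. \<zeta> \<omega> * (X \<omega> - cond s X \<omega>) \<partial>P) - (\<integral>\<omega>. \<zeta> \<omega> * (X \<omega> - W \<omega>) \<partial>P)"
      using im[OF X] im[OF W] im[OF C] by (simp add: right_diff_distrib)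
    with eq[OF P z] G_cond_dominates[OF X s P z] show "(\<integral>\<omega>. \<zeta> \<omega> * (W \<omega> - cond s X \<omega>) \<partial>P) \<le> 0" by simp
  qed
  ultimately show "AE \<omega> in P. cond s X \<omega> = W \<omega>" by eventually_elim simp
qed

lemma G_cond_leD:
  assumes X: "X \<in> LGk 1 t" and W: "W \<in> LGk 1 s" and le: "qs \<P> (\<lambda>\<omega>. cond s X \<omega> \<le> W \<omega>)" and P: "P \<in> \<P>"
    and \<zeta>: "\<zeta> \<in> LGk 1 s" "\<And>\<omega>. 0 \<le> \<zeta> \<omega> \<and> \<zeta> \<omega> \<le> K"
  shows "(\<integral>\<omega>. \<zeta> \<omega> * (X \<omega> - W \<omega>) \<partial>P) \<le> 0"
proof -
  have s: "0 \<le> s" by (rule LGk_nonneg_time[OF W]) simp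
  have C: "cond s X \<in> LGk 1 s" by (rule G_cond_LGk[OF X s])
  have zb: "\<zeta> \<in> borel_measurable borel" "\<And>\<omega>. \<bar>\<zeta> \<omega>\<bar> \<le> K" using \<zeta> LGk_measurable by auto
  note im = integrable_mult_bounded[OF P _ zb]
  note iX = LGk_integrable[OF X P] and iW = LGk_integrable[OF W P] and iC = LGk_integrable[OF C P]
  have "(\<integral>\<omega>. \<zeta> \<omega> * (X \<omega> - W \<omega>) \<partial>P) \<le> (\<integral>\<omega>. \<zeta> \<omega> * (X \<omega> - cond s X \<omega>) \<partial>P)"
  proof (rule integral_mono_AE)
    show "AE \<omega> in P. \<zeta> \<omega> * (X \<omega> - W \<omega>) \<le> \<zeta> \<omega> * (X \<omega> - cond s X \<omega>)"
      using qs_AE[OF le P] by eventually_elim (use \<zeta>(2) in \<open>auto intro!: mult_left_mono\<close>)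
  qed (intro im Bochner_Integration.integrable_diff iX iW iC)+
  with G_cond_dominates[OF X s P \<zeta>] show ?thesis by linarith
qed

text \<open>The G-martingale properties of \<open>M\<close> and of \<open>-M\<close> bound the integral from above and from below. Hence
  symmetric G-martingales are exactly the processes in \<open>L\<^sub>G\<^sup>1\<close> that are martingales under every \<open>P \<in> \<P>\<close>,
  tested against bounded random variables of the past.\<close>

lemma symmetric_G_martingale_integral:
  assumes M: "symmetric_G_martingale \<P> E\<^sub>\<xi> \<xi> T M" and st: "0 \<le> s" "s \<le> t" "t \<le> T" and P: "P \<in> \<P>"
    and \<zeta>: "\<zeta> \<in> LGk 1 s" "\<And>\<omega>. \<bar>\<zeta> \<omega>\<bar> \<le> K"
  shows "(\<integral>\<omega>. \<zeta> \<omega> * (M t \<omega> - M s \<omega>) \<partial>P) = 0"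
proof -
  have Mt: "M r \<in> LGk 1 r" if "0 \<le> r" "r \<le> T" for r
    using M that unfolding symmetric_G_martingale_def G_martingale_def LG_1 by auto
  have m1: "qs \<P> (\<lambda>\<omega>. cond s (M t) \<omega> \<le> M s \<omega>)" "qs \<P> (\<lambda>\<omega>. cond s (\<lambda>\<omega>. - M t \<omega>) \<omega> \<le> - M s \<omega>)"
  proof -
    have e: "qs \<P> (\<lambda>\<omega>. cond s (M t) \<omega> = M s \<omega>)" "qs \<P> (\<lambda>\<omega>. cond s (\<lambda>\<omega>. - M t \<omega>) \<omega> = - M s \<omega>)"
      using M st unfolding symmetric_G_martingale_def G_martingale_def by auto
    from e show "qs \<P> (\<lambda>\<omega>. cond s (M t) \<omega> \<le> M s \<omega>)" "qs \<P> (\<lambda>\<omega>. cond s (\<lambda>\<omega>. - M t \<omega>) \<omega> \<le> - M s \<omega>)"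
      unfolding qs_def by (metis order.refl)+
  qed
  have s: "M s \<in> LGk 1 s" and t: "M t \<in> LGk 1 t" using Mt st by auto
  have nonneg: "(\<integral>\<omega>. Z \<omega> * (M t \<omega> - M s \<omega>) \<partial>P) = 0" if Z: "Z \<in> LGk 1 s" "\<And>\<omega>. 0 \<le> Z \<omega> \<and> Z \<omega> \<le> L" for Z L
  proof (rule antisym)
    show "(\<integral>\<omega>. Z \<omega> * (M t \<omega> - M s \<omega>) \<partial>P) \<le> 0" by (rule G_cond_leD[OF t s m1(1) P Z])
    have "(\<integral>\<omega>. Z \<omega> * (- M t \<omega> - - M s \<omega>) \<partial>P) \<le> 0"
      by (rule G_cond_leD[OF LGk_minus[OF t] LGk_minus[OF s] m1(2) P Z]) simp_all
    moreover have "(\<lambda>\<omega>. Z \<omega> * (- M t \<omega> - - M s \<omega>)) = (\<lambda>\<omega>. - (Z \<omega> * (M t \<omega> - M s \<omega>)))"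
      by (simp add: algebra_simps)
    ultimately show "0 \<le> (\<integral>\<omega>. Z \<omega> * (M t \<omega> - M s \<omega>) \<partial>P)" by simp
  qed
  have K: "0 \<le> K" using \<zeta>(2)[of undefined] by linarith
  \<comment> \<open>A signed weight is the difference of two nonnegative ones.\<close>
  have 1: "(\<integral>\<omega>. (\<zeta> \<omega> + K) * (M t \<omega> - M s \<omega>) \<partial>P) = 0"
  proof (rule nonneg[of _ "2 * K"])
    show "(\<lambda>\<omega>. \<zeta> \<omega> + K) \<in> LGk 1 s" by (intro LGk_add \<zeta>(1) LGk_const st order.refl)
    show "0 \<le> \<zeta> \<omega> + K \<and> \<zeta> \<omega> + K \<le> 2 * K" for \<omega> using \<zeta>(2)[of \<omega>] by linarith
  qed
  have 2: "(\<integral>\<omega>. K * (M t \<omega> - M s \<omega>) \<partial>P) = 0"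
    by (rule nonneg[of _ K]) (use K st in \<open>auto intro: LGk_const\<close>)
  have iD: "integrable P (\<lambda>\<omega>. M t \<omega> - M s \<omega>)" using LGk_integrable[OF t P] LGk_integrable[OF s P] by simp
  have "(\<integral>\<omega>. \<zeta> \<omega> * (M t \<omega> - M s \<omega>) \<partial>P) = (\<integral>\<omega>. (\<zeta> \<omega> + K) * (M t \<omega> - M s \<omega>) - K * (M t \<omega> - M s \<omega>) \<partial>P)"
    by (simp add: distrib_right)
  also have "\<dots> = (\<integral>\<omega>. (\<zeta> \<omega> + K) * (M t \<omega> - M s \<omega>) \<partial>P) - (\<integral>\<omega>. K * (M t \<omega> - M s \<omega>) \<partial>P)"
  proof (rule Bochner_Integration.integral_diff)
    show "integrable P (\<lambda>\<omega>. (\<zeta> \<omega> + K) * (M t \<omega> - M s \<omega>))"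
      using integrable_mult_bounded[OF P iD LGk_measurable[OF \<zeta>(1)] \<zeta>(2)] iD by (simp add: distrib_right)
  qed (use iD in simp)
  finally show ?thesis using 1 2 by simp
qed

lemma symmetric_G_martingaleI:
  assumes X: "\<And>t. 0 \<le> t \<Longrightarrow> t \<le> T \<Longrightarrow> X t \<in> LGk 1 t"
    and eq: "\<And>s t P \<zeta>. 0 \<le> s \<Longrightarrow> s \<le> t \<Longrightarrow> t \<le> T \<Longrightarrow> P \<in> \<P> \<Longrightarrow> \<zeta> \<in> LGk 1 s \<Longrightarrow> (\<And>\<omega>. 0 \<le> \<zeta> \<omega> \<and> \<zeta> \<omega> \<le> 1) \<Longrightarrow>
       (\<integral>\<omega>. \<zeta> \<omega> * (X t \<omega> - X s \<omega>) \<partial>P) = 0"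
  shows "symmetric_G_martingale \<P> E\<^sub>\<xi> \<xi> T X"
proof -
  have "G_martingale \<P> E\<^sub>\<xi> \<xi> T X"
    unfolding G_martingale_def LG_1
  proof (intro conjI allI impI ballI)
    show "qs \<P> (\<lambda>\<omega>. cond s (X t) \<omega> = X s \<omega>)" if "0 \<le> s \<and> s \<le> t \<and> t \<le> T" for s t
      by (rule G_cond_eqI[of _ t]) (use that X eq in auto)
  qed (use X in auto)
  moreover have "G_martingale \<P> E\<^sub>\<xi> \<xi> T (\<lambda>t \<omega>. - X t \<omega>)"
    unfolding G_martingale_def LG_1
  proof (intro conjI allI impI ballI)
    show "qs \<P> (\<lambda>\<omega>. cond s (\<lambda>\<omega>. - X t \<omega>) \<omega> = - X s \<omega>)" if st: "0 \<le> s \<and> s \<le> t \<and> t \<le> T" for s t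
    proof (rule G_cond_eqI[of _ t])
      fix Q \<zeta> assume "Q \<in> \<P>" "\<zeta> \<in> LGk 1 s" "\<And>\<omega>. 0 \<le> \<zeta> \<omega> \<and> \<zeta> \<omega> \<le> 1"
      with eq[of s t Q \<zeta>] st have "(\<integral>\<omega>. \<zeta> \<omega> * (X t \<omega> - X s \<omega>) \<partial>Q) = 0" by blast
      moreover have "(\<lambda>\<omega>. \<zeta> \<omega> * (- X t \<omega> - - X s \<omega>)) = (\<lambda>\<omega>. - (\<zeta> \<omega> * (X t \<omega> - X s \<omega>)))"
        by (simp add: algebra_simps)
      ultimately show "(\<integral>\<omega>. \<zeta> \<omega> * (- X t \<omega> - - X s \<omega>) \<partial>Q) = 0" by simp
    qed (use st X in \<open>auto intro: LGk_minus\<close>)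
  qed (use X in \<open>auto intro: LGk_minus\<close>)
  ultimately show ?thesis unfolding symmetric_G_martingale_def ..
qed

end

section \<open>Step processes on finite grids\<close>

text \<open>A step process is described by the finite set of its grid points instead of an enumeration:
  then a refinement is a larger set, and its value at a time is its value at the preceding grid point.\<close>

definition grid :: "real \<Rightarrow> real set \<Rightarrow> bool" where
  "grid T F \<longleftrightarrow> finite F \<and> 0 \<in> F \<and> T \<in> F \<and> F \<subseteq> {0..T}"

definition gnext :: "real set \<Rightarrow> real \<Rightarrow> real" where
  "gnext F x = Min {y\<in>F. x < y}"

definition gprev :: "real set \<Rightarrow> real \<Rightarrow> real" where
  "gprev F u = Max {x\<in>F. x \<le> u}"

definition step_on :: "path measure set \<Rightarrow> real \<Rightarrow> real \<Rightarrow> real set \<Rightarrow> (real \<Rightarrow> path \<Rightarrow> real) \<Rightarrow> bool" where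
  "step_on \<P> p T F \<eta> \<longleftrightarrow> grid T F \<and> (\<forall>x\<in>F - {T}. \<eta> x \<in> LG \<P> p x) \<and>
     (\<forall>u. \<eta> u = (if 0 \<le> u \<and> u < T then \<eta> (gprev F u) else (\<lambda>_. 0)))"

definition step_sum :: "real \<Rightarrow> real set \<Rightarrow> (real \<Rightarrow> real) \<Rightarrow> (real \<Rightarrow> real) \<Rightarrow> real" where
  "step_sum T F f m = (\<Sum>x\<in>F - {T}. f x * (m (gnext F x) - m x))"

lemma gnext_eqI:
  assumes "finite F" "z \<in> F" "x < z" "\<And>y. y \<in> F \<Longrightarrow> x < y \<Longrightarrow> z \<le> y"
  shows "gnext F x = z"
  unfolding gnext_def by (rule Min_eqI) (use assms in auto)

lemma gprev_eqI:
  assumes "finite F" "z \<in> F" "z \<le> u" "\<And>y. y \<in> F \<Longrightarrow> y \<le> u \<Longrightarrow> y \<le> z"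
  shows "gprev F u = z"
  unfolding gprev_def by (rule Max_eqI) (use assms in auto)

lemma gnext_grid:
  assumes "grid T F" "x \<in> F - {T}"
  shows "gnext F x \<in> F" "x < gnext F x" "\<And>y. y \<in> F \<Longrightarrow> x < y \<Longrightarrow> gnext F x \<le> y" "gnext F x \<le> T" "0 \<le> x" "x < T"
proof -
  have fin: "finite {y\<in>F. x < y}" and T: "T \<in> F" using assms(1) by (auto simp: grid_def)
  have x: "0 \<le> x" "x < T" using assms by (auto simp: grid_def less_le)
  then have ne: "{y\<in>F. x < y} \<noteq> {}" using T by blast
  have "gnext F x \<in> {y\<in>F. x < y}" unfolding gnext_def by (rule Min_in[OF fin ne])
  then show 1: "gnext F x \<in> F" "x < gnext F x" by auto
  show "gnext F x \<le> y" if "y \<in> F" "x < y" for y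
    unfolding gnext_def by (rule Min_le[OF fin]) (use that in auto)
  show "gnext F x \<le> T" using 1(1) assms(1) by (auto simp: grid_def)
  show "0 \<le> x" "x < T" by fact+
qed

lemma gprev_grid:
  assumes "grid T F" "0 \<le> u"
  shows "gprev F u \<in> F" "gprev F u \<le> u" "\<And>x. x \<in> F \<Longrightarrow> x \<le> u \<Longrightarrow> x \<le> gprev F u" "0 \<le> gprev F u"
    "u < T \<Longrightarrow> gprev F u \<in> F - {T}"
proof -
  have fin: "finite {x\<in>F. x \<le> u}" and "0 \<in> F" using assms(1) by (auto simp: grid_def)
  then have ne: "{x\<in>F. x \<le> u} \<noteq> {}" using assms(2) by blast
  have "gprev F u \<in> {x\<in>F. x \<le> u}" unfolding gprev_def by (rule Max_in[OF fin ne])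
  then show 1: "gprev F u \<in> F" "gprev F u \<le> u" by auto
  show "x \<le> gprev F u" if "x \<in> F" "x \<le> u" for x
    unfolding gprev_def by (rule Max_ge[OF fin]) (use that in auto)
  show "0 \<le> gprev F u" using 1(1) assms(1) by (auto simp: grid_def)
  show "gprev F u \<in> F - {T}" if "u < T" using 1 that by auto
qed

lemma gprev_of_grid_point: "grid T F \<Longrightarrow> x \<in> F \<Longrightarrow> gprev F x = x"
  by (rule gprev_eqI) (auto simp: grid_def)

lemma in_grid_interval_iff:
  assumes "grid T F" "x \<in> F - {T}"
  shows "u \<in> {x..<gnext F x} \<longleftrightarrow> 0 \<le> u \<and> u < T \<and> gprev F u = x"
proof
  assume u: "u \<in> {x..<gnext F x}"
  note n = gnext_grid[OF assms]
  have "gprev F u = x"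
  proof (rule gprev_eqI)
    show "y \<le> x" if "y \<in> F" "y \<le> u" for y using n(3)[OF that(1)] that(2) u by fastforce
  qed (use assms u in \<open>auto simp: grid_def\<close>)
  with u n show "0 \<le> u \<and> u < T \<and> gprev F u = x" by auto
next
  assume u: "0 \<le> u \<and> u < T \<and> gprev F u = x"
  note p = gprev_grid[OF assms(1), of u]
  have "u < gnext F x"
  proof (rule ccontr)
    assume "\<not> u < gnext F x"
    with p(3)[of "gnext F x"] gnext_grid[OF assms] u show False by auto
  qed
  with p u show "u \<in> {x..<gnext F x}" by auto
qed

lemma sum_grid_indicator:
  assumes F: "grid T F"
  shows "(\<Sum>x\<in>F - {T}. (f x :: 'b :: {semiring_1, zero}) * indicator {x..<gnext F x} u) = (if 0 \<le> u \<and> u < T then f (gprev F u) else 0)"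
proof (cases "0 \<le> u \<and> u < T")
  case True
  then have p: "gprev F u \<in> F - {T}" using gprev_grid(5)[OF F] by blast
  have "(\<Sum>x\<in>F - {T}. f x * indicator {x..<gnext F x} u) = (\<Sum>x\<in>F - {T}. if x = gprev F u then f x else 0)"
    using in_grid_interval_iff[OF F] True by (intro sum.cong) (auto simp: indicator_def)
  also have "\<dots> = f (gprev F u)" using p F by (simp add: sum.delta' grid_def)
  finally show ?thesis using True by simp
next
  case False
  have "(\<Sum>x\<in>F - {T}. f x * indicator {x..<gnext F x} u) = (\<Sum>x\<in>F - {T}. 0)"
    using in_grid_interval_iff[OF F] False by (intro sum.cong) (auto simp: indicator_def)
  then show ?thesis unfolding if_not_P[OF False] by (simp only: sum.neutral_const)
qed

lemma grid_insert: "grid T F \<Longrightarrow> y \<in> {0..T} \<Longrightarrow> grid T (insert y F)"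
  by (auto simp: grid_def)

lemma gprev_refine:
  assumes "grid T F" "grid T F'" "F \<subseteq> F'" "0 \<le> u"
  shows "gprev F (gprev F' u) = gprev F u"
proof (rule gprev_eqI)
  note p = gprev_grid[OF assms(1,4)] and p' = gprev_grid[OF assms(2,4)]
  show "finite F" using assms(1) by (simp add: grid_def)
  show "gprev F u \<in> F" by (rule p)
  show "gprev F u \<le> gprev F' u" using p p' assms(3) by blast
  show "y \<le> gprev F u" if "y \<in> F" "y \<le> gprev F' u" for y using p(3)[OF that(1)] that p'(2) by linarith
qed

lemma step_sum_insert:
  assumes F: "grid T F" and y: "0 \<le> y" "y < T" "y \<notin> F" and f: "f y = f (gprev F y)"
  shows "step_sum T (insert y F) f m = step_sum T F f m"
proof -
  let ?F = "insert y F"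
  define x where "x = gprev F y"
  note p = gprev_grid[OF F y(1)]
  have x: "x \<in> F - {T}" "x < y" using p y by (auto simp: x_def less_le)
  have fin: "finite F" "finite ?F" using F by (auto simp: grid_def)
  have nx: "y < gnext F x" using in_grid_interval_iff[OF F x(1), of y] y by (auto simp: x_def)
  note n = gnext_grid[OF F x(1)]
  have 1: "gnext ?F x = y"
    by (rule gnext_eqI) (use fin x n(3) nx in force)+
  have 2: "gnext ?F y = gnext F x"
  proof (rule gnext_eqI)
    show "gnext F x \<le> z" if "z \<in> ?F" "y < z" for z using that x(2) n(3)[of z] by auto
  qed (use fin nx n in auto)
  have 3: "gnext ?F z = gnext F z" if z: "z \<in> F - {T}" "z \<noteq> x" for z
  proof (rule gnext_eqI)
    note nz = gnext_grid[OF F z(1)]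
    show "gnext F z \<in> ?F" "z < gnext F z" using nz by auto
    show "gnext F z \<le> w" if "w \<in> ?F" "z < w" for w
    proof (cases "w = y")
      case True
      then have "z \<le> x" using p(3)[of z] z(1) that(2) by (auto simp: x_def)
      then have "z < x" using z(2) by simp
      then have "gnext F z \<le> x" using nz(3)[of x] x(1) by simp
      then show ?thesis using True x(2) by simp
    next
      case False
      then show ?thesis using nz(3) that by auto
    qed
  qed (rule fin)
  have yT: "y \<noteq> T" using y by simp
  have "step_sum T ?F f m = f y * (m (gnext ?F y) - m y) + (\<Sum>z\<in>F - {T}. f z * (m (gnext ?F z) - m z))"
    unfolding step_sum_def using fin y(3) yT by (simp add: insert_Diff_if)
  also have "(\<Sum>z\<in>F - {T}. f z * (m (gnext ?F z) - m z)) = f x * (m y - m x) + (\<Sum>z\<in>F - {T} - {x}. f z * (m (gnext F z) - m z))"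
    using x(1) fin 1 3 by (subst sum.remove[of _ x]) auto
  also have "f y * (m (gnext ?F y) - m y) + (f x * (m y - m x) + (\<Sum>z\<in>F - {T} - {x}. f z * (m (gnext F z) - m z))) = 
     f x * (m (gnext F x) - m x) + (\<Sum>z\<in>F - {T} - {x}. f z * (m (gnext F z) - m z))"
    using f 2 by (simp add: x_def algebra_simps)
  also have "\<dots> = step_sum T F f m" unfolding step_sum_def using x(1) fin by (subst sum.remove[of _ x]) auto
  finally show ?thesis .
qed

lemma LG_mono_time:
  assumes "X \<in> LG \<P> p s" "s \<le> t" shows "X \<in> LG \<P> p t"
proof -
  have "Lip0 s \<subseteq> Lip0 t" using Lip0_mono[OF _ assms(2)] by blast
  then have "(\<forall>n. Z n \<in> Lip0 s) \<longrightarrow> (\<forall>n. Z n \<in> Lip0 t)" for Z :: "nat \<Rightarrow> path \<Rightarrow> real" by blast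
  with assms(1) show ?thesis unfolding LG_def Lp_closure_def mem_Collect_eq by blast
qed

lemma step_on_insert:
  assumes \<eta>: "step_on \<P> p T F \<eta>" and y: "y \<in> {0..T}"
  shows "step_on \<P> p T (insert y F) \<eta>"
proof -
  have F: "grid T F" and lg: "\<And>x. x \<in> F - {T} \<Longrightarrow> \<eta> x \<in> LG \<P> p x"
    and eq: "\<And>u. \<eta> u = (if 0 \<le> u \<and> u < T then \<eta> (gprev F u) else (\<lambda>_. 0))" using \<eta> unfolding step_on_def by blast+
  have F': "grid T (insert y F)" by (rule grid_insert[OF F y])
  have in_range: "\<eta> u = \<eta> (gprev (insert y F) u)" if u: "0 \<le> u" "u < T" for u
  proof -
    let ?v = "gprev (insert y F) u"
    note p = gprev_grid[OF F' u(1)]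
    have "\<eta> ?v = \<eta> (gprev F ?v)" using eq[of ?v] p u by simp
    also have "gprev F ?v = gprev F u" by (rule gprev_refine[OF F F' _ u(1)]) blast
    also have "\<eta> (gprev F u) = \<eta> u" using eq[of u] u by simp
    finally show ?thesis by simp
  qed
  have "\<forall>u. \<eta> u = (if 0 \<le> u \<and> u < T then \<eta> (gprev (insert y F) u) else (\<lambda>_. 0))"
  proof
    fix u show "\<eta> u = (if 0 \<le> u \<and> u < T then \<eta> (gprev (insert y F) u) else (\<lambda>_. 0))"
    proof (cases "0 \<le> u \<and> u < T")
      case True
      then show ?thesis unfolding if_P[OF True] using in_range by blast
    next
      case False
      show ?thesis using eq[of u] unfolding if_not_P[OF False] .
    qed
  qed
  moreover have "\<eta> x \<in> LG \<P> p x" if x: "x \<in> insert y F - {T}" for x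
  proof (cases "x \<in> F")
    case False
    then have xy: "x = y" "y < T" "0 \<le> y" using x y by auto
    note p = gprev_grid[OF F xy(3)]
    have "\<eta> y = \<eta> (gprev F y)" using eq[of y] xy by simp
    also have "\<dots> \<in> LG \<P> p y" using lg[OF p(5)[OF xy(2)]] p(2) by (rule LG_mono_time)
    finally show ?thesis using xy by simp
  qed (use lg x in auto)
  ultimately show ?thesis using F' unfolding step_on_def by blast
qed

lemma step_on_refine:
  assumes \<eta>: "step_on \<P> p T F \<eta>" and "finite D" "D \<subseteq> {0..T}"
  shows "step_on \<P> p T (F \<union> D) \<eta> \<and> step_sum T (F \<union> D) (\<lambda>x. \<eta> x \<omega>) m = step_sum T F (\<lambda>x. \<eta> x \<omega>) m"
  using assms(2,3)
proof (induction D rule: finite_induct)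
  case empty
  then show ?case using \<eta> by simp
next
  case (insert y D)
  then have IH: "step_on \<P> p T (F \<union> D) \<eta>" "step_sum T (F \<union> D) (\<lambda>x. \<eta> x \<omega>) m = step_sum T F (\<lambda>x. \<eta> x \<omega>) m"
    and y: "y \<in> {0..T}" by auto
  have "step_sum T (insert y (F \<union> D)) (\<lambda>x. \<eta> x \<omega>) m = step_sum T (F \<union> D) (\<lambda>x. \<eta> x \<omega>) m"
  proof (cases "y \<in> F \<union> D")
    case True
    then show ?thesis by (simp add: insert_absorb)
  next
    case False
    have g: "grid T (F \<union> D)" using IH(1) by (simp add: step_on_def)
    then have yT: "0 \<le> y" "y < T" using False y by (auto simp: grid_def less_le)
    have e: "\<And>u. \<eta> u = (if 0 \<le> u \<and> u < T then \<eta> (gprev (F \<union> D) u) else (\<lambda>_. 0))"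
      using IH(1) unfolding step_on_def by blast
    have "\<eta> y = \<eta> (gprev (F \<union> D) y)" using e[of y] unfolding if_P[OF conjI[OF yT]] .
    then show ?thesis by (intro step_sum_insert[OF g yT False]) simp
  qed
  with IH step_on_insert[OF IH(1) y] show ?case by simp
qed

lemma step_on_common:
  assumes "step_on \<P> p T F \<eta>" "step_on \<P> p T D \<zeta>"
  shows "step_on \<P> p T (F \<union> D) \<eta>" "step_on \<P> p T (F \<union> D) \<zeta>"
proof -
  have "finite F" "F \<subseteq> {0..T}" "finite D" "D \<subseteq> {0..T}" using assms by (auto simp: step_on_def grid_def)
  then show "step_on \<P> p T (F \<union> D) \<eta>" "step_on \<P> p T (F \<union> D) \<zeta>"
    using step_on_refine[OF assms(1), of D] step_on_refine[OF assms(2), of F] by (auto simp: Un_commute)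
qed

text \<open>Both sums agree with the one over the union of the two grids.\<close>

lemma step_sum_unique:
  assumes "step_on \<P> p T F \<eta>" "step_on \<P> p T D \<eta>"
  shows "step_sum T F (\<lambda>x. \<eta> x \<omega>) m = step_sum T D (\<lambda>x. \<eta> x \<omega>) m"
proof -
  have "finite F" "F \<subseteq> {0..T}" "finite D" "D \<subseteq> {0..T}" using assms by (auto simp: step_on_def grid_def)
  then show ?thesis
    using step_on_refine[OF assms(1), of D \<omega> m] step_on_refine[OF assms(2), of F \<omega> m] by (simp add: Un_commute)
qed

definition step_integral :: "path measure set \<Rightarrow> real \<Rightarrow> real \<Rightarrow> (real \<Rightarrow> path \<Rightarrow> real) \<Rightarrow> (real \<Rightarrow> path \<Rightarrow> real) \<Rightarrow> path \<Rightarrow> real" where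
  "step_integral \<P> p T M \<eta> \<omega> = step_sum T (SOME F. step_on \<P> p T F \<eta>) (\<lambda>x. \<eta> x \<omega>) (\<lambda>x. M x \<omega>)"

lemma step_integral_eq:
  assumes "step_on \<P> p T F \<eta>"
  shows "step_integral \<P> p T M \<eta> \<omega> = step_sum T F (\<lambda>x. \<eta> x \<omega>) (\<lambda>x. M x \<omega>)"
proof -
  have "\<exists>F. step_on \<P> p T F \<eta>" using assms by (rule exI)
  then have "step_on \<P> p T (SOME F. step_on \<P> p T F \<eta>) \<eta>" by (rule someI_ex)
  from step_sum_unique[OF this assms] show ?thesis unfolding step_integral_def .
qed

lemma increasing_enumeration:
  fixes t :: "nat \<Rightarrow> real"
  assumes "\<And>j. j < n \<Longrightarrow> t j < t (Suc j)"
  shows "j \<le> n \<Longrightarrow> i < j \<Longrightarrow> t i < t j"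
proof (induction j)
  case (Suc j)
  then show ?case using assms[of j] by (cases "i = j") force+
qed simp

lemma enumerated_grid:
  fixes t :: "nat \<Rightarrow> real"
  assumes "t 0 = 0" "t n = T" and inc: "\<And>j. j < n \<Longrightarrow> t j < t (Suc j)"
  shows "grid T (t ` {..n})" "inj_on t {..<n}" "t ` {..n} - {T} = t ` {..<n}" "j < n \<Longrightarrow> gnext (t ` {..n}) (t j) = t (Suc j)"
proof -
  have lt: "t i < t j" if "j \<le> n" "i < j" for i j
    by (rule increasing_enumeration[OF _ that]) (rule inc)
  have le: "t i \<le> t j" if "i \<le> j" "j \<le> n" for i j
  proof (cases "i = j")
    case False
    with that have "i < j" by simp
    from lt[OF that(2) this] show ?thesis by simp
  qed simp
  show "grid T (t ` {..n})" unfolding grid_def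
  proof (intro conjI)
    show "0 \<in> t ` {..n}" by (rule image_eqI[of _ _ 0]) (use assms(1) in auto)
    show "T \<in> t ` {..n}" using assms(2) by auto
    show "t ` {..n} \<subseteq> {0..T}" using le[of 0] le[of _ n] assms(1,2) by auto
  qed simp
  show "inj_on t {..<n}"
  proof (rule inj_onI)
    fix i j assume "i \<in> {..<n}" "j \<in> {..<n}" "t i = t j"
    then show "i = j" using lt[of i j] lt[of j i] by (cases i j rule: linorder_cases) auto
  qed
  show "t ` {..n} - {T} = t ` {..<n}"
  proof -
    have a: "t j \<noteq> T" if "j < n" for j using lt[OF order.refl that] assms(2) by simp
    have b: "j < n" if "j \<le> n" "t j \<noteq> T" for j using that assms(2) by (cases "j = n") auto
    show ?thesis
    proof (intro equalityI subsetI)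
      fix y assume "y \<in> t ` {..n} - {T}"
      then obtain j where "j \<le> n" "y = t j" "t j \<noteq> T" by auto
      with b show "y \<in> t ` {..<n}" by auto
    next
      fix y assume "y \<in> t ` {..<n}"
      then obtain j where "j < n" "y = t j" by auto
      with a show "y \<in> t ` {..n} - {T}" by auto
    qed
  qed
  show "gnext (t ` {..n}) (t j) = t (Suc j)" if "j < n"
  proof (rule gnext_eqI)
    fix y assume "y \<in> t ` {..n}" "t j < y"
    then obtain i where i: "i \<le> n" "y = t i" "t j < t i" by auto
    have "j < i"
    proof (rule ccontr)
      assume "\<not> j < i"
      then have "t i \<le> t j" using le[of i j] that by simp
      with i show False by simp
    qed
    then show "t (Suc j) \<le> y" using le[of "Suc j" i] i by simp
  qed (use that inc in auto)
qed

lemma step_rep_imp_step_on: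
  assumes rep: "step_rep \<P> p T n t \<zeta> \<eta>"
  shows "step_on \<P> p T (t ` {..n}) \<eta>"
    and "step_sum T (t ` {..n}) (\<lambda>x. \<eta> x \<omega>) m = (\<Sum>j<n. \<zeta> j \<omega> * (m (t (Suc j)) - m (t j)))"
proof -
  have t: "t 0 = 0" "t n = T" "\<And>j. j < n \<Longrightarrow> t j < t (Suc j)" and z: "\<And>j. j < n \<Longrightarrow> \<zeta> j \<in> LG \<P> p (t j)"
    and \<eta>: "\<eta> = (\<lambda>u \<omega>. \<Sum>j<n. \<zeta> j \<omega> * indicator {t j..<t (Suc j)} u)"
    using rep unfolding step_rep_def by auto
  let ?F = "t ` {..n}"
  have g: "grid T ?F" "inj_on t {..<n}" "?F - {T} = t ` {..<n}" "\<And>j. j < n \<Longrightarrow> gnext ?F (t j) = t (Suc j)"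
    by (rule enumerated_grid[OF t(1,2)]; (rule t(3))?; assumption)+
  define \<theta> where "\<theta> x \<omega> = (\<zeta> (the_inv_into {..<n} t x) \<omega>)" for x \<omega>
  have \<theta>: "\<theta> (t j) = \<zeta> j" if "j < n" for j
    unfolding \<theta>_def by (rule ext) (simp add: the_inv_into_f_f[OF g(2)] that)
  have \<eta>': "\<eta> u \<omega> = (if 0 \<le> u \<and> u < T then \<theta> (gprev ?F u) \<omega> else 0)" for u \<omega>
  proof -
    have "(\<Sum>x\<in>?F - {T}. \<theta> x \<omega> * indicator {x..<gnext ?F x} u) = (\<Sum>j<n. \<theta> (t j) \<omega> * indicator {t j..<gnext ?F (t j)} u)"
      unfolding g(3) sum.reindex[OF g(2)] comp_def by (rule refl)
    also have "\<dots> = \<eta> u \<omega>" unfolding \<eta> by (rule sum.cong) (use g(4) \<theta> in auto)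
    finally show ?thesis using sum_grid_indicator[OF g(1), of "\<lambda>x. \<theta> x \<omega>" u] by simp
  qed
  have at: "\<eta> x = \<theta> x" if x: "x \<in> ?F - {T}" for x
  proof
    fix \<omega> show "\<eta> x \<omega> = \<theta> x \<omega>"
      using \<eta>'[of x \<omega>] gnext_grid(5,6)[OF g(1) x] gprev_of_grid_point[OF g(1), of x] x by simp
  qed
  show "step_on \<P> p T ?F \<eta>" unfolding step_on_def
  proof (intro conjI g(1) ballI allI)
    fix x assume x: "x \<in> ?F - {T}"
    then obtain j where "j < n" "x = t j" unfolding g(3) by auto
    then show "\<eta> x \<in> LG \<P> p x" using at[OF x] \<theta> z by simp
  next
    fix u show "\<eta> u = (if 0 \<le> u \<and> u < T then \<eta> (gprev ?F u) else (\<lambda>_. 0))"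
    proof (cases "0 \<le> u \<and> u < T")
      case True
      then have "\<eta> (gprev ?F u) = \<theta> (gprev ?F u)" using at[OF gprev_grid(5)[OF g(1)]] by blast
      then show ?thesis using True \<eta>'[of u] by (intro ext) simp
    next
      case False
      then show ?thesis using \<eta>'[of u] by (intro ext) auto
    qed
  qed
  have "step_sum T ?F (\<lambda>x. \<eta> x \<omega>) m = (\<Sum>x\<in>?F - {T}. \<theta> x \<omega> * (m (gnext ?F x) - m x))"
    unfolding step_sum_def by (rule sum.cong) (auto simp: at)
  also have "\<dots> = (\<Sum>j<n. \<theta> (t j) \<omega> * (m (gnext ?F (t j)) - m (t j)))"
    unfolding g(3) sum.reindex[OF g(2)] comp_def by (rule refl)
  also have "\<dots> = (\<Sum>j<n. \<zeta> j \<omega> * (m (t (Suc j)) - m (t j)))"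
    by (rule sum.cong) (use g(4) \<theta> in auto)
  finally show "step_sum T ?F (\<lambda>x. \<eta> x \<omega>) m = (\<Sum>j<n. \<zeta> j \<omega> * (m (t (Suc j)) - m (t j)))" .
qed

lemma step_on_imp_MG0:
  assumes \<eta>: "step_on \<P> p T F \<eta>"
  shows "\<eta> \<in> MG0 \<P> p T"
proof -
  have F: "grid T F" and lg: "\<And>x. x \<in> F - {T} \<Longrightarrow> \<eta> x \<in> LG \<P> p x"
    and eq: "\<And>u. \<eta> u = (if 0 \<le> u \<and> u < T then \<eta> (gprev F u) else (\<lambda>_. 0))" using \<eta> unfolding step_on_def by blast+
  have fin: "finite F" "0 \<in> F" "T \<in> F" "F \<subseteq> {0..T}" using F by (auto simp: grid_def)
  define L where "L = sorted_list_of_set F"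
  define n where "n = card F - 1"
  define t where "t j = L ! j" for j
  have "F \<noteq> {}" using fin by blast
  then have n: "card F = Suc n" using fin(1) by (simp add: n_def card_gt_0_iff)
  have L: "length L = Suc n" "set L = F" "sorted_wrt (<) L"
    using fin(1) n by (simp_all add: L_def)
  have inc: "t j < t (Suc j)" if "j < n" for j
    using sorted_wrt_nth_less[OF L(3), of j "Suc j"] that L(1) by (simp add: t_def)
  have img: "t ` {..n} = F"
    using nth_image[of "length L" L] L by (simp add: t_def image_def atLeast0LessThan lessThan_Suc_atMost)
  have le: "t i \<le> t j" if "i \<le> j" "j \<le> n" for i j
  proof (cases "i = j")
    case False
    with that have "i < j" by simp
    have "t i < t j" by (rule increasing_enumeration[OF _ that(2) \<open>i < j\<close>]) (rule inc)
    then show ?thesis by simp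
  qed simp
  have t0: "t 0 = 0"
  proof (rule antisym)
    obtain i where "i \<le> n" "t i = 0" using fin(2) img by (metis atMost_iff imageE)
    then show "t 0 \<le> 0" using le[of 0 i] by simp
    have "t 0 \<in> F" using img by auto
    then show "0 \<le> t 0" using fin(4) by auto
  qed
  have tn: "t n = T"
  proof (rule antisym)
    obtain i where "i \<le> n" "t i = T" using fin(3) img by (metis atMost_iff imageE)
    then show "T \<le> t n" using le[of i n] by simp
    have "t n \<in> F" using img by auto
    then show "t n \<le> T" using fin(4) by auto
  qed
  have "grid T (t ` {..n})" "inj_on t {..<n}" "t ` {..n} - {T} = t ` {..<n}" "\<And>j. j < n \<Longrightarrow> gnext (t ` {..n}) (t j) = t (Suc j)"
    by (rule enumerated_grid[OF t0 tn]; (rule inc)?; assumption)+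
  note g = this[unfolded img]
  have "step_rep \<P> p T n t (\<lambda>j. \<eta> (t j)) \<eta>"
    unfolding step_rep_def
  proof (intro conjI allI impI t0 tn inc)
    show "\<eta> (t j) \<in> LG \<P> p (t j)" if "j < n" for j
      using lg g(3) that by blast
    show "\<eta> = (\<lambda>u \<omega>. \<Sum>j<n. \<eta> (t j) \<omega> * indicator {t j..<t (Suc j)} u)"
    proof (intro ext)
      fix u \<omega>
      have at: "\<eta> u \<omega> = (if 0 \<le> u \<and> u < T then \<eta> (gprev F u) \<omega> else 0)" for u
      proof (cases "0 \<le> u \<and> u < T")
        case True
        show ?thesis using eq[of u] unfolding if_P[OF True] by (rule fun_cong)
      next
        case False
        show ?thesis using eq[of u] unfolding if_not_P[OF False] by (rule fun_cong)
      qed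
      have "(\<Sum>x\<in>F - {T}. \<eta> x \<omega> * indicator {x..<gnext F x} u) = (\<Sum>j<n. \<eta> (t j) \<omega> * indicator {t j..<gnext F (t j)} u)"
        unfolding g(3) sum.reindex[OF g(2)] comp_def by (rule refl)
      also have "\<dots> = (\<Sum>j<n. \<eta> (t j) \<omega> * indicator {t j..<t (Suc j)} u)" by (rule sum.cong) (use g(4) in auto)
      finally show "\<eta> u \<omega> = (\<Sum>j<n. \<eta> (t j) \<omega> * indicator {t j..<t (Suc j)} u)"
        using at[of u] sum_grid_indicator[OF g(1), of "\<lambda>x. \<eta> x \<omega>" u] by (simp only:)
    qed
  qed
  then show ?thesis unfolding MG0_def mem_Collect_eq by (intro exI)
qed

lemma MG0_iff_step_on: "\<eta> \<in> MG0 \<P> p T \<longleftrightarrow> (\<exists>F. step_on \<P> p T F \<eta>)"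
proof
  assume "\<eta> \<in> MG0 \<P> p T"
  then obtain n t \<zeta> where "step_rep \<P> p T n t \<zeta> \<eta>" unfolding MG0_def mem_Collect_eq by (elim exE)
  from step_rep_imp_step_on(1)[OF this] show "\<exists>F. step_on \<P> p T F \<eta>" by (rule exI)
next
  assume "\<exists>F. step_on \<P> p T F \<eta>"
  then obtain F where "step_on \<P> p T F \<eta>" by (elim exE)
  then show "\<eta> \<in> MG0 \<P> p T" by (rule step_on_imp_MG0)
qed

section \<open>Integration with respect to the increasing process\<close>

lemma interval_measure_half_open:
  fixes F :: "real \<Rightarrow> real"
  assumes mono: "\<And>x y. x \<le> y \<Longrightarrow> F x \<le> F y" and cont: "continuous_on UNIV F" and le: "a \<le> b"
  shows "emeasure (interval_measure F) {a..<b} = ennreal (F b - F a)"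
proof -
  have Icc: "emeasure (interval_measure F) {x..y} = ennreal (F y - F x)" if "x \<le> y" for x y
    by (rule emeasure_interval_measure_Icc[OF that mono cont])
  have "emeasure (interval_measure F) {a..<b} = emeasure (interval_measure F) ({a..b} - {b..b})"
    using le by (intro arg_cong[where f = "emeasure _"]) auto
  also have "emeasure (interval_measure F) ({a..b} - {b..b}) = emeasure (interval_measure F) {a..b} - emeasure (interval_measure F) {b..b}"
    by (rule emeasure_Diff) (use le Icc[of b b] in auto)
  also have "\<dots> = ennreal (F b - F a)" using Icc[of b b] Icc[OF le] by simp
  finally show ?thesis .
qed

lemma increasing_path_extension:
  fixes a :: "real \<Rightarrow> real"
  assumes T: "0 < T" and c: "continuous_on {0..T} a" and m: "mono_on {0..T} a"
  shows "x \<le> y \<Longrightarrow> a (max 0 (min x T)) \<le> a (max 0 (min y T))" "continuous_on UNIV (\<lambda>t. a (max 0 (min t T)))"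
proof -
  show "a (max 0 (min x T)) \<le> a (max 0 (min y T))" if "x \<le> y"
    by (rule mono_onD[OF m]) (use T that in auto)
  show "continuous_on UNIV (\<lambda>t. a (max 0 (min t T)))"
    by (rule continuous_on_compose2[OF c]) (use T in \<open>auto intro!: continuous_intros\<close>)
qed

definition increasing_path :: "real \<Rightarrow> (real \<Rightarrow> path \<Rightarrow> real) \<Rightarrow> path \<Rightarrow> bool" where
  "increasing_path T A \<omega> \<longleftrightarrow> A 0 \<omega> = 0 \<and> continuous_on {0..T} (\<lambda>t. A t \<omega>) \<and> mono_on {0..T} (\<lambda>t. A t \<omega>)"

lemma dA_integral_step:
  assumes T: "0 < T" and \<omega>: "increasing_path T A \<omega>" and F: "grid T F"
    and f: "\<And>u. u \<in> {0..T} \<Longrightarrow> f u = (if u < T then c (gprev F u) else 0)"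
    and c: "\<And>x. x \<in> F - {T} \<Longrightarrow> 0 \<le> c x"
  shows "dA_integral T A (\<lambda>u. ennreal (f u)) \<omega> = ennreal (step_sum T F c (\<lambda>x. A x \<omega>))"
proof -
  let ?a = "\<lambda>t. A (max 0 (min t T)) \<omega>"
  have ip: "continuous_on {0..T} (\<lambda>t. A t \<omega>)" "mono_on {0..T} (\<lambda>t. A t \<omega>)" using \<omega> by (auto simp: increasing_path_def)
  note e = increasing_path_extension[OF T ip]
  have meas: "emeasure (interval_measure ?a) {x..<gnext F x} = ennreal (A (gnext F x) \<omega> - A x \<omega>)" if x: "x \<in> F - {T}" for x
  proof -
    note n = gnext_grid[OF F x]
    have "emeasure (interval_measure ?a) {x..<gnext F x} = ennreal (?a (gnext F x) - ?a x)"
      by (rule interval_measure_half_open[OF e]) (use n in auto)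
    moreover have "max 0 (min (gnext F x) T) = gnext F x" "max 0 (min x T) = x" using n by auto
    ultimately show ?thesis by simp
  qed
  have "ennreal (f u) * indicator {0..T} u = (\<Sum>x\<in>F - {T}. ennreal (c x) * indicator {x..<gnext F x} u)" for u
    unfolding sum_grid_indicator[OF F] using f[of u] by (auto simp: indicator_def)
  then have "dA_integral T A (\<lambda>u. ennreal (f u)) \<omega> = (\<integral>\<^sup>+u. (\<Sum>x\<in>F - {T}. ennreal (c x) * indicator {x..<gnext F x} u) \<partial>interval_measure ?a)"
    unfolding dA_integral_def by simp
  also have "\<dots> = (\<Sum>x\<in>F - {T}. \<integral>\<^sup>+u. ennreal (c x) * indicator {x..<gnext F x} u \<partial>interval_measure ?a)"
    by (rule nn_integral_sum) simp
  also have "\<dots> = (\<Sum>x\<in>F - {T}. ennreal (c x) * ennreal (A (gnext F x) \<omega> - A x \<omega>))"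
    by (rule sum.cong) (simp_all add: nn_integral_cmult_indicator meas)
  also have "\<dots> = (\<Sum>x\<in>F - {T}. ennreal (c x * (A (gnext F x) \<omega> - A x \<omega>)))"
  proof (rule sum.cong)
    fix x assume x: "x \<in> F - {T}"
    note n = gnext_grid[OF F x]
    have "A x \<omega> \<le> A (gnext F x) \<omega>" by (rule mono_onD[OF ip(2)]) (use n in auto)
    then show "ennreal (c x) * ennreal (A (gnext F x) \<omega> - A x \<omega>) = ennreal (c x * (A (gnext F x) \<omega> - A x \<omega>))"
      using c[OF x] by (simp add: ennreal_mult)
  qed simp
  also have "\<dots> = ennreal (step_sum T F c (\<lambda>x. A x \<omega>))"
    unfolding step_sum_def
  proof (rule sum_ennreal)
    fix x assume x: "x \<in> F - {T}"
    note n = gnext_grid[OF F x]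
    have "A x \<omega> \<le> A (gnext F x) \<omega>" by (rule mono_onD[OF ip(2)]) (use n in auto)
    then show "0 \<le> c x * (A (gnext F x) \<omega> - A x \<omega>)" using c[OF x] by simp
  qed
  finally show ?thesis .
qed

text \<open>A continuous integrator has no atoms.\<close>

lemma dA_integral_point:
  assumes T: "0 < T" and \<omega>: "increasing_path T A \<omega>" and f: "\<And>u. u \<in> {0..T} \<Longrightarrow> u \<noteq> s \<Longrightarrow> f u = g u"
    and s: "0 \<le> s" "s \<le> T"
  shows "dA_integral T A f \<omega> = dA_integral T A g \<omega>"
proof -
  let ?a = "\<lambda>t. A (max 0 (min t T)) \<omega>"
  have ip: "continuous_on {0..T} (\<lambda>t. A t \<omega>)" "mono_on {0..T} (\<lambda>t. A t \<omega>)" using \<omega> by (auto simp: increasing_path_def)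
  note e = increasing_path_extension[OF T ip]
  have "emeasure (interval_measure ?a) {s..s} = ennreal (?a s - ?a s)"
    by (rule emeasure_interval_measure_Icc[OF order.refl e])
  then have "{s} \<in> null_sets (interval_measure ?a)" by (auto intro: null_setsI)
  from AE_not_in[OF this] have "AE u in interval_measure ?a. u \<noteq> s" by simp
  then show ?thesis unfolding dA_integral_def
    by (intro nn_integral_cong_AE, eventually_elim) (use f in \<open>auto simp: indicator_def\<close>)
qed

lemma Int_stable_Ioc: "Int_stable (range (\<lambda>(a, b). {a<..b::real}))"
proof (rule Int_stableI)
  fix a b assume "a \<in> range (\<lambda>(a, b). {a<..b::real})" "b \<in> range (\<lambda>(a, b). {a<..b::real})"
  then obtain x y x' y' where "a = {x<..y}" "b = {x'<..y'}" by auto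
  then have "a \<inter> b = (\<lambda>(a, b). {a<..b}) (max x x', min y y')" by auto
  then show "a \<inter> b \<in> range (\<lambda>(a, b). {a<..b::real})" by blast
qed

lemma UN_symmetric_Ioc: "(\<Union>i::nat. {- real i<..real i}) = UNIV"
proof -
  have "\<exists>i::nat. x \<in> {- real i<..real i}" for x
  proof -
    obtain i :: nat where "\<bar>x\<bar> < real i" using reals_Archimedean2 by blast
    then show ?thesis by (intro exI[of _ i]) auto
  qed
  then show ?thesis by blast
qed

lemma interval_measure_scale:
  fixes F :: "real \<Rightarrow> real"
  assumes mono: "\<And>x y. x \<le> y \<Longrightarrow> F x \<le> F y" and cont: "continuous_on UNIV F" and c: "0 < c"
  shows "interval_measure F = scale_measure (ennreal c) (interval_measure (\<lambda>x. F x / c))"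
proof -
  have cr: "continuous (at_right a) D" if "continuous_on UNIV D" for D :: "real \<Rightarrow> real" and a
    using that by (meson UNIV_I continuous_on_eq_continuous_within continuous_within_subset subset_UNIV)
  have m: "F x / c \<le> F y / c" if "x \<le> y" for x y using mono[OF that] c by (simp add: divide_right_mono)
  have cc: "continuous_on UNIV (\<lambda>x. F x / c)" using cont c by (intro continuous_intros) auto
  let ?E = "range (\<lambda>(a, b). {a<..b::real})"
  show ?thesis
  proof (rule measure_eqI_generator_eq[of ?E UNIV _ _ "\<lambda>i::nat. {- real i<..real i}"])
    show "Int_stable ?E" by (rule Int_stable_Ioc)
    show "emeasure (interval_measure F) X = emeasure (scale_measure (ennreal c) (interval_measure (\<lambda>x. F x / c))) X" if "X \<in> ?E" for X
    proof -
      from that obtain x y where X: "X = {x<..y}" by auto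
      show ?thesis
        unfolding X emeasure_scale_measure
        using emeasure_interval_measure_Ioc_eq[of F x y, OF mono cr[OF cont]] emeasure_interval_measure_Ioc_eq[of "\<lambda>x. F x / c" x y, OF m cr[OF cc]]
          c mono[of x y] m[of x y] by (auto simp: ennreal_mult[symmetric] field_simps)
    qed
    show "sets (interval_measure F) = sigma_sets UNIV ?E" "sets (scale_measure (ennreal c) (interval_measure (\<lambda>x. F x / c))) = sigma_sets UNIV ?E"
      unfolding sets_scale_measure sets_interval_measure by (subst borel_sigma_sets_Ioc, simp)+
    show "(\<Union>i::nat. {- real i<..real i}) = UNIV" by (rule UN_symmetric_Ioc)
    show "emeasure (interval_measure F) {- real i<..real i} \<noteq> \<infinity>" for i
      using emeasure_interval_measure_Ioc_eq[of F "- real i" "real i", OF mono cr[OF cont]] by simp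
  qed auto
qed

text \<open>The Lebesgue-Stieltjes measures of a measurable family of increasing paths form a kernel. After
  division by a bound of the total mass they are subprobability measures, to which the measurability
  theorem for integrals of kernels applies.\<close>

lemma nn_integral_interval_measure_measurable:
  fixes a :: "'w \<Rightarrow> real \<Rightarrow> real"
  assumes a [measurable]: "\<And>t. (\<lambda>w. a w t) \<in> borel_measurable M"
    and mono: "\<And>w x y. x \<le> y \<Longrightarrow> a w x \<le> a w y" and cont: "\<And>w. continuous_on UNIV (a w)"
    and c [measurable]: "c \<in> borel_measurable M" and bound: "\<And>w t. 0 \<le> a w t \<and> a w t \<le> c w"
    and f [measurable]: "(\<lambda>(w, t). f w t) \<in> borel_measurable (M \<Otimes>\<^sub>M borel)"
  shows "(\<lambda>w. \<integral>\<^sup>+t. f w t \<partial>interval_measure (a w)) \<in> borel_measurable M"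
proof -
  define b where "b w t = a w t / (1 + c w)" for w t
  have c0: "0 < 1 + c w" for w using bound[of w 0] by linarith
  have bm: "b w x \<le> b w y" if "x \<le> y" for w x y using mono[OF that, of w] c0[of w] by (simp add: b_def divide_right_mono)
  have bc: "continuous_on UNIV (b w)" for w unfolding b_def using cont[of w] c0[of w] by (intro continuous_intros) auto
  have b1: "0 \<le> b w t" "b w t \<le> 1" for w t using bound[of w t] c0[of w] by (auto simp: b_def)
  have cr: "continuous (at_right x) (b w)" for x w
    using bc[of w] by (meson UNIV_I continuous_on_eq_continuous_within continuous_within_subset subset_UNIV)
  have Ioc: "emeasure (interval_measure (b w)) {x<..y} = (if x \<le> y then ennreal (b w y - b w x) else 0)" for w x y
    using emeasure_interval_measure_Ioc_eq[of "b w" x y, OF bm cr] by simp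
  have total: "emeasure (interval_measure (b w)) UNIV = (SUP i::nat. ennreal (b w (real i) - b w (- real i)))" for w
  proof -
    have "(SUP i::nat. emeasure (interval_measure (b w)) {- real i<..real i}) = emeasure (interval_measure (b w)) (\<Union>i::nat. {- real i<..real i})"
      by (rule SUP_emeasure_incseq) (auto simp: incseq_def)
    then show ?thesis unfolding UN_symmetric_Ioc Ioc by simp
  qed
  let ?E = "range (\<lambda>(a, b). {a<..b::real})"
  have K: "(\<lambda>w. interval_measure (b w)) \<in> measurable M (subprob_algebra borel)"
  proof (rule measurable_subprob_algebra_generated[of _ UNIV ?E])
    show "sets borel = sigma_sets UNIV ?E" by (subst borel_sigma_sets_Ioc) simp
    show "Int_stable ?E" by (rule Int_stable_Ioc)
    show "subprob_space (interval_measure (b w))" for w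
    proof (rule subprob_spaceI)
      have "ennreal (b w (real i) - b w (- real i)) \<le> 1" for i
        using b1[of w] by (simp add: diff_le_eq add_increasing2 flip: ennreal_1)
      then show "emeasure (interval_measure (b w)) (space (interval_measure (b w))) \<le> 1"
        unfolding space_interval_measure total by (intro SUP_least)
    qed simp
    show "(\<lambda>w. emeasure (interval_measure (b w)) X) \<in> borel_measurable M" if "X \<in> ?E" for X
    proof -
      from that obtain x y where X: "X = {x<..y}" by auto
      show ?thesis unfolding X Ioc b_def by (cases "x \<le> y") simp_all
    qed
    show "(\<lambda>w. emeasure (interval_measure (b w)) UNIV) \<in> borel_measurable M"
      unfolding total b_def by measurable
  qed auto
  have eq: "(\<integral>\<^sup>+t. f w t \<partial>interval_measure (a w)) = ennreal (1 + c w) * (\<integral>\<^sup>+t. f w t \<partial>interval_measure (b w))" if w: "w \<in> space M" for w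
  proof -
    have fw: "f w \<in> borel_measurable (interval_measure (b w))"
      using measurable_Pair2[OF f w] by simp
    have "interval_measure (a w) = scale_measure (ennreal (1 + c w)) (interval_measure (b w))"
      unfolding b_def by (rule interval_measure_scale[OF mono cont c0])
    then show ?thesis using nn_integral_scale_measure[OF fw] by simp
  qed
  have "(\<lambda>w. ennreal (1 + c w) * (\<integral>\<^sup>+t. f w t \<partial>interval_measure (b w))) \<in> borel_measurable M"
    using nn_integral_measurable_subprob_algebra2[OF f K] by measurable
  then show ?thesis by (subst measurable_cong[OF eq])
qed

lemma dA_integral_measurable:
  assumes T: "0 < T" and N: "N \<in> sets borel" "\<And>\<omega>. \<omega> \<notin> N \<Longrightarrow> increasing_path T A \<omega>"
    and A: "\<And>t. t \<in> {0..T} \<Longrightarrow> A t \<in> borel_measurable borel"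
    and f: "(\<lambda>(t, \<omega>). f t \<omega>) \<in> borel_measurable (restrict_space borel {0..T} \<Otimes>\<^sub>M borel)"
  shows "\<exists>g\<in>borel_measurable borel. \<forall>\<omega>. \<omega> \<notin> N \<longrightarrow> dA_integral T A (\<lambda>t. f t \<omega>) \<omega> = g \<omega>"
proof -
  let ?p = "\<lambda>t. max 0 (min t T)"
  have p: "?p t \<in> {0..T}" for t using T by auto
  \<comment> \<open>On the exceptional set the path of \<open>A\<close> is replaced by \<open>0\<close>, so that all paths are increasing.\<close>
  define a where "a \<omega> t = (if \<omega> \<in> N then 0 else A (?p t) \<omega>)" for \<omega> t
  define h where "h \<omega> t = f (?p t) \<omega> * indicator {0..T} t" for \<omega> t
  have m: "(\<lambda>\<omega>. \<integral>\<^sup>+t. h \<omega> t \<partial>interval_measure (a \<omega>)) \<in> borel_measurable borel"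
  proof (rule nn_integral_interval_measure_measurable)
    show "(\<lambda>\<omega>. a \<omega> t) \<in> borel_measurable borel" for t
      unfolding a_def using N(1) A[OF p[of t]] by measurable
    show "(\<lambda>\<omega>. a \<omega> T) \<in> borel_measurable borel"
      unfolding a_def using N(1) A[OF p[of T]] by measurable
    show mono: "a \<omega> x \<le> a \<omega> y" if "x \<le> y" for \<omega> x y
      using increasing_path_extension(1)[OF T, of "\<lambda>t. A t \<omega>" x y] that N(2)[of \<omega>]
      by (auto simp: a_def increasing_path_def)
    show "continuous_on UNIV (a \<omega>)" for \<omega>
      unfolding a_def[abs_def] using increasing_path_extension(2)[OF T, of "\<lambda>t. A t \<omega>"] N(2)[of \<omega>]
      by (cases "\<omega> \<in> N") (auto simp: increasing_path_def)
    show "0 \<le> a \<omega> t \<and> a \<omega> t \<le> a \<omega> T" for \<omega> t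
    proof -
      have "a \<omega> 0 = 0" using N(2)[of \<omega>] T by (auto simp: a_def increasing_path_def)
      moreover have "a \<omega> (min 0 t) = a \<omega> 0" "a \<omega> (max T t) = a \<omega> T" using T by (auto simp: a_def max_def min_def)
      moreover have "a \<omega> (min 0 t) \<le> a \<omega> t" "a \<omega> t \<le> a \<omega> (max T t)" by (auto intro: mono)
      ultimately show ?thesis by linarith
    qed
    have "(\<lambda>x. (?p (snd x), fst x)) \<in> (borel \<Otimes>\<^sub>M borel) \<rightarrow>\<^sub>M (restrict_space borel {0..T} \<Otimes>\<^sub>M borel)"
      by (intro measurable_Pair measurable_restrict_space2) (use p in auto)
    from measurable_compose[OF this f] 
    have "(\<lambda>x. f (?p (snd x)) (fst x)) \<in> borel_measurable (borel \<Otimes>\<^sub>M borel)" by simp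
    then show "(\<lambda>(\<omega>, t). h \<omega> t) \<in> borel_measurable (borel \<Otimes>\<^sub>M borel)"
      unfolding h_def case_prod_beta by measurable
  qed
  have e: "dA_integral T A (\<lambda>t. f t \<omega>) \<omega> = (\<integral>\<^sup>+t. h \<omega> t \<partial>interval_measure (a \<omega>))" if "\<omega> \<notin> N" for \<omega>
  proof -
    have "a \<omega> = (\<lambda>t. A (?p t) \<omega>)" using that by (simp add: a_def[abs_def])
    moreover have "f t \<omega> * indicator {0..T} t = h \<omega> t" for t by (auto simp: h_def indicator_def)
    ultimately show ?thesis unfolding dA_integral_def by simp
  qed
  show ?thesis
  proof (rule bexI[OF _ m], intro allI impI)
    show "dA_integral T A (\<lambda>t. f t \<omega>) \<omega> = (\<integral>\<^sup>+t. h \<omega> t \<partial>interval_measure (a \<omega>))" if "\<omega> \<notin> N" for \<omega>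
      by (rule e[OF that])
  qed
qed

section \<open>Integrals of step processes\<close>

lemma step_onD:
  assumes "step_on \<P> p T F \<eta>"
  shows "grid T F" "x \<in> F - {T} \<Longrightarrow> \<eta> x \<in> LG \<P> p x"
    "\<eta> u \<omega> = (if 0 \<le> u \<and> u < T then \<eta> (gprev F u) \<omega> else 0)"
proof -
  show "grid T F" using assms unfolding step_on_def by (rule conjunct1)
  show "x \<in> F - {T} \<Longrightarrow> \<eta> x \<in> LG \<P> p x" using assms unfolding step_on_def by (elim conjE) (erule (1) bspec)
  have eq: "\<eta> u = (if 0 \<le> u \<and> u < T then \<eta> (gprev F u) else (\<lambda>_. 0))"
    using assms unfolding step_on_def by (elim conjE) (erule spec)
  show "\<eta> u \<omega> = (if 0 \<le> u \<and> u < T then \<eta> (gprev F u) \<omega> else 0)"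
  proof (cases "0 \<le> u \<and> u < T")
    case True
    show ?thesis using eq unfolding if_P[OF True] by (rule fun_cong)
  next
    case False
    show ?thesis using eq unfolding if_not_P[OF False] by (rule fun_cong)
  qed
qed

lemma step_onI:
  assumes "grid T F" "\<And>x. x \<in> F - {T} \<Longrightarrow> \<eta> x \<in> LG \<P> p x"
    and eq: "\<And>u \<omega>. \<eta> u \<omega> = (if 0 \<le> u \<and> u < T then \<eta> (gprev F u) \<omega> else 0)"
  shows "step_on \<P> p T F \<eta>"
  unfolding step_on_def
proof (intro conjI allI ballI assms(1,2))
  fix u show "\<eta> u = (if 0 \<le> u \<and> u < T then \<eta> (gprev F u) else (\<lambda>_. 0))"
  proof (cases "0 \<le> u \<and> u < T")
    case True
    show ?thesis unfolding if_P[OF True]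
    proof
      fix \<omega> show "\<eta> u \<omega> = \<eta> (gprev F u) \<omega>" using eq[of u \<omega>] unfolding if_P[OF True] .
    qed
  next
    case False
    show ?thesis unfolding if_not_P[OF False]
    proof
      fix \<omega> show "\<eta> u \<omega> = 0" using eq[of u \<omega>] unfolding if_not_P[OF False] .
    qed
  qed
qed

lemma abs_powr_2: "\<bar>x::real\<bar> powr 2 = x\<^sup>2"
  using powr_realpow[of "\<bar>x\<bar>" 2] by (cases "x = 0") auto

text \<open>As \<open>e\<close> tends to \<open>0\<close>, the factor of \<open>a\<^sup>2\<close> tends to \<open>1\<close>. This is why the inequality for the extended
  integral has the same constant as the one for step processes.\<close>

lemma square_add_le:
  fixes a b e :: real
  assumes e: "0 < e"
  shows "(a + b)\<^sup>2 \<le> (1 + e) * a\<^sup>2 + (1 + 1 / e) * b\<^sup>2"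
proof -
  have "0 \<le> (e * a - b)\<^sup>2" by simp
  then have "2 * e * a * b \<le> e * e * a\<^sup>2 + b\<^sup>2" by (simp add: power2_eq_square algebra_simps)
  then have "(2 * e * a * b) / e \<le> (e * e * a\<^sup>2 + b\<^sup>2) / e" using e by (intro divide_right_mono) auto
  then have "2 * a * b \<le> e * a\<^sup>2 + b\<^sup>2 / e" using e by (simp add: add_divide_distrib)
  then show ?thesis by (simp add: power2_eq_square algebra_simps)
qed

lemma square_diff_clip_le:
  assumes N: "0 \<le> N"
  shows "(x - clip (-N) N x)\<^sup>2 \<le> x\<^sup>2 * indicator {N<..} \<bar>x\<bar>" "x\<^sup>2 - (clip (-N) N x)\<^sup>2 \<le> x\<^sup>2 * indicator {N<..} \<bar>x\<bar>"
    "(clip (-N) N x)\<^sup>2 \<le> x\<^sup>2"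
proof -
  have "\<bar>x - clip (-N) N x\<bar>\<^sup>2 \<le> (\<bar>x\<bar> * indicator {N<..} \<bar>x\<bar>)\<^sup>2" by (intro power_mono clip_sym_diff N) simp
  then show "(x - clip (-N) N x)\<^sup>2 \<le> x\<^sup>2 * indicator {N<..} \<bar>x\<bar>" by (cases "N < \<bar>x\<bar>") auto
  show "x\<^sup>2 - (clip (-N) N x)\<^sup>2 \<le> x\<^sup>2 * indicator {N<..} \<bar>x\<bar>"
    using clip_sym_eq[of x N] by (cases "N < \<bar>x\<bar>") auto
  show "(clip (-N) N x)\<^sup>2 \<le> x\<^sup>2" using abs_clip_sym(2)[OF N, of x] by (simp add: abs_le_square_iff)
qed

context prob_family
begin

lemma LGk_cong_AE:
  assumes X: "X \<in> borel_measurable borel" and Y: "Y \<in> LGk k t" and k: "1 \<le> k"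
    and eq: "\<And>P. P \<in> \<P> \<Longrightarrow> AE \<omega> in P. X \<omega> = Y \<omega>"
  shows "X \<in> LGk k t"
proof (rule LGk_closed[OF X k])
  fix e :: real assume "0 < e"
  have "pnorm k (\<lambda>\<omega>. X \<omega> - Y \<omega>) \<le> pnorm k (\<lambda>\<omega>. Y \<omega> - Y \<omega>)"
  proof (rule pnorm_mono_AE)
    fix P assume "P \<in> \<P>"
    from eq[OF this] show "AE \<omega> in P. \<bar>X \<omega> - Y \<omega>\<bar> \<le> \<bar>Y \<omega> - Y \<omega>\<bar>" by eventually_elim simp
  qed
  then have "pnorm k (\<lambda>\<omega>. X \<omega> - Y \<omega>) \<le> ennreal e" unfolding pnorm_diff_self[OF k] by simp
  with Y show "\<exists>Y\<in>LGk k t. pnorm k (\<lambda>\<omega>. X \<omega> - Y \<omega>) \<le> ennreal e" by (intro bexI[of _ Y])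
qed

text \<open>By uniform integrability of \<open>X\<^sup>2\<close>, the truncations of \<open>X\<close> converge to \<open>X\<close> in mean square.\<close>

lemma LGk_2_of_square:
  assumes X: "X \<in> LGk 1 t" and X2: "(\<lambda>\<omega>. (X \<omega>)\<^sup>2) \<in> LGk 1 t"
  shows "X \<in> LGk 2 t"
proof (rule LGk_closed[OF LGk_measurable[OF X]])
  fix e :: real assume e: "0 < e"
  obtain K where K: "0 < K" "\<And>N. N \<ge> K \<Longrightarrow> UE (\<lambda>\<omega>. ennreal (\<bar>(X \<omega>)\<^sup>2\<bar> ^ 1 * indicator {N<..} \<bar>(X \<omega>)\<^sup>2\<bar>)) \<le> ennreal e"
    by (rule LGk_uniformly_integrable[OF X2 order.refl e]) blast
  define N where "N = max 1 K"
  have N: "1 \<le> N" "K \<le> N" "0 \<le> N" by (auto simp: N_def)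
  have "N * 1 \<le> N * N" using N by (intro mult_left_mono) auto
  then have NN: "K \<le> N\<^sup>2" unfolding power2_eq_square using N(2) by linarith
  have "pnorm 2 (\<lambda>\<omega>. X \<omega> - clip (-N) N (X \<omega>)) \<le> UE (\<lambda>\<omega>. ennreal (\<bar>(X \<omega>)\<^sup>2\<bar> ^ 1 * indicator {N\<^sup>2<..} \<bar>(X \<omega>)\<^sup>2\<bar>))"
    unfolding pnorm_def
  proof (intro UE_mono ennreal_leI)
    fix \<omega>
    have iff: "N\<^sup>2 < (X \<omega>)\<^sup>2 \<longleftrightarrow> N < \<bar>X \<omega>\<bar>"
      using abs_le_square_iff[of "X \<omega>" N] N(3) by (auto simp: not_le[symmetric])
    show "\<bar>X \<omega> - clip (-N) N (X \<omega>)\<bar>\<^sup>2 \<le> \<bar>(X \<omega>)\<^sup>2\<bar> ^ 1 * indicator {N\<^sup>2<..} \<bar>(X \<omega>)\<^sup>2\<bar>"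
      using square_diff_clip_le(1)[OF N(3), of "X \<omega>"] iff by (simp add: indicator_def)
  qed
  also have "\<dots> \<le> ennreal e" by (rule K(2)[OF NN])
  finally have le: "pnorm 2 (\<lambda>\<omega>. X \<omega> - clip (-N) N (X \<omega>)) \<le> ennreal e" .
  have "(\<lambda>\<omega>. clip (-N) N (X \<omega>)) \<in> LGk 2 t"
    by (rule LGk_bounded[OF LGk_clip[OF X order.refl] abs_clip_sym(1)[OF N(3)]]) simp
  with le show "\<exists>Y\<in>LGk 2 t. pnorm 2 (\<lambda>\<omega>. X \<omega> - Y \<omega>) \<le> ennreal e"
    by (intro bexI[of _ "\<lambda>\<omega>. clip (-N) N (X \<omega>)"])
qed simp

text \<open>Finitely many coefficients are dealt with at once, so that one truncation level serves a whole step
  process.\<close>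

lemma LGk_markov_finite:
  assumes "finite I" "\<And>i. i \<in> I \<Longrightarrow> X i \<in> LGk 1 (t i)" "0 < d"
  shows "\<exists>K>0. \<forall>N\<ge>K. UE (indicator (\<Union>i\<in>I. {\<omega>. N < \<bar>X i \<omega>\<bar>})) \<le> ennreal d"
  using assms
proof (induction I arbitrary: d rule: finite_induct)
  case empty
  have "UE (indicator {}) \<le> ennreal d" using UE_const_le[of 0] by (simp add: indicator_def[abs_def])
  then show ?case unfolding UN_empty by (intro exI[of _ 1] conjI allI impI) simp
next
  case (insert i I)
  have d2: "0 < d / 2" using insert.prems(2) by simp
  obtain K where K: "0 < K" "\<And>N. N \<ge> K \<Longrightarrow> UE (indicator {\<omega>. N < \<bar>X i \<omega>\<bar>}) \<le> ennreal (d/2)"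
    by (rule LGk_markov[OF insert.prems(1)[of i] d2]) auto
  have "\<exists>K>0. \<forall>N\<ge>K. UE (indicator (\<Union>i\<in>I. {\<omega>. N < \<bar>X i \<omega>\<bar>})) \<le> ennreal (d/2)"
    by (rule insert.IH) (use insert.prems(1) d2 in auto)
  then obtain K' where K': "0 < K'" "\<And>N. N \<ge> K' \<Longrightarrow> UE (indicator (\<Union>i\<in>I. {\<omega>. N < \<bar>X i \<omega>\<bar>})) \<le> ennreal (d/2)" by blast
  have "UE (indicator (\<Union>i\<in>insert i I. {\<omega>. N < \<bar>X i \<omega>\<bar>})) \<le> ennreal d" if N: "max K K' \<le> N" for N
  proof -
    have [measurable]: "X j \<in> borel_measurable borel" if "j \<in> insert i I" for j using LGk_measurable insert.prems(1)[OF that] by blast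
    have sets: "{\<omega>. N < \<bar>X j \<omega>\<bar>} \<in> sets borel" if "j \<in> insert i I" for j
    proof -
      have [measurable]: "X j \<in> borel_measurable borel" using LGk_measurable insert.prems(1)[OF that] by blast
      have "{\<omega> \<in> space borel. N < \<bar>X j \<omega>\<bar>} \<in> sets borel" by measurable
      then show ?thesis by simp
    qed
    have U: "(\<Union>i\<in>I. {\<omega>. N < \<bar>X i \<omega>\<bar>}) \<in> sets borel" using sets insert.hyps(1) by (intro sets.finite_UN) auto
    have "UE (indicator (\<Union>i\<in>insert i I. {\<omega>. N < \<bar>X i \<omega>\<bar>})) \<le> UE (\<lambda>\<omega>. indicator {\<omega>. N < \<bar>X i \<omega>\<bar>} \<omega> + indicator (\<Union>i\<in>I. {\<omega>. N < \<bar>X i \<omega>\<bar>}) \<omega>)"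
      by (rule UE_mono) (auto simp: indicator_def)
    also have "\<dots> \<le> UE (indicator {\<omega>. N < \<bar>X i \<omega>\<bar>}) + UE (indicator (\<Union>i\<in>I. {\<omega>. N < \<bar>X i \<omega>\<bar>}))"
      by (rule UE_add) (use sets U in \<open>auto intro: borel_measurable_indicator\<close>)
    also have "\<dots> \<le> ennreal (d/2) + ennreal (d/2)" by (intro add_mono K(2) K'(2)) (use N in auto)
    also have "\<dots> = ennreal d" using d2 by (simp flip: ennreal_plus)
    finally show ?thesis .
  qed
  then show ?case using K(1) by (intro exI[of _ "max K K'"]) auto
qed

end

locale G_integrator = G_framework +
  fixes T :: real and A M :: "real \<Rightarrow> path \<Rightarrow> real"
  assumes T: "0 < T"
    and A_increasing: "qs \<P> (increasing_path T A)"
    and A_LG: "t \<in> {0..T} \<Longrightarrow> A t \<in> LG \<P> 1 t"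
    and M: "M \<in> integrators \<P> E\<^sub>\<xi> \<xi> T A"
begin

abbreviation NA :: "(real \<Rightarrow> path \<Rightarrow> real) \<Rightarrow> ennreal" where "NA \<equiv> normA_pow \<P> 2 T A"
abbreviation SI :: "(real \<Rightarrow> path \<Rightarrow> real) \<Rightarrow> path \<Rightarrow> real" where "SI \<equiv> step_integral \<P> 2 T M"

lemma A_AE: "P \<in> \<P> \<Longrightarrow> AE \<omega> in P. increasing_path T A \<omega>"
  by (rule qs_AE[OF A_increasing])

lemma A_mono: "increasing_path T A \<omega> \<Longrightarrow> 0 \<le> s \<Longrightarrow> s \<le> t \<Longrightarrow> t \<le> T \<Longrightarrow> A s \<omega> \<le> A t \<omega>"
  unfolding increasing_path_def by (auto elim: mono_onD)

lemma A_LGk: "0 \<le> t \<Longrightarrow> t \<le> T \<Longrightarrow> A t \<in> LGk 1 t"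
  using A_LG[of t] unfolding LG_1 by simp

lemma M_sym: "symmetric_G_martingale \<P> E\<^sub>\<xi> \<xi> T M"
  using M by (simp add: integrators_def)

lemma M_LGk_1: "0 \<le> t \<Longrightarrow> t \<le> T \<Longrightarrow> M t \<in> LGk 1 t"
  using M_sym unfolding symmetric_G_martingale_def G_martingale_def LG_1 by auto

lemma M2A_LGk: "0 \<le> t \<Longrightarrow> t \<le> T \<Longrightarrow> (\<lambda>\<omega>. (M t \<omega>)\<^sup>2 - A t \<omega>) \<in> LGk 1 t"
  using M unfolding integrators_def G_supermartingale_def LG_1 by auto

lemma M_LGk: "0 \<le> t \<Longrightarrow> t \<le> T \<Longrightarrow> M t \<in> LGk 2 t"
  using LGk_2_of_square[OF M_LGk_1] LGk_add[OF M2A_LGk A_LGk] by simp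

lemma dM_LGk: "0 \<le> s \<Longrightarrow> s \<le> t \<Longrightarrow> t \<le> T \<Longrightarrow> (\<lambda>\<omega>. M t \<omega> - M s \<omega>) \<in> LGk 2 t"
  by (intro LGk_diff M_LGk LGk_mono_time[OF M_LGk[of s]]) auto

text \<open>The martingale identity holds for the truncations of \<open>X\<close>; products of square integrable factors being
  integrable, dominated convergence removes the truncation.\<close>

lemma M_orthogonal:
  assumes st: "0 \<le> s" "s \<le> t" "t \<le> T" and X: "X \<in> LGk 2 s" and P: "P \<in> \<P>"
  shows "(\<integral>\<omega>. X \<omega> * (M t \<omega> - M s \<omega>) \<partial>P) = 0"
proof -
  note D = dM_LGk[OF st]
  have int: "integrable P (\<lambda>\<omega>. X \<omega> * (M t \<omega> - M s \<omega>))" by (rule LGk_product_integrable[OF X D P])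
  have X1: "X \<in> LGk 1 s" by (rule LGk_1[OF X]) simp
  note [measurable] = LGk_measurable[OF X] LGk_measurable[OF D]
  note [measurable_cong] = P_sets[OF P]
  have "(\<lambda>n. \<integral>\<omega>. clip (- real n) (real n) (X \<omega>) * (M t \<omega> - M s \<omega>) \<partial>P) \<longlonglongrightarrow> (\<integral>\<omega>. X \<omega> * (M t \<omega> - M s \<omega>) \<partial>P)"
  proof (rule integral_dominated_convergence)
    show "integrable P (\<lambda>\<omega>. \<bar>X \<omega> * (M t \<omega> - M s \<omega>)\<bar>)" using int by simp
    show "AE \<omega> in P. (\<lambda>n. clip (- real n) (real n) (X \<omega>) * (M t \<omega> - M s \<omega>)) \<longlonglongrightarrow> X \<omega> * (M t \<omega> - M s \<omega>)"
      by (intro AE_I2 tendsto_mult clip_tendsto tendsto_const)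
    show "AE \<omega> in P. norm (clip (- real n) (real n) (X \<omega>) * (M t \<omega> - M s \<omega>)) \<le> \<bar>X \<omega> * (M t \<omega> - M s \<omega>)\<bar>" for n
      by (intro AE_I2) (auto simp: abs_mult intro!: mult_right_mono abs_clip_sym)
  qed measurable
  moreover have "(\<integral>\<omega>. clip (- real n) (real n) (X \<omega>) * (M t \<omega> - M s \<omega>) \<partial>P) = 0" for n
    by (rule symmetric_G_martingale_integral[OF M_sym st P LGk_clip[OF X1 order.refl] abs_clip_sym(1)]) simp
  ultimately have "(\<lambda>n::nat. 0) \<longlonglongrightarrow> (\<integral>\<omega>. X \<omega> * (M t \<omega> - M s \<omega>) \<partial>P)" by simp
  then show ?thesis using LIMSEQ_unique tendsto_const by blast
qed

text \<open>When the square is expanded, the mixed term vanishes by orthogonality. Hence \<open>(M\<^sub>t - M\<^sub>s)\<^sup>2\<close> may be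
  replaced by \<open>M\<^sub>t\<^sup>2 - M\<^sub>s\<^sup>2\<close>, which the supermartingale property of \<open>M\<^sup>2 - A\<close> bounds.\<close>

lemma M_energy:
  assumes st: "0 \<le> s" "s \<le> t" "t \<le> T" and \<zeta>: "\<zeta> \<in> LGk 1 s" "\<And>\<omega>. \<bar>\<zeta> \<omega>\<bar> \<le> K" and P: "P \<in> \<P>"
  shows "(\<integral>\<omega>. (\<zeta> \<omega>)\<^sup>2 * (M t \<omega> - M s \<omega>)\<^sup>2 \<partial>P) \<le> (\<integral>\<omega>. (\<zeta> \<omega>)\<^sup>2 * (A t \<omega> - A s \<omega>) \<partial>P)"
proof -
  have K: "0 \<le> K" using \<zeta>(2)[of undefined] by linarith
  define Z where "Z \<omega> = (\<zeta> \<omega>)\<^sup>2" for \<omega>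
  have Z: "Z \<in> LGk 1 s" unfolding Z_def power2_eq_square by (rule LGk_mult_bounded[OF \<zeta> \<zeta>(1) order.refl])
  have Zb: "0 \<le> Z \<omega> \<and> Z \<omega> \<le> K\<^sup>2" for \<omega>
    unfolding Z_def using \<zeta>(2)[of \<omega>] K abs_le_square_iff[of "\<zeta> \<omega>" K] by simp
  have Zb': "\<bar>Z \<omega>\<bar> \<le> K\<^sup>2" for \<omega> using Zb[of \<omega>] by simp
  note im = integrable_mult_bounded[OF P _ LGk_measurable[OF Z] Zb']
  have tT: "0 \<le> t" "s \<le> T" using st by auto
  have iMt: "integrable P (\<lambda>\<omega>. Z \<omega> * (M t \<omega>)\<^sup>2)" by (rule im[OF LGk_square_integrable[OF M_LGk P]]) (use st in auto)
  have iMs: "integrable P (\<lambda>\<omega>. Z \<omega> * (M s \<omega>)\<^sup>2)" by (rule im[OF LGk_square_integrable[OF M_LGk P]]) (use st in auto)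
  have iAt: "integrable P (\<lambda>\<omega>. Z \<omega> * A t \<omega>)" by (rule im[OF LGk_integrable[OF A_LGk P]]) (use st in auto)
  have iAs: "integrable P (\<lambda>\<omega>. Z \<omega> * A s \<omega>)" by (rule im[OF LGk_integrable[OF A_LGk P]]) (use st in auto)
  have ZM: "(\<lambda>\<omega>. Z \<omega> * M s \<omega>) \<in> LGk 2 s"
    by (rule LGk_mult_bounded[OF Z Zb' M_LGk]) (use st in auto)
  have iC: "integrable P (\<lambda>\<omega>. (Z \<omega> * M s \<omega>) * (M t \<omega> - M s \<omega>))" by (rule LGk_product_integrable[OF ZM dM_LGk[OF st] P])
  have C: "(\<integral>\<omega>. (Z \<omega> * M s \<omega>) * (M t \<omega> - M s \<omega>) \<partial>P) = 0" by (rule M_orthogonal[OF st ZM P])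
  have "qs \<P> (\<lambda>\<omega>. cond s (\<lambda>\<omega>. (M t \<omega>)\<^sup>2 - A t \<omega>) \<omega> \<le> (M s \<omega>)\<^sup>2 - A s \<omega>)"
    using M st unfolding integrators_def G_supermartingale_def by auto
  from G_cond_leD[OF M2A_LGk[OF tT(1) st(3)] M2A_LGk[OF st(1) tT(2)] this P Z Zb]
  have super: "(\<integral>\<omega>. Z \<omega> * ((M t \<omega>)\<^sup>2 - A t \<omega> - ((M s \<omega>)\<^sup>2 - A s \<omega>)) \<partial>P) \<le> 0" .
  have "(\<integral>\<omega>. Z \<omega> * ((M t \<omega>)\<^sup>2 - A t \<omega> - ((M s \<omega>)\<^sup>2 - A s \<omega>)) \<partial>P)
     = (\<integral>\<omega>. Z \<omega> * (M t \<omega>)\<^sup>2 \<partial>P) - (\<integral>\<omega>. Z \<omega> * A t \<omega> \<partial>P) - ((\<integral>\<omega>. Z \<omega> * (M s \<omega>)\<^sup>2 \<partial>P) - (\<integral>\<omega>. Z \<omega> * A s \<omega> \<partial>P))"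
    unfolding right_diff_distrib using iMt iMs iAt iAs by simp
  moreover have "(\<integral>\<omega>. Z \<omega> * (A t \<omega> - A s \<omega>) \<partial>P) = (\<integral>\<omega>. Z \<omega> * A t \<omega> \<partial>P) - (\<integral>\<omega>. Z \<omega> * A s \<omega> \<partial>P)"
    unfolding right_diff_distrib using iAt iAs by simp
  moreover have "(\<integral>\<omega>. Z \<omega> * (M t \<omega> - M s \<omega>)\<^sup>2 \<partial>P) = (\<integral>\<omega>. Z \<omega> * (M t \<omega>)\<^sup>2 \<partial>P) - (\<integral>\<omega>. Z \<omega> * (M s \<omega>)\<^sup>2 \<partial>P)"
  proof -
    have "(\<integral>\<omega>. Z \<omega> * (M t \<omega> - M s \<omega>)\<^sup>2 \<partial>P) =
       (\<integral>\<omega>. Z \<omega> * (M t \<omega>)\<^sup>2 - Z \<omega> * (M s \<omega>)\<^sup>2 - 2 * ((Z \<omega> * M s \<omega>) * (M t \<omega> - M s \<omega>)) \<partial>P)"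
      by (rule Bochner_Integration.integral_cong) (auto simp: power2_eq_square algebra_simps)
    also have "\<dots> = (\<integral>\<omega>. Z \<omega> * (M t \<omega>)\<^sup>2 \<partial>P) - (\<integral>\<omega>. Z \<omega> * (M s \<omega>)\<^sup>2 \<partial>P) - 2 * (\<integral>\<omega>. (Z \<omega> * M s \<omega>) * (M t \<omega> - M s \<omega>) \<partial>P)"
      using iMt iMs iC by simp
    finally show ?thesis using C by simp
  qed
  ultimately show ?thesis using super unfolding Z_def[symmetric] by linarith
qed

lemma step_sum_A_nonneg:
  assumes "increasing_path T A \<omega>" "grid T F" "\<And>x. x \<in> F - {T} \<Longrightarrow> 0 \<le> f x"
  shows "0 \<le> step_sum T F f (\<lambda>x. A x \<omega>)"
  unfolding step_sum_def
proof (rule sum_nonneg)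
  fix x assume x: "x \<in> F - {T}"
  note n = gnext_grid[OF assms(2) x]
  have "A x \<omega> \<le> A (gnext F x) \<omega>" by (rule A_mono[OF assms(1)]) (use n in auto)
  then show "0 \<le> f x * (A (gnext F x) \<omega> - A x \<omega>)" using assms(3)[OF x] by simp
qed

lemma step_sum_A_mono:
  assumes "increasing_path T A \<omega>" "grid T F" "\<And>x. x \<in> F - {T} \<Longrightarrow> f x \<le> g x"
  shows "step_sum T F f (\<lambda>x. A x \<omega>) \<le> step_sum T F g (\<lambda>x. A x \<omega>)"
  unfolding step_sum_def
proof (rule sum_mono)
  fix x assume x: "x \<in> F - {T}"
  note n = gnext_grid[OF assms(2) x]
  have "A x \<omega> \<le> A (gnext F x) \<omega>" by (rule A_mono[OF assms(1)]) (use n in auto)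
  then show "f x * (A (gnext F x) \<omega> - A x \<omega>) \<le> g x * (A (gnext F x) \<omega> - A x \<omega>)"
    using assms(3)[OF x] by (intro mult_right_mono) auto
qed

lemma step_sum_measurable:
  assumes F: "grid T F" and c: "\<And>x. x \<in> F - {T} \<Longrightarrow> c x \<in> borel_measurable borel"
    and m: "\<And>x. 0 \<le> x \<Longrightarrow> x \<le> T \<Longrightarrow> m x \<in> borel_measurable borel"
  shows "(\<lambda>\<omega>. step_sum T F (\<lambda>x. c x \<omega>) (\<lambda>x. m x \<omega>)) \<in> borel_measurable borel"
  unfolding step_sum_def
proof (rule borel_measurable_sum)
  fix x assume x: "x \<in> F - {T}"
  note n = gnext_grid[OF F x]
  have [measurable]: "c x \<in> borel_measurable borel" "m x \<in> borel_measurable borel" "m (gnext F x) \<in> borel_measurable borel"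
    using c[OF x] n by (auto intro!: m)
  show "(\<lambda>\<omega>. c x \<omega> * (m (gnext F x) \<omega> - m x \<omega>)) \<in> borel_measurable borel" by measurable
qed

lemma M_measurable: "0 \<le> x \<Longrightarrow> x \<le> T \<Longrightarrow> M x \<in> borel_measurable borel"
  using M_LGk LGk_measurable by blast

lemma A_measurable: "0 \<le> x \<Longrightarrow> x \<le> T \<Longrightarrow> A x \<in> borel_measurable borel"
  using A_LGk LGk_measurable by blast

text \<open>In the square of the sum, a mixed term is the product of the later increment of \<open>M\<close> with a random
  variable known at its left end point, and therefore has integral \<open>0\<close>.\<close>

lemma step_isometry_bounded:
  assumes F: "grid T F" and c: "\<And>x. x \<in> F - {T} \<Longrightarrow> c x \<in> LGk 1 x" "\<And>x \<omega>. \<bar>c x \<omega>\<bar> \<le> K" and P: "P \<in> \<P>"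
  shows "integrable P (\<lambda>\<omega>. (step_sum T F (\<lambda>x. c x \<omega>) (\<lambda>x. M x \<omega>))\<^sup>2)"
    "integrable P (\<lambda>\<omega>. step_sum T F (\<lambda>x. (c x \<omega>)\<^sup>2) (\<lambda>x. A x \<omega>))"
    "(\<integral>\<omega>. (step_sum T F (\<lambda>x. c x \<omega>) (\<lambda>x. M x \<omega>))\<^sup>2 \<partial>P) \<le> (\<integral>\<omega>. step_sum T F (\<lambda>x. (c x \<omega>)\<^sup>2) (\<lambda>x. A x \<omega>) \<partial>P)"
proof -
  let ?I = "F - {T}"
  define a where "a x \<omega> = c x \<omega> * (M (gnext F x) \<omega> - M x \<omega>)" for x \<omega>
  have fin: "finite ?I" using F by (simp add: grid_def)
  have a: "a x \<in> LGk 2 (gnext F x)" if x: "x \<in> ?I" for x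
  proof -
    note n = gnext_grid[OF F x]
    show ?thesis unfolding a_def
      by (rule LGk_mult_bounded[OF LGk_mono_time[OF c(1)[OF x]] c(2) dM_LGk]) (use n in auto)
  qed
  have int: "integrable P (\<lambda>\<omega>. a x \<omega> * a y \<omega>)" if "x \<in> ?I" "y \<in> ?I" for x y
    by (rule LGk_product_integrable[OF a[OF that(1)] a[OF that(2)] P])
  have zero: "(\<integral>\<omega>. a x \<omega> * a y \<omega> \<partial>P) = 0" if x: "x \<in> ?I" and y: "y \<in> ?I" and xy: "x < y" for x y
  proof -
    note nx = gnext_grid[OF F x] and ny = gnext_grid[OF F y]
    have "gnext F x \<le> y" by (rule nx(3)) (use y xy in auto)
    then have "a x \<in> LGk 2 y" by (rule LGk_mono_time[OF a[OF x]]) simp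
    then have "(\<lambda>\<omega>. c y \<omega> * a x \<omega>) \<in> LGk 2 y" by (rule LGk_mult_bounded[OF c(1)[OF y] c(2)]) simp
    then have "(\<integral>\<omega>. (c y \<omega> * a x \<omega>) * (M (gnext F y) \<omega> - M y \<omega>) \<partial>P) = 0"
      by (rule M_orthogonal[rotated 3, OF _ P]) (use ny in auto)
    then show ?thesis by (simp add: a_def mult_ac)
  qed
  have off: "(\<integral>\<omega>. a x \<omega> * a y \<omega> \<partial>P) = (if y = x then (\<integral>\<omega>. (a x \<omega>)\<^sup>2 \<partial>P) else 0)" if "x \<in> ?I" "y \<in> ?I" for x y
    using zero[OF that] zero[OF that(2,1)] by (cases x y rule: linorder_cases) (auto simp: power2_eq_square mult.commute)
  have sq: "(step_sum T F (\<lambda>x. c x \<omega>) (\<lambda>x. M x \<omega>))\<^sup>2 = (\<Sum>x\<in>?I. \<Sum>y\<in>?I. a x \<omega> * a y \<omega>)" for \<omega>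
    unfolding step_sum_def a_def power2_eq_square by (rule sum_product)
  show "integrable P (\<lambda>\<omega>. (step_sum T F (\<lambda>x. c x \<omega>) (\<lambda>x. M x \<omega>))\<^sup>2)"
    unfolding sq by (intro Bochner_Integration.integrable_sum int)
  have iA: "integrable P (\<lambda>\<omega>. (c x \<omega>)\<^sup>2 * (A (gnext F x) \<omega> - A x \<omega>))" if x: "x \<in> ?I" for x
  proof (rule integrable_mult_bounded[OF P])
    note n = gnext_grid[OF F x]
    have gT: "0 \<le> gnext F x" "x \<le> T" using n by auto
    show "integrable P (\<lambda>\<omega>. A (gnext F x) \<omega> - A x \<omega>)"
      using LGk_integrable[OF A_LGk[OF gT(1) n(4)] P] LGk_integrable[OF A_LGk[OF n(5) gT(2)] P] by simp
    have [measurable]: "c x \<in> borel_measurable borel" by (rule LGk_measurable[OF c(1)[OF x]])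
    show "(\<lambda>\<omega>. (c x \<omega>)\<^sup>2) \<in> borel_measurable borel" by measurable
    have "0 \<le> K" using c(2)[of x undefined] by linarith
    then show "\<bar>(c x \<omega>)\<^sup>2\<bar> \<le> K\<^sup>2" for \<omega> using c(2)[of x \<omega>] abs_le_square_iff[of "c x \<omega>" K] by simp
  qed
  show "integrable P (\<lambda>\<omega>. step_sum T F (\<lambda>x. (c x \<omega>)\<^sup>2) (\<lambda>x. A x \<omega>))"
    unfolding step_sum_def by (intro Bochner_Integration.integrable_sum iA)
  have "(\<integral>\<omega>. (step_sum T F (\<lambda>x. c x \<omega>) (\<lambda>x. M x \<omega>))\<^sup>2 \<partial>P) = (\<Sum>x\<in>?I. \<integral>\<omega>. (\<Sum>y\<in>?I. a x \<omega> * a y \<omega>) \<partial>P)"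
    unfolding sq by (rule Bochner_Integration.integral_sum) (intro Bochner_Integration.integrable_sum int)
  also have "\<dots> = (\<Sum>x\<in>?I. \<Sum>y\<in>?I. \<integral>\<omega>. a x \<omega> * a y \<omega> \<partial>P)"
    by (intro sum.cong refl Bochner_Integration.integral_sum int)
  also have "\<dots> = (\<Sum>x\<in>?I. \<Sum>y\<in>?I. if y = x then (\<integral>\<omega>. (a x \<omega>)\<^sup>2 \<partial>P) else 0)"
    by (intro sum.cong refl off)
  also have "\<dots> = (\<Sum>x\<in>?I. \<integral>\<omega>. (a x \<omega>)\<^sup>2 \<partial>P)"
    by (rule sum.cong) (use fin in \<open>auto simp: sum.delta\<close>)
  also have "\<dots> \<le> (\<Sum>x\<in>?I. \<integral>\<omega>. (c x \<omega>)\<^sup>2 * (A (gnext F x) \<omega> - A x \<omega>) \<partial>P)"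
  proof (rule sum_mono)
    fix x assume x: "x \<in> ?I"
    note n = gnext_grid[OF F x]
    show "(\<integral>\<omega>. (a x \<omega>)\<^sup>2 \<partial>P) \<le> (\<integral>\<omega>. (c x \<omega>)\<^sup>2 * (A (gnext F x) \<omega> - A x \<omega>) \<partial>P)"
      unfolding a_def power_mult_distrib by (rule M_energy[OF _ _ _ c(1)[OF x] c(2) P]) (use n in auto)
  qed
  also have "\<dots> = (\<integral>\<omega>. step_sum T F (\<lambda>x. (c x \<omega>)\<^sup>2) (\<lambda>x. A x \<omega>) \<partial>P)"
    unfolding step_sum_def by (rule Bochner_Integration.integral_sum[symmetric]) (rule iA)
  finally show "(\<integral>\<omega>. (step_sum T F (\<lambda>x. c x \<omega>) (\<lambda>x. M x \<omega>))\<^sup>2 \<partial>P) \<le> (\<integral>\<omega>. step_sum T F (\<lambda>x. (c x \<omega>)\<^sup>2) (\<lambda>x. A x \<omega>) \<partial>P)" .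
qed

text \<open>Coefficients that are only square integrable are truncated; Fatou's lemma removes the truncation.\<close>

lemma step_isometry:
  assumes F: "grid T F" and c: "\<And>x. x \<in> F - {T} \<Longrightarrow> c x \<in> LGk 2 x" and P: "P \<in> \<P>"
  shows "(\<integral>\<^sup>+\<omega>. ennreal ((step_sum T F (\<lambda>x. c x \<omega>) (\<lambda>x. M x \<omega>))\<^sup>2) \<partial>P) \<le> (\<integral>\<^sup>+\<omega>. ennreal (step_sum T F (\<lambda>x. (c x \<omega>)\<^sup>2) (\<lambda>x. A x \<omega>)) \<partial>P)"
proof -
  define cn where "cn n x \<omega> = clip (- real n) (real n) (c x \<omega>)" for n x \<omega>
  have cn: "cn n x \<in> LGk 1 x" if "x \<in> F - {T}" for n x
    unfolding cn_def by (intro LGk_clip LGk_1[OF c[OF that]]) auto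
  have cb: "\<bar>cn n x \<omega>\<bar> \<le> real n" for n x \<omega> unfolding cn_def by (rule abs_clip_sym) simp
  let ?S = "\<lambda>n \<omega>. (step_sum T F (\<lambda>x. cn n x \<omega>) (\<lambda>x. M x \<omega>))\<^sup>2"
  note iso = step_isometry_bounded[OF F cn cb P]
  have lim: "(\<lambda>n. ?S n \<omega>) \<longlonglongrightarrow> (step_sum T F (\<lambda>x. c x \<omega>) (\<lambda>x. M x \<omega>))\<^sup>2" for \<omega>
    unfolding step_sum_def cn_def by (intro tendsto_power tendsto_sum tendsto_mult clip_tendsto tendsto_const)
  have meas: "(\<lambda>\<omega>. ennreal (?S n \<omega>)) \<in> borel_measurable P" for n
    using borel_measurable_integrable[OF iso(1)[of n]] by simp
  have bound: "(\<integral>\<^sup>+\<omega>. ennreal (?S n \<omega>) \<partial>P) \<le> (\<integral>\<^sup>+\<omega>. ennreal (step_sum T F (\<lambda>x. (c x \<omega>)\<^sup>2) (\<lambda>x. A x \<omega>)) \<partial>P)" for n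
  proof -
    have "(\<integral>\<^sup>+\<omega>. ennreal (?S n \<omega>) \<partial>P) = ennreal (\<integral>\<omega>. ?S n \<omega> \<partial>P)"
      by (rule nn_integral_eq_integral[OF iso(1)]) auto
    also have "\<dots> \<le> ennreal (\<integral>\<omega>. step_sum T F (\<lambda>x. (cn n x \<omega>)\<^sup>2) (\<lambda>x. A x \<omega>) \<partial>P)"
      by (rule ennreal_leI) (rule iso(3))
    also have "\<dots> = (\<integral>\<^sup>+\<omega>. ennreal (step_sum T F (\<lambda>x. (cn n x \<omega>)\<^sup>2) (\<lambda>x. A x \<omega>)) \<partial>P)"
    proof (rule nn_integral_eq_integral[OF iso(2), symmetric])
      show "AE \<omega> in P. 0 \<le> step_sum T F (\<lambda>x. (cn n x \<omega>)\<^sup>2) (\<lambda>x. A x \<omega>)"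
        using A_AE[OF P] by eventually_elim (rule step_sum_A_nonneg[OF _ F], auto)
    qed
    also have "\<dots> \<le> (\<integral>\<^sup>+\<omega>. ennreal (step_sum T F (\<lambda>x. (c x \<omega>)\<^sup>2) (\<lambda>x. A x \<omega>)) \<partial>P)"
    proof (rule nn_integral_mono_AE)
      show "AE \<omega> in P. ennreal (step_sum T F (\<lambda>x. (cn n x \<omega>)\<^sup>2) (\<lambda>x. A x \<omega>)) \<le> ennreal (step_sum T F (\<lambda>x. (c x \<omega>)\<^sup>2) (\<lambda>x. A x \<omega>))"
        using A_AE[OF P]
      proof eventually_elim
        case (elim \<omega>)
        show ?case unfolding cn_def
          by (intro ennreal_leI step_sum_A_mono[OF elim F] square_diff_clip_le(3)) simp
      qed
    qed
    finally show ?thesis .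
  qed
  have "(\<integral>\<^sup>+\<omega>. ennreal ((step_sum T F (\<lambda>x. c x \<omega>) (\<lambda>x. M x \<omega>))\<^sup>2) \<partial>P) = (\<integral>\<^sup>+\<omega>. liminf (\<lambda>n. ennreal (?S n \<omega>)) \<partial>P)"
  proof (rule nn_integral_cong)
    fix \<omega>
    have "(\<lambda>n. ennreal (?S n \<omega>)) \<longlonglongrightarrow> ennreal ((step_sum T F (\<lambda>x. c x \<omega>) (\<lambda>x. M x \<omega>))\<^sup>2)"
      by (rule tendsto_ennrealI[OF lim])
    then show "ennreal ((step_sum T F (\<lambda>x. c x \<omega>) (\<lambda>x. M x \<omega>))\<^sup>2) = liminf (\<lambda>n. ennreal (?S n \<omega>))"
      by (rule lim_imp_Liminf[OF sequentially_bot, symmetric])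
  qed
  also have "\<dots> \<le> liminf (\<lambda>n. \<integral>\<^sup>+\<omega>. ennreal (?S n \<omega>) \<partial>P)" by (rule nn_integral_liminf) (rule meas)
  also have "\<dots> \<le> liminf (\<lambda>n. \<integral>\<^sup>+\<omega>. ennreal (step_sum T F (\<lambda>x. (c x \<omega>)\<^sup>2) (\<lambda>x. A x \<omega>)) \<partial>P)"
    by (rule Liminf_mono) (intro always_eventually allI bound)
  also have "\<dots> = (\<integral>\<^sup>+\<omega>. ennreal (step_sum T F (\<lambda>x. (c x \<omega>)\<^sup>2) (\<lambda>x. A x \<omega>)) \<partial>P)" by (simp add: Liminf_const)
  finally show ?thesis .
qed

lemma dA_integral_step_process:
  assumes \<omega>: "increasing_path T A \<omega>" and \<eta>: "step_on \<P> 2 T F \<eta>"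
  shows "dA_integral T A (\<lambda>t. ennreal (\<bar>\<eta> t \<omega>\<bar> powr 2)) \<omega> = ennreal (step_sum T F (\<lambda>x. (\<eta> x \<omega>)\<^sup>2) (\<lambda>x. A x \<omega>))"
  unfolding abs_powr_2
proof (rule dA_integral_step[OF T \<omega> step_onD(1)[OF \<eta>]])
  show "(\<eta> u \<omega>)\<^sup>2 = (if u < T then (\<eta> (gprev F u) \<omega>)\<^sup>2 else 0)" if "u \<in> {0..T}" for u
    using step_onD(3)[OF \<eta>, of u \<omega>] that by (cases "u < T") (simp_all only: atLeastAtMost_iff simp_thms if_True if_False zero_power2)
qed simp

lemma NA_step:
  assumes "step_on \<P> 2 T F \<eta>"
  shows "NA \<eta> = UE (\<lambda>\<omega>. ennreal (step_sum T F (\<lambda>x. (\<eta> x \<omega>)\<^sup>2) (\<lambda>x. A x \<omega>)))"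
proof -
  have ae: "AE \<omega> in P. dA_integral T A (\<lambda>t. ennreal (\<bar>\<eta> t \<omega>\<bar> powr 2)) \<omega> = ennreal (step_sum T F (\<lambda>x. (\<eta> x \<omega>)\<^sup>2) (\<lambda>x. A x \<omega>))" if "P \<in> \<P>" for P
    using A_AE[OF that] by eventually_elim (rule dA_integral_step_process[OF _ assms])
  show ?thesis unfolding normA_pow_def
  proof (rule antisym; rule UE_mono_AE)
    fix P assume "P \<in> \<P>"
    from ae[OF this] show "AE \<omega> in P. dA_integral T A (\<lambda>t. ennreal (\<bar>\<eta> t \<omega>\<bar> powr 2)) \<omega> \<le> ennreal (step_sum T F (\<lambda>x. (\<eta> x \<omega>)\<^sup>2) (\<lambda>x. A x \<omega>))"
       by eventually_elim simp
  next
    fix P assume "P \<in> \<P>"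
    from ae[OF this] show "AE \<omega> in P. ennreal (step_sum T F (\<lambda>x. (\<eta> x \<omega>)\<^sup>2) (\<lambda>x. A x \<omega>)) \<le> dA_integral T A (\<lambda>t. ennreal (\<bar>\<eta> t \<omega>\<bar> powr 2)) \<omega>"
       by eventually_elim simp
  qed
qed

lemma SI_eq: "step_on \<P> 2 T F \<eta> \<Longrightarrow> SI \<eta> = (\<lambda>\<omega>. step_sum T F (\<lambda>x. \<eta> x \<omega>) (\<lambda>x. M x \<omega>))"
  by (rule ext) (rule step_integral_eq)

lemma pnorm_step_sum_le:
  assumes F: "grid T F" and c: "\<And>x. x \<in> F - {T} \<Longrightarrow> c x \<in> LGk 2 x"
  shows "pnorm 2 (\<lambda>\<omega>. step_sum T F (\<lambda>x. c x \<omega>) (\<lambda>x. M x \<omega>)) \<le> UE (\<lambda>\<omega>. ennreal (step_sum T F (\<lambda>x. (c x \<omega>)\<^sup>2) (\<lambda>x. A x \<omega>)))"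
  unfolding pnorm_def power2_abs
proof (rule UE_least)
  fix P assume P: "P \<in> \<P>"
  have "(\<integral>\<^sup>+\<omega>. ennreal ((step_sum T F (\<lambda>x. c x \<omega>) (\<lambda>x. M x \<omega>))\<^sup>2) \<partial>P) \<le> (\<integral>\<^sup>+\<omega>. ennreal (step_sum T F (\<lambda>x. (c x \<omega>)\<^sup>2) (\<lambda>x. A x \<omega>)) \<partial>P)"
    by (rule step_isometry[OF F c P])
  also have "\<dots> \<le> UE (\<lambda>\<omega>. ennreal (step_sum T F (\<lambda>x. (c x \<omega>)\<^sup>2) (\<lambda>x. A x \<omega>)))" by (rule UE_upper[OF P])
  finally show "(\<integral>\<^sup>+\<omega>. ennreal ((step_sum T F (\<lambda>x. c x \<omega>) (\<lambda>x. M x \<omega>))\<^sup>2) \<partial>P) \<le> UE (\<lambda>\<omega>. ennreal (step_sum T F (\<lambda>x. (c x \<omega>)\<^sup>2) (\<lambda>x. A x \<omega>)))" .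
qed

lemma step_on_LGk: "step_on \<P> 2 T F \<eta> \<Longrightarrow> x \<in> F - {T} \<Longrightarrow> \<eta> x \<in> LGk 2 x"
  using step_onD(2)[of \<P> 2 T F \<eta> x] unfolding LG_2 .

lemma pnorm_SI_le: "\<eta> \<in> MG0 \<P> 2 T \<Longrightarrow> pnorm 2 (SI \<eta>) \<le> NA \<eta>"
proof -
  assume "\<eta> \<in> MG0 \<P> 2 T"
  then obtain F where F: "step_on \<P> 2 T F \<eta>" unfolding MG0_iff_step_on by (elim exE)
  show ?thesis unfolding NA_step[OF F] SI_eq[OF F]
    by (rule pnorm_step_sum_le[OF step_onD(1)[OF F]]) (rule step_on_LGk[OF F])
qed

lemma SI_measurable: "\<eta> \<in> MG0 \<P> 2 T \<Longrightarrow> SI \<eta> \<in> borel_measurable borel"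
proof -
  assume "\<eta> \<in> MG0 \<P> 2 T"
  then obtain F where F: "step_on \<P> 2 T F \<eta>" unfolding MG0_iff_step_on by (elim exE)
  show ?thesis unfolding SI_eq[OF F]
    by (rule step_sum_measurable[OF step_onD(1)[OF F] LGk_measurable[OF step_on_LGk[OF F]] M_measurable])
qed

lemma step_on_lincomb:
  assumes "step_on \<P> 2 T F \<eta>" "step_on \<P> 2 T F \<zeta>"
  shows "step_on \<P> 2 T F (\<lambda>t \<omega>. a * \<eta> t \<omega> + b * \<zeta> t \<omega>)"
proof (rule step_onI[OF step_onD(1)[OF assms(1)]])
  fix x assume "x \<in> F - {T}"
  then show "(\<lambda>\<omega>. a * \<eta> x \<omega> + b * \<zeta> x \<omega>) \<in> LG \<P> 2 x"
    unfolding LG_2 by (intro LGk_add LGk_cmult step_on_LGk[OF assms(1)] step_on_LGk[OF assms(2)]) auto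
next
  fix u \<omega>
  show "a * \<eta> u \<omega> + b * \<zeta> u \<omega> = (if 0 \<le> u \<and> u < T then a * \<eta> (gprev F u) \<omega> + b * \<zeta> (gprev F u) \<omega> else 0)"
  proof (cases "0 \<le> u \<and> u < T")
    case True
    have "\<eta> u \<omega> = \<eta> (gprev F u) \<omega>" "\<zeta> u \<omega> = \<zeta> (gprev F u) \<omega>"
      using step_onD(3)[OF assms(1), of u \<omega>] step_onD(3)[OF assms(2), of u \<omega>] unfolding if_P[OF True] .
    then show ?thesis unfolding if_P[OF True] by (simp only:)
  next
    case False
    have "\<eta> u \<omega> = 0" "\<zeta> u \<omega> = 0"
      using step_onD(3)[OF assms(1), of u \<omega>] step_onD(3)[OF assms(2), of u \<omega>] unfolding if_not_P[OF False] .
    then show ?thesis unfolding if_not_P[OF False] by simp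
  qed
qed

lemma MG0_common:
  assumes "\<eta> \<in> MG0 \<P> 2 T" "\<zeta> \<in> MG0 \<P> 2 T"
  obtains F where "step_on \<P> 2 T F \<eta>" "step_on \<P> 2 T F \<zeta>"
proof -
  obtain F1 where F1: "step_on \<P> 2 T F1 \<eta>" using assms(1) unfolding MG0_iff_step_on by (elim exE)
  obtain F2 where F2: "step_on \<P> 2 T F2 \<zeta>" using assms(2) unfolding MG0_iff_step_on by (elim exE)
  from step_on_common[OF F1 F2] show thesis by (rule that)
qed

lemma MG0_lincomb:
  assumes "\<eta> \<in> MG0 \<P> 2 T" "\<zeta> \<in> MG0 \<P> 2 T"
  shows "(\<lambda>t \<omega>. a * \<eta> t \<omega> + b * \<zeta> t \<omega>) \<in> MG0 \<P> 2 T"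
    "SI (\<lambda>t \<omega>. a * \<eta> t \<omega> + b * \<zeta> t \<omega>) \<omega> = a * SI \<eta> \<omega> + b * SI \<zeta> \<omega>"
proof -
  obtain F where F: "step_on \<P> 2 T F \<eta>" "step_on \<P> 2 T F \<zeta>" by (rule MG0_common[OF assms])
  note l = step_on_lincomb[OF F, of a b]
  show "(\<lambda>t \<omega>. a * \<eta> t \<omega> + b * \<zeta> t \<omega>) \<in> MG0 \<P> 2 T" by (rule step_on_imp_MG0[OF l])
  show "SI (\<lambda>t \<omega>. a * \<eta> t \<omega> + b * \<zeta> t \<omega>) \<omega> = a * SI \<eta> \<omega> + b * SI \<zeta> \<omega>"
    unfolding SI_eq[OF l] SI_eq[OF F(1)] SI_eq[OF F(2)] step_sum_def
    unfolding sum_distrib_left sum.distrib[symmetric] by (rule sum.cong) (simp_all add: algebra_simps)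
qed

lemma MG0_A_D:
  assumes "\<eta> \<in> MG0_A \<P> 2 T A" and F: "step_on \<P> 2 T F \<eta>"
  shows "(\<lambda>\<omega>. step_sum T F (\<lambda>x. (\<eta> x \<omega>)\<^sup>2) (\<lambda>x. A x \<omega>)) \<in> LGk 1 T"
proof -
  obtain Y where Y: "Y \<in> LGk 1 T" "qs \<P> (\<lambda>\<omega>. 0 \<le> Y \<omega> \<and>
     dA_integral T A (\<lambda>t. ennreal (\<bar>\<eta> t \<omega>\<bar> powr 2)) \<omega> = ennreal (Y \<omega>))"
    using assms(1) unfolding MG0_A_def LG_1 mem_Collect_eq by (elim conjE bexE)
  show ?thesis
  proof (rule LGk_cong_AE[OF _ Y(1)])
    show "(\<lambda>\<omega>. step_sum T F (\<lambda>x. (\<eta> x \<omega>)\<^sup>2) (\<lambda>x. A x \<omega>)) \<in> borel_measurable borel"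
    proof (rule step_sum_measurable[OF step_onD(1)[OF F] _ A_measurable])
      fix x assume "x \<in> F - {T}"
      then have [measurable]: "\<eta> x \<in> borel_measurable borel" by (rule LGk_measurable[OF step_on_LGk[OF F]])
      show "(\<lambda>\<omega>. (\<eta> x \<omega>)\<^sup>2) \<in> borel_measurable borel" by measurable
    qed
    fix P assume P: "P \<in> \<P>"
    from A_AE[OF P] qs_AE[OF Y(2) P] show "AE \<omega> in P. step_sum T F (\<lambda>x. (\<eta> x \<omega>)\<^sup>2) (\<lambda>x. A x \<omega>) = Y \<omega>"
    proof eventually_elim
      case (elim \<omega>)
      have "0 \<le> step_sum T F (\<lambda>x. (\<eta> x \<omega>)\<^sup>2) (\<lambda>x. A x \<omega>)" by (rule step_sum_A_nonneg[OF elim(1) step_onD(1)[OF F]]) simp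
      then show ?case using elim(2) dA_integral_step_process[OF elim(1) F] by simp
    qed
  qed simp
qed

text \<open>The tail bound behind both uses of uniform integrability: what is lost by truncating the
  coefficients of a step process at level \<open>N\<close> is at most \<open>Y\<close> on the event that some coefficient
  exceeds \<open>N\<close>.\<close>

lemma truncation_small:
  assumes F: "step_on \<P> 2 T F \<eta>" and Y: "Y \<in> LGk 1 T"
    and dom: "\<And>P. P \<in> \<P> \<Longrightarrow> AE \<omega> in P. step_sum T F (\<lambda>x. (\<eta> x \<omega>)\<^sup>2) (\<lambda>x. A x \<omega>) \<le> Y \<omega>"
    and e: "0 < e"
  shows "\<exists>N\<ge>0. UE (\<lambda>\<omega>. ennreal (step_sum T F (\<lambda>x. (\<eta> x \<omega>)\<^sup>2 * indicator {N<..} \<bar>\<eta> x \<omega>\<bar>) (\<lambda>x. A x \<omega>))) \<le> ennreal e"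
proof -
  note g = step_onD(1)[OF F]
  obtain d where d: "0 < d" "\<And>D. D \<in> sets borel \<Longrightarrow> UE (indicator D) \<le> ennreal d \<Longrightarrow> UE (\<lambda>\<omega>. ennreal (\<bar>Y \<omega>\<bar> * indicator D \<omega>)) \<le> ennreal e"
    by (rule LGk_absolutely_continuous[OF Y e]) blast
  have "\<exists>K>0. \<forall>N\<ge>K. UE (indicator (\<Union>x\<in>F - {T}. {\<omega>. N < \<bar>\<eta> x \<omega>\<bar>})) \<le> ennreal d"
  proof (rule LGk_markov_finite[OF _ _ d(1), where t = "\<lambda>x. x"])
    show "finite (F - {T})" using g by (simp add: grid_def)
    show "\<eta> x \<in> LGk 1 x" if "x \<in> F - {T}" for x by (rule LGk_1[OF step_on_LGk[OF F that]]) simp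
  qed
  then obtain N where N: "0 < N" "UE (indicator (\<Union>x\<in>F - {T}. {\<omega>. N < \<bar>\<eta> x \<omega>\<bar>})) \<le> ennreal d" by blast
  define D where "D = (\<Union>x\<in>F - {T}. {\<omega>. N < \<bar>\<eta> x \<omega>\<bar>})"
  have "{\<omega>. N < \<bar>\<eta> x \<omega>\<bar>} \<in> sets borel" if "x \<in> F - {T}" for x
  proof -
    have [measurable]: "\<eta> x \<in> borel_measurable borel" by (rule LGk_measurable[OF step_on_LGk[OF F that]])
    have "{\<omega> \<in> space borel. N < \<bar>\<eta> x \<omega>\<bar>} \<in> sets borel" by measurable
    then show ?thesis by simp
  qed
  then have D: "D \<in> sets borel" unfolding D_def using g by (intro sets.finite_UN) (auto simp: grid_def)
  have "UE (\<lambda>\<omega>. ennreal (step_sum T F (\<lambda>x. (\<eta> x \<omega>)\<^sup>2 * indicator {N<..} \<bar>\<eta> x \<omega>\<bar>) (\<lambda>x. A x \<omega>))) \<le> UE (\<lambda>\<omega>. ennreal (\<bar>Y \<omega>\<bar> * indicator D \<omega>))"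
  proof (rule UE_mono_AE)
    fix P assume P: "P \<in> \<P>"
    from A_AE[OF P] dom[OF P] show "AE \<omega> in P. ennreal (step_sum T F (\<lambda>x. (\<eta> x \<omega>)\<^sup>2 * indicator {N<..} \<bar>\<eta> x \<omega>\<bar>) (\<lambda>x. A x \<omega>)) \<le> ennreal (\<bar>Y \<omega>\<bar> * indicator D \<omega>)"
    proof eventually_elim
      case (elim \<omega>)
      show ?case
      proof (cases "\<omega> \<in> D")
        case True
        have "step_sum T F (\<lambda>x. (\<eta> x \<omega>)\<^sup>2 * indicator {N<..} \<bar>\<eta> x \<omega>\<bar>) (\<lambda>x. A x \<omega>) \<le> step_sum T F (\<lambda>x. (\<eta> x \<omega>)\<^sup>2) (\<lambda>x. A x \<omega>)"
          by (rule step_sum_A_mono[OF elim(1) g]) (auto simp: indicator_def)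
        also have "\<dots> \<le> \<bar>Y \<omega>\<bar>" using elim(2) by simp
        finally show ?thesis using True by (simp add: ennreal_leI)
      next
        case False
        then have "indicator {N<..} \<bar>\<eta> x \<omega>\<bar> = (0::real)" if "x \<in> F - {T}" for x using that by (auto simp: D_def indicator_def)
        then have "step_sum T F (\<lambda>x. (\<eta> x \<omega>)\<^sup>2 * indicator {N<..} \<bar>\<eta> x \<omega>\<bar>) (\<lambda>x. A x \<omega>) = 0"
          unfolding step_sum_def by (intro sum.neutral) auto
        then show ?thesis by simp
      qed
    qed
  qed
  also have "\<dots> \<le> ennreal e" by (rule d(2)[OF D]) (use N(2) in \<open>simp add: D_def\<close>)
  finally show ?thesis using N(1) by (intro exI[of _ N]) auto
qed

text \<open>With truncated coefficients the integral of the square lies in \<open>L\<^sub>G\<^sup>1\<close>, and domination by \<open>Y\<close> makes the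
  truncation error small. The criterion shows that these step processes are closed under linear
  combinations and under stopping.\<close>

lemma MG0_A_dominated:
  assumes F: "step_on \<P> 2 T F \<eta>" and Y: "Y \<in> LGk 1 T"
    and dom: "\<And>P. P \<in> \<P> \<Longrightarrow> AE \<omega> in P. step_sum T F (\<lambda>x. (\<eta> x \<omega>)\<^sup>2) (\<lambda>x. A x \<omega>) \<le> Y \<omega>"
  shows "\<eta> \<in> MG0_A \<P> 2 T A"
proof -
  note g = step_onD(1)[OF F]
  let ?W = "\<lambda>\<omega>. step_sum T F (\<lambda>x. (\<eta> x \<omega>)\<^sup>2) (\<lambda>x. A x \<omega>)"
  have meas: "(\<lambda>\<omega>. (\<eta> x \<omega>)\<^sup>2) \<in> borel_measurable borel" if "x \<in> F - {T}" for x
  proof -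
    have [measurable]: "\<eta> x \<in> borel_measurable borel" by (rule LGk_measurable[OF step_on_LGk[OF F that]])
    show ?thesis by measurable
  qed
  have W: "?W \<in> LGk 1 T"
  proof (rule LGk_closed)
    show "?W \<in> borel_measurable borel" by (rule step_sum_measurable[OF g meas A_measurable])
    fix e :: real assume e: "0 < e"
    obtain N where N: "0 \<le> N" "UE (\<lambda>\<omega>. ennreal (step_sum T F (\<lambda>x. (\<eta> x \<omega>)\<^sup>2 * indicator {N<..} \<bar>\<eta> x \<omega>\<bar>) (\<lambda>x. A x \<omega>))) \<le> ennreal e"
      using truncation_small[OF F Y dom e] by blast
    let ?c = "\<lambda>x \<omega>. clip (-N) N (\<eta> x \<omega>)"
    let ?V = "\<lambda>\<omega>. step_sum T F (\<lambda>x. (?c x \<omega>)\<^sup>2) (\<lambda>x. A x \<omega>)"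
    have V: "?V \<in> LGk 1 T" unfolding step_sum_def
    proof (rule LGk_sum)
      fix x assume x: "x \<in> F - {T}"
      note n = gnext_grid[OF g x]
      have c: "?c x \<in> LGk 1 x" by (intro LGk_clip LGk_1[OF step_on_LGk[OF F x]]) auto
      have c2: "(\<lambda>\<omega>. (?c x \<omega>)\<^sup>2) \<in> LGk 1 x" unfolding power2_eq_square
        by (rule LGk_mult_bounded[OF c abs_clip_sym(1)[OF N(1)] c order.refl])
      have b: "\<bar>(?c x \<omega>)\<^sup>2\<bar> \<le> N\<^sup>2" for \<omega>
        using abs_clip_sym(1)[OF N(1), of "\<eta> x \<omega>"] abs_le_square_iff[of "?c x \<omega>" N] N(1) by simp
      have nn: "0 \<le> gnext F x" "x \<le> T" using n by auto
      have dA: "(\<lambda>\<omega>. A (gnext F x) \<omega> - A x \<omega>) \<in> LGk 1 T"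
        by (intro LGk_diff LGk_mono_time[OF A_LGk[OF nn(1) n(4)] n(4)] LGk_mono_time[OF A_LGk[OF n(5) nn(2)] nn(2)] order.refl)
      show "(\<lambda>\<omega>. (?c x \<omega>)\<^sup>2 * (A (gnext F x) \<omega> - A x \<omega>)) \<in> LGk 1 T"
        by (rule LGk_mult_bounded[OF LGk_mono_time[OF c2 nn(2) order.refl] b dA order.refl])
    qed (use T in auto)
    have "pnorm 1 (\<lambda>\<omega>. ?W \<omega> - ?V \<omega>) \<le> UE (\<lambda>\<omega>. ennreal (step_sum T F (\<lambda>x. (\<eta> x \<omega>)\<^sup>2 * indicator {N<..} \<bar>\<eta> x \<omega>\<bar>) (\<lambda>x. A x \<omega>)))"
      unfolding pnorm_def
    proof (rule UE_mono_AE)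
      fix P assume P: "P \<in> \<P>"
      from A_AE[OF P] show "AE \<omega> in P. ennreal (\<bar>?W \<omega> - ?V \<omega>\<bar> ^ 1) \<le> ennreal (step_sum T F (\<lambda>x. (\<eta> x \<omega>)\<^sup>2 * indicator {N<..} \<bar>\<eta> x \<omega>\<bar>) (\<lambda>x. A x \<omega>))"
      proof eventually_elim
        case (elim \<omega>)
        have eq: "?W \<omega> - ?V \<omega> = step_sum T F (\<lambda>x. (\<eta> x \<omega>)\<^sup>2 - (?c x \<omega>)\<^sup>2) (\<lambda>x. A x \<omega>)"
          unfolding step_sum_def by (simp add: sum_subtractf left_diff_distrib)
        have "0 \<le> ?W \<omega> - ?V \<omega>" unfolding eq
          by (rule step_sum_A_nonneg[OF elim g]) (use square_diff_clip_le(3)[OF N(1)] in simp)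
        moreover have "?W \<omega> - ?V \<omega> \<le> step_sum T F (\<lambda>x. (\<eta> x \<omega>)\<^sup>2 * indicator {N<..} \<bar>\<eta> x \<omega>\<bar>) (\<lambda>x. A x \<omega>)"
          unfolding eq by (rule step_sum_A_mono[OF elim g]) (rule square_diff_clip_le(2)[OF N(1)])
        ultimately show ?case by (simp add: ennreal_leI)
      qed
    qed
    also note N(2)
    finally show "\<exists>Y\<in>LGk 1 T. pnorm 1 (\<lambda>\<omega>. ?W \<omega> - Y \<omega>) \<le> ennreal e" using V by (intro bexI[of _ ?V])
  qed simp
  obtain N where N: "N \<in> sets borel" "capacity \<P> N = 0" "\<And>\<omega>. \<omega> \<notin> N \<Longrightarrow> increasing_path T A \<omega>"
    using A_increasing unfolding qs_def by blast
  have "qs \<P> (\<lambda>\<omega>. 0 \<le> ?W \<omega> \<and> dA_integral T A (\<lambda>t. ennreal (\<bar>\<eta> t \<omega>\<bar> powr 2)) \<omega> = ennreal (?W \<omega>))"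
    unfolding qs_def
  proof (intro bexI[of _ N] conjI allI impI N(1,2))
    fix \<omega> assume "\<omega> \<notin> N"
    note ip = N(3)[OF this]
    show "0 \<le> ?W \<omega>" by (rule step_sum_A_nonneg[OF ip g]) simp
    show "dA_integral T A (\<lambda>t. ennreal (\<bar>\<eta> t \<omega>\<bar> powr 2)) \<omega> = ennreal (?W \<omega>)"
      by (rule dA_integral_step_process[OF ip F])
  qed
  with W step_on_imp_MG0[OF F] show ?thesis unfolding MG0_A_def LG_1 mem_Collect_eq
    by (intro conjI bexI[of _ ?W])
qed

lemma MG0_A_MG0: "\<eta> \<in> MG0_A \<P> 2 T A \<Longrightarrow> \<eta> \<in> MG0 \<P> 2 T"
  unfolding MG0_A_def by simp

lemma MG0_A_lincomb:
  assumes "\<eta> \<in> MG0_A \<P> 2 T A" "\<zeta> \<in> MG0_A \<P> 2 T A"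
  shows "(\<lambda>t \<omega>. a * \<eta> t \<omega> + b * \<zeta> t \<omega>) \<in> MG0_A \<P> 2 T A"
proof -
  obtain F where F: "step_on \<P> 2 T F \<eta>" "step_on \<P> 2 T F \<zeta>" by (rule MG0_common[OF MG0_A_MG0[OF assms(1)] MG0_A_MG0[OF assms(2)]])
  let ?Y = "\<lambda>\<omega>. (2 * a\<^sup>2) * step_sum T F (\<lambda>x. (\<eta> x \<omega>)\<^sup>2) (\<lambda>x. A x \<omega>) + (2 * b\<^sup>2) * step_sum T F (\<lambda>x. (\<zeta> x \<omega>)\<^sup>2) (\<lambda>x. A x \<omega>)"
  show ?thesis
  proof (rule MG0_A_dominated[OF step_on_lincomb[OF F]])
    show "?Y \<in> LGk 1 T"
      by (intro LGk_add LGk_cmult MG0_A_D[OF assms(1) F(1)] MG0_A_D[OF assms(2) F(2)] order.refl)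
    fix P assume P: "P \<in> \<P>"
    from A_AE[OF P] show "AE \<omega> in P. step_sum T F (\<lambda>x. (a * \<eta> x \<omega> + b * \<zeta> x \<omega>)\<^sup>2) (\<lambda>x. A x \<omega>) \<le> ?Y \<omega>"
    proof eventually_elim
      case (elim \<omega>)
      have "step_sum T F (\<lambda>x. (a * \<eta> x \<omega> + b * \<zeta> x \<omega>)\<^sup>2) (\<lambda>x. A x \<omega>) \<le> step_sum T F (\<lambda>x. (2 * a\<^sup>2) * (\<eta> x \<omega>)\<^sup>2 + (2 * b\<^sup>2) * (\<zeta> x \<omega>)\<^sup>2) (\<lambda>x. A x \<omega>)"
      proof (rule step_sum_A_mono[OF elim step_onD(1)[OF F(1)]])
        show "(a * \<eta> x \<omega> + b * \<zeta> x \<omega>)\<^sup>2 \<le> (2 * a\<^sup>2) * (\<eta> x \<omega>)\<^sup>2 + (2 * b\<^sup>2) * (\<zeta> x \<omega>)\<^sup>2" for x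
          using square_add_le[of 1 "a * \<eta> x \<omega>" "b * \<zeta> x \<omega>"] by (simp add: power_mult_distrib)
      qed
      also have "\<dots> = ?Y \<omega>" unfolding step_sum_def sum_distrib_left sum.distrib[symmetric]
        by (rule sum.cong) (simp_all add: algebra_simps)
      finally show ?case .
    qed
  qed
qed

text \<open>Step processes are cut off on half-open intervals, since \<open>[0,t]\<close> is not a union of grid intervals.\<close>

lemma step_on_stop:
  assumes F: "step_on \<P> 2 T F \<eta>" and t: "t \<in> F"
  shows "step_on \<P> 2 T F (\<lambda>u \<omega>. indicator {0..<t} u * \<eta> u \<omega>)"
proof (rule step_onI[OF step_onD(1)[OF F]])
  fix x assume x: "x \<in> F - {T}"
  show "(\<lambda>\<omega>. indicator {0..<t} x * \<eta> x \<omega>) \<in> LG \<P> 2 x"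
    unfolding LG_2 by (rule LGk_cmult[OF step_on_LGk[OF F x]]) simp
next
  fix u \<omega>
  note g = step_onD(1)[OF F]
  show "indicator {0..<t} u * \<eta> u \<omega> = (if 0 \<le> u \<and> u < T then indicator {0..<t} (gprev F u) * \<eta> (gprev F u) \<omega> else 0)"
  proof (cases "0 \<le> u \<and> u < T")
    case True
    note p = gprev_grid[OF g, of u]
    have "indicator {0..<t} (gprev F u) = (indicator {0..<t} u :: real)"
    proof (cases "u < t")
      case True
      with p \<open>0 \<le> u \<and> u < T\<close> show ?thesis by (simp add: indicator_def)
    next
      case False
      with p(3)[of t] t \<open>0 \<le> u \<and> u < T\<close> show ?thesis by (simp add: indicator_def)
    qed
    moreover have "\<eta> u \<omega> = \<eta> (gprev F u) \<omega>" using step_onD(3)[OF F, of u \<omega>] unfolding if_P[OF True] .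
    ultimately show ?thesis unfolding if_P[OF True] by (simp only:)
  next
    case False
    have "\<eta> u \<omega> = 0" using step_onD(3)[OF F, of u \<omega>] unfolding if_not_P[OF False] .
    then show ?thesis unfolding if_not_P[OF False] by (simp only: mult_zero_right)
  qed
qed

lemma MG0_A_stop:
  assumes \<eta>: "\<eta> \<in> MG0_A \<P> 2 T A" and F: "step_on \<P> 2 T F \<eta>" and t: "t \<in> F"
  shows "(\<lambda>u \<omega>. indicator {0..<t} u * \<eta> u \<omega>) \<in> MG0_A \<P> 2 T A"
proof (rule MG0_A_dominated[OF step_on_stop[OF F t] MG0_A_D[OF \<eta> F]])
  fix P assume P: "P \<in> \<P>"
  from A_AE[OF P] show "AE \<omega> in P. step_sum T F (\<lambda>x. (indicator {0..<t} x * \<eta> x \<omega>)\<^sup>2) (\<lambda>x. A x \<omega>) \<le> step_sum T F (\<lambda>x. (\<eta> x \<omega>)\<^sup>2) (\<lambda>x. A x \<omega>)"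
    by eventually_elim (rule step_sum_A_mono[OF _ step_onD(1)[OF F]], auto simp: indicator_def)
qed

lemma MG0_grid_containing:
  assumes "\<eta> \<in> MG0 \<P> 2 T" "D \<subseteq> {0..T}" "finite D"
  obtains F where "step_on \<P> 2 T F \<eta>" "D \<subseteq> F"
proof -
  obtain F where F: "step_on \<P> 2 T F \<eta>" using assms(1) unfolding MG0_iff_step_on by (elim exE)
  have "step_on \<P> 2 T (F \<union> D) \<eta>" using step_on_refine[OF F assms(3,2)] by (rule conjunct1)
  then show thesis by (rule that) blast
qed

text \<open>With truncated coefficients the integral lies in \<open>L\<^sub>G\<^sup>2(F\<^sub>t)\<close>; by the isometry inequality, the error is
  bounded by what the truncation removes from the integral of the square.\<close>

lemma SI_stop_LGk:
  assumes \<eta>: "\<eta> \<in> MG0_A \<P> 2 T A" and t: "0 \<le> t" "t \<le> T"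
  shows "SI (\<lambda>u \<omega>. indicator {0..<t} u * \<eta> u \<omega>) \<in> LGk 2 t"
proof -
  obtain F where F: "step_on \<P> 2 T F \<eta>" "{t} \<subseteq> F"
    by (rule MG0_grid_containing[OF MG0_A_MG0[OF \<eta>], of "{t}"]) (use t in auto)
  have tF: "t \<in> F" using F(2) by simp
  note F' = step_on_stop[OF F(1) tF]
  let ?\<eta> = "\<lambda>u \<omega>. indicator {0..<t} u * \<eta> u \<omega>"
  note g = step_onD(1)[OF F']
  have \<eta>': "?\<eta> \<in> MG0_A \<P> 2 T A" by (rule MG0_A_stop[OF \<eta> F(1) tF])
  show ?thesis
  proof (rule LGk_closed)
    show "SI ?\<eta> \<in> borel_measurable borel" by (rule SI_measurable[OF MG0_A_MG0[OF \<eta>']])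
    fix e :: real assume e: "0 < e"
    have "\<exists>N\<ge>0. UE (\<lambda>\<omega>. ennreal (step_sum T F (\<lambda>x. (?\<eta> x \<omega>)\<^sup>2 * indicator {N<..} \<bar>?\<eta> x \<omega>\<bar>) (\<lambda>x. A x \<omega>))) \<le> ennreal e"
      by (rule truncation_small[OF F' MG0_A_D[OF \<eta>' F'] _ e]) simp
    then obtain N where N: "0 \<le> N" "UE (\<lambda>\<omega>. ennreal (step_sum T F (\<lambda>x. (?\<eta> x \<omega>)\<^sup>2 * indicator {N<..} \<bar>?\<eta> x \<omega>\<bar>) (\<lambda>x. A x \<omega>))) \<le> ennreal e"
      by (elim exE conjE)
    let ?c = "\<lambda>x \<omega>. clip (-N) N (?\<eta> x \<omega>)"
    let ?V = "\<lambda>\<omega>. step_sum T F (\<lambda>x. ?c x \<omega>) (\<lambda>x. M x \<omega>)"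
    have c: "?c x \<in> LGk 1 x" if "x \<in> F - {T}" for x by (intro LGk_clip LGk_1[OF step_on_LGk[OF F' that]]) auto
    have V: "?V \<in> LGk 2 t" unfolding step_sum_def
    proof (rule LGk_sum)
      fix x assume x: "x \<in> F - {T}"
      note n = gnext_grid[OF g x]
      show "(\<lambda>\<omega>. ?c x \<omega> * (M (gnext F x) \<omega> - M x \<omega>)) \<in> LGk 2 t"
      proof (cases "x < t")
        case True
        have nt: "gnext F x \<le> t" by (rule n(3)[OF tF True])
        show ?thesis
        proof (rule LGk_mult_bounded[OF LGk_mono_time[OF c[OF x]] abs_clip_sym(1)[OF N(1)]])
          show "(\<lambda>\<omega>. M (gnext F x) \<omega> - M x \<omega>) \<in> LGk 2 t"
            by (rule LGk_mono_time[OF dM_LGk nt]) (use n in auto)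
        qed (use True in auto)
      next
        case False
        then have "?c x \<omega> = 0" for \<omega> using N(1) by (simp add: clip_def)
        then show ?thesis using LGk_const[OF t(1), of 2 0] by simp
      qed
    qed (use t in auto)
    have "pnorm 2 (\<lambda>\<omega>. SI ?\<eta> \<omega> - ?V \<omega>) = pnorm 2 (\<lambda>\<omega>. step_sum T F (\<lambda>x. ?\<eta> x \<omega> - ?c x \<omega>) (\<lambda>x. M x \<omega>))"
      unfolding SI_eq[OF F'] step_sum_def by (simp add: sum_subtractf left_diff_distrib)
    also have "\<dots> \<le> UE (\<lambda>\<omega>. ennreal (step_sum T F (\<lambda>x. (?\<eta> x \<omega> - ?c x \<omega>)\<^sup>2) (\<lambda>x. A x \<omega>)))"
    proof (rule pnorm_step_sum_le[OF g])
      fix x assume x: "x \<in> F - {T}"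
      show "(\<lambda>\<omega>. ?\<eta> x \<omega> - ?c x \<omega>) \<in> LGk 2 x"
        by (intro LGk_diff LGk_clip step_on_LGk[OF F' x]) auto
    qed
    also have "\<dots> \<le> UE (\<lambda>\<omega>. ennreal (step_sum T F (\<lambda>x. (?\<eta> x \<omega>)\<^sup>2 * indicator {N<..} \<bar>?\<eta> x \<omega>\<bar>) (\<lambda>x. A x \<omega>)))"
    proof (rule UE_mono_AE)
      fix P assume P: "P \<in> \<P>"
      from A_AE[OF P] show "AE \<omega> in P. ennreal (step_sum T F (\<lambda>x. (?\<eta> x \<omega> - ?c x \<omega>)\<^sup>2) (\<lambda>x. A x \<omega>)) \<le> ennreal (step_sum T F (\<lambda>x. (?\<eta> x \<omega>)\<^sup>2 * indicator {N<..} \<bar>?\<eta> x \<omega>\<bar>) (\<lambda>x. A x \<omega>))"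
      proof eventually_elim
        case (elim \<omega>)
        show ?case by (intro ennreal_leI step_sum_A_mono[OF elim g] square_diff_clip_le(1)[OF N(1)])
      qed
    qed
    also note N(2)
    finally show "\<exists>Y\<in>LGk 2 t. pnorm 2 (\<lambda>\<omega>. SI ?\<eta> \<omega> - Y \<omega>) \<le> ennreal e" using V by (intro bexI[of _ ?V])
  qed simp
qed

lemma SI_LGk:
  assumes \<eta>: "\<eta> \<in> MG0_A \<P> 2 T A" shows "SI \<eta> \<in> LGk 2 T"
proof -
  obtain F where F: "step_on \<P> 2 T F \<eta>" using MG0_A_MG0[OF \<eta>] unfolding MG0_iff_step_on by (elim exE)
  have "(\<lambda>u \<omega>. indicator {0..<T} u * \<eta> u \<omega>) = \<eta>"
  proof (intro ext)
    fix u \<omega>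
    show "indicator {0..<T} u * \<eta> u \<omega> = \<eta> u \<omega>"
    proof (cases "0 \<le> u \<and> u < T")
      case False
      have "\<eta> u \<omega> = 0" using step_onD(3)[OF F, of u \<omega>] unfolding if_not_P[OF False] .
      then show ?thesis by simp
    qed simp
  qed
  with SI_stop_LGk[OF \<eta>, of T] T show ?thesis by simp
qed

text \<open>Each grid interval between \<open>s\<close> and \<open>t\<close> contributes an increment of \<open>M\<close>, multiplied by a random variable
  known at its left end point.\<close>

lemma SI_stop_martingale:
  assumes \<eta>: "\<eta> \<in> MG0_A \<P> 2 T A" and st: "0 \<le> s" "s \<le> t" "t \<le> T" and P: "P \<in> \<P>"
    and \<zeta>: "\<zeta> \<in> LGk 1 s" "\<And>\<omega>. \<bar>\<zeta> \<omega>\<bar> \<le> K"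
  shows "(\<integral>\<omega>. \<zeta> \<omega> * (SI (\<lambda>u \<omega>. indicator {0..<t} u * \<eta> u \<omega>) \<omega> - SI (\<lambda>u \<omega>. indicator {0..<s} u * \<eta> u \<omega>) \<omega>) \<partial>P) = 0"
proof -
  obtain F where F: "step_on \<P> 2 T F \<eta>" "{s, t} \<subseteq> F"
    by (rule MG0_grid_containing[OF MG0_A_MG0[OF \<eta>], of "{s, t}"]) (use st in auto)
  have sF: "s \<in> F" and tF: "t \<in> F" using F(2) by auto
  note g = step_onD(1)[OF F(1)]
  let ?d = "\<lambda>x. (if s \<le> x \<and> x < t then 1 else 0 :: real)"
  have eq: "\<zeta> \<omega> * (SI (\<lambda>u \<omega>. indicator {0..<t} u * \<eta> u \<omega>) \<omega> - SI (\<lambda>u \<omega>. indicator {0..<s} u * \<eta> u \<omega>) \<omega>)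
     = (\<Sum>x\<in>F - {T}. ?d x * ((\<zeta> \<omega> * \<eta> x \<omega>) * (M (gnext F x) \<omega> - M x \<omega>)))" for \<omega>
    unfolding SI_eq[OF step_on_stop[OF F(1) sF]] SI_eq[OF step_on_stop[OF F(1) tF]] step_sum_def sum_subtractf[symmetric] sum_distrib_left
  proof (rule sum.cong[OF refl])
    fix x assume x: "x \<in> F - {T}"
    have "indicator {0..<t} x - indicator {0..<s} x = ?d x" using gnext_grid(5)[OF g x] st by (simp add: indicator_def)
    then show "\<zeta> \<omega> * (indicator {0..<t} x * \<eta> x \<omega> * (M (gnext F x) \<omega> - M x \<omega>) - indicator {0..<s} x * \<eta> x \<omega> * (M (gnext F x) \<omega> - M x \<omega>))
       = ?d x * ((\<zeta> \<omega> * \<eta> x \<omega>) * (M (gnext F x) \<omega> - M x \<omega>))"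
      by (simp only: flip: left_diff_distrib) (simp only: mult_ac)
  qed
  have each: "integrable P (\<lambda>\<omega>. ?d x * ((\<zeta> \<omega> * \<eta> x \<omega>) * (M (gnext F x) \<omega> - M x \<omega>)))"
    "(\<integral>\<omega>. ?d x * ((\<zeta> \<omega> * \<eta> x \<omega>) * (M (gnext F x) \<omega> - M x \<omega>)) \<partial>P) = 0" if x: "x \<in> F - {T}" for x
  proof -
    note n = gnext_grid[OF g x]
    have "integrable P (\<lambda>\<omega>. ?d x * ((\<zeta> \<omega> * \<eta> x \<omega>) * (M (gnext F x) \<omega> - M x \<omega>))) \<and>
       (\<integral>\<omega>. ?d x * ((\<zeta> \<omega> * \<eta> x \<omega>) * (M (gnext F x) \<omega> - M x \<omega>)) \<partial>P) = 0"
    proof (cases "s \<le> x \<and> x < t")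
      case True
      have X: "(\<lambda>\<omega>. \<zeta> \<omega> * \<eta> x \<omega>) \<in> LGk 2 x"
        by (rule LGk_mult_bounded[OF LGk_mono_time[OF \<zeta>(1)] \<zeta>(2) step_on_LGk[OF F(1) x]]) (use True in auto)
      have nn: "x \<le> gnext F x" using n by simp
      have "integrable P (\<lambda>\<omega>. (\<zeta> \<omega> * \<eta> x \<omega>) * (M (gnext F x) \<omega> - M x \<omega>))"
        by (rule LGk_product_integrable[OF X dM_LGk[OF n(5) nn n(4)] P])
      moreover have "(\<integral>\<omega>. (\<zeta> \<omega> * \<eta> x \<omega>) * (M (gnext F x) \<omega> - M x \<omega>) \<partial>P) = 0"
        by (rule M_orthogonal[OF n(5) nn n(4) X P])
      ultimately show ?thesis unfolding if_P[OF True] by simp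
    next
      case False
      show ?thesis unfolding if_not_P[OF False] by simp
    qed
    then show "integrable P (\<lambda>\<omega>. ?d x * ((\<zeta> \<omega> * \<eta> x \<omega>) * (M (gnext F x) \<omega> - M x \<omega>)))"
      "(\<integral>\<omega>. ?d x * ((\<zeta> \<omega> * \<eta> x \<omega>) * (M (gnext F x) \<omega> - M x \<omega>)) \<partial>P) = 0" by auto
  qed
  have "(\<integral>\<omega>. (\<Sum>x\<in>F - {T}. ?d x * ((\<zeta> \<omega> * \<eta> x \<omega>) * (M (gnext F x) \<omega> - M x \<omega>))) \<partial>P)
     = (\<Sum>x\<in>F - {T}. \<integral>\<omega>. ?d x * ((\<zeta> \<omega> * \<eta> x \<omega>) * (M (gnext F x) \<omega> - M x \<omega>)) \<partial>P)"
    by (rule Bochner_Integration.integral_sum) (rule each(1))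
  also have "\<dots> = 0" by (rule sum.neutral) (intro ballI each(2))
  finally show ?thesis unfolding eq .
qed

end

section \<open>Extension of the integral\<close>

context G_integrator
begin

definition measurable_process :: "(real \<Rightarrow> path \<Rightarrow> real) \<Rightarrow> bool" where
  "measurable_process \<eta> \<longleftrightarrow> (\<lambda>(t, \<omega>). \<eta> t \<omega>) \<in> borel_measurable (restrict_space borel {0..T} \<Otimes>\<^sub>M borel)"

lemma measurable_processD:
  "measurable_process \<eta> \<Longrightarrow> (\<lambda>z. \<eta> (fst z) (snd z)) \<in> borel_measurable (restrict_space borel {0..T} \<Otimes>\<^sub>M borel)"
  unfolding measurable_process_def case_prod_beta' .

lemma measurable_processI:
  "(\<lambda>z. \<eta> (fst z) (snd z)) \<in> borel_measurable (restrict_space borel {0..T} \<Otimes>\<^sub>M borel) \<Longrightarrow> measurable_process \<eta>"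
  unfolding measurable_process_def case_prod_beta' .

lemma measurable_process_lincomb:
  assumes "measurable_process \<eta>" "measurable_process \<zeta>"
  shows "measurable_process (\<lambda>t \<omega>. a * \<eta> t \<omega> + b * \<zeta> t \<omega>)"
proof (rule measurable_processI)
  note [measurable] = measurable_processD[OF assms(1)] measurable_processD[OF assms(2)]
  show "(\<lambda>z. a * \<eta> (fst z) (snd z) + b * \<zeta> (fst z) (snd z)) \<in> borel_measurable (restrict_space borel {0..T} \<Otimes>\<^sub>M borel)"
    by measurable
qed

lemma measurable_indicator_time:
  assumes "S \<in> sets borel"
  shows "(\<lambda>z. indicator S (fst z) :: real) \<in> borel_measurable (restrict_space borel {0..T} \<Otimes>\<^sub>M (borel :: path measure))"
proof (rule measurable_compose[OF measurable_fst])
  show "(indicator S :: real \<Rightarrow> real) \<in> borel_measurable (restrict_space borel {0..T})"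
    by (rule measurable_restrict_space1) (rule borel_measurable_indicator[OF assms])
qed

lemma measurable_process_stop:
  assumes "measurable_process \<eta>" "S \<in> sets borel"
  shows "measurable_process (\<lambda>t \<omega>. indicator S t * \<eta> t \<omega>)"
proof (rule measurable_processI)
  show "(\<lambda>z. indicator S (fst z) * \<eta> (fst z) (snd z)) \<in> borel_measurable (restrict_space borel {0..T} \<Otimes>\<^sub>M borel)"
    by (rule borel_measurable_times[OF measurable_indicator_time[OF assms(2)] measurable_processD[OF assms(1)]])
qed

lemma measurable_process_step:
  assumes F: "step_on \<P> 2 T F \<eta>" shows "measurable_process \<eta>"
proof (rule measurable_processI)
  note g = step_onD(1)[OF F]
  have "\<eta> u \<omega> = (\<Sum>x\<in>F - {T}. \<eta> x \<omega> * indicator {x..<gnext F x} u)" for u \<omega>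
    using step_onD(3)[OF F, of u \<omega>] sum_grid_indicator[OF g, of "\<lambda>x. \<eta> x \<omega>" u] by (simp only:)
  then have eq: "(\<lambda>z. \<eta> (fst z) (snd z)) = (\<lambda>z. \<Sum>x\<in>F - {T}. \<eta> x (snd z) * indicator {x..<gnext F x} (fst z))" by (rule ext)
  show "(\<lambda>z. \<eta> (fst z) (snd z)) \<in> borel_measurable (restrict_space borel {0..T} \<Otimes>\<^sub>M borel)"
    unfolding eq
  proof (intro borel_measurable_sum borel_measurable_times)
    fix x assume "x \<in> F - {T}"
    then have "\<eta> x \<in> borel_measurable borel" by (rule LGk_measurable[OF step_on_LGk[OF F]])
    then show "(\<lambda>z. \<eta> x (snd z)) \<in> borel_measurable (restrict_space borel {0..T} \<Otimes>\<^sub>M borel)"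
      by (rule measurable_compose[OF measurable_snd])
    show "(\<lambda>z :: real \<times> path. indicator {x..<gnext F x} (fst z) :: real) \<in> borel_measurable (restrict_space borel {0..T} \<Otimes>\<^sub>M borel)"
      by (rule measurable_indicator_time) simp
  qed
qed

lemma measurable_process_MG0: "\<eta> \<in> MG0 \<P> 2 T \<Longrightarrow> measurable_process \<eta>"
  unfolding MG0_iff_step_on by (elim exE) (rule measurable_process_step)

abbreviation dA_square :: "(real \<Rightarrow> path \<Rightarrow> real) \<Rightarrow> path \<Rightarrow> ennreal" where
  "dA_square \<eta> \<omega> \<equiv> dA_integral T A (\<lambda>t. ennreal ((\<eta> t \<omega>)\<^sup>2)) \<omega>"

lemma NA_eq: "NA \<eta> = UE (dA_square \<eta>)"
  unfolding normA_pow_def abs_powr_2 ..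

text \<open>On a set of capacity zero the paths of \<open>A\<close> need not be increasing, so \<open>dA_square \<eta>\<close> is only
  measurable up to such a set.\<close>

lemma dA_square_measurable:
  assumes "measurable_process \<eta>"
  obtains g where "g \<in> borel_measurable borel" "\<And>P. P \<in> \<P> \<Longrightarrow> AE \<omega> in P. dA_square \<eta> \<omega> = g \<omega>"
proof -
  obtain N where N: "N \<in> sets borel" "capacity \<P> N = 0" "\<And>\<omega>. \<omega> \<notin> N \<Longrightarrow> increasing_path T A \<omega>"
    using A_increasing unfolding qs_def by blast
  note [measurable] = measurable_processD[OF assms]
  have f: "(\<lambda>(t, \<omega>). ennreal ((\<eta> t \<omega>)\<^sup>2)) \<in> borel_measurable (restrict_space borel {0..T} \<Otimes>\<^sub>M borel)"
    unfolding case_prod_beta' by measurable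
  have "\<exists>g\<in>borel_measurable borel. \<forall>\<omega>. \<omega> \<notin> N \<longrightarrow> dA_square \<eta> \<omega> = g \<omega>"
    by (rule dA_integral_measurable[OF T N(1) N(3) _ f]) (auto intro: A_measurable)
  then obtain g where g: "g \<in> borel_measurable borel" "\<And>\<omega>. \<omega> \<notin> N \<Longrightarrow> dA_square \<eta> \<omega> = g \<omega>" by blast
  have "AE \<omega> in P. dA_square \<eta> \<omega> = g \<omega>" if P: "P \<in> \<P>" for P
  proof -
    have "emeasure P N \<le> capacity \<P> N" unfolding capacity_def using P by (rule SUP_upper)
    then have "N \<in> null_sets P" using N P_sets[OF P] by auto
    from AE_not_in[OF this] show ?thesis by eventually_elim (rule g(2))
  qed
  with g(1) show thesis by (rule that)
qed

lemma measurable_process_section: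
  assumes "measurable_process \<eta>"
  shows "(\<lambda>t. ennreal ((\<eta> t \<omega>)\<^sup>2) * indicator {0..T} t) \<in> borel_measurable (interval_measure F)"
proof -
  have "(\<lambda>t. (t, \<omega>)) \<in> restrict_space borel {0..T} \<rightarrow>\<^sub>M restrict_space borel {0..T} \<Otimes>\<^sub>M borel"
    by (rule measurable_Pair) simp_all
  from measurable_compose[OF this measurable_processD[OF assms]]
  have [measurable]: "(\<lambda>t. \<eta> t \<omega>) \<in> borel_measurable (restrict_space borel {0..T})" by simp
  have "(\<lambda>t. ennreal ((\<eta> t \<omega>)\<^sup>2)) \<in> borel_measurable (restrict_space borel {0..T})" by measurable
  then show ?thesis by (subst (asm) borel_measurable_restrict_space_iff_ennreal) simp_all
qed

lemma dA_square_add_le: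
  assumes e: "0 < e" and m: "measurable_process \<eta>" "measurable_process \<zeta>"
  shows "dA_square (\<lambda>t \<omega>. \<eta> t \<omega> + \<zeta> t \<omega>) \<omega> \<le> ennreal (1 + e) * dA_square \<eta> \<omega> + ennreal (1 + 1 / e) * dA_square \<zeta> \<omega>"
proof -
  let ?\<mu> = "interval_measure (\<lambda>t. A (max 0 (min t T)) \<omega>)"
  note sec = measurable_process_section[where \<omega> = \<omega>]
  have "dA_square (\<lambda>t \<omega>. \<eta> t \<omega> + \<zeta> t \<omega>) \<omega> \<le>
     (\<integral>\<^sup>+t. ennreal (1 + e) * (ennreal ((\<eta> t \<omega>)\<^sup>2) * indicator {0..T} t) + ennreal (1 + 1 / e) * (ennreal ((\<zeta> t \<omega>)\<^sup>2) * indicator {0..T} t) \<partial>?\<mu>)"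
    unfolding dA_integral_def
  proof (rule nn_integral_mono)
    fix t
    show "ennreal ((\<eta> t \<omega> + \<zeta> t \<omega>)\<^sup>2) * indicator {0..T} t \<le> ennreal (1 + e) * (ennreal ((\<eta> t \<omega>)\<^sup>2) * indicator {0..T} t) + ennreal (1 + 1 / e) * (ennreal ((\<zeta> t \<omega>)\<^sup>2) * indicator {0..T} t)"
    proof (cases "t \<in> {0..T}")
      case True
      have "ennreal ((\<eta> t \<omega> + \<zeta> t \<omega>)\<^sup>2) \<le> ennreal ((1 + e) * (\<eta> t \<omega>)\<^sup>2 + (1 + 1 / e) * (\<zeta> t \<omega>)\<^sup>2)"
        by (rule ennreal_leI) (rule square_add_le[OF e])
      also have "\<dots> = ennreal ((1 + e) * (\<eta> t \<omega>)\<^sup>2) + ennreal ((1 + 1 / e) * (\<zeta> t \<omega>)\<^sup>2)"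
        by (rule ennreal_plus) (use e in auto)
      also have "\<dots> = ennreal (1 + e) * ennreal ((\<eta> t \<omega>)\<^sup>2) + ennreal (1 + 1 / e) * ennreal ((\<zeta> t \<omega>)\<^sup>2)"
        using e by (subst (1 2) ennreal_mult) auto
      finally show ?thesis using True by simp
    qed simp
  qed
  also have "\<dots> = (\<integral>\<^sup>+t. ennreal (1 + e) * (ennreal ((\<eta> t \<omega>)\<^sup>2) * indicator {0..T} t) \<partial>?\<mu>) + (\<integral>\<^sup>+t. ennreal (1 + 1 / e) * (ennreal ((\<zeta> t \<omega>)\<^sup>2) * indicator {0..T} t) \<partial>?\<mu>)"
    by (rule nn_integral_add) (use sec[OF m(1)] sec[OF m(2)] in measurable)
  also have "\<dots> = ennreal (1 + e) * dA_square \<eta> \<omega> + ennreal (1 + 1 / e) * dA_square \<zeta> \<omega>"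
    unfolding dA_integral_def by (intro arg_cong2[where f = "(+)"] nn_integral_cmult sec m)
  finally show ?thesis .
qed

lemma NA_add:
  assumes e: "0 < e" and m: "measurable_process \<eta>" "measurable_process \<zeta>"
  shows "NA (\<lambda>t \<omega>. \<eta> t \<omega> + \<zeta> t \<omega>) \<le> ennreal (1 + e) * NA \<eta> + ennreal (1 + 1 / e) * NA \<zeta>"
  unfolding NA_eq
proof (rule UE_least)
  fix P assume P: "P \<in> \<P>"
  obtain g where g: "g \<in> borel_measurable borel" "AE \<omega> in P. dA_square \<eta> \<omega> = g \<omega>"
    by (rule dA_square_measurable[OF m(1)]) (use P in blast)
  obtain h where h: "h \<in> borel_measurable borel" "AE \<omega> in P. dA_square \<zeta> \<omega> = h \<omega>"
    by (rule dA_square_measurable[OF m(2)]) (use P in blast)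
  have gh: "g \<in> borel_measurable P" "h \<in> borel_measurable P" using g(1) h(1) unfolding P_meas[OF P] by auto
  have "(\<integral>\<^sup>+\<omega>. dA_square (\<lambda>t \<omega>. \<eta> t \<omega> + \<zeta> t \<omega>) \<omega> \<partial>P) \<le> (\<integral>\<^sup>+\<omega>. ennreal (1 + e) * g \<omega> + ennreal (1 + 1 / e) * h \<omega> \<partial>P)"
  proof (rule nn_integral_mono_AE)
    show "AE \<omega> in P. dA_square (\<lambda>t \<omega>. \<eta> t \<omega> + \<zeta> t \<omega>) \<omega> \<le> ennreal (1 + e) * g \<omega> + ennreal (1 + 1 / e) * h \<omega>"
      using g(2) h(2)
    proof eventually_elim
      case (elim \<omega>)
      show ?case using dA_square_add_le[OF e m, of \<omega>] unfolding elim .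
    qed
  qed
  also have "\<dots> = ennreal (1 + e) * (\<integral>\<^sup>+\<omega>. g \<omega> \<partial>P) + ennreal (1 + 1 / e) * (\<integral>\<^sup>+\<omega>. h \<omega> \<partial>P)"
    using gh by (simp add: nn_integral_add nn_integral_cmult)
  also have "(\<integral>\<^sup>+\<omega>. g \<omega> \<partial>P) = (\<integral>\<^sup>+\<omega>. dA_square \<eta> \<omega> \<partial>P)"
    by (rule nn_integral_cong_AE) (use g(2) in eventually_elim, simp)
  also have "(\<integral>\<^sup>+\<omega>. h \<omega> \<partial>P) = (\<integral>\<^sup>+\<omega>. dA_square \<zeta> \<omega> \<partial>P)"
    by (rule nn_integral_cong_AE) (use h(2) in eventually_elim, simp)
  also have "ennreal (1 + e) * (\<integral>\<^sup>+\<omega>. dA_square \<eta> \<omega> \<partial>P) + ennreal (1 + 1 / e) * (\<integral>\<^sup>+\<omega>. dA_square \<zeta> \<omega> \<partial>P) \<le> ennreal (1 + e) * UE (dA_square \<eta>) + ennreal (1 + 1 / e) * UE (dA_square \<zeta>)"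
    by (intro add_mono mult_left_mono UE_upper P) auto
  finally show "(\<integral>\<^sup>+\<omega>. dA_square (\<lambda>t \<omega>. \<eta> t \<omega> + \<zeta> t \<omega>) \<omega> \<partial>P) \<le> ennreal (1 + e) * UE (dA_square \<eta>) + ennreal (1 + 1 / e) * UE (dA_square \<zeta>)" .
qed

lemma NA_cmult:
  assumes m: "measurable_process \<eta>"
  shows "NA (\<lambda>t \<omega>. a * \<eta> t \<omega>) \<le> ennreal (a\<^sup>2) * NA \<eta>"
  unfolding NA_eq
proof (rule UE_least)
  fix P assume P: "P \<in> \<P>"
  obtain g where g: "g \<in> borel_measurable borel" "AE \<omega> in P. dA_square \<eta> \<omega> = g \<omega>"
    by (rule dA_square_measurable[OF m(1)]) (use P in blast)
  have g': "g \<in> borel_measurable P" using g(1) unfolding P_meas[OF P] .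
  have pw: "dA_square (\<lambda>t \<omega>. a * \<eta> t \<omega>) \<omega> = ennreal (a\<^sup>2) * dA_square \<eta> \<omega>" for \<omega>
  proof -
    let ?\<mu> = "interval_measure (\<lambda>t. A (max 0 (min t T)) \<omega>)"
    note sec = measurable_process_section[OF m]
    have "dA_square (\<lambda>t \<omega>. a * \<eta> t \<omega>) \<omega> = (\<integral>\<^sup>+t. ennreal (a\<^sup>2) * (ennreal ((\<eta> t \<omega>)\<^sup>2) * indicator {0..T} t) \<partial>?\<mu>)"
      unfolding dA_integral_def power_mult_distrib
      by (rule nn_integral_cong) (simp add: ennreal_mult mult.assoc)
    also have "\<dots> = ennreal (a\<^sup>2) * dA_square \<eta> \<omega>"
      unfolding dA_integral_def by (rule nn_integral_cmult[OF sec])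
    finally show ?thesis .
  qed
  have "(\<integral>\<^sup>+\<omega>. dA_square (\<lambda>t \<omega>. a * \<eta> t \<omega>) \<omega> \<partial>P) = (\<integral>\<^sup>+\<omega>. ennreal (a\<^sup>2) * g \<omega> \<partial>P)"
    unfolding pw by (rule nn_integral_cong_AE) (use g(2) in eventually_elim, simp)
  also have "\<dots> = ennreal (a\<^sup>2) * (\<integral>\<^sup>+\<omega>. g \<omega> \<partial>P)" by (rule nn_integral_cmult[OF g'])
  also have "(\<integral>\<^sup>+\<omega>. g \<omega> \<partial>P) = (\<integral>\<^sup>+\<omega>. dA_square \<eta> \<omega> \<partial>P)"
    by (rule nn_integral_cong_AE) (use g(2) in eventually_elim, simp)
  also have "ennreal (a\<^sup>2) * (\<integral>\<^sup>+\<omega>. dA_square \<eta> \<omega> \<partial>P) \<le> ennreal (a\<^sup>2) * UE (dA_square \<eta>)"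
    by (intro mult_left_mono UE_upper P) simp
  finally show "(\<integral>\<^sup>+\<omega>. dA_square (\<lambda>t \<omega>. a * \<eta> t \<omega>) \<omega> \<partial>P) \<le> ennreal (a\<^sup>2) * UE (dA_square \<eta>)" .
qed

lemma measurable_process_diff:
  "measurable_process \<eta> \<Longrightarrow> measurable_process \<zeta> \<Longrightarrow> measurable_process (\<lambda>t \<omega>. \<eta> t \<omega> - \<zeta> t \<omega>)"
  using measurable_process_lincomb[of \<eta> \<zeta> 1 "-1"] by simp

lemma NA_lincomb:
  assumes "measurable_process \<eta>" "measurable_process \<zeta>"
  shows "NA (\<lambda>t \<omega>. a * \<eta> t \<omega> + b * \<zeta> t \<omega>) \<le> ennreal (2 * a\<^sup>2) * NA \<eta> + ennreal (2 * b\<^sup>2) * NA \<zeta>"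
proof -
  have ma: "measurable_process (\<lambda>t \<omega>. a * \<eta> t \<omega>)" using measurable_process_lincomb[OF assms, of a 0] by simp
  have mb: "measurable_process (\<lambda>t \<omega>. b * \<zeta> t \<omega>)" using measurable_process_lincomb[OF assms, of 0 b] by simp
  have "NA (\<lambda>t \<omega>. a * \<eta> t \<omega> + b * \<zeta> t \<omega>) \<le> ennreal (1 + 1) * NA (\<lambda>t \<omega>. a * \<eta> t \<omega>) + ennreal (1 + 1 / 1) * NA (\<lambda>t \<omega>. b * \<zeta> t \<omega>)"
    by (rule NA_add[OF _ ma mb]) simp
  also have "\<dots> \<le> ennreal (1 + 1) * (ennreal (a\<^sup>2) * NA \<eta>) + ennreal (1 + 1 / 1) * (ennreal (b\<^sup>2) * NA \<zeta>)"
    by (intro add_mono mult_left_mono NA_cmult assms) auto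
  also have "\<dots> = ennreal (2 * a\<^sup>2) * NA \<eta> + ennreal (2 * b\<^sup>2) * NA \<zeta>"
    by (simp add: ennreal_mult mult.assoc)
  finally show ?thesis .
qed

lemma NA_diff_commute: "NA (\<lambda>t \<omega>. \<eta> t \<omega> - \<zeta> t \<omega>) = NA (\<lambda>t \<omega>. \<zeta> t \<omega> - \<eta> t \<omega>)"
  unfolding NA_eq by (simp add: power2_commute)

lemma NA_zero: "NA (\<lambda>t \<omega>. 0) = 0"
proof -
  have "NA (\<lambda>t \<omega>. 0) = UE (\<lambda>_. 0)" unfolding NA_eq dA_integral_def by simp
  then show ?thesis using UE_const_le[of 0] by simp
qed

lemma pnorm_2_add:
  assumes e: "0 < e" and X: "X \<in> borel_measurable borel" "Y \<in> borel_measurable borel"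
  shows "pnorm 2 (\<lambda>\<omega>. X \<omega> + Y \<omega>) \<le> ennreal (1 + e) * pnorm 2 X + ennreal (1 + 1 / e) * pnorm 2 Y"
proof -
  note [measurable] = X
  have "pnorm 2 (\<lambda>\<omega>. X \<omega> + Y \<omega>) \<le> UE (\<lambda>\<omega>. ennreal (1 + e) * ennreal ((X \<omega>)\<^sup>2) + ennreal (1 + 1 / e) * ennreal ((Y \<omega>)\<^sup>2))"
    unfolding pnorm_def power2_abs
  proof (rule UE_mono)
    fix \<omega>
    have "ennreal ((X \<omega> + Y \<omega>)\<^sup>2) \<le> ennreal ((1 + e) * (X \<omega>)\<^sup>2 + (1 + 1 / e) * (Y \<omega>)\<^sup>2)"
      by (rule ennreal_leI) (rule square_add_le[OF e])
    also have "\<dots> = ennreal ((1 + e) * (X \<omega>)\<^sup>2) + ennreal ((1 + 1 / e) * (Y \<omega>)\<^sup>2)"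
      by (rule ennreal_plus) (use e in auto)
    also have "\<dots> = ennreal (1 + e) * ennreal ((X \<omega>)\<^sup>2) + ennreal (1 + 1 / e) * ennreal ((Y \<omega>)\<^sup>2)"
      using e by (subst (1 2) ennreal_mult) auto
    finally show "ennreal ((X \<omega> + Y \<omega>)\<^sup>2) \<le> ennreal (1 + e) * ennreal ((X \<omega>)\<^sup>2) + ennreal (1 + 1 / e) * ennreal ((Y \<omega>)\<^sup>2)" .
  qed
  also have "\<dots> \<le> UE (\<lambda>\<omega>. ennreal (1 + e) * ennreal ((X \<omega>)\<^sup>2)) + UE (\<lambda>\<omega>. ennreal (1 + 1 / e) * ennreal ((Y \<omega>)\<^sup>2))"
    by (rule UE_add) measurable
  also have "\<dots> \<le> ennreal (1 + e) * UE (\<lambda>\<omega>. ennreal ((X \<omega>)\<^sup>2)) + ennreal (1 + 1 / e) * UE (\<lambda>\<omega>. ennreal ((Y \<omega>)\<^sup>2))"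
    by (intro add_mono UE_cmult) measurable
  finally show ?thesis unfolding pnorm_def power2_abs .
qed

lemma pnorm_2_lincomb:
  assumes [measurable]: "X \<in> borel_measurable borel" "Y \<in> borel_measurable borel"
  shows "pnorm 2 (\<lambda>\<omega>. a * X \<omega> + b * Y \<omega>) \<le> ennreal (2 * a\<^sup>2) * pnorm 2 X + ennreal (2 * b\<^sup>2) * pnorm 2 Y"
proof -
  have "pnorm 2 (\<lambda>\<omega>. a * X \<omega> + b * Y \<omega>) \<le> ennreal (1 + 1) * pnorm 2 (\<lambda>\<omega>. a * X \<omega>) + ennreal (1 + 1 / 1) * pnorm 2 (\<lambda>\<omega>. b * Y \<omega>)"
    by (rule pnorm_2_add) auto
  also have "\<dots> \<le> ennreal (1 + 1) * (ennreal (\<bar>a\<bar>\<^sup>2) * pnorm 2 X) + ennreal (1 + 1 / 1) * (ennreal (\<bar>b\<bar>\<^sup>2) * pnorm 2 Y)"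
    by (intro add_mono mult_left_mono pnorm_cmult) auto
  also have "\<dots> = ennreal (2 * a\<^sup>2) * pnorm 2 X + ennreal (2 * b\<^sup>2) * pnorm 2 Y"
    by (simp add: ennreal_mult mult.assoc)
  finally show ?thesis .
qed

lemma ennreal_lincomb_tendsto_0:
  fixes f g :: "nat \<Rightarrow> ennreal"
  assumes "f \<longlonglongrightarrow> 0" "g \<longlonglongrightarrow> 0" and le: "\<And>n. h n \<le> ennreal a * f n + ennreal b * g n"
  shows "h \<longlonglongrightarrow> 0"
proof (rule tendsto_sandwich[of "\<lambda>_. 0" _ _ "\<lambda>n. ennreal a * f n + ennreal b * g n"])
  have "(\<lambda>n. ennreal a * f n + ennreal b * g n) \<longlonglongrightarrow> ennreal a * 0 + ennreal b * 0"
    by (intro tendsto_add ennreal_tendsto_cmult assms) auto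
  then show "(\<lambda>n. ennreal a * f n + ennreal b * g n) \<longlonglongrightarrow> 0" by simp
qed (use le in auto)

text \<open>\<open>X\<close> is a value of the extended integral at \<open>\<eta>\<close>. As a relation it is linear, and bounded by the
  isometry inequality; this makes the value unique up to quasi-sure equality.\<close>

definition integral_rel :: "(real \<Rightarrow> path \<Rightarrow> real) \<Rightarrow> (path \<Rightarrow> real) \<Rightarrow> bool" where
  "integral_rel \<eta> X \<longleftrightarrow> measurable_process \<eta> \<and> X \<in> borel_measurable borel \<and>
     (\<exists>\<zeta>. (\<forall>n::nat. \<zeta> n \<in> MG0_A \<P> 2 T A) \<and> (\<lambda>n. NA (\<lambda>t \<omega>. \<eta> t \<omega> - \<zeta> n t \<omega>)) \<longlonglongrightarrow> 0 \<and>
        (\<lambda>n. pnorm 2 (\<lambda>\<omega>. X \<omega> - SI (\<zeta> n) \<omega>)) \<longlonglongrightarrow> 0)"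

lemma integral_relE:
  assumes "integral_rel \<eta> X"
  obtains \<zeta> where "measurable_process \<eta>" "X \<in> borel_measurable borel" "\<And>n::nat. \<zeta> n \<in> MG0_A \<P> 2 T A"
    "(\<lambda>n. NA (\<lambda>t \<omega>. \<eta> t \<omega> - \<zeta> n t \<omega>)) \<longlonglongrightarrow> 0" "(\<lambda>n. pnorm 2 (\<lambda>\<omega>. X \<omega> - SI (\<zeta> n) \<omega>)) \<longlonglongrightarrow> 0"
  using assms unfolding integral_rel_def by (elim conjE exE) (rule that, auto)

lemma integral_relI:
  assumes "measurable_process \<eta>" "X \<in> borel_measurable borel" "\<And>n::nat. \<zeta> n \<in> MG0_A \<P> 2 T A"
    "(\<lambda>n. NA (\<lambda>t \<omega>. \<eta> t \<omega> - \<zeta> n t \<omega>)) \<longlonglongrightarrow> 0" "(\<lambda>n. pnorm 2 (\<lambda>\<omega>. X \<omega> - SI (\<zeta> n) \<omega>)) \<longlonglongrightarrow> 0"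
  shows "integral_rel \<eta> X"
  unfolding integral_rel_def by (intro conjI exI[of _ \<zeta>] allI assms)

lemma MGA_E:
  assumes "\<eta> \<in> MGA \<P> 2 T A"
  obtains \<zeta> where "measurable_process \<eta>" "\<And>n::nat. \<zeta> n \<in> MG0_A \<P> 2 T A"
    "(\<lambda>n. NA (\<lambda>t \<omega>. \<eta> t \<omega> - \<zeta> n t \<omega>)) \<longlonglongrightarrow> 0"
  using assms unfolding MGA_def mem_Collect_eq measurable_process_def[symmetric] by (elim conjE exE) (rule that, auto)

lemma MGA_I:
  assumes "measurable_process \<eta>" "\<And>n::nat. \<zeta> n \<in> MG0_A \<P> 2 T A"
    "(\<lambda>n. NA (\<lambda>t \<omega>. \<eta> t \<omega> - \<zeta> n t \<omega>)) \<longlonglongrightarrow> 0"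
  shows "\<eta> \<in> MGA \<P> 2 T A"
  unfolding MGA_def mem_Collect_eq measurable_process_def[symmetric] by (intro conjI exI[of _ \<zeta>] allI assms)

lemma integral_rel_MGA: "integral_rel \<eta> X \<Longrightarrow> \<eta> \<in> MGA \<P> 2 T A"
  by (erule integral_relE) (rule MGA_I)

lemma SI_diff:
  assumes "\<eta> \<in> MG0 \<P> 2 T" "\<zeta> \<in> MG0 \<P> 2 T"
  shows "(\<lambda>t \<omega>. \<eta> t \<omega> - \<zeta> t \<omega>) \<in> MG0 \<P> 2 T" "SI (\<lambda>t \<omega>. \<eta> t \<omega> - \<zeta> t \<omega>) \<omega> = SI \<eta> \<omega> - SI \<zeta> \<omega>"
  using MG0_lincomb[OF assms, of 1 "-1"] by simp_all

lemma pnorm_SI_diff_le: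
  assumes "\<eta> \<in> MG0 \<P> 2 T" "\<zeta> \<in> MG0 \<P> 2 T"
  shows "pnorm 2 (\<lambda>\<omega>. SI \<eta> \<omega> - SI \<zeta> \<omega>) \<le> NA (\<lambda>t \<omega>. \<eta> t \<omega> - \<zeta> t \<omega>)"
  using pnorm_SI_le[OF SI_diff(1)[OF assms]] unfolding SI_diff(2)[OF assms] .

text \<open>By the isometry inequality the integrals of approximating step processes form a Cauchy sequence.\<close>

lemma integral_rel_exists:
  assumes "\<eta> \<in> MGA \<P> 2 T A"
  shows "\<exists>X. integral_rel \<eta> X"
proof -
  obtain \<zeta> where \<zeta>: "measurable_process \<eta>" "\<And>n::nat. \<zeta> n \<in> MG0_A \<P> 2 T A"
    and lim: "(\<lambda>n. NA (\<lambda>t \<omega>. \<eta> t \<omega> - \<zeta> n t \<omega>)) \<longlonglongrightarrow> 0" by (rule MGA_E[OF assms]) blast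
  have m: "measurable_process (\<zeta> n)" for n by (rule measurable_process_MG0[OF MG0_A_MG0[OF \<zeta>(2)]])
  have cauchy: "\<exists>N. \<forall>m\<ge>N. \<forall>n\<ge>N. pnorm 2 (\<lambda>\<omega>. SI (\<zeta> m) \<omega> - SI (\<zeta> n) \<omega>) \<le> ennreal e" if e: "0 < e" for e
  proof -
    have e4: "0 < e / 4" using e by simp
    obtain N where N: "\<And>n. n \<ge> N \<Longrightarrow> NA (\<lambda>t \<omega>. \<eta> t \<omega> - \<zeta> n t \<omega>) \<le> ennreal (e / 4)"
      using ennreal_tendsto_0D[OF lim e4] by blast
    have "pnorm 2 (\<lambda>\<omega>. SI (\<zeta> i) \<omega> - SI (\<zeta> j) \<omega>) \<le> ennreal e" if ij: "i \<ge> N" "j \<ge> N" for i j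
    proof -
      have "pnorm 2 (\<lambda>\<omega>. SI (\<zeta> i) \<omega> - SI (\<zeta> j) \<omega>) \<le> NA (\<lambda>t \<omega>. \<zeta> i t \<omega> - \<zeta> j t \<omega>)"
        by (rule pnorm_SI_diff_le) (intro MG0_A_MG0 \<zeta>(2))+
      also have "(\<lambda>t \<omega>. \<zeta> i t \<omega> - \<zeta> j t \<omega>) = (\<lambda>t \<omega>. (-1) * (\<eta> t \<omega> - \<zeta> i t \<omega>) + 1 * (\<eta> t \<omega> - \<zeta> j t \<omega>))" by (intro ext) simp
      also have "NA \<dots> \<le> ennreal (2 * (-1)\<^sup>2) * NA (\<lambda>t \<omega>. \<eta> t \<omega> - \<zeta> i t \<omega>) + ennreal (2 * 1\<^sup>2) * NA (\<lambda>t \<omega>. \<eta> t \<omega> - \<zeta> j t \<omega>)"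
        by (rule NA_lincomb) (intro measurable_process_diff \<zeta>(1) m)+
      also have "\<dots> \<le> ennreal (2 * (-1)\<^sup>2) * ennreal (e / 4) + ennreal (2 * 1\<^sup>2) * ennreal (e / 4)"
        by (intro add_mono mult_left_mono N ij) auto
      also have "\<dots> = ennreal (2 * (-1)\<^sup>2 * (e / 4)) + ennreal (2 * 1\<^sup>2 * (e / 4))" using e by (subst (1 2) ennreal_mult) auto
      also have "\<dots> = ennreal (2 * (-1)\<^sup>2 * (e / 4) + 2 * 1\<^sup>2 * (e / 4))" by (rule ennreal_plus[symmetric]) (use e in auto)
      also have "2 * (-1)\<^sup>2 * (e / 4) + 2 * 1\<^sup>2 * (e / 4) = e" by simp
      finally show ?thesis .
    qed
    then show ?thesis by blast
  qed
  have "\<exists>X\<in>LGk 2 T. (\<lambda>n. pnorm 2 (\<lambda>\<omega>. X \<omega> - SI (\<zeta> n) \<omega>)) \<longlonglongrightarrow> 0"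
    by (rule LGk_complete[OF SI_LGk[OF \<zeta>(2)] _ cauchy]) simp_all
  then obtain X where X: "X \<in> LGk 2 T" "(\<lambda>n. pnorm 2 (\<lambda>\<omega>. X \<omega> - SI (\<zeta> n) \<omega>)) \<longlonglongrightarrow> 0" by blast
  have "integral_rel \<eta> X" by (rule integral_relI[OF \<zeta>(1) LGk_measurable[OF X(1)] \<zeta>(2) lim X(2)])
  then show ?thesis by (rule exI[of _ X])
qed

lemma integral_rel_MG0:
  assumes "\<eta> \<in> MGA \<P> 2 T A" "\<eta> \<in> MG0 \<P> 2 T"
  shows "integral_rel \<eta> (SI \<eta>)"
proof -
  obtain \<zeta> where \<zeta>: "measurable_process \<eta>" "\<And>n::nat. \<zeta> n \<in> MG0_A \<P> 2 T A"
    and lim: "(\<lambda>n. NA (\<lambda>t \<omega>. \<eta> t \<omega> - \<zeta> n t \<omega>)) \<longlonglongrightarrow> 0" by (rule MGA_E[OF assms(1)]) blast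
  have "(\<lambda>n. pnorm 2 (\<lambda>\<omega>. SI \<eta> \<omega> - SI (\<zeta> n) \<omega>)) \<longlonglongrightarrow> 0"
  proof (rule tendsto_sandwich[OF _ _ tendsto_const lim])
    show "\<forall>\<^sub>F n in sequentially. pnorm 2 (\<lambda>\<omega>. SI \<eta> \<omega> - SI (\<zeta> n) \<omega>) \<le> NA (\<lambda>t \<omega>. \<eta> t \<omega> - \<zeta> n t \<omega>)"
      by (intro always_eventually allI pnorm_SI_diff_le assms(2) MG0_A_MG0 \<zeta>(2))
  qed simp
  then show ?thesis by (rule integral_relI[OF \<zeta>(1) SI_measurable[OF assms(2)] \<zeta>(2) lim])
qed

lemma MG0_A_MGA: "\<eta> \<in> MG0_A \<P> 2 T A \<Longrightarrow> \<eta> \<in> MGA \<P> 2 T A"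
  by (rule MGA_I[of _ "\<lambda>_. \<eta>"]) (simp_all add: NA_zero measurable_process_MG0 MG0_A_MG0)

lemma integral_rel_lincomb:
  assumes "integral_rel \<eta> X" "integral_rel \<eta>' X'"
  shows "integral_rel (\<lambda>t \<omega>. a * \<eta> t \<omega> + b * \<eta>' t \<omega>) (\<lambda>\<omega>. a * X \<omega> + b * X' \<omega>)"
proof -
  obtain \<zeta> where z: "measurable_process \<eta>" "X \<in> borel_measurable borel" "\<And>n::nat. \<zeta> n \<in> MG0_A \<P> 2 T A"
    and l: "(\<lambda>n. NA (\<lambda>t \<omega>. \<eta> t \<omega> - \<zeta> n t \<omega>)) \<longlonglongrightarrow> 0" "(\<lambda>n. pnorm 2 (\<lambda>\<omega>. X \<omega> - SI (\<zeta> n) \<omega>)) \<longlonglongrightarrow> 0"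
    by (rule integral_relE[OF assms(1)]) blast
  obtain \<zeta>' where z': "measurable_process \<eta>'" "X' \<in> borel_measurable borel" "\<And>n::nat. \<zeta>' n \<in> MG0_A \<P> 2 T A"
    and l': "(\<lambda>n. NA (\<lambda>t \<omega>. \<eta>' t \<omega> - \<zeta>' n t \<omega>)) \<longlonglongrightarrow> 0" "(\<lambda>n. pnorm 2 (\<lambda>\<omega>. X' \<omega> - SI (\<zeta>' n) \<omega>)) \<longlonglongrightarrow> 0"
    by (rule integral_relE[OF assms(2)]) blast
  note m0 = MG0_A_MG0[OF z(3)] and m0' = MG0_A_MG0[OF z'(3)]
  note [measurable] = z(2) z'(2) SI_measurable[OF m0] SI_measurable[OF m0']
  show ?thesis
  proof (rule integral_relI[where \<zeta> = "\<lambda>n t \<omega>. a * \<zeta> n t \<omega> + b * \<zeta>' n t \<omega>"])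
    show "measurable_process (\<lambda>t \<omega>. a * \<eta> t \<omega> + b * \<eta>' t \<omega>)" by (rule measurable_process_lincomb[OF z(1) z'(1)])
    show "(\<lambda>\<omega>. a * X \<omega> + b * X' \<omega>) \<in> borel_measurable borel" by measurable
    show "(\<lambda>t \<omega>. a * \<zeta> n t \<omega> + b * \<zeta>' n t \<omega>) \<in> MG0_A \<P> 2 T A" for n by (rule MG0_A_lincomb[OF z(3) z'(3)])
    show "(\<lambda>n. NA (\<lambda>t \<omega>. a * \<eta> t \<omega> + b * \<eta>' t \<omega> - (a * \<zeta> n t \<omega> + b * \<zeta>' n t \<omega>))) \<longlonglongrightarrow> 0"
    proof (rule ennreal_lincomb_tendsto_0[OF l(1) l'(1)])
      fix n
      have eq: "(\<lambda>t \<omega>. a * \<eta> t \<omega> + b * \<eta>' t \<omega> - (a * \<zeta> n t \<omega> + b * \<zeta>' n t \<omega>)) = (\<lambda>t \<omega>. a * (\<eta> t \<omega> - \<zeta> n t \<omega>) + b * (\<eta>' t \<omega> - \<zeta>' n t \<omega>))"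
        by (intro ext) (simp add: algebra_simps)
      show "NA (\<lambda>t \<omega>. a * \<eta> t \<omega> + b * \<eta>' t \<omega> - (a * \<zeta> n t \<omega> + b * \<zeta>' n t \<omega>)) \<le> ennreal (2 * a\<^sup>2) * NA (\<lambda>t \<omega>. \<eta> t \<omega> - \<zeta> n t \<omega>) + ennreal (2 * b\<^sup>2) * NA (\<lambda>t \<omega>. \<eta>' t \<omega> - \<zeta>' n t \<omega>)"
        unfolding eq by (rule NA_lincomb) (intro measurable_process_diff z(1) z'(1) measurable_process_MG0 m0 m0')+
    qed
    show "(\<lambda>n. pnorm 2 (\<lambda>\<omega>. a * X \<omega> + b * X' \<omega> - SI (\<lambda>t \<omega>. a * \<zeta> n t \<omega> + b * \<zeta>' n t \<omega>) \<omega>)) \<longlonglongrightarrow> 0"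
    proof (rule ennreal_lincomb_tendsto_0[OF l(2) l'(2)])
      fix n
      have eq: "(\<lambda>\<omega>. a * X \<omega> + b * X' \<omega> - SI (\<lambda>t \<omega>. a * \<zeta> n t \<omega> + b * \<zeta>' n t \<omega>) \<omega>) = (\<lambda>\<omega>. a * (X \<omega> - SI (\<zeta> n) \<omega>) + b * (X' \<omega> - SI (\<zeta>' n) \<omega>))"
        unfolding MG0_lincomb(2)[OF m0 m0'] by (intro ext) (simp add: algebra_simps)
      show "pnorm 2 (\<lambda>\<omega>. a * X \<omega> + b * X' \<omega> - SI (\<lambda>t \<omega>. a * \<zeta> n t \<omega> + b * \<zeta>' n t \<omega>) \<omega>) \<le> ennreal (2 * a\<^sup>2) * pnorm 2 (\<lambda>\<omega>. X \<omega> - SI (\<zeta> n) \<omega>) + ennreal (2 * b\<^sup>2) * pnorm 2 (\<lambda>\<omega>. X' \<omega> - SI (\<zeta>' n) \<omega>)"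
        unfolding eq by (rule pnorm_2_lincomb) measurable
    qed
  qed
qed

text \<open>The weights \<open>1 + e\<close> and \<open>1 + 1/e\<close> in the triangle inequality keep the constant \<open>1\<close> in the limit.\<close>

lemma integral_rel_bound:
  assumes "integral_rel \<eta> X" shows "pnorm 2 X \<le> NA \<eta>"
proof -
  obtain \<zeta> where z: "measurable_process \<eta>" "X \<in> borel_measurable borel" "\<And>n::nat. \<zeta> n \<in> MG0_A \<P> 2 T A"
    and l: "(\<lambda>n. NA (\<lambda>t \<omega>. \<eta> t \<omega> - \<zeta> n t \<omega>)) \<longlonglongrightarrow> 0" "(\<lambda>n. pnorm 2 (\<lambda>\<omega>. X \<omega> - SI (\<zeta> n) \<omega>)) \<longlonglongrightarrow> 0"
    by (rule integral_relE[OF assms(1)]) blast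
  note m0 = MG0_A_MG0[OF z(3)]
  note [measurable] = z(2) SI_measurable[OF m0]
  have step: "pnorm 2 X \<le> ennreal (1 + e) * (ennreal (1 + e) * NA \<eta>)" if e: "0 < e" for e
  proof (rule LIMSEQ_le_const)
    let ?r = "\<lambda>n. ennreal (1 + e) * (ennreal (1 + e) * NA \<eta> + ennreal (1 + 1 / e) * NA (\<lambda>t \<omega>. \<eta> t \<omega> - \<zeta> n t \<omega>)) + ennreal (1 + 1 / e) * pnorm 2 (\<lambda>\<omega>. X \<omega> - SI (\<zeta> n) \<omega>)"
    have "?r \<longlonglongrightarrow> ennreal (1 + e) * (ennreal (1 + e) * NA \<eta> + ennreal (1 + 1 / e) * 0) + ennreal (1 + 1 / e) * 0"
      by (intro tendsto_add ennreal_tendsto_cmult tendsto_const l) auto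
    then show "?r \<longlonglongrightarrow> ennreal (1 + e) * (ennreal (1 + e) * NA \<eta>)" by simp
    have "pnorm 2 X \<le> ?r n" for n
    proof -
      have "pnorm 2 X = pnorm 2 (\<lambda>\<omega>. SI (\<zeta> n) \<omega> + (X \<omega> - SI (\<zeta> n) \<omega>))" by simp
      also have "\<dots> \<le> ennreal (1 + e) * pnorm 2 (SI (\<zeta> n)) + ennreal (1 + 1 / e) * pnorm 2 (\<lambda>\<omega>. X \<omega> - SI (\<zeta> n) \<omega>)"
        by (rule pnorm_2_add[OF e]) measurable
      also have "pnorm 2 (SI (\<zeta> n)) \<le> NA (\<zeta> n)" by (rule pnorm_SI_le[OF m0])
      also have "NA (\<zeta> n) = NA (\<lambda>t \<omega>. \<eta> t \<omega> + (\<zeta> n t \<omega> - \<eta> t \<omega>))" by simp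
      also have "\<dots> \<le> ennreal (1 + e) * NA \<eta> + ennreal (1 + 1 / e) * NA (\<lambda>t \<omega>. \<zeta> n t \<omega> - \<eta> t \<omega>)"
        by (rule NA_add[OF e z(1)]) (intro measurable_process_diff z(1) measurable_process_MG0 m0)
      finally show ?thesis unfolding NA_diff_commute[of "\<zeta> n"] by (simp add: add_mono mult_left_mono)
    qed
    then show "\<exists>N. \<forall>n\<ge>N. pnorm 2 X \<le> ?r n" by blast
  qed
  show ?thesis
  proof (cases "NA \<eta>")
    case (real r)
    show ?thesis unfolding real(2)
    proof (rule LIMSEQ_le_const)
      have "(\<lambda>n. (1 + inverse (real (Suc n))) * ((1 + inverse (real (Suc n))) * r)) \<longlonglongrightarrow> (1 + 0) * ((1 + 0) * r)"
        by (intro tendsto_intros LIMSEQ_inverse_real_of_nat)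
      then show "(\<lambda>n. ennreal ((1 + inverse (real (Suc n))) * ((1 + inverse (real (Suc n))) * r))) \<longlonglongrightarrow> ennreal r"
        by (intro tendsto_ennrealI) simp
      have "pnorm 2 X \<le> ennreal ((1 + inverse (real (Suc n))) * ((1 + inverse (real (Suc n))) * r))" for n
      proof -
        define d where "d = inverse (real (Suc n))"
        have e: "0 < d" unfolding d_def by simp
        have "ennreal (1 + d) * (ennreal (1 + d) * ennreal r) = ennreal ((1 + d) * ((1 + d) * r))"
          using e real(1) by (simp add: ennreal_mult)
        with step[OF e] real(2) show ?thesis unfolding d_def by (simp only:)
      qed
      then show "\<exists>N. \<forall>n\<ge>N. pnorm 2 X \<le> ennreal ((1 + inverse (real (Suc n))) * ((1 + inverse (real (Suc n))) * r))" by blast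
    qed
  qed simp
qed

lemma integral_rel_diff:
  assumes "integral_rel \<eta> X" "integral_rel \<eta>' X'"
  shows "integral_rel (\<lambda>t \<omega>. \<eta> t \<omega> - \<eta>' t \<omega>) (\<lambda>\<omega>. X \<omega> - X' \<omega>)"
  using integral_rel_lincomb[OF assms, of 1 "-1"] by simp

lemma integral_rel_unique:
  assumes "integral_rel \<eta> X" "integral_rel \<eta> X'"
  shows "qs \<P> (\<lambda>\<omega>. X \<omega> = X' \<omega>)"
proof -
  have m: "X \<in> borel_measurable borel" "X' \<in> borel_measurable borel"
    using assms unfolding integral_rel_def by auto
  have "pnorm 2 (\<lambda>\<omega>. X \<omega> - X' \<omega>) \<le> NA (\<lambda>t \<omega>. \<eta> t \<omega> - \<eta> t \<omega>)"
    by (rule integral_rel_bound[OF integral_rel_diff[OF assms]])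
  then have z: "pnorm 2 (\<lambda>\<omega>. X \<omega> - X' \<omega>) = 0" using NA_zero by simp
  show ?thesis
  proof (rule AE_qs_eq[OF m])
    fix P assume P: "P \<in> \<P>"
    have "AE \<omega> in P. X \<omega> - X' \<omega> = 0" by (rule pnorm_0_AE[OF _ z _ P]) (use m in auto)
    then show "AE \<omega> in P. X \<omega> = X' \<omega>" by eventually_elim simp
  qed
qed

lemma integral_rel_LGk:
  assumes "integral_rel \<eta> X" shows "X \<in> LGk 2 T"
proof -
  obtain \<zeta> where z: "X \<in> borel_measurable borel" "\<And>n::nat. \<zeta> n \<in> MG0_A \<P> 2 T A"
    and l: "(\<lambda>n. pnorm 2 (\<lambda>\<omega>. X \<omega> - SI (\<zeta> n) \<omega>)) \<longlonglongrightarrow> 0"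
    by (rule integral_relE[OF assms(1)]) blast
  show ?thesis by (rule LGk_closed_limit[OF z(1) _ SI_LGk[OF z(2)] l]) simp
qed

text \<open>Integrating over \<open>[0,t]\<close> or \<open>[0,t)\<close> makes no difference, because \<open>A\<close> is continuous.\<close>

lemma NA_stop_le:
  assumes t: "0 \<le> t" "t \<le> T"
  shows "NA (\<lambda>u \<omega>. indicator {0..t} u * \<eta> u \<omega> - indicator {0..<t} u * \<zeta> u \<omega>) \<le> NA (\<lambda>u \<omega>. \<eta> u \<omega> - \<zeta> u \<omega>)"
  unfolding NA_eq
proof (rule UE_mono_AE)
  fix P assume "P \<in> \<P>"
  from A_AE[OF this] show "AE \<omega> in P. dA_square (\<lambda>u \<omega>. indicator {0..t} u * \<eta> u \<omega> - indicator {0..<t} u * \<zeta> u \<omega>) \<omega> \<le> dA_square (\<lambda>u \<omega>. \<eta> u \<omega> - \<zeta> u \<omega>) \<omega>"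
  proof eventually_elim
    case (elim \<omega>)
    have "dA_square (\<lambda>u \<omega>. indicator {0..t} u * \<eta> u \<omega> - indicator {0..<t} u * \<zeta> u \<omega>) \<omega> = dA_integral T A (\<lambda>u. indicator {0..<t} u * ennreal ((\<eta> u \<omega> - \<zeta> u \<omega>)\<^sup>2)) \<omega>"
      by (rule dA_integral_point[OF T elim _ t]) (auto simp: indicator_def)
    also have "\<dots> \<le> dA_square (\<lambda>u \<omega>. \<eta> u \<omega> - \<zeta> u \<omega>) \<omega>"
      unfolding dA_integral_def by (intro nn_integral_mono) (auto simp: indicator_def)
    finally show ?case .
  qed
qed

text \<open>One approximating sequence serves all times \<open>t\<close> simultaneously.\<close>

lemma stopped_approximation:
  assumes \<eta>: "\<eta> \<in> MGA \<P> 2 T A"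
  obtains \<zeta> where "\<And>n::nat. \<zeta> n \<in> MG0_A \<P> 2 T A"
    "\<And>t. 0 \<le> t \<Longrightarrow> t \<le> T \<Longrightarrow> (\<lambda>u \<omega>. indicator {0..t} u * \<eta> u \<omega>) \<in> MGA \<P> 2 T A"
    "\<And>t X. 0 \<le> t \<Longrightarrow> t \<le> T \<Longrightarrow> integral_rel (\<lambda>u \<omega>. indicator {0..t} u * \<eta> u \<omega>) X \<Longrightarrow>
       (\<lambda>n. pnorm 2 (\<lambda>\<omega>. X \<omega> - SI (\<lambda>u \<omega>. indicator {0..<t} u * \<zeta> n u \<omega>) \<omega>)) \<longlonglongrightarrow> 0"
proof -
  obtain \<zeta> where z: "measurable_process \<eta>" "\<And>n::nat. \<zeta> n \<in> MG0_A \<P> 2 T A"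
    and l: "(\<lambda>n. NA (\<lambda>t \<omega>. \<eta> t \<omega> - \<zeta> n t \<omega>)) \<longlonglongrightarrow> 0"
    by (rule MGA_E[OF \<eta>]) blast
  have st: "(\<lambda>u \<omega>. indicator {0..<t} u * \<zeta> n u \<omega>) \<in> MG0_A \<P> 2 T A" if t: "0 \<le> t" "t \<le> T" for t n
  proof -
    obtain F where F: "step_on \<P> 2 T F (\<zeta> n)" "{t} \<subseteq> F"
      by (rule MG0_grid_containing[OF MG0_A_MG0[OF z(2)], of "{t}"]) (use t in auto)
    show ?thesis by (rule MG0_A_stop[OF z(2) F(1)]) (use F(2) in simp)
  qed
  have lim: "(\<lambda>n. NA (\<lambda>u \<omega>. indicator {0..t} u * \<eta> u \<omega> - indicator {0..<t} u * \<zeta> n u \<omega>)) \<longlonglongrightarrow> 0" if t: "0 \<le> t" "t \<le> T" for t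
  proof (rule tendsto_sandwich[OF _ _ tendsto_const l])
    show "\<forall>\<^sub>F n in sequentially. NA (\<lambda>u \<omega>. indicator {0..t} u * \<eta> u \<omega> - indicator {0..<t} u * \<zeta> n u \<omega>) \<le> NA (\<lambda>t \<omega>. \<eta> t \<omega> - \<zeta> n t \<omega>)"
      by (intro always_eventually allI NA_stop_le t)
  qed simp
  show thesis
  proof (rule that[OF z(2)])
    fix t assume t: "0 \<le> t" "t \<le> T"
    show "(\<lambda>u \<omega>. indicator {0..t} u * \<eta> u \<omega>) \<in> MGA \<P> 2 T A"
      by (rule MGA_I[OF measurable_process_stop[OF z(1)] st[OF t] lim[OF t]]) simp
    fix X assume X: "integral_rel (\<lambda>u \<omega>. indicator {0..t} u * \<eta> u \<omega>) X"
    show "(\<lambda>n. pnorm 2 (\<lambda>\<omega>. X \<omega> - SI (\<lambda>u \<omega>. indicator {0..<t} u * \<zeta> n u \<omega>) \<omega>)) \<longlonglongrightarrow> 0"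
    proof (rule tendsto_sandwich[OF _ _ tendsto_const lim[OF t]])
      show "\<forall>\<^sub>F n in sequentially. pnorm 2 (\<lambda>\<omega>. X \<omega> - SI (\<lambda>u \<omega>. indicator {0..<t} u * \<zeta> n u \<omega>) \<omega>) \<le> NA (\<lambda>u \<omega>. indicator {0..t} u * \<eta> u \<omega> - indicator {0..<t} u * \<zeta> n u \<omega>)"
        by (intro always_eventually allI integral_rel_bound integral_rel_diff[OF X] integral_rel_MG0 MG0_A_MGA MG0_A_MG0 st t)
    qed simp
  qed
qed

text \<open>The martingale identity of the stopped step integrals passes to the limit, since convergence in mean
  square is uniform over \<open>\<P>\<close> and implies convergence of the integrals against bounded weights.\<close>

lemma integral_symmetric_martingale:
  assumes \<eta>: "\<eta> \<in> MGA \<P> 2 T A" and X: "\<And>t. 0 \<le> t \<Longrightarrow> t \<le> T \<Longrightarrow> integral_rel (\<lambda>u \<omega>. indicator {0..t} u * \<eta> u \<omega>) (X t)"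
  shows "symmetric_G_martingale \<P> E\<^sub>\<xi> \<xi> T X"
proof -
  obtain \<zeta> where z: "\<And>n::nat. \<zeta> n \<in> MG0_A \<P> 2 T A"
    and l: "\<And>t X. 0 \<le> t \<Longrightarrow> t \<le> T \<Longrightarrow> integral_rel (\<lambda>u \<omega>. indicator {0..t} u * \<eta> u \<omega>) X \<Longrightarrow>
       (\<lambda>n. pnorm 2 (\<lambda>\<omega>. X \<omega> - SI (\<lambda>u \<omega>. indicator {0..<t} u * \<zeta> n u \<omega>) \<omega>)) \<longlonglongrightarrow> 0"
    by (rule stopped_approximation[OF \<eta>]) blast
  let ?S = "\<lambda>n t. SI (\<lambda>u \<omega>. indicator {0..<t} u * \<zeta> n u \<omega>)"
  have S: "?S n t \<in> LGk 2 t" if "0 \<le> t" "t \<le> T" for n t by (rule SI_stop_LGk[OF z that])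
  have Xm: "X t \<in> borel_measurable borel" if "0 \<le> t" "t \<le> T" for t
    using X[OF that] unfolding integral_rel_def by (elim conjE)
  have X2: "X t \<in> LGk 2 t" if "0 \<le> t" "t \<le> T" for t
    by (rule LGk_closed_limit[OF Xm[OF that] _ S[OF that] l[OF that X[OF that]]]) simp
  have X1: "X t \<in> LGk 1 t" if "0 \<le> t" "t \<le> T" for t by (rule LGk_1[OF X2[OF that]]) simp
  show ?thesis
  proof (rule symmetric_G_martingaleI[OF X1])
    fix s t P \<theta> assume st: "0 \<le> s" "s \<le> t" "t \<le> T" and P: "P \<in> \<P>" and \<theta>: "\<theta> \<in> LGk 1 s" "\<And>\<omega>. 0 \<le> \<theta> \<omega> \<and> \<theta> \<omega> \<le> 1"
    have sT: "0 \<le> s" "s \<le> T" and tT: "0 \<le> t" "t \<le> T" using st by auto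
    have \<theta>b: "\<bar>\<theta> \<omega>\<bar> \<le> 1" for \<omega> using \<theta>(2)[of \<omega>] by simp
    note im = integrable_mult_bounded[OF P _ LGk_measurable[OF \<theta>(1)] \<theta>b]
    have small: "\<bar>\<integral>\<omega>. \<theta> \<omega> * (X t \<omega> - X s \<omega>) \<partial>P\<bar> \<le> e" if e: "0 < e" for e
    proof -
      define d where "d = e / 4"
      have d: "0 < d" "0 \<le> 2 * d" using e by (auto simp: d_def)
      have d2: "0 < d\<^sup>2" using d by simp
      obtain N1 where N1: "\<And>n. n \<ge> N1 \<Longrightarrow> pnorm 2 (\<lambda>\<omega>. X t \<omega> - ?S n t \<omega>) \<le> ennreal (d\<^sup>2)"
        using ennreal_tendsto_0D[OF l[OF tT X[OF tT]] d2] by blast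
      obtain N2 where N2: "\<And>n. n \<ge> N2 \<Longrightarrow> pnorm 2 (\<lambda>\<omega>. X s \<omega> - ?S n s \<omega>) \<le> ennreal (d\<^sup>2)"
        using ennreal_tendsto_0D[OF l[OF sT X[OF sT]] d2] by blast
      define n where "n = max N1 N2"
      have iS: "integrable P (?S n r)" if "0 \<le> r" "r \<le> T" for r
        by (rule LGk_integrable[OF LGk_1[OF S[OF that]] P]) simp
      note iX = LGk_integrable[OF X1 P]
      have close: "\<bar>(\<integral>\<omega>. \<theta> \<omega> * X r \<omega> \<partial>P) - (\<integral>\<omega>. \<theta> \<omega> * ?S n r \<omega> \<partial>P)\<bar> \<le> 2 * d"
        if r: "0 \<le> r" "r \<le> T" and n2: "pnorm 2 (\<lambda>\<omega>. X r \<omega> - ?S n r \<omega>) \<le> ennreal (d\<^sup>2)" for r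
      proof -
        have "(\<lambda>\<omega>. X r \<omega> - ?S n r \<omega>) \<in> borel_measurable borel"
          by (rule LGk_measurable[OF LGk_diff[OF X2[OF r] S[OF r]]]) simp
        then have "pnorm 1 (\<lambda>\<omega>. X r \<omega> - ?S n r \<omega>) \<le> ennreal (2 * d)"
          by (rule pnorm_1_le[OF _ d(1) _ n2]) simp
        from integral_mult_diff_le[OF P iX[OF r] iS[OF r] LGk_measurable[OF \<theta>(1)] \<theta>b this d(2)]
        show ?thesis by simp
      qed
      have "(\<integral>\<omega>. \<theta> \<omega> * (?S n t \<omega> - ?S n s \<omega>) \<partial>P) = 0"
        by (rule SI_stop_martingale[OF z st P \<theta>(1) \<theta>b])
      then have 0: "(\<integral>\<omega>. \<theta> \<omega> * ?S n t \<omega> \<partial>P) - (\<integral>\<omega>. \<theta> \<omega> * ?S n s \<omega> \<partial>P) = 0"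
        using im[OF iS[OF tT]] im[OF iS[OF sT]] by (simp add: right_diff_distrib)
      have "(\<integral>\<omega>. \<theta> \<omega> * (X t \<omega> - X s \<omega>) \<partial>P) = (\<integral>\<omega>. \<theta> \<omega> * X t \<omega> \<partial>P) - (\<integral>\<omega>. \<theta> \<omega> * X s \<omega> \<partial>P)"
        using im[OF iX[OF tT]] im[OF iX[OF sT]] by (simp add: right_diff_distrib)
      moreover have "N1 \<le> n" "N2 \<le> n" by (auto simp: n_def)
      moreover have "4 * d = e" by (simp add: d_def)
      ultimately show ?thesis using close[OF tT N1] close[OF sT N2] 0 by linarith
    qed
    have "\<bar>\<integral>\<omega>. \<theta> \<omega> * (X t \<omega> - X s \<omega>) \<partial>P\<bar> \<le> 0"
    proof (rule field_le_epsilon)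
      fix e :: real assume "0 < e"
      then show "\<bar>\<integral>\<omega>. \<theta> \<omega> * (X t \<omega> - X s \<omega>) \<partial>P\<bar> \<le> 0 + e" unfolding add_0_left by (rule small)
    qed
    then show "(\<integral>\<omega>. \<theta> \<omega> * (X t \<omega> - X s \<omega>) \<partial>P) = 0" by (simp only: abs_le_zero_iff)
  qed
qed

text \<open>Outside the completion there may be further step processes, and on all step processes the integral is
  required to be the Riemann sum itself; elsewhere any value of the relation will do.\<close>

definition stochastic_integral :: "(real \<Rightarrow> path \<Rightarrow> real) \<Rightarrow> path \<Rightarrow> real" where
  "stochastic_integral \<eta> = (if \<eta> \<in> MG0 \<P> 2 T then SI \<eta> else (SOME X. integral_rel \<eta> X))"

lemma stochastic_integral_rel:
  assumes "\<eta> \<in> MGA \<P> 2 T A" shows "integral_rel \<eta> (stochastic_integral \<eta>)"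
proof (cases "\<eta> \<in> MG0 \<P> 2 T")
  case True
  show ?thesis unfolding stochastic_integral_def if_P[OF True] by (rule integral_rel_MG0[OF assms True])
next
  case False
  show ?thesis unfolding stochastic_integral_def if_not_P[OF False] by (rule someI_ex[OF integral_rel_exists[OF assms]])
qed

lemma stochastic_integral_step:
  assumes "step_rep \<P> 2 T n t \<zeta> \<eta>"
  shows "stochastic_integral \<eta> = (\<lambda>\<omega>. \<Sum>j<n. \<zeta> j \<omega> * (M (t (Suc j)) \<omega> - M (t j) \<omega>))"
proof -
  note F = step_rep_imp_step_on(1)[OF assms]
  have "\<eta> \<in> MG0 \<P> 2 T" by (rule step_on_imp_MG0[OF F])
  then have "stochastic_integral \<eta> = SI \<eta>" unfolding stochastic_integral_def by (rule if_P)
  also have "\<dots> = (\<lambda>\<omega>. \<Sum>j<n. \<zeta> j \<omega> * (M (t (Suc j)) \<omega> - M (t j) \<omega>))"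
    unfolding SI_eq[OF F] step_rep_imp_step_on(2)[OF assms] ..
  finally show ?thesis .
qed

lemma stochastic_integral_MG0: "\<eta> \<in> MG0 \<P> 2 T \<Longrightarrow> stochastic_integral \<eta> = SI \<eta>"
  unfolding stochastic_integral_def by (rule if_P)

lemma qs_all: "(\<And>\<omega>. Q \<omega>) \<Longrightarrow> qs \<P> Q"
  unfolding qs_def capacity_def by (intro bexI[of _ "{}"]) (auto intro!: antisym SUP_least)

lemma stochastic_integral_linear_MG0: "linear_map_on \<P> (MG0 \<P> 2 T) stochastic_integral"
  unfolding linear_map_on_def
proof (intro ballI allI conjI)
  fix \<eta> \<zeta> a b assume m: "\<eta> \<in> MG0 \<P> 2 T" "\<zeta> \<in> MG0 \<P> 2 T"
  note l = MG0_lincomb[OF m, of a b]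
  show "(\<lambda>t \<omega>. a * \<eta> t \<omega> + b * \<zeta> t \<omega>) \<in> MG0 \<P> 2 T" by (rule l(1))
  show "qs \<P> (\<lambda>\<omega>. stochastic_integral (\<lambda>t \<omega>. a * \<eta> t \<omega> + b * \<zeta> t \<omega>) \<omega> = a * stochastic_integral \<eta> \<omega> + b * stochastic_integral \<zeta> \<omega>)"
    unfolding stochastic_integral_MG0[OF l(1)] stochastic_integral_MG0[OF m(1)] stochastic_integral_MG0[OF m(2)] by (rule qs_all) (rule l(2))
qed

lemma stochastic_integral_linear_MGA: "linear_map_on \<P> (MGA \<P> 2 T A) stochastic_integral"
  unfolding linear_map_on_def
proof (intro ballI allI conjI)
  fix \<eta> \<zeta> a b assume m: "\<eta> \<in> MGA \<P> 2 T A" "\<zeta> \<in> MGA \<P> 2 T A"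
  note l = integral_rel_lincomb[OF stochastic_integral_rel[OF m(1)] stochastic_integral_rel[OF m(2)], of a b]
  show mem: "(\<lambda>t \<omega>. a * \<eta> t \<omega> + b * \<zeta> t \<omega>) \<in> MGA \<P> 2 T A" by (rule integral_rel_MGA[OF l])
  show "qs \<P> (\<lambda>\<omega>. stochastic_integral (\<lambda>t \<omega>. a * \<eta> t \<omega> + b * \<zeta> t \<omega>) \<omega> = a * stochastic_integral \<eta> \<omega> + b * stochastic_integral \<zeta> \<omega>)"
    by (rule integral_rel_unique[OF stochastic_integral_rel[OF mem] l])
qed

lemma continuous_map_onI:
  assumes "\<And>\<eta> \<zeta>. \<eta> \<in> S \<Longrightarrow> \<zeta> \<in> S \<Longrightarrow> pnorm 2 (\<lambda>\<omega>. I \<zeta> \<omega> - I \<eta> \<omega>) \<le> NA (\<lambda>t \<omega>. \<zeta> t \<omega> - \<eta> t \<omega>)"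
  shows "continuous_map_on \<P> T A S I"
  unfolding continuous_map_on_def
proof (intro ballI allI impI, elim conjE)
  fix \<eta> and \<zeta> :: "nat \<Rightarrow> real \<Rightarrow> path \<Rightarrow> real"
  assume \<eta>: "\<eta> \<in> S" and \<zeta>: "\<forall>n. \<zeta> n \<in> S" and lim: "(\<lambda>n. NA (\<lambda>t \<omega>. \<zeta> n t \<omega> - \<eta> t \<omega>)) \<longlonglongrightarrow> 0"
  have "(\<lambda>n. pnorm 2 (\<lambda>\<omega>. I (\<zeta> n) \<omega> - I \<eta> \<omega>)) \<longlonglongrightarrow> 0"
  proof (rule tendsto_sandwich[OF _ _ tendsto_const lim])
    show "\<forall>\<^sub>F n in sequentially. pnorm 2 (\<lambda>\<omega>. I (\<zeta> n) \<omega> - I \<eta> \<omega>) \<le> NA (\<lambda>t \<omega>. \<zeta> n t \<omega> - \<eta> t \<omega>)"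
      by (intro always_eventually allI assms \<eta> \<zeta>[rule_format])
  qed simp
  then show "(\<lambda>n. UE (\<lambda>\<omega>. ennreal (\<bar>I (\<zeta> n) \<omega> - I \<eta> \<omega>\<bar>\<^sup>2))) \<longlonglongrightarrow> 0" unfolding pnorm_def .
qed

lemma stochastic_integral_properties:
  "(\<forall>n t \<zeta> \<eta>. step_rep \<P> 2 T n t \<zeta> \<eta> \<longrightarrow>
        stochastic_integral \<eta> = (\<lambda>\<omega>. \<Sum>j<n. \<zeta> j \<omega> * (M (t (Suc j)) \<omega> - M (t j) \<omega>))) \<and>
     linear_map_on \<P> (MG0 \<P> 2 T) stochastic_integral \<and>
     continuous_map_on \<P> T A (MG0 \<P> 2 T) stochastic_integral \<and>
     MG0_A \<P> 2 T A \<subseteq> MGA \<P> 2 T A \<and>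
     (\<forall>\<eta>\<in>MGA \<P> 2 T A. stochastic_integral \<eta> \<in> LG \<P> 2 T) \<and>
     linear_map_on \<P> (MGA \<P> 2 T A) stochastic_integral \<and>
     continuous_map_on \<P> T A (MGA \<P> 2 T A) stochastic_integral \<and>
     (\<forall>\<eta>\<in>MGA \<P> 2 T A.
        symmetric_G_martingale \<P> E\<^sub>\<xi> \<xi> T (\<lambda>t. stochastic_integral (\<lambda>u \<omega>. indicator {0..t} u * \<eta> u \<omega>)) \<and>
        upper_expectation \<P> (\<lambda>\<omega>. ennreal (\<bar>stochastic_integral \<eta> \<omega>\<bar>\<^sup>2)) \<le>
        upper_expectation \<P> (\<lambda>\<omega>. dA_integral T A (\<lambda>t. ennreal (\<bar>\<eta> t \<omega>\<bar>\<^sup>2)) \<omega>))"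
proof (intro conjI allI impI ballI subsetI)
  fix n t \<zeta> \<eta> assume "step_rep \<P> 2 T n t \<zeta> \<eta>"
  then show "stochastic_integral \<eta> = (\<lambda>\<omega>. \<Sum>j<n. \<zeta> j \<omega> * (M (t (Suc j)) \<omega> - M (t j) \<omega>))" by (rule stochastic_integral_step)
next
  show "linear_map_on \<P> (MG0 \<P> 2 T) stochastic_integral" by (rule stochastic_integral_linear_MG0)
  show "continuous_map_on \<P> T A (MG0 \<P> 2 T) stochastic_integral"
  proof (rule continuous_map_onI)
    fix \<eta> \<zeta> assume m: "\<eta> \<in> MG0 \<P> 2 T" "\<zeta> \<in> MG0 \<P> 2 T"
    show "pnorm 2 (\<lambda>\<omega>. stochastic_integral \<zeta> \<omega> - stochastic_integral \<eta> \<omega>) \<le> NA (\<lambda>t \<omega>. \<zeta> t \<omega> - \<eta> t \<omega>)"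
      unfolding stochastic_integral_MG0[OF m(1)] stochastic_integral_MG0[OF m(2)] by (rule pnorm_SI_diff_le[OF m(2,1)])
  qed
  show "\<eta> \<in> MGA \<P> 2 T A" if "\<eta> \<in> MG0_A \<P> 2 T A" for \<eta> by (rule MG0_A_MGA[OF that])
  show "stochastic_integral \<eta> \<in> LG \<P> 2 T" if "\<eta> \<in> MGA \<P> 2 T A" for \<eta>
    unfolding LG_2 by (rule integral_rel_LGk[OF stochastic_integral_rel[OF that]])
  show "linear_map_on \<P> (MGA \<P> 2 T A) stochastic_integral" by (rule stochastic_integral_linear_MGA)
  show "continuous_map_on \<P> T A (MGA \<P> 2 T A) stochastic_integral"
    by (rule continuous_map_onI) (intro integral_rel_bound integral_rel_diff stochastic_integral_rel)
next
  fix \<eta> assume \<eta>: "\<eta> \<in> MGA \<P> 2 T A"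
  show "symmetric_G_martingale \<P> E\<^sub>\<xi> \<xi> T (\<lambda>t. stochastic_integral (\<lambda>u \<omega>. indicator {0..t} u * \<eta> u \<omega>))"
  proof (rule integral_symmetric_martingale[OF \<eta>])
    fix t assume t: "0 \<le> t" "t \<le> T"
    have "(\<lambda>u \<omega>. indicator {0..t} u * \<eta> u \<omega>) \<in> MGA \<P> 2 T A"
      by (rule stopped_approximation[OF \<eta>]) (use t in blast)
    then show "integral_rel (\<lambda>u \<omega>. indicator {0..t} u * \<eta> u \<omega>) (stochastic_integral (\<lambda>u \<omega>. indicator {0..t} u * \<eta> u \<omega>))"
      by (rule stochastic_integral_rel)
  qed
  show "upper_expectation \<P> (\<lambda>\<omega>. ennreal (\<bar>stochastic_integral \<eta> \<omega>\<bar>\<^sup>2)) \<le>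
        upper_expectation \<P> (\<lambda>\<omega>. dA_integral T A (\<lambda>t. ennreal (\<bar>\<eta> t \<omega>\<bar>\<^sup>2)) \<omega>)"
    using integral_rel_bound[OF stochastic_integral_rel[OF \<eta>]] unfolding pnorm_def NA_eq power2_abs .
qed

end

theorem proposition3p2:
  fixes \<sigma>\<^sub>0 T :: real
    and H :: "('a \<Rightarrow> real) set" and E\<^sub>\<xi> :: "('a \<Rightarrow> real) \<Rightarrow> real" and \<xi> :: "nat \<Rightarrow> 'a \<Rightarrow> real"
    and E :: "(path \<Rightarrow> real) \<Rightarrow> real" and \<P> :: "path measure set"
    and A M :: "real \<Rightarrow> path \<Rightarrow> real"
  assumes "0 \<le> \<sigma>\<^sub>0" and "\<sigma>\<^sub>0 \<le> 1"
    and "sublinear_expectation H E\<^sub>\<xi>"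
    and "\<And>i. \<xi> i \<in> H"
    and "\<And>i. G_normal \<sigma>\<^sub>0 E\<^sub>\<xi> (\<xi> i)"
    and "\<And>i. independent_of E\<^sub>\<xi> [\<xi> (Suc i)] (map \<xi> [0..<Suc i])"
    and "G_expectation E\<^sub>\<xi> \<xi> E"
    and "represents \<P> E"
    and "0 < T"
    and "qs \<P> (\<lambda>\<omega>. A 0 \<omega> = 0 \<and> continuous_on {0..T} (\<lambda>t. A t \<omega>) \<and> mono_on {0..T} (\<lambda>t. A t \<omega>))"
    and "\<And>t. t \<in> {0..T} \<Longrightarrow> A t \<in> LG \<P> 1 t"
    and "upper_expectation \<P> (\<lambda>\<omega>. ennreal (A T \<omega>)) < \<infinity>"
    and "M \<in> integrators \<P> E\<^sub>\<xi> \<xi> T A"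
  shows "\<exists>I :: (real \<Rightarrow> path \<Rightarrow> real) \<Rightarrow> path \<Rightarrow> real.
     (\<forall>n t \<zeta> \<eta>. step_rep \<P> 2 T n t \<zeta> \<eta> \<longrightarrow>
        I \<eta> = (\<lambda>\<omega>. \<Sum>j<n. \<zeta> j \<omega> * (M (t (Suc j)) \<omega> - M (t j) \<omega>))) \<and>
     linear_map_on \<P> (MG0 \<P> 2 T) I \<and>
     continuous_map_on \<P> T A (MG0 \<P> 2 T) I \<and>
     MG0_A \<P> 2 T A \<subseteq> MGA \<P> 2 T A \<and>
     (\<forall>\<eta>\<in>MGA \<P> 2 T A. I \<eta> \<in> LG \<P> 2 T) \<and>
     linear_map_on \<P> (MGA \<P> 2 T A) I \<and>
     continuous_map_on \<P> T A (MGA \<P> 2 T A) I \<and>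
     (\<forall>\<eta>\<in>MGA \<P> 2 T A.
        symmetric_G_martingale \<P> E\<^sub>\<xi> \<xi> T (\<lambda>t. I (\<lambda>u \<omega>. indicator {0..t} u * \<eta> u \<omega>)) \<and>
        upper_expectation \<P> (\<lambda>\<omega>. ennreal (\<bar>I \<eta> \<omega>\<bar>\<^sup>2)) \<le>
        upper_expectation \<P> (\<lambda>\<omega>. dA_integral T A (\<lambda>t. ennreal (\<bar>\<eta> t \<omega>\<bar>\<^sup>2)) \<omega>))"
proof -
  interpret G_integrator \<sigma>\<^sub>0 H E\<^sub>\<xi> \<xi> E \<P> T A M
  proof (intro G_integrator.intro G_framework.intro G_expectation_space.intro G_normal_sequence.intro
      G_expectation_space_axioms.intro G_framework_axioms.intro G_integrator_axioms.intro)
    show "qs \<P> (increasing_path T A)" using assms(10) unfolding increasing_path_def[abs_def] .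
  qed (fact assms)+
  show ?thesis by (rule exI[of _ stochastic_integral]) (rule stochastic_integral_properties)
qed

end
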